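(* Let $\mathcal V_1,\mathcal V_2$ be finite-dimensional representations of $U_q(L\mathfrak g)$, $\mathcal C_1$ a contour enclosing $\sigma(\mathcal V_1)$, and for $\zeta$ such that $w\mapsto H^-_j(q^{l+r}\zeta w)$ (on $\mathcal V_2$) is analytic inside $\mathcal C_1$ for all relevant $j,r$, set $$\mathscr A_{\mathcal V_1,\mathcal V_2}(\zeta)=\exp\Big(-\sum_{i,j\in I,\,r\in\mathbb Z}c^{(r)}_{ij}\oint_{\mathcal C_1}\Psi_i(w)^{-1}\Psi_i'(w)\otimes H^-_j(q^{l+r}\zeta w)\,dw\Big).$$ Then: (i) $\mathscr A_{\mathcal V_1,\mathcal V_2}(\zeta)$ extends to a rational function of $\zeta$, regular at $0$ and $\infty$, with $\mathscr A_{\mathcal V_1,\mathcal V_2}(0)=\mathscr A_{\mathcal V_1,\mathcal V_2}(\infty)=1$; (ii) the poles of $\mathscr A_{\mathcal V_1,\mathcal V_2}(\zeta)^{\pm1}$ are contained in $\sigma(\mathcal V_2)\sigma(\mathcal V_1)^{-1}q^{-l-r}$, $r$ ranging over integers with $c^{(r)}_{ij}\ne0$ for some $i,j$; (iii) $[\mathscr A_{\mathcal V_1,\mathcal V_2}(\zeta),\mathscr A_{\mathcal V_1,\mathcal V_2}(\zeta')]=0$; (iv) $\mathscr A_{\mathcal V_1\otimes_{\zeta_1}\mathcal V_2,\mathcal V_3}(\zeta_2)=\mathscr A_{\mathcal V_1,\mathcal V_3}(\zeta_1\zeta_2)\mathscr A_{\mathcal V_2,\mathcal V_3}(\zeta_2)$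 and $\mathscr A_{\mathcal V_1,\mathcal V_2\otimes_{\zeta_2}\mathcal V_3}(\zeta_1\zeta_2)=\mathscr A_{\mathcal V_1,\mathcal V_3}(\zeta_1\zeta_2)\mathscr A_{\mathcal V_1,\mathcal V_2}(\zeta_1)$; (v) $\sigma\circ\mathscr A_{\mathcal V_1,\mathcal V_2}(\zeta^{-1})\circ\sigma^{-1}=\mathscr A_{\mathcal V_2,\mathcal V_1}(q^{-2l}\zeta)$, $\sigma$ the flip; (vi) $\mathscr A_{\mathcal V_1(\alpha),\mathcal V_2(\beta)}(\zeta)=\mathscr A_{\mathcal V_1,\mathcal V_2}(\zeta\alpha\beta^{-1})$ for $\alpha,\beta\in\mathbb C^\times$.
   Context: $\mathfrak g$ complex semisimple with simple roots $\alpha_i$ ($i\in I$), $d_i=(\alpha_i,\alpha_i)/2$ (short roots of squared length 2), $a_{ij}=2(\alpha_i,\alpha_j)/(\alpha_i,\alpha_i)$; $q\in\mathbb C^\times$ not a root of unity, $q_i=q^{d_i}$. $U_q(L\mathfrak g)$ is generated by $\Psi^\pm_{i,\pm r}$ ($r\in\mathbb N$), $\mathcal X^\pm_{i,k}$ ($k\in\mathbb Z$) with relations: all $\Psi$'s commute, $\Psi^+_{i,0}\Psi^-_{i,0}=1$; $\Psi^+_{i,0}\mathcal X^\pm_{j,k}\Psi^-_{i,0}=q_i^{\pm a_{ij}}\mathcal X^\pm_{j,k}$; $\Psi^\epsilon_{i,k+1}\mathcal X^\pm_{j,l}-q_i^{\pm a_{ij}}\mathcal X^\pm_{j,l}\Psi^\epsilon_{i,k+1}=q_i^{\pm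 a_{ij}}\Psi^\epsilon_{i,k}\mathcal X^\pm_{j,l+1}-\mathcal X^\pm_{j,l+1}\Psi^\epsilon_{i,k}$ ($k\ge0$ for $\epsilon=+$, $k<0$ for $\epsilon=-$); $\mathcal X^\pm_{i,k+1}\mathcal X^\pm_{j,l}-q_i^{\pm a_{ij}}\mathcal X^\pm_{j,l}\mathcal X^\pm_{i,k+1}=q_i^{\pm a_{ij}}\mathcal X^\pm_{i,k}\mathcal X^\pm_{j,l+1}-\mathcal X^\pm_{j,l+1}\mathcal X^\pm_{i,k}$; $[\mathcal X^+_{i,k},\mathcal X^-_{j,l}]=\delta_{ij}(\Psi^+_{i,k+l}-\Psi^-_{i,k+l})/(q_i-q_i^{-1})$ ($\Psi^\pm_{i,\mp k}=0$ for $k\ge1$); quantum Serre relations. On finite-dimensional $\mathcal V$, $\Psi_i(z)$ and $\mathcal X^\pm_i(z)$ are the rational functions whose expansions at $\infty$ are $\sum_{r\ge0}\Psi^+_{i,r}z^{-r}$, $\sum_{r\ge0}\mathcal X^\pm_{i,r}z^{-r}$ and at $0$ are $\sum_{r\le0}\Psi^-_{i,r}z^{-r}$, $-\sum_{r<0}\mathcal X^\pm_{i,r}z^{-r}$; $\sigma(\mathcal V)$ = their poles (and those of $\Psi_i^{-1}$). $H^-_j(w)$ is the holomorphic logarithm (vanishing at $w=0$) of the rational function $\Psi^+_{j,0}\Psi_j(w)$, defined off the rays $[\alpha,\infty)$, $\alpha$ a pole of $(\Psi^+_{j,0}\Psi_j)^{\pm1}$. ${\mathbf B}(T)=([d_ia_{ij}]_T)$,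 $[n]_T=(T^n-T^{-n})/(T-T^{-1})$; $l$ a fixed positive integer with $[l]_T{\mathbf B}(T)^{-1}=(c_{ij}(T))$, $c_{ij}(T)=\sum_rc^{(r)}_{ij}T^r\in\mathbb Z[T^{\pm1}]$. $\mathcal V(\alpha)$: pullback by $\tau_\alpha(Y_k)=\alpha^kY_k$. $\mathcal V\otimes_\zeta\mathcal W$ (Drinfeld tensor product, $\zeta\sigma(\mathcal V)\cap\sigma(\mathcal W)=\emptyset$): $\Psi^\pm_{i,\pm m}\mapsto\sum_{p+q=m}\zeta^{\pm p}\Psi^\pm_{i,\pm p}\otimes\Psi^\pm_{i,\pm q}$, $\mathcal X^+_{i,k}\mapsto\zeta^k\mathcal X^+_{i,k}\otimes1+\oint_{C_2}\Psi_i(\zeta^{-1}w)\otimes\mathcal X^+_i(w)w^{k-1}dw$, $\mathcal X^-_{i,k}\mapsto\oint_{C_1}\mathcal X^-_i(\zeta^{-1}w)\otimes\Psi_i(w)w^{k-1}dw+1\otimes\mathcal X^-_{i,k}$, with $C_1,C_2$ not enclosing $0$, $C_1$ enclosing $\zeta\sigma(\mathcal V)$ but not $\sigma(\mathcal W)$, $C_2$ the reverse, $\oint=\frac1{2\pi\iota}\int$. *)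

theory Defs
  imports "HOL-Complex_Analysis.Complex_Analysis"
begin

section \<open>Matrices over C indexed by finite types\<close>

type_synonym 'n cmat = "complex^'n^'n"

definition smat :: "complex \<Rightarrow> 'n::finite cmat \<Rightarrow> 'n cmat" where
  "smat c M = (\<chi> a b. c * M $ a $ b)"

fun mpow :: "'n::finite cmat \<Rightarrow> nat \<Rightarrow> 'n cmat" where
  "mpow M 0 = mat 1"
| "mpow M (Suc k) = M ** mpow M k"

text \<open>Matrix exponential.\<close>
definition mexp :: "'n::finite cmat \<Rightarrow> 'n cmat" where
  "mexp M = (\<Sum>k. smat (1 / of_nat (fact k)) (mpow M k))"

text \<open>Ordered product of a list of matrices.\<close>
definition mlist_prod :: "'n::finite cmat list \<Rightarrow> 'n cmat" where
  "mlist_prod xs = foldr (**) xs (mat 1)"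

text \<open>Kronecker (tensor) product.\<close>
definition kron :: "'a::finite cmat \<Rightarrow> 'b::finite cmat \<Rightarrow> ('a \<times> 'b) cmat" where
  "kron A B = (\<chi> x y. A $ fst x $ fst y * B $ snd x $ snd y)"

text \<open>Embeddings into triple tensor products (legs) and the flip.\<close>
definition leg12 :: "('a::finite \<times> 'b::finite) cmat \<Rightarrow> (('a \<times> 'b) \<times> 'c::finite) cmat" where
  "leg12 M = (\<chi> x y. M $ fst x $ fst y * (if snd x = snd y then 1 else 0))"
definition leg13 :: "('a::finite \<times> 'c::finite) cmat \<Rightarrow> (('a \<times> 'b::finite) \<times> 'c) cmat" where
  "leg13 M = (\<chi> x y. M $ (fst (fst x), snd x) $ (fst (fst y), snd y) *
                       (if snd (fst x) = snd (fst y) then 1 else 0))"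
definition leg23 :: "('b::finite \<times> 'c::finite) cmat \<Rightarrow> (('a::finite \<times> 'b) \<times> 'c) cmat" where
  "leg23 M = (\<chi> x y. M $ (snd (fst x), snd x) $ (snd (fst y), snd y) *
                       (if fst (fst x) = fst (fst y) then 1 else 0))"
definition legR12 :: "('a::finite \<times> 'b::finite) cmat \<Rightarrow> ('a \<times> ('b \<times> 'c::finite)) cmat" where
  "legR12 M = (\<chi> x y. M $ (fst x, fst (snd x)) $ (fst y, fst (snd y)) *
                       (if snd (snd x) = snd (snd y) then 1 else 0))"
definition legR13 :: "('a::finite \<times> 'c::finite) cmat \<Rightarrow> ('a \<times> ('b::finite \<times> 'c)) cmat" where
  "legR13 M = (\<chi> x y. M $ (fst x, snd (snd x)) $ (fst y, snd (snd y)) *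
                       (if fst (snd x) = fst (snd y) then 1 else 0))"
text \<open>Conjugation by the flip  V1 \<otimes> V2 \<rightarrow> V2 \<otimes> V1.\<close>
definition flipm :: "('a::finite \<times> 'b::finite) cmat \<Rightarrow> ('b \<times> 'a) cmat" where
  "flipm M = (\<chi> x y. M $ (snd x, fst x) $ (snd y, fst y))"

text \<open>Entrywise complex derivative and contour integrals of matrix-valued functions.\<close>
definition mderiv :: "(complex \<Rightarrow> 'n::finite cmat) \<Rightarrow> complex \<Rightarrow> 'n cmat" where
  "mderiv f w = (\<chi> a b. deriv (\<lambda>z. f z $ a $ b) w)"

definition mcint :: "(real \<Rightarrow> complex) \<Rightarrow> (complex \<Rightarrow> 'n::finite cmat) \<Rightarrow> 'n cmat" where
  "mcint \<gamma> f = (\<chi> a b. contour_integral \<gamma> (\<lambda>w. f w $ a $ b))"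

text \<open>The normalised integral  \<oint> = 1/(2 \<pi> i) \<integral>.\<close>
definition moint :: "(real \<Rightarrow> complex) \<Rightarrow> (complex \<Rightarrow> 'n::finite cmat) \<Rightarrow> 'n cmat" where
  "moint \<gamma> f = smat (1 / (2 * pi * \<i>)) (mcint \<gamma> f)"

section \<open>Rational (matrix-valued) functions and poles\<close>

text \<open>A rational function, represented by its reduced quotient (so its values at
  non-poles are the values of the rational function; at poles the value is 0).\<close>
definition ratfun :: "(complex \<Rightarrow> complex) \<Rightarrow> bool" where
  "ratfun f \<longleftrightarrow> (\<exists>p r :: complex poly. r \<noteq> 0 \<and> coprime p r \<and>
                        (\<forall>z. f z = poly p z / poly r z))"

definition ratm :: "(complex \<Rightarrow> 'n::finite cmat) \<Rightarrow> bool" where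
  "ratm f \<longleftrightarrow> (\<forall>a b. ratfun (\<lambda>z. f z $ a $ b))"

definition mpoles :: "(complex \<Rightarrow> 'n::finite cmat) \<Rightarrow> complex set" where
  "mpoles f = {z. is_pole f z}"

section \<open>Cartan data and q-numbers\<close>

text \<open>Cartan matrix of a complex semisimple Lie algebra with symmetrising integers
  d i = (\<alpha>_i,\<alpha>_i)/2, normalised so that short roots have squared length 2
  (in every simple component some d j = 1).\<close>
definition finite_cartan :: "('i::finite \<Rightarrow> 'i \<Rightarrow> int) \<Rightarrow> ('i \<Rightarrow> nat) \<Rightarrow> bool" where
  "finite_cartan a d \<longleftrightarrow>
     (\<forall>i. a i i = 2) \<and> (\<forall>i j. i \<noteq> j \<longrightarrow> a i j \<le> 0) \<and> (\<forall>i. d i > 0) \<and>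
     (\<forall>i j. int (d i) * a i j = int (d j) * a j i) \<and>
     (\<forall>x :: 'i \<Rightarrow> real. x \<noteq> (\<lambda>_. 0) \<longrightarrow>
         (\<Sum>i\<in>UNIV. \<Sum>j\<in>UNIV. x i * real (d i) * of_int (a i j) * x j) > 0) \<and>
     (\<forall>i. \<exists>j. (i, j) \<in> {(u, v). a u v \<noteq> 0}\<^sup>* \<and> d j = 1)"

text \<open>[n]_T = (T^n - T^-n)/(T - T^-1).\<close>
definition qnum :: "int \<Rightarrow> complex \<Rightarrow> complex" where
  "qnum n T = (T powi n - T powi (- n)) / (T - inverse T)"

definition qfact :: "nat \<Rightarrow> complex \<Rightarrow> complex" where
  "qfact n T = (\<Prod>k\<in>{1..n}. qnum (int k) T)"

definition qbinom :: "nat \<Rightarrow> nat \<Rightarrow> complex \<Rightarrow> complex" where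
  "qbinom m s T = qfact m T / (qfact s T * qfact (m - s) T)"

text \<open>The integers r with c^(r)_ij \<noteq> 0 for some i, j.\<close>
definition relevant_r :: "('i \<Rightarrow> 'i \<Rightarrow> int \<Rightarrow> int) \<Rightarrow> int set" where
  "relevant_r c = {r. \<exists>i j. c i j r \<noteq> 0}"

text \<open>c_ij(T) = \<Sum>_r c^(r)_ij T^r is a Laurent polynomial and (c_ij(T)) = [l]_T B(T)^{-1},
  B(T) = ([d_i a_ij]_T); stated as the Laurent polynomial identity C(T) B(T) = [l]_T Id
  (an identity of Laurent polynomials is an identity for all T \<noteq> 0, \<plusminus>1).\<close>
definition is_c_matrix :: "('i::finite \<Rightarrow> 'i \<Rightarrow> int) \<Rightarrow> ('i \<Rightarrow> nat) \<Rightarrow> nat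
      \<Rightarrow> ('i \<Rightarrow> 'i \<Rightarrow> int \<Rightarrow> int) \<Rightarrow> bool" where
  "is_c_matrix a d l c \<longleftrightarrow> finite (relevant_r c) \<and>
     (\<forall>T::complex. T \<noteq> 0 \<and> T\<^sup>2 \<noteq> 1 \<longrightarrow> (\<forall>i j.
        (\<Sum>k\<in>UNIV. (\<Sum>r\<in>relevant_r c. of_int (c i k r) * T powi r) * qnum (int (d k) * a k j) T)
        = (if i = j then qnum (int l) T else 0)))"

section \<open>Finite-dimensional representations of U_q(Lg)\<close>

text \<open>Pp i r = \<Psi>^+_{i,r},  Pm i r = \<Psi>^-_{i,-r}  (r \<ge> 0),  Xp i k = X^+_{i,k},  Xm i k = X^-_{i,k}.\<close>
record ('i, 'n) lrep =
  Pp :: "'i \<Rightarrow> nat \<Rightarrow> complex^'n^'n"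
  Pm :: "'i \<Rightarrow> nat \<Rightarrow> complex^'n^'n"
  Xp :: "'i \<Rightarrow> int \<Rightarrow> complex^'n^'n"
  Xm :: "'i \<Rightarrow> int \<Rightarrow> complex^'n^'n"

text \<open>\<Psi>^+_{i,n} (zero for n<0) and \<Psi>^-_{i,n} (zero for n>0).\<close>
definition PsiP :: "('i, 'n::finite, 'z) lrep_scheme \<Rightarrow> 'i \<Rightarrow> int \<Rightarrow> 'n cmat" where
  "PsiP V i n = (if n \<ge> 0 then Pp V i (nat n) else 0)"
definition PsiM :: "('i, 'n::finite, 'z) lrep_scheme \<Rightarrow> 'i \<Rightarrow> int \<Rightarrow> 'n cmat" where
  "PsiM V i n = (if n \<le> 0 then Pm V i (nat (- n)) else 0)"

text \<open>X^\<epsilon> with \<epsilon> = True for + and False for -.\<close>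
definition Xs :: "('i, 'n::finite, 'z) lrep_scheme \<Rightarrow> bool \<Rightarrow> 'i \<Rightarrow> int \<Rightarrow> 'n cmat" where
  "Xs V e = (if e then Xp V else Xm V)"

definition sgn_e :: "bool \<Rightarrow> int" where "sgn_e e = (if e then 1 else -1)"

definition is_rep :: "('i::finite \<Rightarrow> 'i \<Rightarrow> int) \<Rightarrow> ('i \<Rightarrow> nat) \<Rightarrow> complex
      \<Rightarrow> ('i, 'n::finite) lrep \<Rightarrow> bool" where
  "is_rep a d q V \<longleftrightarrow>
    \<comment> \<open>all \<Psi>'s commute\<close>
    (\<forall>i j r s. Pp V i r ** Pp V j s = Pp V j s ** Pp V i r \<and>
               Pp V i r ** Pm V j s = Pm V j s ** Pp V i r \<and>
               Pm V i r ** Pm V j s = Pm V j s ** Pm V i r) \<and>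
    (\<forall>i. Pp V i 0 ** Pm V i 0 = mat 1) \<and>
    (\<forall>e i j k. let qi = q ^ d i; X = Xs V e; c = qi powi (sgn_e e * a i j) in
       Pp V i 0 ** X j k ** Pm V i 0 = smat c (X j k)) \<and>
    (\<forall>e i j k l. let qi = q ^ d i; X = Xs V e; c = qi powi (sgn_e e * a i j) in
       Pp V i (Suc k) ** X j l - smat c (X j l ** Pp V i (Suc k)) =
         smat c (Pp V i k ** X j (l + 1)) - X j (l + 1) ** Pp V i k) \<and>
    (\<forall>e i j m l. let qi = q ^ d i; X = Xs V e; c = qi powi (sgn_e e * a i j) in
       Pm V i m ** X j l - smat c (X j l ** Pm V i m) =
         smat c (Pm V i (Suc m) ** X j (l + 1)) - X j (l + 1) ** Pm V i (Suc m)) \<and>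
    (\<forall>e i j k l. let qi = q ^ d i; X = Xs V e; c = qi powi (sgn_e e * a i j) in
       X i (k + 1) ** X j l - smat c (X j l ** X i (k + 1)) =
         smat c (X i k ** X j (l + 1)) - X j (l + 1) ** X i k) \<and>
    (\<forall>i j k l. Xp V i k ** Xm V j l - Xm V j l ** Xp V i k =
       (if i = j then smat (1 / (q ^ d i - inverse (q ^ d i)))
                         (PsiP V i (k + l) - PsiM V i (k + l)) else 0)) \<and>
    \<comment> \<open>quantum Serre relations\<close>
    (\<forall>e i j. i \<noteq> j \<longrightarrow> (let m = nat (1 - a i j); X = Xs V e; qi = q ^ d i in
       \<forall>(k :: nat \<Rightarrow> int) l.
         (\<Sum>\<pi> \<in> {\<pi>. \<pi> permutes {0..<m}}. \<Sum>s\<le>m.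
            smat ((-1) ^ s * qbinom m s qi)
              (mlist_prod (map (\<lambda>t. X i (k (\<pi> t))) [0..<s] @ [X j l] @
                           map (\<lambda>t. X i (k (\<pi> t))) [s..<m]))) = 0))"

section \<open>The rational currents \<Psi>_i(z), X^\<pm>_i(z) and the set \<sigma>(V)\<close>

definition Psi_fun :: "('i, 'n::finite) lrep \<Rightarrow> 'i \<Rightarrow> complex \<Rightarrow> 'n cmat" where
  "Psi_fun V i = (SOME f. ratm f \<and>
     (\<exists>R. \<forall>z. norm z > R \<longrightarrow> (\<lambda>r. smat (z powi (- int r)) (Pp V i r)) sums f z) \<and>
     (\<exists>\<epsilon>>0. \<forall>z. 0 < norm z \<and> norm z < \<epsilon> \<longrightarrow> (\<lambda>r. smat (z ^ r) (Pm V i r)) sums f z))"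

definition X_fun :: "('i, 'n::finite) lrep \<Rightarrow> bool \<Rightarrow> 'i \<Rightarrow> complex \<Rightarrow> 'n cmat" where
  "X_fun V e i = (SOME f. ratm f \<and>
     (\<exists>R. \<forall>z. norm z > R \<longrightarrow> (\<lambda>r. smat (z powi (- int r)) (Xs V e i (int r))) sums f z) \<and>
     (\<exists>\<epsilon>>0. \<forall>z. 0 < norm z \<and> norm z < \<epsilon> \<longrightarrow>
        (\<lambda>r. smat (- (z ^ Suc r)) (Xs V e i (- int (Suc r)))) sums f z))"

definition spec :: "('i, 'n::finite) lrep \<Rightarrow> complex set" where
  "spec V = (\<Union>i. mpoles (Psi_fun V i) \<union> mpoles (\<lambda>z. matrix_inv (Psi_fun V i z)) \<union>
                   mpoles (X_fun V True i) \<union> mpoles (X_fun V False i))"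

text \<open>H^-_j(w): the holomorphic logarithm of \<Psi>^+_{j,0}\<Psi>_j(w) vanishing at 0, i.e. the
  integral of its logarithmic derivative along the segment [0,w] (the complement of the
  rays [\<alpha>,\<infinity>) is star-shaped with respect to 0).\<close>
definition H_fun :: "('i, 'n::finite) lrep \<Rightarrow> 'i \<Rightarrow> complex \<Rightarrow> 'n cmat" where
  "H_fun V j w = (let F = (\<lambda>u. Pp V j 0 ** Psi_fun V j u) in
      mcint (linepath 0 w) (\<lambda>u. matrix_inv (F u) ** mderiv F u))"

section \<open>The operator \<A>_{V1,V2}(\<zeta>)\<close>

text \<open>Admissible contour C_1: closed valid path avoiding \<sigma>(V1) and winding once around it.\<close>
definition adm_contour :: "complex set \<Rightarrow> (real \<Rightarrow> complex) \<Rightarrow> bool" where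
  "adm_contour S \<gamma> \<longleftrightarrow> valid_path \<gamma> \<and> pathfinish \<gamma> = pathstart \<gamma> \<and>
      path_image \<gamma> \<inter> S = {} \<and> (\<forall>s\<in>S. winding_number \<gamma> s = 1)"

definition inside_path :: "(real \<Rightarrow> complex) \<Rightarrow> complex set" where
  "inside_path \<gamma> = {z. z \<notin> path_image \<gamma> \<and> winding_number \<gamma> z \<noteq> 0}"

text \<open>\<zeta> for which w \<mapsto> H^-_j(q^{l+r} \<zeta> w) is analytic inside (and on) C_1.\<close>
definition A_dom :: "complex \<Rightarrow> nat \<Rightarrow> ('i \<Rightarrow> 'i \<Rightarrow> int \<Rightarrow> int) \<Rightarrow> ('i, 'm::finite) lrep
      \<Rightarrow> (real \<Rightarrow> complex) \<Rightarrow> complex set" where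
  "A_dom q l c V2 \<gamma> = {\<zeta>. \<forall>j. \<forall>r\<in>relevant_r c. \<forall>a b.
      (\<lambda>w. H_fun V2 j (q powi (int l + r) * \<zeta> * w) $ a $ b)
        analytic_on (path_image \<gamma> \<union> inside_path \<gamma>)}"

definition A_int :: "complex \<Rightarrow> nat \<Rightarrow> ('i::finite \<Rightarrow> 'i \<Rightarrow> int \<Rightarrow> int) \<Rightarrow> ('i, 'n::finite) lrep
      \<Rightarrow> ('i, 'm::finite) lrep \<Rightarrow> (real \<Rightarrow> complex) \<Rightarrow> complex \<Rightarrow> ('n \<times> 'm) cmat" where
  "A_int q l c V1 V2 \<gamma> \<zeta> = mexp (smat (-1)
     (\<Sum>i\<in>UNIV. \<Sum>j\<in>UNIV. \<Sum>r\<in>relevant_r c. smat (of_int (c i j r))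
        (moint \<gamma> (\<lambda>w. kron (matrix_inv (Psi_fun V1 i w) ** mderiv (Psi_fun V1 i) w)
                          (H_fun V2 j (q powi (int l + r) * \<zeta> * w))))))"

text \<open>The property "R is a rational function extending \<A>_{V1,V2}".\<close>
definition A_ext_prop :: "complex \<Rightarrow> nat \<Rightarrow> ('i::finite \<Rightarrow> 'i \<Rightarrow> int \<Rightarrow> int) \<Rightarrow> ('i, 'n::finite) lrep
      \<Rightarrow> ('i, 'm::finite) lrep \<Rightarrow> (complex \<Rightarrow> ('n \<times> 'm) cmat) \<Rightarrow> bool" where
  "A_ext_prop q l c V1 V2 R \<longleftrightarrow> ratm R \<and>
     (\<forall>\<gamma> \<zeta>. adm_contour (spec V1) \<gamma> \<longrightarrow> \<zeta> \<in> A_dom q l c V2 \<gamma> \<longrightarrow>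
             A_int q l c V1 V2 \<gamma> \<zeta> = R \<zeta>)"

text \<open>The rational function \<A>_{V1,V2}(\<zeta>).\<close>
definition A_op :: "complex \<Rightarrow> nat \<Rightarrow> ('i::finite \<Rightarrow> 'i \<Rightarrow> int \<Rightarrow> int) \<Rightarrow> ('i, 'n::finite) lrep
      \<Rightarrow> ('i, 'm::finite) lrep \<Rightarrow> complex \<Rightarrow> ('n \<times> 'm) cmat" where
  "A_op q l c V1 V2 = (SOME R. A_ext_prop q l c V1 V2 R)"

section \<open>Drinfeld tensor product and spectral shift\<close>

text \<open>Closed contour enclosing (winding number 1) the set S and not enclosing
  (winding number 0) the set T nor 0.\<close>
definition sep_contour :: "complex set \<Rightarrow> complex set \<Rightarrow> (real \<Rightarrow> complex) \<Rightarrow> bool" where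
  "sep_contour S T \<gamma> \<longleftrightarrow> valid_path \<gamma> \<and> pathfinish \<gamma> = pathstart \<gamma> \<and>
      path_image \<gamma> \<inter> (S \<union> T \<union> {0}) = {} \<and> (\<forall>s\<in>S. winding_number \<gamma> s = 1) \<and>
      (\<forall>t\<in>T \<union> {0}. winding_number \<gamma> t = 0)"

definition dtensor :: "complex \<Rightarrow> ('i, 'n::finite) lrep \<Rightarrow> ('i, 'm::finite) lrep
      \<Rightarrow> ('i, 'n \<times> 'm) lrep" where
  "dtensor \<zeta> V W = (let
      C1 = (SOME \<gamma>. sep_contour ((\<lambda>s. \<zeta> * s) ` spec V) (spec W) \<gamma>);
      C2 = (SOME \<gamma>. sep_contour (spec W) ((\<lambda>s. \<zeta> * s) ` spec V) \<gamma>) in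
    \<lparr> Pp = (\<lambda>i m. \<Sum>p\<le>m. smat (\<zeta> ^ p) (kron (Pp V i p) (Pp W i (m - p)))),
      Pm = (\<lambda>i m. \<Sum>p\<le>m. smat (\<zeta> powi (- int p)) (kron (Pm V i p) (Pm W i (m - p)))),
      Xp = (\<lambda>i k. smat (\<zeta> powi k) (kron (Xp V i k) (mat 1)) +
                 moint C2 (\<lambda>w. smat (w powi (k - 1))
                    (kron (Psi_fun V i (w / \<zeta>)) (X_fun W True i w)))),
      Xm = (\<lambda>i k. moint C1 (\<lambda>w. smat (w powi (k - 1))
                    (kron (X_fun V False i (w / \<zeta>)) (Psi_fun W i w))) +
                 kron (mat 1) (Xm W i k)) \<rparr>)"

text \<open>V(\<alpha>): pullback along \<tau>_\<alpha>(Y_k) = \<alpha>^k Y_k.\<close>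
definition shift :: "complex \<Rightarrow> ('i, 'n::finite) lrep \<Rightarrow> ('i, 'n) lrep" where
  "shift \<alpha> V = \<lparr> Pp = (\<lambda>i r. smat (\<alpha> ^ r) (Pp V i r)),
                 Pm = (\<lambda>i r. smat (\<alpha> powi (- int r)) (Pm V i r)),
                 Xp = (\<lambda>i k. smat (\<alpha> powi k) (Xp V i k)),
                 Xm = (\<lambda>i k. smat (\<alpha> powi k) (Xm V i k)) \<rparr>"

end

theory Submission
  imports Defs "HOL-Computational_Algebra.Fundamental_Theorem_Algebra"
begin

text \<open>The currents \<open>\<Psi>\<^sub>i(w)\<close> of one module commute, and after splitting into generalised
  eigenspaces their logarithmic derivatives have partial fractions
  \<open>\<Sum>\<^sub>s \<Sum>\<^sub>k L\<^sub>i(s,k) / (w - s)^(k+1)\<close> in which the residues \<open>L\<^sub>i(s,0)\<close> are diagonalisable with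
  integer eigenvalues (orders of zeros and poles), the \<open>L\<^sub>i(s,k)\<close> with \<open>k > 0\<close> are nilpotent, and
  \<open>\<Sum>\<^sub>s L\<^sub>i(s,0) = 0\<close>. The residue theorem turns the exponent of \<open>A\<close> into a finite sum over pairs of
  singular points \<open>(s, t)\<close> of the two modules: the terms with \<open>k = m = 0\<close> carry the coefficient
  \<open>Ln (1 - q^(l+r) \<zeta> s / t)\<close> times a matrix with integer eigenvalues, hence exponentiate to
  rational functions, and all other terms are nilpotent with rational coefficients. Their poles lie at
  \<open>\<zeta> = t / s * q^(-l-r)\<close>. All identities between the operators reduce to identities between
  exponents for \<open>\<zeta>\<close> near \<open>0\<close> (or \<open>\<infinity>\<close>) and extend by rationality: multiplicativity and the
  shift property from the behaviour of logarithmic derivatives of products, unitarity from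
  \<open>c\<^sub>i\<^sub>j(T) = c\<^sub>j\<^sub>i(1/T)\<close>.\<close>

section \<open>Square complex matrices as a Banach algebra\<close>

text \<open>Total functions have default values: \<open>H_fun\<close> is 0 wherever its segment
  integral diverges, and \<open>A_dom\<close> asks only for analyticity. Before \<open>A_int\<close>
  can be evaluated for an arbitrary admissible contour, analyticity must be shown to keep genuine
  poles off the segments from 0, and this requires a study of divergent integrals. Tensor products
  are defined through chosen contours, so only a few properties are carried over to them: commuting
  \<Psi> coefficients and rational currents with the prescribed two expansions. For representations
  and for contour integrals alike, rationality comes from one fact: a two-sided sequence with a
  linear recurrence is the pair of expansions of a single rational function. Integration constants
  and branches of logarithms must disappear. Constants are multiplied by total residues, which
  vanish because \<Psi> is regular and invertible at infinity. Branches disappear since an integral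
  spectrum lets the exponential see only the exponentials of the logarithms.\<close>

typedef (overloaded) 'n sqm = "UNIV :: ('n::finite cmat) set"
  morphisms mat_of Sq by auto

setup_lifting type_definition_sqm

lemma mat_of_eqI: "mat_of A = mat_of B \<Longrightarrow> A = B"
  by (simp add: mat_of_inject)

lemma mat_of_Sq [simp]: "mat_of (Sq M) = M"
  by (simp add: Sq_inverse)

lemma Sq_mat_of [simp]: "Sq (mat_of A) = A"
  by (simp add: mat_of_inverse)

lemma cmat_mult_add_left: "(A + B) ** C = A ** C + B ** (C :: 'n::finite cmat)"
  and cmat_mult_add_right: "C ** (A + B) = C ** A + C ** (B :: 'n::finite cmat)"
  by (simp_all add: matrix_matrix_mult_def vec_eq_iff sum.distrib algebra_simps)

lemma cmat_nth_mult: "(A ** B) $ a $ b = (\<Sum>k\<in>UNIV. A $ a $ k * (B :: 'n::finite cmat) $ k $ b)"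
  by (simp add: matrix_matrix_mult_def)

text \<open>A separate type makes \<open>**\<close> the multiplication of a ring class, so powers,
  \<open>exp\<close> and its laws for commuting arguments apply to matrices directly.\<close>

instantiation sqm :: (finite) ring_1
begin
lift_definition zero_sqm :: "'a sqm" is 0 .
lift_definition one_sqm :: "'a sqm" is "mat 1" .
lift_definition plus_sqm :: "'a sqm \<Rightarrow> 'a sqm \<Rightarrow> 'a sqm" is "(+)" .
lift_definition minus_sqm :: "'a sqm \<Rightarrow> 'a sqm \<Rightarrow> 'a sqm" is "(-)" .
lift_definition uminus_sqm :: "'a sqm \<Rightarrow> 'a sqm" is uminus .
lift_definition times_sqm :: "'a sqm \<Rightarrow> 'a sqm \<Rightarrow> 'a sqm" is "(**)" .
instance
proof
  show "(0 :: 'a sqm) \<noteq> 1"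
    by transfer (simp add: vec_eq_iff mat_def)
qed (transfer; simp add: matrix_mul_assoc cmat_mult_add_left cmat_mult_add_right add.assoc add.commute)+
end

text \<open>The operator norm is chosen because the class demands submultiplicativity and
  \<open>norm 1 = 1\<close>.\<close>

instantiation sqm :: (finite) real_normed_algebra_1
begin
lift_definition scaleR_sqm :: "real \<Rightarrow> 'a sqm \<Rightarrow> 'a sqm" is "scaleR" .
lift_definition norm_sqm :: "'a sqm \<Rightarrow> real" is "\<lambda>M. onorm (\<lambda>v. M *v v)" .
definition dist_sqm :: "'a sqm \<Rightarrow> 'a sqm \<Rightarrow> real" where "dist_sqm A B = norm (A - B)"
definition sgn_sqm :: "'a sqm \<Rightarrow> 'a sqm" where "sgn_sqm A = inverse (norm A) *\<^sub>R A"
definition uniformity_sqm :: "('a sqm \<times> 'a sqm) filter"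
  where "uniformity_sqm = (INF e\<in>{0 <..}. principal {(x, y). dist x y < e})"
definition open_sqm :: "'a sqm set \<Rightarrow> bool"
  where "open_sqm S = (\<forall>x\<in>S. \<forall>\<^sub>F (x', y) in uniformity. x' = x \<longrightarrow> y \<in> S)"
instance
proof
  fix A B :: "'a sqm" and r s :: real
  show "r *\<^sub>R (A + B) = r *\<^sub>R A + r *\<^sub>R B" "(r + s) *\<^sub>R A = r *\<^sub>R A + s *\<^sub>R A"
    "r *\<^sub>R s *\<^sub>R A = (r * s) *\<^sub>R A" "1 *\<^sub>R A = A"
    by (transfer; simp add: algebra_simps)+
  show "r *\<^sub>R A * B = r *\<^sub>R (A * B)" "A * r *\<^sub>R B = r *\<^sub>R (A * B)"
    by (transfer; simp add: matrix_matrix_mult_def vec_eq_iff scaleR_sum_right)+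
  show "dist A B = norm (A - B)" by (rule dist_sqm_def)
  show "sgn A = inverse (norm A) *\<^sub>R A" by (rule sgn_sqm_def)
  show "uniformity = (INF e\<in>{0 <..}. principal {(x :: 'a sqm, y). dist x y < e})"
    by (rule uniformity_sqm_def)
  show "open U = (\<forall>x\<in>U. \<forall>\<^sub>F (x', y) in uniformity. x' = x \<longrightarrow> y \<in> U)" for U :: "'a sqm set"
    by (rule open_sqm_def)
  have bl: "bounded_linear (\<lambda>v. M *v v)" for M :: "'a cmat"
    by (rule matrix_vector_mul_bounded_linear)
  show "(norm A = 0) = (A = 0)"
  proof transfer
    fix M :: "'a cmat"
    have "onorm (\<lambda>v. M *v v) = 0 \<longleftrightarrow> (\<forall>v. M *v v = 0)"
      by (rule onorm_eq_0[OF bl])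
    also have "\<dots> \<longleftrightarrow> M = 0"
      by (metis matrix_eq matrix_vector_mult_0)
    finally show "onorm (\<lambda>v. M *v v) = 0 \<longleftrightarrow> M = 0" .
  qed
  show "norm (A + B) \<le> norm A + norm B"
  proof transfer
    fix M N :: "'a cmat"
    have "(\<lambda>v. (M + N) *v v) = (\<lambda>v. M *v v + N *v v)"
      by (rule ext) (simp add: matrix_vector_mult_def vec_eq_iff sum.distrib algebra_simps)
    then show "onorm (\<lambda>v. (M + N) *v v) \<le> onorm (\<lambda>v. M *v v) + onorm (\<lambda>v. N *v v)"
      using onorm_triangle[OF bl[of M] bl[of N]] by simp
  qed
  show "norm (r *\<^sub>R A) = \<bar>r\<bar> * norm A"
  proof transfer
    fix r and M :: "'a cmat"
    have "(r *\<^sub>R M) *v v = r *\<^sub>R (M *v v)" for v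
      by (simp add: matrix_vector_mult_def vec_eq_iff scaleR_sum_right)
    then show "onorm (\<lambda>v. (r *\<^sub>R M) *v v) = \<bar>r\<bar> * onorm (\<lambda>v. M *v v)"
      using onorm_scaleR[OF bl, of r M] by simp
  qed
  show "norm (A * B) \<le> norm A * norm B"
  proof transfer
    fix M N :: "'a cmat"
    show "onorm (\<lambda>v. (M ** N) *v v) \<le> onorm (\<lambda>v. M *v v) * onorm (\<lambda>v. N *v v)"
      using onorm_compose[OF bl, OF bl, of M N] by (simp add: o_def matrix_vector_mul_assoc)
  qed
  show "norm (1 :: 'a sqm) = 1"
  proof transfer
    show "onorm ((*v) (mat 1 :: 'a cmat)) = 1"
      using onorm_id[where 'a = "complex^'a"] by (simp add: matrix_vector_mul_lid[abs_def])
  qed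
qed
end

lemma norm_entry_le_onorm: "norm (M $ a $ b) \<le> onorm (\<lambda>v. (M :: 'n::finite cmat) *v v)"
proof -
  have "norm (M $ a $ b) = norm ((M *v axis b 1) $ a)"
    by (simp add: matrix_vector_mult_def axis_def if_distrib sum.delta cong: if_cong)
  also have "\<dots> \<le> norm (M *v axis b 1)" by (rule Finite_Cartesian_Product.norm_nth_le)
  also have "\<dots> \<le> onorm (\<lambda>v. M *v v) * norm (axis b (1::complex) :: complex^'n)"
    by (rule onorm[OF matrix_vector_mul_bounded_linear])
  finally show ?thesis by (simp add: norm_axis_1)
qed

lemma norm_entry_le: "norm (mat_of A $ a $ b) \<le> norm A"
  by transfer (rule norm_entry_le_onorm)

lemma norm_cmat_le_sum: "norm (M :: 'n::finite cmat) \<le> (\<Sum>a\<in>UNIV. \<Sum>b\<in>UNIV. norm (M $ a $ b))"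
proof -
  have "norm M \<le> (\<Sum>a\<in>UNIV. norm (M $ a))" unfolding norm_vec_def by (rule L2_set_le_sum) simp
  also have "\<dots> \<le> (\<Sum>a\<in>UNIV. \<Sum>b\<in>UNIV. norm (M $ a $ b))"
    by (intro sum_mono) (unfold norm_vec_def, rule L2_set_le_sum, simp)
  finally show ?thesis .
qed

lemma bounded_linear_mat_of: "bounded_linear (mat_of :: 'n::finite sqm \<Rightarrow> _)"
proof (rule bounded_linear_intro[where K = "real (CARD('n)) * real (CARD('n))"])
  show "mat_of (x + y) = mat_of x + mat_of y" for x y :: "'n sqm" by transfer simp
  show "mat_of (r *\<^sub>R x) = r *\<^sub>R mat_of x" for r and x :: "'n sqm" by transfer simp
  show "norm (mat_of x) \<le> norm x * (real CARD('n) * real CARD('n))" for x :: "'n sqm"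
  proof -
    have "norm (mat_of x) \<le> (\<Sum>a\<in>(UNIV::'n set). \<Sum>b\<in>(UNIV::'n set). norm x)"
      by (rule order_trans[OF norm_cmat_le_sum]) (intro sum_mono norm_entry_le)
    then show ?thesis by (simp add: mult_ac)
  qed
qed

text \<open>Together with \<open>bounded_linear_mat_of\<close> this makes the operator norm
  equivalent to the Euclidean one, so limits, sums and completeness can be moved between the two
  types.\<close>

lemma bounded_linear_Sq: "bounded_linear (Sq :: 'n::finite cmat \<Rightarrow> _)"
proof -
  define f :: "'n cmat \<Rightarrow> complex^'n \<Rightarrow> complex^'n" where "f M v = M *v v" for M v
  interpret bounded_bilinear f
  proof (unfold f_def, standard)
    show "\<exists>K. \<forall>a b. norm ((a :: 'n cmat) *v (b :: complex^'n)) \<le> norm a * norm b * K"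
    proof (intro exI allI)
      fix M :: "'n cmat" and v :: "complex^'n"
      have e: "norm ((M *v v) $ a) \<le> (\<Sum>j\<in>(UNIV::'n set). norm M * norm v)" for a
      proof -
        have "norm ((M *v v) $ a) \<le> (\<Sum>j\<in>UNIV. norm (M $ a $ j * v $ j))"
          unfolding matrix_vector_mult_def by (simp add: norm_sum)
        also have "\<dots> \<le> (\<Sum>j\<in>(UNIV::'n set). norm M * norm v)"
        proof (intro sum_mono)
          fix j
          have "norm (M $ a $ j) \<le> norm M"
            using Finite_Cartesian_Product.norm_nth_le[of M a] Finite_Cartesian_Product.norm_nth_le[of "M $ a" j] by linarith
          then show "norm (M $ a $ j * v $ j) \<le> norm M * norm v"
            by (simp add: norm_mult mult_mono Finite_Cartesian_Product.norm_nth_le)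
        qed
        finally show ?thesis .
      qed
      have "norm (M *v v) \<le> (\<Sum>a\<in>UNIV. norm ((M *v v) $ a))"
        unfolding norm_vec_def by (rule L2_set_le_sum) simp
      also have "\<dots> \<le> (\<Sum>a\<in>(UNIV::'n set). \<Sum>j\<in>(UNIV::'n set). norm M * norm v)"
        by (intro sum_mono e)
      finally show "norm (M *v v) \<le> norm M * norm v * (real CARD('n) * real CARD('n))"
        by (simp add: mult_ac)
    qed
  qed (simp_all add: matrix_vector_mult_def vec_eq_iff scaleR_sum_right sum.distrib algebra_simps)
  obtain K where K: "\<And>M v. norm (f M v) \<le> norm M * norm v * K" "K \<ge> 0"
    using nonneg_bounded by blast
  show ?thesis
  proof (rule bounded_linear_intro[where K = K])
    show "Sq (x + y) = Sq x + Sq y" for x y :: "'n cmat" by (simp add: plus_sqm.abs_eq)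
    show "Sq (r *\<^sub>R x) = r *\<^sub>R Sq x" for r and x :: "'n cmat" by (simp add: scaleR_sqm.abs_eq)
    show "norm (Sq x) \<le> norm x * K" for x :: "'n cmat"
      unfolding norm_sqm.abs_eq
      by (rule onorm_bound) (use K in \<open>simp_all add: f_def mult_ac\<close>)
  qed
qed

instance sqm :: (finite) banach
proof
  fix X :: "nat \<Rightarrow> 'a sqm"
  assume "Cauchy X"
  then have "Cauchy (\<lambda>n. mat_of (X n))"
    by (rule bounded_linear.Cauchy[OF bounded_linear_mat_of])
  then obtain M where "(\<lambda>n. mat_of (X n)) \<longlonglongrightarrow> M"
    using Cauchy_convergent convergent_def by blast
  then have "(\<lambda>n. Sq (mat_of (X n))) \<longlonglongrightarrow> Sq M"
    by (rule bounded_linear.tendsto[OF bounded_linear_Sq])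
  then show "convergent X" by (auto simp: convergent_def)
qed

lemma mat_of_simps [simp]:
  "mat_of 0 = 0" "mat_of 1 = mat 1" "mat_of (A + B) = mat_of A + mat_of B"
  "mat_of (A - B) = mat_of A - mat_of B" "mat_of (- A) = - mat_of A"
  "mat_of (A * B) = mat_of A ** mat_of B"
  by (transfer; simp)+

lemma mat_of_sum: "mat_of (sum f S) = (\<Sum>x\<in>S. mat_of (f x))"
  by (induction S rule: infinite_finite_induct) auto

lemma Sq_simps:
  "Sq 0 = 0" "Sq (mat 1) = 1" "Sq (M + N) = Sq M + Sq N" "Sq (M - N) = Sq M - Sq N"
  "Sq (- M) = - Sq M" "Sq (M ** N) = Sq M * Sq N"
  by (rule mat_of_eqI; simp)+

lemma mat_of_power: "mat_of (A ^ k) = mpow (mat_of A) k"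
  by (induction k) auto

text \<open>Complex scaling; the class structure provides real scaling only.\<close>

lift_definition cs :: "complex \<Rightarrow> 'n::finite sqm \<Rightarrow> 'n sqm" is smat .

lemma mat_of_cs: "mat_of (cs c A) = smat c (mat_of A)" by transfer simp

lemma smat_nth [simp]: "smat c M $ a $ b = c * M $ a $ b" by (simp add: smat_def)

lemma mat_of_cs_nth [simp]: "mat_of (cs c A) $ a $ b = c * mat_of A $ a $ b"
  by (simp add: mat_of_cs)

lemma sqm_eqI: "(\<And>a b. mat_of A $ a $ b = mat_of B $ a $ b) \<Longrightarrow> A = B"
  by (rule mat_of_eqI) (simp add: vec_eq_iff)

lemma sqm_mult_nth: "mat_of (A * B) $ a $ b = (\<Sum>k\<in>UNIV. mat_of A $ a $ k * mat_of B $ k $ b)"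
  by (simp add: matrix_matrix_mult_def)

lemma cs_add_left: "cs (x + y) A = cs x A + cs y A"
  and cs_add_right: "cs x (A + B) = cs x A + cs x B"
  and cs_diff_left: "cs (x - y) A = cs x A - cs y A"
  and cs_diff_right: "cs x (A - B) = cs x A - cs x B"
  and cs_minus_left: "cs (- x) A = - cs x A"
  and cs_minus_right: "cs x (- A) = - cs x A"
  and cs_cs [simp]: "cs x (cs y A) = cs (x * y) A"
  by (rule sqm_eqI; simp add: algebra_simps)+

lemma cs_simps [simp]: "cs 0 A = 0" "cs x 0 = 0" "cs 1 A = A"
  by (rule sqm_eqI; simp)+

lemma cs_mult_left [simp]: "cs x A * B = cs x (A * B)"
  and cs_mult_right [simp]: "A * cs x B = cs x (A * B)"
  by (rule sqm_eqI; simp add: sqm_mult_nth sum_distrib_left mult_ac del: mat_of_simps(6))+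

lemma cs_sum_right: "cs x (sum f S) = (\<Sum>i\<in>S. cs x (f i))"
  by (induction S rule: infinite_finite_induct) (auto simp: cs_add_right)

lemma cs_sum_left: "cs (sum f S) A = (\<Sum>i\<in>S. cs (f i) A)"
  by (induction S rule: infinite_finite_induct) (auto simp: cs_add_left)

lemma cs_power: "cs x A ^ k = cs (x ^ k) (A ^ k)"
  by (induction k) (auto simp: mult_ac)

lemma scaleR_cs: "r *\<^sub>R A = cs (of_real r) A"
  by (rule sqm_eqI) (simp only: scaleR_sqm.rep_eq vector_scaleR_component mat_of_cs_nth, simp only: scaleR_conv_of_real)

lemma norm_cs: "norm (cs c A) = norm c * norm A"
proof -
  have le: "norm (cs c A) \<le> norm c * norm A" for c and A :: "'a sqm"
    unfolding norm_sqm.rep_eq mat_of_cs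
  proof (rule onorm_bound)
    fix v
    have "smat c (mat_of A) *v v = c *s (mat_of A *v v)"
      by (simp add: matrix_vector_mult_def vec_eq_iff vector_scalar_mult_def sum_distrib_left mult_ac)
    moreover have "norm (c *s w) = norm c * norm w" for w :: "complex^'a"
      by (simp add: norm_vec_def vector_scalar_mult_def norm_mult L2_set_right_distrib)
    ultimately show "norm (smat c (mat_of A) *v v) \<le> norm c * onorm (\<lambda>v. mat_of A *v v) * norm v"
      using onorm[OF matrix_vector_mul_bounded_linear, of "mat_of A" v]
      by (simp add: mult_left_mono mult.assoc)
  qed (simp add: onorm_pos_le[OF matrix_vector_mul_bounded_linear])
  show ?thesis
  proof (cases "c = 0")
    case False
    then have "norm A = norm (cs (1 / c) (cs c A))" by simp
    also have "\<dots> \<le> norm (1 / c) * norm (cs c A)" by (rule le)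
    finally have "norm c * norm A \<le> norm (cs c A)" using False
      by (simp add: norm_divide field_simps)
    with le[of c A] show ?thesis by simp
  qed simp
qed

lemma mexp_exp: "mexp M = mat_of (exp (Sq M))"
proof -
  have "(\<lambda>k. Sq M ^ k /\<^sub>R fact k) sums exp (Sq M)" by (rule exp_converges)
  then have "(\<lambda>k. mat_of (Sq M ^ k /\<^sub>R fact k)) sums mat_of (exp (Sq M))"
    by (rule bounded_linear.sums[OF bounded_linear_mat_of])
  moreover have "mat_of (Sq M ^ k /\<^sub>R fact k) = smat (1 / of_nat (fact k)) (mpow M k)" for k
    by (simp add: scaleR_cs mat_of_cs mat_of_power inverse_eq_divide)
  ultimately show ?thesis unfolding mexp_def by (simp add: sums_iff)
qed

text \<open>In finite dimension linearity alone gives continuity; this lets \<open>exp_hom\<close>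
  push a homomorphism through the exponential series, later for legs of tensor products and for the
  flip.\<close>

lemma linear_continuous_on_sqm_hom:
  fixes \<phi> :: "'a::finite sqm \<Rightarrow> 'b::finite sqm"
  assumes add: "\<And>x y. \<phi> (x + y) = \<phi> x + \<phi> y" and cs: "\<And>c x. \<phi> (cs c x) = cs c (\<phi> x)"
  shows "bounded_linear \<phi>"
proof -
  have "linear (\<lambda>M. mat_of (\<phi> (Sq M)))"
  proof (rule linearI)
    show "mat_of (\<phi> (Sq (r *\<^sub>R b))) = r *\<^sub>R mat_of (\<phi> (Sq b))" for r b
    proof -
      have "Sq (r *\<^sub>R b) = cs (of_real r) (Sq b)"
        by (metis scaleR_cs scaleR_sqm.abs_eq)
      then show ?thesis by (metis cs scaleR_cs scaleR_sqm.rep_eq)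
    qed
  qed (simp add: Sq_simps add)
  then have "bounded_linear (\<lambda>M. mat_of (\<phi> (Sq M)))" by (simp add: linear_conv_bounded_linear)
  from bounded_linear_compose[OF bounded_linear_Sq bounded_linear_compose[OF this bounded_linear_mat_of]]
  show ?thesis by simp
qed

lemma exp_hom:
  fixes \<phi> :: "'a::finite sqm \<Rightarrow> 'b::finite sqm"
  assumes add: "\<And>x y. \<phi> (x + y) = \<phi> x + \<phi> y" and cs: "\<And>c x. \<phi> (cs c x) = cs c (\<phi> x)"
    and mult: "\<And>x y. \<phi> (x * y) = \<phi> x * \<phi> y" and one: "\<phi> 1 = 1"
  shows "\<phi> (exp x) = exp (\<phi> x)"
proof -
  have pw: "\<phi> (x ^ k) = \<phi> x ^ k" for k by (induction k) (auto simp: one mult)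
  have "(\<lambda>k. \<phi> (x ^ k /\<^sub>R fact k)) sums \<phi> (exp x)"
    by (rule bounded_linear.sums[OF linear_continuous_on_sqm_hom[OF add cs] exp_converges])
  moreover have "\<phi> (x ^ k /\<^sub>R fact k) = \<phi> x ^ k /\<^sub>R fact k" for k
    by (simp add: scaleR_cs cs pw)
  ultimately show ?thesis
    using exp_converges[of "\<phi> x"] sums_unique2 by auto
qed

section \<open>Nilpotent elements and idempotent decompositions\<close>

definition nilp :: "'a::ring_1 \<Rightarrow> bool" where "nilp X \<longleftrightarrow> (\<exists>p. X ^ p = 0)"

lemma commute_sum:
  fixes X :: "'a::ring_1"
  assumes "\<And>i. i \<in> S \<Longrightarrow> X * f i = f i * X"
  shows "X * sum f S = sum f S * X"
  by (simp add: sum_distrib_left sum_distrib_right assms)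

lemma commute_mult:
  fixes X :: "'a::ring_1"
  assumes "X * Y = Y * X" "X * Z = Z * X"
  shows "X * (Y * Z) = (Y * Z) * X"
  by (metis assms mult.assoc)

lemma commute_power:
  fixes X :: "'a::ring_1"
  assumes "X * Y = Y * X"
  shows "X * Y ^ n = Y ^ n * X"
  using power_commuting_commutes[of Y X n] assms by simp

lemma power_zero_mono: "X ^ p = 0 \<Longrightarrow> p \<le> q \<Longrightarrow> (X :: 'a::ring_1) ^ q = 0"
  by (metis le_add_diff_inverse mult_zero_left power_add)

lemma nilp_add_power:
  fixes X Y :: "'a::ring_1"
  assumes c: "X * Y = Y * X" and X: "X ^ p = 0" and Y: "Y ^ q = 0"
  shows "(X + Y) ^ (p + q) = 0"
proof -
  \<comment> \<open>Carrying a monomial \<open>X ^ i * Y ^ j\<close> through the induction replaces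
    the binomial theorem: each factor \<open>X + Y\<close> raises one exponent, until one of the two
    powers vanishes.\<close>
  have "p + q \<le> n + i + j \<Longrightarrow> (X + Y) ^ n * (X ^ i * Y ^ j) = 0" for n i j
  proof (induction n arbitrary: i j)
    case 0
    then have "p \<le> i \<or> q \<le> j" by auto
    then show ?case using power_zero_mono[OF X] power_zero_mono[OF Y] by fastforce
  next
    case (Suc n)
    have "Y * X ^ i = X ^ i * Y" using commute_power[of Y X i] c by simp
    then have "(X + Y) * (X ^ i * Y ^ j) = X ^ Suc i * Y ^ j + X ^ i * Y ^ Suc j"
      by (simp add: distrib_right mult.assoc) (metis mult.assoc)
    then have "(X + Y) ^ Suc n * (X ^ i * Y ^ j)
        = (X + Y) ^ n * (X ^ Suc i * Y ^ j) + (X + Y) ^ n * (X ^ i * Y ^ Suc j)"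
      by (simp only: power_Suc2 mult.assoc) (simp only: distrib_left)
    also have "\<dots> = 0" using Suc.IH[of "Suc i" j] Suc.IH[of i "Suc j"] Suc.prems by simp
    finally show ?case .
  qed
  from this[of "p + q" 0 0] show ?thesis by simp
qed

lemma nilp_add:
  assumes "X * Y = Y * (X :: 'a::ring_1)" "nilp X" "nilp Y"
  shows "nilp (X + Y)"
  using assms nilp_add_power unfolding nilp_def by blast

lemma nilp_0 [simp]: "nilp (0 :: 'a::ring_1)"
  unfolding nilp_def by (rule exI[of _ 1]) simp

text \<open>The explicit exponent matters: for a matrix function it is the same at every point, so
  one truncation of the logarithm series will work everywhere.\<close>

lemma nilp_sum_power:
  fixes f :: "'b \<Rightarrow> 'a::ring_1"
  assumes "finite S" "\<And>i j. i \<in> S \<Longrightarrow> j \<in> S \<Longrightarrow> f i * f j = f j * f i"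
    "\<And>i. i \<in> S \<Longrightarrow> f i ^ p i = 0"
  shows "sum f S ^ (Suc (sum p S)) = 0"
  using assms
proof (induction S rule: finite_induct)
  case (insert x F)
  have "f x * sum f F = sum f F * f x"
    by (rule commute_sum) (use insert in auto)
  moreover have "f x ^ p x = 0" using insert by auto
  moreover have "sum f F ^ Suc (sum p F) = 0" using insert by auto
  ultimately have "(f x + sum f F) ^ (p x + Suc (sum p F)) = 0"
    by (rule nilp_add_power)
  then show ?case using insert by simp
qed simp

lemma power_mult_commuting:
  fixes X Y :: "'a::ring_1"
  assumes "X * Y = Y * X"
  shows "(X * Y) ^ n = X ^ n * Y ^ n"
proof (induction n)
  case (Suc n)
  have "Y * X ^ n = X ^ n * Y" using commute_power[of Y X n] assms by simp
  then show ?case by (simp add: Suc mult.assoc) (metis mult.assoc)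
qed simp

lemma nilp_mult:
  fixes X Y :: "'a::ring_1"
  assumes "X * Y = Y * X" "nilp X"
  shows "nilp (X * Y)"
  using assms power_mult_commuting[OF assms(1)] unfolding nilp_def by (metis mult_zero_left)

lemma nilp_cs: "nilp X \<Longrightarrow> nilp (cs c X)"
  unfolding nilp_def using cs_power by (metis cs_simps(2))

section \<open>Polynomials in a matrix and spectral idempotents\<close>

definition pev :: "complex poly \<Rightarrow> 'n::finite sqm \<Rightarrow> 'n sqm" where
  "pev p C = fold_coeffs (\<lambda>a f. cs a 1 + C * f) p 0"

lemma pev_0 [simp]: "pev 0 C = 0"
  by (simp add: pev_def)

lemma pev_pCons [simp]: "pev (pCons a p) C = cs a 1 + C * pev p C"
  by (cases "p = 0 \<and> a = 0") (auto simp: pev_def)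

lemma pev_add [simp]: "pev (p + q) C = pev p C + pev q C"
  by (induction p q rule: poly_induct2) (auto simp: cs_add_left algebra_simps)

lemma pev_smult [simp]: "pev (smult c p) C = cs c (pev p C)"
  by (induction p) (auto simp: cs_add_right algebra_simps)

lemma pev_mult [simp]: "pev (p * q) C = pev p C * pev q C"
  by (induction p) (auto simp: algebra_simps)

lemma pev_1 [simp]: "pev 1 C = 1"
  by (simp add: one_pCons)

lemma pev_power [simp]: "pev (p ^ n) C = pev p C ^ n"
  by (induction n) auto

lemma pev_monom: "pev (monom c n) C = cs c (C ^ n)"
  by (induction n) (auto simp: monom_0 monom_Suc)

lemma pev_sum: "pev (sum f S) C = (\<Sum>i\<in>S. pev (f i) C)"
  by (induction S rule: infinite_finite_induct) auto

lemma commute_pev: "X * C = C * X \<Longrightarrow> X * pev p C = pev p C * X"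
proof (induction p)
  case (pCons a p)
  then have "X * (C * pev p C) = C * pev p C * X" by (intro commute_mult) auto
  then show ?case by (simp add: distrib_left distrib_right)
qed simp

text \<open>Families instead of sets, so that a repeated vector counts as a relation; powers of a
  matrix may well repeat.\<close>

lemma finite_dim_dependent:
  fixes v :: "nat \<Rightarrow> 'a::euclidean_space"
  shows "\<exists>u :: nat \<Rightarrow> real. (\<exists>k\<le>DIM('a). u k \<noteq> 0) \<and> (\<Sum>k\<le>DIM('a). u k *\<^sub>R v k) = 0"
proof (cases "inj_on v {..DIM('a)}")
  case True
  let ?S = "v ` {..DIM('a)}"
  have "card ?S > DIM('a)" using True by (simp add: card_image)
  then have "dependent ?S" by (intro dependent_biggerset) auto
  then obtain u w where u: "w \<in> ?S" "u w \<noteq> 0" "(\<Sum>x\<in>?S. u x *\<^sub>R x) = 0"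
    using dependent_finite[of ?S] by auto
  from u(1) obtain k where k: "k \<le> DIM('a)" "w = v k" by auto
  have "(\<Sum>k\<le>DIM('a). u (v k) *\<^sub>R v k) = 0"
    using u(3) True by (simp add: sum.reindex)
  then show ?thesis using k u(2) by (intro exI[of _ "\<lambda>k. u (v k)"]) auto
next
  case False
  then obtain i j where ij: "i \<le> DIM('a)" "j \<le> DIM('a)" "i \<noteq> j" "v i = v j"
    by (auto simp: inj_on_def)
  define u :: "nat \<Rightarrow> real" where "u k = (if k = i then 1 else if k = j then -1 else 0)" for k
  have "(\<Sum>k\<le>DIM('a). u k *\<^sub>R v k)
      = (\<Sum>k\<le>DIM('a). (if k = i then v i else 0) - (if k = j then v j else 0))"
    by (rule sum.cong) (use ij in \<open>auto simp: u_def\<close>)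
  also have "\<dots> = 0" using ij by (simp add: sum_subtractf)
  finally show ?thesis using ij by (intro exI[of _ u]) (auto simp: u_def)
qed

text \<open>The powers of C up to the real dimension of the matrix space are linearly dependent, and
  a dependence is a polynomial.\<close>

lemma exists_annihilating_poly: "\<exists>p. p \<noteq> 0 \<and> pev p (C :: 'n::finite sqm) = 0"
proof -
  let ?D = "DIM('n cmat)"
  obtain u k where u: "k \<le> ?D" "u k \<noteq> 0" "(\<Sum>k\<le>?D. u k *\<^sub>R mat_of (C ^ k)) = 0"
    using finite_dim_dependent[of "\<lambda>k. mat_of (C ^ k)"] by blast
  define p :: "complex poly" where "p = (\<Sum>k\<le>?D. monom (of_real (u k)) k)"
  have "coeff p k = of_real (u k)"
    using u(1) by (simp add: p_def coeff_sum)
  with u(2) have "p \<noteq> 0" by auto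
  moreover have "pev p C = (\<Sum>k\<le>?D. u k *\<^sub>R (C ^ k))"
    by (simp add: p_def pev_sum pev_monom scaleR_cs)
  then have "mat_of (pev p C) = 0" using u(3)
    by (simp add: mat_of_sum scaleR_sqm.rep_eq)
  then have "pev p C = 0" by (intro mat_of_eqI) simp
  ultimately show ?thesis by blast
qed

lemma bezout_linear_power:
  fixes p :: "complex poly"
  assumes "poly p x \<noteq> 0"
  shows "\<exists>u v. u * [:- x, 1:] ^ m + v * p = 1"
proof (induction m)
  case 0
  show ?case by (rule exI[of _ 1], rule exI[of _ 0]) simp
next
  case (Suc m)
  define c where "c = poly p x"
  define s where "s = synthetic_div p x"
  \<comment> \<open>Division by the linear factor leaves the value at x; dividing by this nonzero
    constant gives the identity for exponent one.\<close>
  have "p = [:c:] + [:- x, 1:] * s"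
    using synthetic_div_correct'[of x p] unfolding c_def s_def by (metis add.commute)
  then have "[:1 / c:] * p = [:1 / c:] * [:c:] + [:1 / c:] * ([:- x, 1:] * s)"
    by (simp only: distrib_left)
  moreover have "[:1 / c:] * [:c:] = 1" using assms by (simp add: c_def one_pCons)
  ultimately have "[:1 / c:] * p = 1 + [:1 / c:] * ([:- x, 1:] * s)" by (simp only:)
  moreover have "k * p = 1 + k * (a * s) \<Longrightarrow> (- (k * s)) * a + k * p = 1" for k a
    by (simp add: algebra_simps)
  ultimately have "(- ([:1 / c:] * s)) * [:- x, 1:] + [:1 / c:] * p = 1" by blast
  then obtain u v where uv: "u * [:- x, 1:] + v * p = 1" by blast
  obtain u' v' where uv': "u' * [:- x, 1:] ^ m + v' * p = 1" using Suc by blast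
  \<comment> \<open>Inserting the identity for exponent m into the one for exponent one raises the
    exponent.\<close>
  have "1 = u * [:- x, 1:] * (u' * [:- x, 1:] ^ m + v' * p) + v * p"
    by (simp only: uv' uv mult_1_right)
  then have "(u * u') * [:- x, 1:] ^ Suc m + (u * [:- x, 1:] * v' + v) * p = 1"
    by (simp add: algebra_simps)
  then show ?case by blast
qed

text \<open>Primary decomposition inside the corner cut out by an idempotent e, so that induction on
  the degree can split off one root at a time. The new idempotents are polynomials in C times e,
  hence commute with whatever commutes with C.\<close>

lemma idempotent_splitting_single:
  fixes C :: "'n::finite sqm"
  assumes "p \<noteq> 0" "pev p C * e = 0" "e * e = e" "\<And>X. X * C = C * X \<Longrightarrow> X * e = e * X"
  shows "\<exists>L E. finite L \<and> L \<subseteq> {x. poly p x = 0} \<and> (\<Sum>x\<in>L. E x) = e \<and>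
    (\<forall>x\<in>L. \<forall>y\<in>L. E x * E y = (if x = y then E x else 0)) \<and>
    (\<forall>x\<in>L. e * E x = E x) \<and>
    (\<forall>x\<in>L. \<exists>m. (C - cs x 1) ^ m * E x = 0) \<and>
    (\<forall>x\<in>L. \<forall>X. X * C = C * X \<longrightarrow> X * E x = E x * X)"
  using assms
proof (induction "degree p" arbitrary: p e rule: less_induct)
  case less
  show ?case
  proof (cases "degree p = 0")
    case True
    then obtain c where c: "p = [:c:]" by (meson degree_eq_zeroE)
    with less.prems(1,2) have "c \<noteq> 0" "cs c e = 0" by auto
    then have "cs (1 / c) (cs c e) = 0" by simp
    then have "e = 0" using \<open>c \<noteq> 0\<close> by simp
    then show ?thesis by (intro exI[of _ "{}"]) auto
  next
    case False
    then have "\<not> constant (poly p)" by (simp add: constant_degree)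
    then obtain x where x: "poly p x = 0" using fundamental_theorem_of_algebra by blast
    define m where "m = order x p"
    obtain p2 where p2: "p = [:- x, 1:] ^ m * p2" "\<not> [:- x, 1:] dvd p2"
      using order_decomp[OF less.prems(1)] m_def by metis
    have px: "poly p2 x \<noteq> 0" using p2(2) by (simp add: poly_eq_0_iff_dvd)
    have "m \<noteq> 0" using x less.prems(1) by (simp add: m_def order_root)
    have p20: "p2 \<noteq> 0" using p2 less.prems(1) by auto
    have "degree p = m + degree p2"
      by (simp add: p2(1) p20 degree_mult_eq degree_power_eq)
    then have deg: "degree p2 < degree p" using \<open>m \<noteq> 0\<close> by simp
    obtain u v where uv: "u * [:- x, 1:] ^ m + v * p2 = 1"
      using bezout_linear_power[OF px] by blast
    \<comment> \<open>The Bezout identity evaluated at C. Times e, P projects onto the generalised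
      eigenspace of x and Q onto the rest: \<open>P * Q\<close> contains the factor
      \<open>pev p C\<close>, which kills e.\<close>
    define P Q where "P = pev (v * p2) C" and "Q = pev (u * [:- x, 1:] ^ m) C"
    have PQ: "P + Q = 1"
      unfolding P_def Q_def by (metis pev_add uv add.commute pev_1)
    have cP: "X * P = P * X" and cQ: "X * Q = Q * X" if "X * C = C * X" for X
      unfolding P_def Q_def by (rule commute_pev[OF that])+
    have Ce: "C * e = e * C" by (rule less.prems(4)) simp
    have pe: "pev r C * e = e * pev r C" for r
      using commute_pev[of e C r] Ce by simp
    have PQe: "P * Q * e = 0"
    proof -
      have "P * Q * e = pev (v * u * p) C * e"
        unfolding P_def Q_def pev_mult[symmetric] by (simp only: p2(1) ac_simps)
      also have "\<dots> = pev (v * u) C * (pev p C * e)" by (simp add: mult.assoc)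
      finally show ?thesis using less.prems(2) by simp
    qed
    have QP: "Q * P = P * Q"
      unfolding P_def Q_def pev_mult[symmetric] by (simp only: ac_simps)
    define e1 e2 where "e1 = P * e" and "e2 = Q * e"
    have Pe: "e * P = P * e" "e * Q = Q * e" using pe P_def Q_def by metis+
    have e12: "e1 + e2 = e" unfolding e1_def e2_def by (metis PQ distrib_right mult_1)
    have o12: "e1 * e2 = 0" "e2 * e1 = 0"
      unfolding e1_def e2_def using PQe Pe QP less.prems(3) by (metis mult.assoc mult_zero_right)+
    have ee: "e * e1 = e1" "e1 * e = e1" "e * e2 = e2" "e2 * e = e2"
      unfolding e1_def e2_def using Pe less.prems(3) by (metis mult.assoc)+
    have i1: "e1 * e1 = e1" using e12 ee(2) o12(1) by (metis add.right_neutral distrib_left)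
    have i2: "e2 * e2 = e2" using e12 ee(4) o12(2) by (metis add.left_neutral distrib_left)
    have a2: "pev p2 C * e2 = 0"
    proof -
      have "pev p2 C * e2 = pev (u * p) C * e"
        unfolding e2_def Q_def mult.assoc[symmetric] pev_mult[symmetric]
        by (simp only: p2(1) ac_simps)
      then show ?thesis using less.prems(2) by (simp add: mult.assoc)
    qed
    have n1: "(C - cs x 1) ^ m * e1 = 0"
    proof -
      have "C - cs x 1 = pev [:- x, 1:] C" by (simp add: cs_minus_left)
      then have "(C - cs x 1) ^ m * e1 = pev ([:- x, 1:] ^ m) C * e1"
        by (simp only: pev_power)
      also have "\<dots> = pev (v * p) C * e"
        unfolding e1_def P_def mult.assoc[symmetric] pev_mult[symmetric]
        by (simp only: p2(1) ac_simps)
      finally show ?thesis using less.prems(2) by (simp add: mult.assoc)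
    qed
    have ce1: "X * e1 = e1 * X" and ce2: "X * e2 = e2 * X" if "X * C = C * X" for X
      unfolding e1_def e2_def using commute_mult cP cQ less.prems(4) that by blast+
    obtain L E where LE: "finite L" "L \<subseteq> {x. poly p2 x = 0}" "(\<Sum>x\<in>L. E x) = e2"
      "\<forall>x\<in>L. \<forall>y\<in>L. E x * E y = (if x = y then E x else 0)"
      "\<forall>x\<in>L. e2 * E x = E x"
      "\<forall>x\<in>L. \<exists>m. (C - cs x 1) ^ m * E x = 0"
      "\<forall>x\<in>L. \<forall>X. X * C = C * X \<longrightarrow> X * E x = E x * X"
      using less.hyps[OF deg p20 a2 i2 ce2] by blast
    have xL: "x \<notin> L" using LE(2) px by auto
    have z1: "e1 * E y = 0" if "y \<in> L" for y
      using LE(5) that o12(1) by (metis mult.assoc mult_zero_left)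
    have z2: "E y * e1 = 0" if "y \<in> L" for y
    proof -
      have "e1 * C = C * e1" using ce1[of C] by simp
      then show ?thesis using LE(7) that z1 by metis
    qed
    let ?E = "E(x := e1)"
    have EL: "?E y = E y" if "y \<in> L" for y using that xL by auto
    show ?thesis
    proof (intro exI[of _ "insert x L"] exI[of _ ?E] conjI)
      show "finite (insert x L)" using LE(1) by simp
      show "insert x L \<subseteq> {x. poly p x = 0}" using x LE(2) p2 by auto
      show "(\<Sum>x\<in>insert x L. ?E x) = e"
        using sum.cong[OF refl EL, of L] xL LE(1,3) e12 by simp
      show "\<forall>y\<in>insert x L. \<forall>z\<in>insert x L. ?E y * ?E z = (if y = z then ?E y else 0)"
        using LE(4) i1 z1 z2 xL EL by (metis fun_upd_same insert_iff)
      show "\<forall>y\<in>insert x L. e * ?E y = ?E y"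
        using LE(5) ee EL by (metis e12 fun_upd_same insert_iff mult.assoc)
      show "\<forall>y\<in>insert x L. \<exists>m. (C - cs y 1) ^ m * ?E y = 0"
        using LE(6) n1 EL by (metis fun_upd_same insert_iff)
      show "\<forall>y\<in>insert x L. \<forall>X. X * C = C * X \<longrightarrow> X * ?E y = ?E y * X"
        using LE(7) ce1 EL by (metis fun_upd_same insert_iff)
    qed
  qed
qed

text \<open>Joint generalised eigenspaces of a commuting list. A label lists one candidate
  eigenvalue per matrix, and its idempotent is the product of the idempotents of the single
  matrices; some products may vanish.\<close>

lemma idempotent_splitting:
  fixes Cs :: "'n::finite sqm list"
  assumes "\<And>C D. C \<in> set Cs \<Longrightarrow> D \<in> set Cs \<Longrightarrow> C * D = D * C"
  shows "\<exists>A e. finite (A :: complex list set) \<and> (\<Sum>a\<in>A. e a) = 1 \<and>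
    (\<forall>a\<in>A. \<forall>b\<in>A. e a * e b = (if a = b then e a else 0)) \<and>
    (\<forall>a\<in>A. \<forall>m<length Cs. nilp ((Cs ! m - cs (a ! m) 1) * e a)) \<and>
    (\<forall>a\<in>A. \<forall>X. (\<forall>C\<in>set Cs. X * C = C * X) \<longrightarrow> X * e a = e a * X)"
  using assms
proof (induction Cs)
  case Nil
  show ?case by (intro exI[of _ "{[]}"] exI[of _ "\<lambda>_. 1"]) auto
next
  case (Cons C Cs)
  obtain p where p: "p \<noteq> 0" "pev p C = 0" using exists_annihilating_poly by blast
  obtain L E where LE: "finite L" "(\<Sum>x\<in>L. E x) = 1"
      "\<forall>x\<in>L. \<forall>y\<in>L. E x * E y = (if x = y then E x else 0)"
      "\<forall>x\<in>L. \<exists>m. (C - cs x 1) ^ m * E x = 0"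
      "\<forall>x\<in>L. \<forall>X. X * C = C * X \<longrightarrow> X * E x = E x * X"
    using idempotent_splitting_single[OF p(1), of C 1] unfolding p(2) mult_zero_left mult_1_left mult_1_right
    by blast
  obtain A e where Ae: "finite (A :: complex list set)" "(\<Sum>a\<in>A. e a) = 1"
    "\<forall>a\<in>A. \<forall>b\<in>A. e a * e b = (if a = b then e a else 0)"
    "\<forall>a\<in>A. \<forall>m<length Cs. nilp ((Cs ! m - cs (a ! m) 1) * e a)"
    "\<forall>a\<in>A. \<forall>X. (\<forall>C\<in>set Cs. X * C = C * X) \<longrightarrow> X * e a = e a * X"
    using Cons.IH[OF Cons.prems[OF list.set_intros(2) list.set_intros(2)]] by blast
  let ?A = "(\<lambda>(x, a). x # a) ` (L \<times> A)"
  let ?e = "\<lambda>l. E (hd l) * e (tl l)"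
  have inj: "inj_on (\<lambda>(x, a). x # a) (L \<times> A)" by (auto simp: inj_on_def)
  have EC: "E x * D = D * E x" if "x \<in> L" "D \<in> set (C # Cs)" for x D
    using LE(5) that Cons.prems by (metis list.set_intros(1))
  have cE: "E x * e a = e a * E x" if "x \<in> L" "a \<in> A" for x a
    using Ae(5) that EC by (metis list.set_intros(2))
  have eC: "e a * D = D * e a" if "a \<in> A" "D \<in> set (C # Cs)" for a D
    using Ae(5) that Cons.prems by (metis list.set_intros(2))
  show ?case
  proof (intro exI[of _ ?A] exI[of _ ?e] conjI ballI allI impI)
    show "finite ?A" using LE(1) Ae(1) by auto
    show "(\<Sum>a\<in>?A. ?e a) = 1"
      by (subst sum.reindex[OF inj])
         (simp add: sum.cartesian_product' case_prod_unfold sum_product[symmetric] LE(2) Ae(2))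
  next
    fix a b assume "a \<in> ?A" "b \<in> ?A"
    then obtain x r y s where ab: "a = x # r" "b = y # s" "x \<in> L" "y \<in> L" "r \<in> A" "s \<in> A" by auto
    have "?e a * ?e b = (E x * E y) * (e r * e s)"
      unfolding ab(1,2) list.sel using cE[OF ab(4,5)] by (metis mult.assoc)
    then show "?e a * ?e b = (if a = b then ?e a else 0)"
      using ab LE(3) Ae(3) by auto
  next
    fix a m assume "a \<in> ?A" "m < length (C # Cs)"
    then obtain x r where a: "a = x # r" "x \<in> L" "r \<in> A" by auto
    show "nilp (((C # Cs) ! m - cs (a ! m) 1) * ?e a)"
    proof (cases m)
      case 0
      obtain k where k: "(C - cs x 1) ^ k * E x = 0" using LE(4) a by blast
      have c: "(C - cs x 1) * E x = E x * (C - cs x 1)"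
        using EC[of x C] a by (simp add: algebra_simps)
      have "((C - cs x 1) * E x) ^ Suc k = 0"
        unfolding power_mult_commuting[OF c] power_Suc2[of "C - cs x 1"] power_Suc[of "E x"]
        using k c by (metis mult.assoc mult_zero_left power_commutes mult_zero_right)
      then have "nilp ((C - cs x 1) * E x)" unfolding nilp_def by blast
      moreover have "((C - cs x 1) * E x) * e r = e r * ((C - cs x 1) * E x)"
      proof (rule commute_mult[symmetric])
        show "e r * (C - cs x 1) = (C - cs x 1) * e r"
          using eC[of r C] a(3) by (simp add: left_diff_distrib right_diff_distrib)
        show "e r * E x = E x * e r" using cE[OF a(2,3)] by simp
      qed
      ultimately have "nilp (((C - cs x 1) * E x) * e r)" 
        using nilp_mult[of "(C - cs x 1) * E x" "e r"] by blast
      then show ?thesis using 0 a by (simp add: mult.assoc)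
    next
      case (Suc k)
      then have k: "k < length Cs" using \<open>m < _\<close> by simp
      then have D: "Cs ! k \<in> set (C # Cs)" by simp
      have n: "nilp ((Cs ! k - cs (r ! k) 1) * e r)" using Ae(4) a k by blast
      have "E x * ((Cs ! k - cs (r ! k) 1) * e r) = ((Cs ! k - cs (r ! k) 1) * e r) * E x"
      proof (rule commute_mult)
        show "E x * (Cs ! k - cs (r ! k) 1) = (Cs ! k - cs (r ! k) 1) * E x"
          using EC[OF a(2) D] by (simp add: left_diff_distrib right_diff_distrib)
        show "E x * e r = e r * E x" by (rule cE[OF a(2,3)])
      qed
      then have "nilp (((Cs ! k - cs (r ! k) 1) * e r) * E x)"
        by (rule nilp_mult[OF sym n])
      then show ?thesis using Suc a(1) cE[OF a(2,3)] by (simp add: mult.assoc)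
    qed
  next
    fix a X assume "a \<in> ?A" and X: "\<forall>D\<in>set (C # Cs). X * D = D * X"
    then obtain x r where a: "a = x # r" "x \<in> L" "r \<in> A" by auto
    show "X * ?e a = ?e a * X"
      unfolding a(1) list.sel
    proof (rule commute_mult)
      show "X * E x = E x * X" using LE(5) X a(2) by (metis list.set_intros(1))
      show "X * e r = e r * X" using Ae(5) X a(3) by (metis list.set_intros(2))
    qed
  qed
qed

section \<open>Integral semisimple matrices and exponentials\<close>

text \<open>Diagonalisable with integer eigenvalues, expressed by a spectral resolution. The
  exponential of \<open>cs \<omega> M\<close> then depends on \<omega> only through
  \<open>exp \<omega>\<close>.\<close>

definition intss :: "'n::finite sqm \<Rightarrow> bool" where
  "intss M \<longleftrightarrow> (\<exists>(N :: int set) E. finite N \<and> M = (\<Sum>n\<in>N. cs (of_int n) (E n)) \<and> (\<Sum>n\<in>N. E n) = 1 \<and>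
     (\<forall>n\<in>N. \<forall>m\<in>N. E n * E m = (if n = m then E n else 0)))"

lemma intssI:
  fixes e :: "'k \<Rightarrow> 'n::finite sqm"
  assumes fin: "finite A" and M: "M = (\<Sum>a\<in>A. cs (of_int (\<nu> a)) (e a))" and one: "(\<Sum>a\<in>A. e a) = 1"
    and orth: "\<And>a b. a \<in> A \<Longrightarrow> b \<in> A \<Longrightarrow> e a * e b = (if a = b then e a else 0)"
  shows "intss M"
proof -
  define E where "E n = (\<Sum>a\<in>{a\<in>A. \<nu> a = n}. e a)" for n
  have "M = (\<Sum>n\<in>\<nu> ` A. \<Sum>a\<in>{a\<in>A. \<nu> a = n}. cs (of_int (\<nu> a)) (e a))"
    unfolding M by (rule sum.group[symmetric]) (use fin in auto)
  also have "\<dots> = (\<Sum>n\<in>\<nu> ` A. cs (of_int n) (E n))"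
    by (simp add: E_def cs_sum_right)
  finally have 1: "M = (\<Sum>n\<in>\<nu> ` A. cs (of_int n) (E n))" .
  have 2: "(\<Sum>n\<in>\<nu> ` A. E n) = 1"
    unfolding one[symmetric] E_def by (rule sum.group) (use fin in auto)
  have 3: "E n * E m = (if n = m then E n else 0)" for n m
  proof -
    have "E n * E m = (\<Sum>a\<in>{a\<in>A. \<nu> a = n}. \<Sum>b\<in>{a\<in>A. \<nu> a = m}. if a = b then e a else 0)"
      unfolding E_def sum_product by (intro sum.cong refl) (auto simp: orth)
    also have "\<dots> = (\<Sum>a\<in>{a\<in>A. \<nu> a = n}. if n = m then e a else 0)"
      by (intro sum.cong refl) (use fin in auto)
    finally show ?thesis by (simp add: E_def)
  qed
  show ?thesis unfolding intss_def
    by (rule exI[of _ "\<nu> ` A"], rule exI[of _ E]) (use fin 1 2 3 in auto)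
qed

lemma bounded_linear_cs_left: "bounded_linear (\<lambda>c. cs c A)"
  by (rule bounded_linear_intro[where K = "norm A"])
     (auto simp: cs_add_left scaleR_cs norm_cs scaleR_conv_of_real)

lemma exp_orthogonal_idempotents:
  fixes e :: "'k \<Rightarrow> 'n::finite sqm"
  assumes fin: "finite A" and one: "(\<Sum>a\<in>A. e a) = 1"
    and orth: "\<And>a b. a \<in> A \<Longrightarrow> b \<in> A \<Longrightarrow> e a * e b = (if a = b then e a else 0)"
  shows "exp (\<Sum>a\<in>A. cs (x a) (e a)) = (\<Sum>a\<in>A. cs (exp (x a)) (e a))"
proof -
  have pw: "(\<Sum>a\<in>A. cs (x a) (e a)) ^ k = (\<Sum>a\<in>A. cs (x a ^ k) (e a))" for k
  proof (induction k)
    case (Suc k)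
    have "(\<Sum>a\<in>A. cs (x a) (e a)) ^ Suc k
        = (\<Sum>a\<in>A. \<Sum>b\<in>A. cs (x a * x b ^ k) (e a * e b))"
      by (simp add: Suc sum_product mult.commute)
    also have "\<dots> = (\<Sum>a\<in>A. \<Sum>b\<in>A. if a = b then cs (x a * x b ^ k) (e a) else 0)"
      by (intro sum.cong refl) (auto simp: orth)
    also have "\<dots> = (\<Sum>a\<in>A. cs (x a ^ Suc k) (e a))" using fin by (intro sum.cong refl) simp
    finally show ?case .
  qed (simp add: one)
  have "(\<lambda>k. \<Sum>a\<in>A. cs (x a ^ k /\<^sub>R fact k) (e a)) sums (\<Sum>a\<in>A. cs (exp (x a)) (e a))"
    by (intro sums_sum bounded_linear.sums[OF bounded_linear_cs_left] exp_converges)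
  moreover have "(\<Sum>a\<in>A. cs (x a ^ k /\<^sub>R fact k) (e a)) = (\<Sum>a\<in>A. cs (x a) (e a)) ^ k /\<^sub>R fact k" for k
    by (simp add: pw scaleR_sum_right) (simp add: scaleR_cs scaleR_conv_of_real)
  ultimately show ?thesis
    using exp_converges[of "\<Sum>a\<in>A. cs (x a) (e a)"] sums_unique2 by fastforce
qed

lemma exp_nilpotent:
  fixes X :: "'a::{real_normed_algebra_1, banach}"
  assumes "X ^ p = 0"
  shows "exp X = (\<Sum>k<p. X ^ k /\<^sub>R fact k)"
  unfolding exp_def
  by (rule suminf_finite) (use power_zero_mono[OF assms] in auto)

section \<open>Kronecker products\<close>

definition kronS :: "'n::finite sqm \<Rightarrow> 'm::finite sqm \<Rightarrow> ('n \<times> 'm) sqm" where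
  "kronS A B = Sq (kron (mat_of A) (mat_of B))"

lemma mat_of_kronS: "mat_of (kronS A B) = kron (mat_of A) (mat_of B)"
  by (simp add: kronS_def)

lemma kron_nth: "kron A B $ x $ y = A $ fst x $ fst y * B $ snd x $ snd y"
  by (simp add: kron_def)

lemma sum_UNIV_prod:
  fixes f :: "'a::finite \<Rightarrow> 'c::semiring_0" and g :: "'b::finite \<Rightarrow> 'c"
  shows "(\<Sum>k\<in>UNIV. f (fst k) * g (snd k)) = (\<Sum>i\<in>UNIV. f i) * (\<Sum>j\<in>UNIV. g j)"
proof -
  have "(\<Sum>k\<in>UNIV. f (fst k) * g (snd k)) = (\<Sum>k\<in>UNIV \<times> UNIV. f (fst k) * g (snd k))"
    by (simp only: UNIV_Times_UNIV)
  also have "\<dots> = (\<Sum>i\<in>UNIV. f i) * (\<Sum>j\<in>UNIV. g j)"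
    unfolding sum_product sum.cartesian_product case_prod_unfold ..
  finally show ?thesis .
qed

lemma kron_mult: "kron A B ** kron C D = kron (A ** C) (B ** D)"
proof -
  have "(\<Sum>k\<in>UNIV. kron A B $ x $ k * kron C D $ k $ y)
      = (\<Sum>k\<in>UNIV. (A $ fst x $ fst k * C $ fst k $ fst y) * (B $ snd x $ snd k * D $ snd k $ snd y))" for x y
    by (simp add: kron_nth mult_ac)
  then show ?thesis
    by (simp only: vec_eq_iff cmat_nth_mult sum_UNIV_prod[where
       f = "\<lambda>k. A $ fst _ $ k * C $ k $ fst _" and g = "\<lambda>k. B $ snd _ $ k * D $ k $ snd _"] kron_nth) 
       (simp add: kron_nth cmat_nth_mult)
qed

lemma kronS_mult: "kronS A B * kronS C D = kronS (A * C) (B * D)"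
  by (rule mat_of_eqI) (simp add: mat_of_kronS kron_mult)

lemma kronS_one [simp]: "kronS 1 1 = 1"
  by (rule sqm_eqI) (auto simp: mat_of_kronS kron_nth mat_def prod_eq_iff)

lemma kronS_add_left: "kronS (A + B) C = kronS A C + kronS B C"
  and kronS_add_right: "kronS C (A + B) = kronS C A + kronS C B"
  and kronS_cs_left [simp]: "kronS (cs c A) C = cs c (kronS A C)"
  and kronS_cs_right [simp]: "kronS C (cs c A) = cs c (kronS C A)"
  and kronS_zero [simp]: "kronS 0 C = 0" "kronS C 0 = 0"
  by (rule sqm_eqI; simp add: mat_of_kronS kron_nth algebra_simps)+

lemma kronS_sum_left: "kronS (sum f S) C = (\<Sum>i\<in>S. kronS (f i) C)"
  by (induction S rule: infinite_finite_induct) (auto simp: kronS_add_left)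

lemma kronS_sum_right: "kronS C (sum f S) = (\<Sum>i\<in>S. kronS C (f i))"
  by (induction S rule: infinite_finite_induct) (auto simp: kronS_add_right)

lemma kronS_power: "kronS A B ^ k = kronS (A ^ k) (B ^ k)"
  by (induction k) (auto simp: kronS_mult)

lemma nilp_kronS: "nilp A \<or> nilp B \<Longrightarrow> nilp (kronS A B)"
  unfolding nilp_def kronS_power by (metis kronS_zero)

text \<open>Tensor products of spectral idempotents resolve the identity, and their eigenvalues are
  products of integers.\<close>

lemma intss_kronS:
  assumes "intss P" "intss Q"
  shows "intss (cs (of_int c) (kronS P Q))"
proof -
  from assms(1) obtain N E where P: "finite (N :: int set)" "P = (\<Sum>n\<in>N. cs (of_int n) (E n))"
    "(\<Sum>n\<in>N. E n) = 1" "\<forall>n\<in>N. \<forall>m\<in>N. E n * E m = (if n = m then E n else 0)"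
    unfolding intss_def by blast
  from assms(2) obtain N' E' where Q: "finite (N' :: int set)" "Q = (\<Sum>n\<in>N'. cs (of_int n) (E' n))"
    "(\<Sum>n\<in>N'. E' n) = 1" "\<forall>n\<in>N'. \<forall>m\<in>N'. E' n * E' m = (if n = m then E' n else 0)"
    unfolding intss_def by blast
  show ?thesis
  proof (rule intssI[of "N \<times> N'" _ "\<lambda>(n, m). c * n * m" "\<lambda>(n, m). kronS (E n) (E' m)"])
    show "finite (N \<times> N')" using P Q by simp
    show "cs (of_int c) (kronS P Q) = (\<Sum>a\<in>N \<times> N'.
        cs (of_int (case a of (n, m) \<Rightarrow> c * n * m)) (case a of (n, m) \<Rightarrow> kronS (E n) (E' m)))"
      unfolding P(2) Q(2) kronS_sum_left kronS_sum_right
      by (subst sum.swap) (simp add: sum.cartesian_product' cs_sum_right mult_ac)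
    show "(\<Sum>a\<in>N \<times> N'. case a of (n, m) \<Rightarrow> kronS (E n) (E' m)) = 1"
      by (simp add: sum.cartesian_product' kronS_sum_left[symmetric] kronS_sum_right[symmetric] P(3) Q(3))
    show "(case a of (n, m) \<Rightarrow> kronS (E n) (E' m)) * (case b of (n, m) \<Rightarrow> kronS (E n) (E' m)) =
       (if a = b then case a of (n, m) \<Rightarrow> kronS (E n) (E' m) else 0)"
      if "a \<in> N \<times> N'" "b \<in> N \<times> N'" for a b
    proof -
      obtain x y x' y' where ab: "a = (x, y)" "b = (x', y')" "x \<in> N" "x' \<in> N" "y \<in> N'" "y' \<in> N'"
        using \<open>a \<in> N \<times> N'\<close> \<open>b \<in> N \<times> N'\<close> by blast
      have "E x * E x' = (if x = x' then E x else 0)" "E' y * E' y' = (if y = y' then E' y else 0)"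
        using P(4) Q(4) ab by blast+
      then show ?thesis unfolding ab by (simp add: kronS_mult)
    qed
  qed
qed

no_notation fps_nth (infixl \<open>$\<close> 75)

section \<open>Rational functions regular off a finite set\<close>

text \<open>Values on B are left open. This makes the notion closed under ring operations, whereas a
  \<open>ratfun\<close> is 0 at its poles, so a sum of two such functions can have the wrong value
  at a cancelled pole.\<close>

definition rreg :: "complex set \<Rightarrow> (complex \<Rightarrow> complex) \<Rightarrow> bool" where
  "rreg B f \<longleftrightarrow> (\<exists>p r. r \<noteq> 0 \<and> (\<forall>z. z \<notin> B \<longrightarrow> poly r z \<noteq> 0 \<and> f z = poly p z / poly r z))"

lemma rregI: "r \<noteq> 0 \<Longrightarrow> (\<And>z. z \<notin> B \<Longrightarrow> poly r z \<noteq> 0) \<Longrightarrow> (\<And>z. z \<notin> B \<Longrightarrow> f z = poly p z / poly r z) \<Longrightarrow> rreg B f"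
  unfolding rreg_def by blast

lemma rreg_poly: "rreg B (poly p)"
  by (rule rregI[where r = 1 and p = p]) auto

lemma rreg_const [simp]: "rreg B (\<lambda>z. c)"
  by (rule rregI[where r = 1 and p = "[:c:]"]) auto

lemma rreg_id [simp]: "rreg B (\<lambda>z. z)"
  by (rule rregI[where r = 1 and p = "[:0, 1:]"]) auto

lemma rreg_add: "rreg B f \<Longrightarrow> rreg B g \<Longrightarrow> rreg B (\<lambda>z. f z + g z)"
proof -
  assume "rreg B f" "rreg B g"
  then obtain p r p' r' where h: "r \<noteq> 0" "\<And>z. z \<notin> B \<Longrightarrow> poly r z \<noteq> 0 \<and> f z = poly p z / poly r z"
    "r' \<noteq> 0" "\<And>z. z \<notin> B \<Longrightarrow> poly r' z \<noteq> 0 \<and> g z = poly p' z / poly r' z"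
    unfolding rreg_def by metis
  show ?thesis
    by (rule rregI[where r = "r * r'" and p = "p * r' + p' * r"]) (use h in \<open>auto simp: field_simps\<close>)
qed

lemma rreg_mult: "rreg B f \<Longrightarrow> rreg B g \<Longrightarrow> rreg B (\<lambda>z. f z * g z)"
proof -
  assume "rreg B f" "rreg B g"
  then obtain p r p' r' where h: "r \<noteq> 0" "\<And>z. z \<notin> B \<Longrightarrow> poly r z \<noteq> 0 \<and> f z = poly p z / poly r z"
    "r' \<noteq> 0" "\<And>z. z \<notin> B \<Longrightarrow> poly r' z \<noteq> 0 \<and> g z = poly p' z / poly r' z"
    unfolding rreg_def by metis
  show ?thesis
    by (rule rregI[where r = "r * r'" and p = "p * p'"]) (use h in \<open>auto simp: field_simps\<close>)
qed

lemma rreg_minus: "rreg B f \<Longrightarrow> rreg B (\<lambda>z. - f z)"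
  using rreg_mult[OF rreg_const[of B "-1"]] by simp

lemma rreg_diff: "rreg B f \<Longrightarrow> rreg B g \<Longrightarrow> rreg B (\<lambda>z. f z - g z)"
  using rreg_add[of B f "\<lambda>z. - g z"] rreg_minus by simp

lemma rreg_sum: "(\<And>i. i \<in> S \<Longrightarrow> rreg B (f i)) \<Longrightarrow> rreg B (\<lambda>z. \<Sum>i\<in>S. f i z)"
  by (induction S rule: infinite_finite_induct) (auto intro: rreg_add)

lemma rreg_power: "rreg B f \<Longrightarrow> rreg B (\<lambda>z. f z ^ n)"
  by (induction n) (auto intro: rreg_mult)

lemma rreg_mono: "rreg B f \<Longrightarrow> B \<subseteq> B' \<Longrightarrow> rreg B' f"
  unfolding rreg_def by blast

lemma rreg_cong: "rreg B f \<Longrightarrow> (\<And>z. z \<notin> B \<Longrightarrow> g z = f z) \<Longrightarrow> rreg B g"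
  unfolding rreg_def by metis

lemma infinite_compl_finite: "finite B \<Longrightarrow> infinite (- B :: complex set)"
  by (metis Compl_eq_Diff_UNIV Diff_infinite_finite infinite_UNIV_char_0)

lemma rreg_inverse:
  assumes "finite B" "rreg B f" "\<And>z. z \<notin> B \<Longrightarrow> f z \<noteq> 0"
  shows "rreg B (\<lambda>z. inverse (f z))"
proof -
  obtain p r where h: "r \<noteq> 0" "\<And>z. z \<notin> B \<Longrightarrow> poly r z \<noteq> 0 \<and> f z = poly p z / poly r z"
    using assms(2) unfolding rreg_def by blast
  obtain z where z: "z \<notin> B" using infinite_compl_finite[OF assms(1)]
    by (metis ComplD finite.emptyI subsetI subset_empty)
  have p: "poly p z \<noteq> 0" if "z \<notin> B" for z using h(2)[OF that] assms(3)[OF that] by auto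
  then have "p \<noteq> 0" using z by auto
  then show ?thesis
    by (intro rregI[where r = p and p = r]) (use h p in auto)
qed

lemma rreg_divide:
  assumes "finite B" "rreg B f" "rreg B g" "\<And>z. z \<notin> B \<Longrightarrow> g z \<noteq> 0"
  shows "rreg B (\<lambda>z. f z / g z)"
  using rreg_mult[OF assms(2) rreg_inverse[OF assms(1,3,4)]] by (simp add: divide_inverse)

lemma rreg_powi:
  assumes "finite B" "rreg B f" "\<And>z. z \<notin> B \<Longrightarrow> f z \<noteq> 0"
  shows "rreg B (\<lambda>z. f z powi n)"
  using rreg_power[OF assms(2)] rreg_power[OF rreg_inverse[OF assms]]
  by (cases "n \<ge> 0") (simp_all add: power_int_def)

lemma rreg_scale:
  assumes "rreg B f" "\<alpha> \<noteq> 0"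
  shows "rreg {z. \<alpha> * z \<in> B} (\<lambda>z. f (\<alpha> * z))"
proof -
  obtain p r where h: "r \<noteq> 0" "\<And>z. z \<notin> B \<Longrightarrow> poly r z \<noteq> 0 \<and> f z = poly p z / poly r z"
    using assms(1) unfolding rreg_def by blast
  have "pcompose r [:0, \<alpha>:] \<noteq> 0" using h(1) assms(2) by (simp add: pcompose_eq_0_iff)
  then show ?thesis
    by (rule rregI[where r = "pcompose r [:0, \<alpha>:]" and p = "pcompose p [:0, \<alpha>:]"])
       (use h in \<open>auto simp: poly_pcompose mult.commute\<close>)
qed

lemma rreg_reciprocal:
  assumes "rreg B f" "c \<noteq> 0"
  shows "rreg (insert 0 {z. c / z \<in> B}) (\<lambda>z. f (c / z))"
proof -
  have "rreg {z. c * z \<in> B} (\<lambda>z. f (c * z))" by (rule rreg_scale[OF assms])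
  then obtain p r where h: "r \<noteq> 0"
    "\<And>z. c * z \<notin> B \<Longrightarrow> poly r z \<noteq> 0 \<and> f (c * z) = poly p z / poly r z"
    unfolding rreg_def by (metis mem_Collect_eq)
  show ?thesis
  \<comment> \<open>\<open>reflect_poly s\<close> at z is \<open>z ^ degree s\<close> times s at
    1/z; the two monomials balance the different degrees of p and r.\<close>
  proof (rule rregI[where r = "reflect_poly r * monom 1 (degree p)" and p = "reflect_poly p * monom 1 (degree r)"])
    show "reflect_poly r * monom 1 (degree p) \<noteq> 0" using h by (simp add: monom_eq_0_iff)
    fix z assume z: "z \<notin> insert 0 {z. c / z \<in> B}"
    then have nz: "z \<noteq> 0" and "c * inverse z \<notin> B" by (auto simp: divide_inverse)
    note h2 = h(2)[OF this(2)]
    have rp: "poly (reflect_poly s) z = z ^ degree s * poly s (inverse z)" for s :: "complex poly"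
      using nz by (rule poly_reflect_poly_nz)
    show "poly (reflect_poly r * monom 1 (degree p)) z \<noteq> 0"
      using h2 nz by (simp add: rp poly_monom)
    show "f (c / z) = poly (reflect_poly p * monom 1 (degree r)) z / poly (reflect_poly r * monom 1 (degree p)) z"
      using h2 nz by (simp add: rp poly_monom divide_inverse[of c])
  qed
qed

text \<open>Cross-multiplication turns equality at a point into a root of one polynomial, which is
  zero once it has infinitely many roots.\<close>

lemma rreg_unique:
  assumes "rreg B f" "rreg B g" "infinite {z. z \<notin> B \<and> f z = g z}" "z \<notin> B"
  shows "f z = g z"
proof -
  obtain p r p' r' where h: "r \<noteq> 0" "\<And>z. z \<notin> B \<Longrightarrow> poly r z \<noteq> 0 \<and> f z = poly p z / poly r z"
    "r' \<noteq> 0" "\<And>z. z \<notin> B \<Longrightarrow> poly r' z \<noteq> 0 \<and> g z = poly p' z / poly r' z"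
    using assms(1,2) unfolding rreg_def by metis
  have iff: "f z = g z \<longleftrightarrow> poly (p * r' - p' * r) z = 0" if "z \<notin> B" for z
    using h(2,4)[OF that] by (auto simp: field_simps)
  have "{z. z \<notin> B \<and> f z = g z} \<subseteq> {z. poly (p * r' - p' * r) z = 0}" using iff by auto
  then have "infinite {z. poly (p * r' - p' * r) z = 0}" using assms(3) finite_subset by blast
  then have "p * r' - p' * r = 0" using poly_roots_finite by blast
  then show ?thesis using iff[OF assms(4)] by simp
qed

lemma eventually_not_in_finite: "finite B \<Longrightarrow> z \<notin> B \<Longrightarrow> eventually (\<lambda>w. w \<notin> (B :: complex set)) (nhds z)"
  using finite_imp_closed[of B] eventually_nhds[of "\<lambda>w. w \<notin> B"]
  by (metis ComplD ComplI open_Compl)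

lemma eventually_at_not_in_finite: "finite B \<Longrightarrow> eventually (\<lambda>w. w \<notin> (B :: complex set)) (at z)"
proof -
  assume "finite B"
  then have "eventually (\<lambda>w. w \<notin> B - {z}) (nhds z)" by (intro eventually_not_in_finite) auto
  then show ?thesis unfolding eventually_at_filter by eventually_elim auto
qed

lemma rreg_field_differentiable:
  assumes "rreg B f" "finite B" "z \<notin> B"
  shows "f field_differentiable (at z)"
proof -
  obtain p r where h: "r \<noteq> 0" "\<And>z. z \<notin> B \<Longrightarrow> poly r z \<noteq> 0 \<and> f z = poly p z / poly r z"
    using assms(1) unfolding rreg_def by blast
  have "(\<lambda>z. poly p z / poly r z) field_differentiable (at z)"
    unfolding field_differentiable_def
    by (rule exI, rule DERIV_divide[OF poly_DERIV poly_DERIV]) (use h assms in auto)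
  moreover have "eventually (\<lambda>w. poly p w / poly r w = f w) (nhds z)"
    using eventually_not_in_finite[OF assms(2,3)] by eventually_elim (use h in auto)
  ultimately show ?thesis
    unfolding field_differentiable_def
    using DERIV_cong_ev[OF refl _ refl, of "\<lambda>z. poly p z / poly r z" f z] by blast
qed

lemma rreg_isCont: "rreg B f \<Longrightarrow> finite B \<Longrightarrow> z \<notin> B \<Longrightarrow> isCont f z"
  using field_differentiable_imp_continuous_at rreg_field_differentiable by blast

lemma rreg_holomorphic: "rreg B f \<Longrightarrow> finite B \<Longrightarrow> f holomorphic_on - B"
  unfolding holomorphic_on_def
  using rreg_field_differentiable field_differentiable_at_within by (metis ComplD)

lemma reduce_fraction:
  fixes p r :: "complex poly"
  assumes "r \<noteq> 0"
  shows "\<exists>p' r'. r' \<noteq> 0 \<and> coprime p' r' \<and>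
    (\<forall>z. poly r z \<noteq> 0 \<longrightarrow> poly r' z \<noteq> 0 \<and> poly p' z / poly r' z = poly p z / poly r z)"
  using assms
proof (induction "degree r" arbitrary: p r rule: less_induct)
  case less
  show ?case
  proof (cases "coprime p r")
    case False
    then obtain c where c: "c dvd p" "c dvd r" "\<not> is_unit c" unfolding coprime_def by blast
    then obtain p1 r1 where pr: "p = c * p1" "r = c * r1" by (auto simp: dvd_def)
    have nz: "c \<noteq> 0" "r1 \<noteq> 0" using less.prems pr by auto
    have "degree c > 0" using c(3) nz by (simp add: is_unit_iff_degree)
    then have "degree r1 < degree r" using nz pr by (simp add: degree_mult_eq)
    from less.hyps[OF this nz(2), of p1] show ?thesis unfolding pr by auto
  qed (use less.prems in blast)
qed

lemma ratfun_of_rreg: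
  assumes "rreg B f"
  shows "\<exists>g. ratfun g \<and> (\<forall>z. z \<notin> B \<longrightarrow> g z = f z)"
proof -
  obtain p r where h: "r \<noteq> 0" "\<And>z. z \<notin> B \<Longrightarrow> poly r z \<noteq> 0 \<and> f z = poly p z / poly r z"
    using assms(1) unfolding rreg_def by blast
  obtain p' r' where h': "r' \<noteq> 0" "coprime p' r'"
    "\<forall>z. poly r z \<noteq> 0 \<longrightarrow> poly r' z \<noteq> 0 \<and> poly p' z / poly r' z = poly p z / poly r z"
    using reduce_fraction[OF h(1), of p] by blast
  show ?thesis
    by (rule exI[of _ "\<lambda>z. poly p' z / poly r' z"]) (use h h' in \<open>auto simp: ratfun_def\<close>)
qed

text \<open>By coprimality the numerator does not vanish where the denominator does, so the zeros of
  the denominator are poles in the analytic sense.\<close>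

lemma ratfun_poles:
  assumes "ratfun f"
  shows "\<exists>B. finite B \<and> rreg B f \<and> (\<forall>z\<in>B. is_pole f z)"
proof -
  obtain p r where h: "r \<noteq> 0" "coprime p r" "\<And>z. f z = poly p z / poly r z"
    using assms unfolding ratfun_def by blast
  have f: "f = (\<lambda>z. poly p z / poly r z)" using h(3) by auto
  have "is_pole f z" if z: "poly r z = 0" for z
  proof -
    have "poly p z \<noteq> 0"
    proof
      assume "poly p z = 0"
      then have "[:- z, 1:] dvd p" "[:- z, 1:] dvd r" using z by (simp_all add: poly_eq_0_iff_dvd)
      then have "is_unit [:- z, 1:]" using h(2) unfolding coprime_def by blast
      then show False by (simp add: is_unit_iff_degree)
    qed
    moreover have "filterlim (poly r) (at 0) (at z)"
      unfolding filterlim_at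
    proof
      show "\<forall>\<^sub>F x in at z. poly r x \<in> UNIV \<and> poly r x \<noteq> 0"
        using eventually_at_not_in_finite[OF poly_roots_finite[OF h(1)], of z] by simp
      have "(poly r \<longlongrightarrow> poly r z) (at z)" using isContD poly_isCont by blast
      then show "(poly r \<longlongrightarrow> 0) (at z)" using z by simp
    qed
    ultimately show ?thesis unfolding f by (intro is_pole_divide) auto
  qed
  then show ?thesis
    using h poly_roots_finite[OF h(1)]
    by (intro exI[of _ "{z. poly r z = 0}"] conjI rregI[where r = r and p = p]) auto
qed

section \<open>Matrix-valued rational functions\<close>

definition mreg :: "complex set \<Rightarrow> (complex \<Rightarrow> 'n::finite cmat) \<Rightarrow> bool" where
  "mreg B f \<longleftrightarrow> (\<forall>a b. rreg B (\<lambda>z. f z $ a $ b))"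

lemma mreg_mono: "mreg B f \<Longrightarrow> B \<subseteq> B' \<Longrightarrow> mreg B' f"
  unfolding mreg_def using rreg_mono by blast

lemma mreg_mult: "mreg B f \<Longrightarrow> mreg B g \<Longrightarrow> mreg B (\<lambda>z. f z ** g z)"
  unfolding mreg_def cmat_nth_mult by (auto intro!: rreg_sum rreg_mult)

lemma mreg_const: "mreg B (\<lambda>z. M)"
  unfolding mreg_def by simp

lemma mreg_add: "mreg B f \<Longrightarrow> mreg B g \<Longrightarrow> mreg B (\<lambda>z. f z + g z)"
  unfolding mreg_def by (auto intro!: rreg_add)

lemma mreg_sum: "(\<And>i. i \<in> S \<Longrightarrow> mreg B (f i)) \<Longrightarrow> mreg B (\<lambda>z. \<Sum>i\<in>S. f i z)"
  unfolding mreg_def by (auto intro!: rreg_sum)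

lemma mreg_smat: "rreg B c \<Longrightarrow> mreg B f \<Longrightarrow> mreg B (\<lambda>z. smat (c z) (f z))"
  unfolding mreg_def by (auto intro!: rreg_mult)

lemma mreg_kron: "mreg B f \<Longrightarrow> mreg B g \<Longrightarrow> mreg B (\<lambda>z. kron (f z) (g z))"
  unfolding mreg_def kron_nth by (auto intro!: rreg_mult)

lemma mreg_unique:
  assumes "mreg B f" "mreg B g" "infinite {z. z \<notin> B \<and> f z = g z}" "z \<notin> B"
  shows "f z = g z"
proof -
  have "f z $ a $ b = g z $ a $ b" for a b
  proof (rule rreg_unique[OF _ _ _ assms(4)])
    show "rreg B (\<lambda>z. f z $ a $ b)" "rreg B (\<lambda>z. g z $ a $ b)" using assms unfolding mreg_def by auto
    have "{z. z \<notin> B \<and> f z = g z} \<subseteq> {z. z \<notin> B \<and> f z $ a $ b = g z $ a $ b}" by auto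
    then show "infinite {z. z \<notin> B \<and> f z $ a $ b = g z $ a $ b}" using assms(3) finite_subset by blast
  qed
  then show ?thesis by (simp add: vec_eq_iff)
qed

lemma mreg_isCont:
  assumes "mreg B f" "finite B" "z \<notin> B"
  shows "isCont f z"
proof -
  have "((\<lambda>z. f z $ a $ b) \<longlongrightarrow> f z $ a $ b) (at z)" for a b
    using rreg_isCont[OF _ assms(2,3)] assms(1) unfolding mreg_def isCont_def by blast
  then show ?thesis unfolding isCont_def by (intro vec_tendstoI)
qed

lemma mreg_not_pole:
  assumes "mreg B g" "finite B" "z \<notin> B" "\<And>z. z \<notin> B \<Longrightarrow> f z = g z"
  shows "\<not> is_pole f z"
proof
  assume "is_pole f z"
  then have "filterlim f at_infinity (at z)" unfolding is_pole_def .
  moreover have "(f \<longlongrightarrow> g z) (at z)"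
  proof (rule Lim_transform_eventually)
    show "(g \<longlongrightarrow> g z) (at z)" using mreg_isCont[OF assms(1-3)] by (simp add: isCont_def)
    show "\<forall>\<^sub>F x in at z. g x = f x"
      using eventually_at_not_in_finite[OF assms(2), of z] by eventually_elim (use assms(4) in auto)
  qed
  ultimately show False using not_tendsto_and_filterlim_at_infinity[of "at z" f] by auto
qed

lemma norm_cmat_entry: "norm ((M :: 'n::finite cmat) $ a $ b) \<le> norm M"
  using Finite_Cartesian_Product.norm_nth_le[of M a]
    Finite_Cartesian_Product.norm_nth_le[of "M $ a" b] by linarith

lemma is_pole_entry:
  fixes f :: "complex \<Rightarrow> 'n::finite cmat"
  assumes "is_pole (\<lambda>z. f z $ a $ b) z"
  shows "is_pole f z"
proof -
  have "filterlim (\<lambda>z. norm (f z $ a $ b)) at_top (at z)"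
    using assms unfolding is_pole_def by (rule filterlim_at_infinity_imp_norm_at_top)
  then have "filterlim (\<lambda>z. norm (f z)) at_top (at z)"
    by (rule filterlim_at_top_mono) (simp add: norm_cmat_entry)
  then show ?thesis unfolding is_pole_def by (rule filterlim_norm_at_top_imp_at_infinity)
qed

text \<open>Links the analytic pole set with algebraic denominators: a pole of an entry is a pole of
  the matrix, and off the finitely many poles of entries the matrix is continuous.\<close>

lemma ratm_mpoles:
  assumes "ratm (f :: complex \<Rightarrow> 'n::finite cmat)"
  shows "finite (mpoles f)" "mreg (mpoles f) f"
proof -
  have "\<forall>a b. \<exists>B. finite B \<and> rreg B (\<lambda>z. f z $ a $ b) \<and> (\<forall>z\<in>B. is_pole (\<lambda>z. f z $ a $ b) z)"
    using assms ratfun_poles unfolding ratm_def by blast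
  then obtain B where B: "\<And>a b. finite (B a b)" "\<And>a b. rreg (B a b) (\<lambda>z. f z $ a $ b)"
    "\<And>a b z. z \<in> B a b \<Longrightarrow> is_pole (\<lambda>z. f z $ a $ b) z"
    by metis
  have sub: "B a b \<subseteq> mpoles f" for a b
    using B(3) is_pole_entry unfolding mpoles_def by blast
  then show m: "mreg (mpoles f) f" unfolding mreg_def using B(2) rreg_mono by blast
  define B' where "B' = (\<Union>a. \<Union>b. B a b)"
  have fin: "finite B'" unfolding B'_def using B(1) by auto
  have "mreg B' f" unfolding mreg_def B'_def using B(2) by (auto intro: rreg_mono)
  then have "mpoles f \<subseteq> B'" unfolding mpoles_def using mreg_not_pole[OF _ fin] by blast
  then show "finite (mpoles f)" using fin finite_subset by blast
qed

lemma ratm_of_mreg: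
  assumes "mreg B f"
  shows "\<exists>g. ratm g \<and> (\<forall>z. z \<notin> B \<longrightarrow> g z = f z)"
proof -
  have "\<forall>a b. \<exists>g. ratfun g \<and> (\<forall>z. z \<notin> B \<longrightarrow> g z = f z $ a $ b)"
    using assms ratfun_of_rreg unfolding mreg_def by blast
  then obtain g where g: "\<And>a b. ratfun (g a b)" "\<And>a b z. z \<notin> B \<Longrightarrow> g a b z = f z $ a $ b" by metis
  show ?thesis
    by (rule exI[of _ "\<lambda>z. \<chi> a b. g a b z"]) (use g in \<open>simp add: ratm_def vec_eq_iff\<close>)
qed

text \<open>Identifies a function obtained by choice with an explicit formula. As f is in reduced
  form, a point outside B can be neither a pole of f nor carry a wrong value, even if agreement was
  known only elsewhere.\<close>

lemma ratm_eq_mreg: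
  assumes f: "ratm f" and g: "mreg B g" and B: "finite B"
    and inf: "\<And>Z. finite Z \<Longrightarrow> \<exists>z. z \<notin> Z \<and> f z = g z"
  shows "mpoles f \<subseteq> B" "mreg B f" "z \<notin> B \<Longrightarrow> f z = g z"
proof -
  let ?B = "B \<union> mpoles f"
  have fB: "mreg ?B f" using ratm_mpoles[OF f] mreg_mono by blast
  have gB: "mreg ?B g" using g mreg_mono by blast
  have finB: "finite ?B" using ratm_mpoles[OF f] B by simp
  have infinite: "infinite {z. z \<notin> C \<and> f z = g z}" if C: "finite C" for C
  proof
    assume "finite {z. z \<notin> C \<and> f z = g z}"
    then have "finite (C \<union> {z. z \<notin> C \<and> f z = g z})" using C by simp
    from inf[OF this] show False by auto
  qed
  have eq: "f z = g z" if "z \<notin> ?B" for z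
    using mreg_unique[OF fB gB infinite[OF finB] that] .
  show sub: "mpoles f \<subseteq> B"
  proof
    fix z assume z: "z \<in> mpoles f"
    show "z \<in> B"
    proof (rule ccontr)
      assume zB: "z \<notin> B"
      have "(f \<longlongrightarrow> g z) (at z)"
      proof (rule Lim_transform_eventually)
        show "(g \<longlongrightarrow> g z) (at z)" using mreg_isCont[OF g B zB] by (simp add: isCont_def)
        show "\<forall>\<^sub>F x in at z. g x = f x"
          using eventually_at_not_in_finite[OF finB, of z] by eventually_elim (use eq in auto)
      qed
      moreover have "filterlim f at_infinity (at z)" using z by (simp add: mpoles_def is_pole_def)
      ultimately show False using not_tendsto_and_filterlim_at_infinity[of "at z" f] by auto
    qed
  qed
  show fB': "mreg B f" using ratm_mpoles(2)[OF f] mreg_mono sub by blast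
  show "f z = g z" if "z \<notin> B"
    using mreg_unique[OF fB' g infinite[OF B] that] .
qed

section \<open>Partial fractions\<close>

definition pfsum :: "complex set \<Rightarrow> nat \<Rightarrow> (complex \<Rightarrow> nat \<Rightarrow> complex) \<Rightarrow> complex \<Rightarrow> complex" where
  "pfsum S K c w = (\<Sum>s\<in>S. \<Sum>k<K. c s k / (w - s) ^ Suc k)"

definition pf :: "complex set \<Rightarrow> (complex \<Rightarrow> complex) \<Rightarrow> bool" where
  "pf S f \<longleftrightarrow> (\<exists>K q c. \<forall>w. w \<notin> S \<longrightarrow> f w = poly q w + pfsum S K c w)"

lemma pfsum_extend:
  assumes "K \<le> K'"
  shows "pfsum S K c w = pfsum S K' (\<lambda>s k. if k < K then c s k else 0) w"
proof -
  have "(\<Sum>k<K'. (if k < K then c s k else 0) / (w - s) ^ Suc k) = (\<Sum>k<K. c s k / (w - s) ^ Suc k)" for s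
    by (rule sum.mono_neutral_cong_right) (use assms in auto)
  then show ?thesis unfolding pfsum_def by simp
qed

lemma pf_add:
  assumes "pf S f" "pf S g"
  shows "pf S (\<lambda>w. f w + g w)"
proof -
  obtain K q c K' q' c' where h: "\<forall>w. w \<notin> S \<longrightarrow> f w = poly q w + pfsum S K c w"
    "\<forall>w. w \<notin> S \<longrightarrow> g w = poly q' w + pfsum S K' c' w"
    using assms unfolding pf_def by metis
  let ?K = "max K K'"
  let ?c = "\<lambda>s k. (if k < K then c s k else 0) + (if k < K' then c' s k else 0)"
  have "pfsum S K c w + pfsum S K' c' w = pfsum S ?K ?c w" for w
    unfolding pfsum_extend[of K ?K S c, OF max.cobounded1] pfsum_extend[of K' ?K S c', OF max.cobounded2]
    by (simp add: pfsum_def sum.distrib add_divide_distrib)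
  then show ?thesis unfolding pf_def
    by (intro exI[of _ ?K] exI[of _ "q + q'"] exI[of _ ?c]) (use h in \<open>simp add: algebra_simps\<close>)
qed

lemma pf_cong: "pf S f \<Longrightarrow> (\<And>w. w \<notin> S \<Longrightarrow> g w = f w) \<Longrightarrow> pf S g"
  unfolding pf_def by metis

lemma pf_cmult: "pf S f \<Longrightarrow> pf S (\<lambda>w. a * f w)"
proof -
  assume "pf S f"
  then obtain K q c where h: "\<forall>w. w \<notin> S \<longrightarrow> f w = poly q w + pfsum S K c w"
    unfolding pf_def by metis
  have "a * pfsum S K c w = pfsum S K (\<lambda>s k. a * c s k) w" for w
    by (simp add: pfsum_def sum_distrib_left)
  then show ?thesis unfolding pf_def
    by (intro exI[of _ K] exI[of _ "smult a q"] exI[of _ "\<lambda>s k. a * c s k"])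
       (use h in \<open>simp add: algebra_simps\<close>)
qed

lemma pf_poly: "pf S (poly q)"
  unfolding pf_def by (intro exI[of _ 0] exI[of _ q]) (simp add: pfsum_def)

lemma pf_0: "pf S (\<lambda>w. 0)"
  using pf_poly[of S 0] by (rule pf_cong) simp

lemma pf_sum: "(\<And>i. i \<in> T \<Longrightarrow> pf S (f i)) \<Longrightarrow> pf S (\<lambda>w. \<Sum>i\<in>T. f i w)"
  by (induction T rule: infinite_finite_induct) (auto intro: pf_add pf_0)

lemma pf_basic:
  assumes "finite S" "s \<in> S"
  shows "pf S (\<lambda>w. a / (w - s) ^ Suc k)"
proof -
  let ?c = "\<lambda>t j. if t = s \<and> j = k then a else 0"
  have "pfsum S (Suc k) ?c w = a / (w - s) ^ Suc k" for w
  proof -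
    have "pfsum S (Suc k) ?c w = (\<Sum>t\<in>S. if t = s then a / (w - s) ^ Suc k else 0)"
      unfolding pfsum_def
    proof (rule sum.cong[OF refl])
      fix t
      have "(\<Sum>j<Suc k. (if t = s \<and> j = k then a else 0) / (w - t) ^ Suc j)
          = (\<Sum>j<Suc k. if j = k then (if t = s then a / (w - s) ^ Suc k else 0) else 0)"
        by (rule sum.cong) auto
      then show "(\<Sum>j<Suc k. (if t = s \<and> j = k then a else 0) / (w - t) ^ Suc j)
          = (if t = s then a / (w - s) ^ Suc k else 0)" by simp
    qed
    then show ?thesis using assms by simp
  qed
  then show ?thesis unfolding pf_def
    by (intro exI[of _ "Suc k"] exI[of _ 0] exI[of _ ?c]) simp
qed

text \<open>For distinct poles the identity \<open>key\<close> lowers the order at s, so induction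
  on k works; for equal poles the order simply rises by one.\<close>

lemma pf_div_basic:
  assumes "finite S" "s \<in> S" "x \<in> S"
  shows "pf S (\<lambda>w. 1 / (w - s) ^ Suc k / (w - x))"
proof (cases "s = x")
  case True
  then show ?thesis using pf_basic[OF assms(1,2), of 1 "Suc k"] by (simp add: mult.commute)
next
  case False
  then have sx: "s - x \<noteq> 0" by simp
  have key: "1 / (w - s) / (w - x) = (1 / (s - x)) * (1 / (w - s) + (-1) * (1 / (w - x)))"
    if "w \<notin> S" for w
  proof -
    have "w - s \<noteq> 0" "w - x \<noteq> 0" using that assms by auto
    then show ?thesis using sx by (simp add: divide_simps)
  qed
  show ?thesis
  proof (induction k)
    case 0
    have "pf S (\<lambda>w. (1 / (s - x)) * (1 / (w - s) ^ Suc 0 + (-1) * (1 / (w - x) ^ Suc 0)))"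
      by (intro pf_cmult pf_add pf_basic assms)
    then show ?case by (rule pf_cong) (use key in simp)
  next
    case (Suc k)
    have "pf S (\<lambda>w. (1 / (s - x)) * (1 / (w - s) ^ Suc (Suc k) + (-1) * (1 / (w - s) ^ Suc k / (w - x))))"
      by (intro pf_cmult pf_add pf_basic assms Suc)
    then show ?case
    proof (rule pf_cong)
      fix w assume w: "w \<notin> S"
      have "1 / (w - s) ^ Suc (Suc k) / (w - x) = (1 / (w - s) / (w - x)) / (w - s) ^ Suc k"
        by (simp add: field_simps)
      also have "\<dots> = (1 / (s - x)) * (1 / (w - s) + (-1) * (1 / (w - x))) / (w - s) ^ Suc k"
        by (simp only: key[OF w])
      also have "\<dots> = (1 / (s - x)) * (1 / (w - s) ^ Suc (Suc k) + (-1) * (1 / (w - s) ^ Suc k / (w - x)))"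
        by (simp add: diff_divide_distrib mult_ac)
      finally show "1 / (w - s) ^ Suc (Suc k) / (w - x) = \<dots>" .
    qed
  qed
qed

lemma pf_div:
  assumes S: "finite S" "x \<in> S" and f: "pf S f"
  shows "pf S (\<lambda>w. f w / (w - x))"
proof -
  obtain K q c where h: "\<forall>w. w \<notin> S \<longrightarrow> f w = poly q w + pfsum S K c w"
    using f unfolding pf_def by metis
  define q' where "q' = synthetic_div q x"
  have q: "poly q w = (w - x) * poly q' w + poly q x" for w
  proof -
    have "poly q w = poly ([:- x, 1:] * q' + [:poly q x:]) w"
      unfolding q'_def by (simp only: synthetic_div_correct')
    then show ?thesis by (simp add: algebra_simps)
  qed
  have "pf S (\<lambda>w. poly q' w + poly q x / (w - x) ^ Suc 0
      + (\<Sum>s\<in>S. \<Sum>k<K. c s k * (1 / (w - s) ^ Suc k / (w - x))))"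
    by (intro pf_add pf_poly pf_basic pf_sum pf_cmult pf_div_basic S) auto
  then show ?thesis
  proof (rule pf_cong)
    fix w assume w: "w \<notin> S"
    then have "w - x \<noteq> 0" using S by auto
    then have "(poly q w + pfsum S K c w) / (w - x)
       = poly q' w + poly q x / (w - x) ^ Suc 0 + pfsum S K c w / (w - x)"
      by (subst q[of w]) (simp add: add_divide_distrib)
    then show "f w / (w - x) = poly q' w + poly q x / (w - x) ^ Suc 0
      + (\<Sum>s\<in>S. \<Sum>k<K. c s k * (1 / (w - s) ^ Suc k / (w - x)))"
      using h w by (simp add: pfsum_def sum_divide_distrib)
  qed
qed

text \<open>The roots of the denominator are divided out one by one, each by
  \<open>pf_div\<close>.\<close>

lemma pf_of_rreg:
  assumes S: "finite S" and f: "rreg S f"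
  shows "pf S f"
proof -
  have "pf S (\<lambda>w. poly p w / poly r w)" if "r \<noteq> 0" "\<And>z. z \<notin> S \<Longrightarrow> poly r z \<noteq> 0" for p r
    using that
  proof (induction "degree r" arbitrary: r rule: less_induct)
    case less
    show ?case
    proof (cases "degree r = 0")
      case True
      then obtain a where "r = [:a:]" by (meson degree_eq_zeroE)
      then show ?thesis using pf_cmult[OF pf_poly, of S "1 / a" p] by simp
    next
      case False
      then have "\<not> constant (poly r)" by (simp add: constant_degree)
      then obtain x where x: "poly r x = 0" using fundamental_theorem_of_algebra by blast
      then have xS: "x \<in> S" using less.prems by blast
      obtain r' where r: "r = [:- x, 1:] * r'" using x by (auto simp: poly_eq_0_iff_dvd dvd_def)
      have r': "r' \<noteq> 0" using less.prems r by auto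
      then have "degree r = 1 + degree r'" unfolding r by (subst degree_mult_eq) auto
      then have "degree r' < degree r" by simp
      moreover have "poly r' z \<noteq> 0" if "z \<notin> S" for z using less.prems(2)[OF that] r by auto
      ultimately have "pf S (\<lambda>w. poly p w / poly r' w)" using less.hyps r' by blast
      from pf_div[OF S xS this] show ?thesis
        by (rule pf_cong) (simp add: r algebra_simps)
    qed
  qed
  moreover obtain p r where "r \<noteq> 0" "\<And>z. z \<notin> S \<Longrightarrow> poly r z \<noteq> 0 \<and> f z = poly p z / poly r z"
    using f unfolding rreg_def by blast
  ultimately show ?thesis using pf_cong[of S "\<lambda>w. poly p w / poly r w" f] by auto
qed

lemma rreg_pfsum: "finite S \<Longrightarrow> rreg S (pfsum S K c)"
proof -
  assume S: "finite S"
  have "rreg S (\<lambda>w. \<Sum>s\<in>S. \<Sum>k<K. c s k / (w - s) ^ Suc k)"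
    by (intro rreg_sum rreg_divide S rreg_power rreg_diff) auto
  then show ?thesis unfolding pfsum_def[abs_def] .
qed

text \<open>The highest order M present at t dominates. This behaviour yields both the uniqueness of
  partial fractions and, later, the divergence of integrals through a pole.\<close>

lemma pfsum_leading:
  assumes S: "finite S" "t \<in> S" and c: "k < K" "c t k \<noteq> 0"
  shows "\<exists>M c0. c0 \<noteq> 0 \<and> ((\<lambda>w. (w - t) ^ Suc M * pfsum S K c w) \<longlongrightarrow> c0) (at t)"
proof -
  define M where "M = Max {k. k < K \<and> c t k \<noteq> 0}"
  have fin: "finite {k. k < K \<and> c t k \<noteq> 0}" by simp
  have "M \<in> {k. k < K \<and> c t k \<noteq> 0}" unfolding M_def using fin c by (intro Max_in) auto
  then have M: "M < K" "c t M \<noteq> 0" by auto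
  have Mmax: "c t j = 0" if "M < j" "j < K" for j
  proof (rule ccontr)
    assume "c t j \<noteq> 0"
    then have "j \<le> M" unfolding M_def using that fin by (intro Max_ge) auto
    then show False using that by simp
  qed
  define g where "g w = (\<Sum>s\<in>S - {t}. \<Sum>k<K. c s k / (w - s) ^ Suc k)" for w
  have g: "(g \<longlongrightarrow> g t) (at t)"
    unfolding g_def by (intro tendsto_intros) auto
  have ev: "\<forall>\<^sub>F w in at t. w \<notin> {t}" by (rule eventually_at_not_in_finite) simp
  have trm: "((\<lambda>w. (w - t) ^ Suc M * (c t j / (w - t) ^ Suc j)) \<longlongrightarrow> (if j = M then c t M else 0)) (at t)"
    if "j < K" for j
  proof -
    consider "j = M" | "M < j" | "j < M" by linarith
    then show ?thesis
    proof cases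
      case 1
      have "\<forall>\<^sub>F w in at t. c t M = (w - t) ^ Suc M * (c t j / (w - t) ^ Suc j)"
        using ev by eventually_elim (simp add: 1)
      then show ?thesis using 1 by (simp add: Lim_transform_eventually[OF tendsto_const])
    next
      case 2
      then show ?thesis using Mmax that by simp
    next
      case 3
      have "((\<lambda>w. (w - t) ^ (M - j) * c t j) \<longlongrightarrow> (t - t) ^ (M - j) * c t j) (at t)"
        by (intro tendsto_intros)
      then have "((\<lambda>w. (w - t) ^ (M - j) * c t j) \<longlongrightarrow> 0) (at t)" using 3 by (simp add: power_0_left)
      moreover have "\<forall>\<^sub>F w in at t. (w - t) ^ (M - j) * c t j = (w - t) ^ Suc M * (c t j / (w - t) ^ Suc j)"
        using ev
      proof eventually_elim
        case (elim w)
        have "(w - t) ^ Suc M = (w - t) ^ (M - j) * (w - t) ^ Suc j"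
          using 3 by (simp flip: power_add add: Suc_diff_le)
        then show ?case using elim by simp
      qed
      ultimately show ?thesis using 3 by (simp add: Lim_transform_eventually)
    qed
  qed
  have "((\<lambda>w. (w - t) ^ Suc M * g w + (\<Sum>j<K. (w - t) ^ Suc M * (c t j / (w - t) ^ Suc j)))
     \<longlongrightarrow> (t - t) ^ Suc M * g t + (\<Sum>j<K. if j = M then c t M else 0)) (at t)"
    by (intro tendsto_add tendsto_mult tendsto_sum trm g tendsto_power tendsto_diff) auto
  moreover have "(w - t) ^ Suc M * g w + (\<Sum>j<K. (w - t) ^ Suc M * (c t j / (w - t) ^ Suc j))
      = (w - t) ^ Suc M * pfsum S K c w" for w
    unfolding pfsum_def sum.remove[OF S] g_def by (simp add: distrib_left sum_distrib_left)
  ultimately have "((\<lambda>w. (w - t) ^ Suc M * pfsum S K c w) \<longlongrightarrow> c t M) (at t)"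
    using M by simp
  then show ?thesis using M by blast
qed

lemma pfsum_eq_0:
  assumes S: "finite S" "t \<in> S" and k: "k < K" and z: "infinite {w. w \<notin> S \<and> pfsum S K c w = 0}"
  shows "c t k = 0"
proof (rule ccontr)
  assume "c t k \<noteq> 0"
  then obtain M c0 where c0: "c0 \<noteq> 0" "((\<lambda>w. (w - t) ^ Suc M * pfsum S K c w) \<longlongrightarrow> c0) (at t)"
    using pfsum_leading[OF S k] by blast
  have z0: "pfsum S K c w = 0" if "w \<notin> S" for w
    using rreg_unique[OF rreg_pfsum[OF S(1)] rreg_const z that] .
  have "\<forall>\<^sub>F w in at t. (w - t) ^ Suc M * pfsum S K c w = 0"
    using eventually_at_not_in_finite[OF S(1), of t] by eventually_elim (simp add: z0)
  then have "((\<lambda>w. (w - t) ^ Suc M * pfsum S K c w) \<longlongrightarrow> 0) (at t)"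
    by (simp add: tendsto_eventually)
  then show False using c0 tendsto_unique[of "at t"] by fastforce
qed

section \<open>Expansions at the origin and at infinity\<close>

text \<open>Punctured neighbourhoods, because expansions at infinity concern
  \<open>f (1 / y)\<close>, whose value at y = 0 is a mere default.\<close>

definition pser :: "(complex \<Rightarrow> complex) \<Rightarrow> (nat \<Rightarrow> complex) \<Rightarrow> bool" where
  "pser f a \<longleftrightarrow> (\<forall>\<^sub>F x in at 0. (\<lambda>r. a r * x ^ r) sums f x)"

lemma pserD:
  assumes "pser f a"
  obtains d where "d > 0" "\<And>x. x \<noteq> 0 \<Longrightarrow> norm x < d \<Longrightarrow> (\<lambda>r. a r * x ^ r) sums f x"
  using assms unfolding pser_def eventually_at by (auto simp: dist_norm)

lemma pserI:
  assumes "d > 0" "\<And>x. x \<noteq> 0 \<Longrightarrow> norm x < d \<Longrightarrow> (\<lambda>r. a r * x ^ r) sums f x"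
  shows "pser f a"
  using assms unfolding pser_def eventually_at by (auto simp: dist_norm)

lemma pser_add: "pser f a \<Longrightarrow> pser g b \<Longrightarrow> pser (\<lambda>x. f x + g x) (\<lambda>r. a r + b r)"
  unfolding pser_def by (erule (1) eventually_elim2) (auto simp: distrib_right intro: sums_add)

lemma pser_cmult: "pser f a \<Longrightarrow> pser (\<lambda>x. c * f x) (\<lambda>r. c * a r)"
  unfolding pser_def by (erule eventually_mono) (auto simp: mult.assoc intro: sums_mult)

lemma pser_const: "pser (\<lambda>x. c) (\<lambda>r. if r = 0 then c else 0)"
proof -
  have "(\<lambda>r. (if r = 0 then c else 0) * x ^ r) sums c" for x :: complex
    using sums_single[of 0 "\<lambda>r. c"] by (rule sums_cong[THEN iffD1, rotated]) auto
  then show ?thesis unfolding pser_def by simp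
qed

lemma pser_sum: "finite S \<Longrightarrow> (\<And>i. i \<in> S \<Longrightarrow> pser (f i) (a i)) \<Longrightarrow> pser (\<lambda>x. \<Sum>i\<in>S. f i x) (\<lambda>r. \<Sum>i\<in>S. a i r)"
proof (induction S rule: finite_induct)
  case empty
  show ?case using pser_const[of 0] by simp
qed (auto intro: pser_add)

lemma pser_mult:
  assumes "pser f a" "pser g b"
  shows "pser (\<lambda>x. f x * g x) (\<lambda>r. \<Sum>p\<le>r. a p * b (r - p))"
proof -
  obtain d where d: "d > 0" "\<And>x. x \<noteq> 0 \<Longrightarrow> norm x < d \<Longrightarrow> (\<lambda>r. a r * x ^ r) sums f x"
    using pserD[OF assms(1)] by blast
  obtain e where e: "e > 0" "\<And>x. x \<noteq> 0 \<Longrightarrow> norm x < e \<Longrightarrow> (\<lambda>r. b r * x ^ r) sums g x"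
    using pserD[OF assms(2)] by blast
  show ?thesis
  proof (rule pserI)
    show "min d e > 0" using d e by simp
    fix x :: complex assume x: "x \<noteq> 0" "norm x < min d e"
    \<comment> \<open>A point y of slightly larger modulus, where both series still converge, gives
      the absolute convergence at x that the Cauchy product requires.\<close>
    define t where "t = (norm x + min d e) / 2"
    define y where "y = complex_of_real t"
    have t: "norm x < t" "t < min d e" unfolding t_def using less_half_sum[OF x(2)] gt_half_sum[OF x(2)] by simp_all
    have "norm y = t" unfolding y_def using t order_trans[OF norm_ge_zero less_imp_le[OF t(1)]] by simp
    then have y: "norm x < norm y" "norm y < min d e" using t by simp_all
    have "y \<noteq> 0" using y by auto
    then have "summable (\<lambda>r. a r * y ^ r)" "summable (\<lambda>r. b r * y ^ r)"
      using d(2)[of y] e(2)[of y] y by (auto simp: sums_iff)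
    then have s: "summable (\<lambda>r. norm (a r * x ^ r))" "summable (\<lambda>r. norm (b r * x ^ r))"
      using powser_insidea y(1) by blast+
    have "(\<lambda>k. \<Sum>i\<le>k. (a i * x ^ i) * (b (k - i) * x ^ (k - i))) sums
        ((\<Sum>r. a r * x ^ r) * (\<Sum>r. b r * x ^ r))"
      by (rule Cauchy_product_sums[OF s])
    moreover have "(\<Sum>i\<le>k. (a i * x ^ i) * (b (k - i) * x ^ (k - i))) = (\<Sum>p\<le>k. a p * b (k - p)) * x ^ k" for k
      unfolding sum_distrib_right
    proof (rule sum.cong[OF refl])
      fix i assume "i \<in> {..k}"
      then have "x ^ k = x ^ i * x ^ (k - i)" by (simp flip: power_add)
      then show "a i * x ^ i * (b (k - i) * x ^ (k - i)) = a i * b (k - i) * x ^ k" by simp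
    qed
    moreover have "(\<Sum>r. a r * x ^ r) = f x" "(\<Sum>r. b r * x ^ r) = g x"
      using d(2)[of x] e(2)[of x] x by (auto simp: sums_iff)
    ultimately show "(\<lambda>r. (\<Sum>p\<le>r. a p * b (r - p)) * x ^ r) sums (f x * g x)" by simp
  qed
qed

lemma pser_scale:
  assumes "pser f a" "\<alpha> \<noteq> 0"
  shows "pser (\<lambda>x. f (\<alpha> * x)) (\<lambda>r. \<alpha> ^ r * a r)"
proof -
  obtain d where d: "d > 0" "\<And>x. x \<noteq> 0 \<Longrightarrow> norm x < d \<Longrightarrow> (\<lambda>r. a r * x ^ r) sums f x"
    using pserD[OF assms(1)] by blast
  show ?thesis
  proof (rule pserI)
    show "d / norm \<alpha> > 0" using d assms by simp
    fix x :: complex assume x: "x \<noteq> 0" "norm x < d / norm \<alpha>"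
    then have "\<alpha> * x \<noteq> 0" "norm (\<alpha> * x) < d" using assms by (auto simp: norm_mult field_simps)
    from d(2)[OF this] show "(\<lambda>r. \<alpha> ^ r * a r * x ^ r) sums f (\<alpha> * x)"
      by (simp add: power_mult_distrib mult_ac)
  qed
qed

lemma pser_analytic:
  assumes "pser f a"
  shows "\<exists>\<delta> g. \<delta> > 0 \<and> g holomorphic_on ball 0 \<delta> \<and> g 0 = a 0 \<and> (\<forall>x. x \<noteq> 0 \<longrightarrow> norm x < \<delta> \<longrightarrow> g x = f x)"
proof -
  obtain d where d: "d > 0" "\<And>x. x \<noteq> 0 \<Longrightarrow> norm x < d \<Longrightarrow> (\<lambda>r. a r * x ^ r) sums f x"
    using pserD[OF assms(1)] by blast
  define g where "g x = (if x = 0 then a 0 else f x)" for x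
  have "(\<lambda>r. a r * (x - 0) ^ r) sums g x" if "x \<in> ball 0 d" for x
  proof (cases "x = 0")
    case True
    have "(\<lambda>r. if r = 0 then a r else 0) sums a 0" using sums_single[of 0 a] .
    then have "(\<lambda>r. a r * 0 ^ r) sums a 0"
      by (rule sums_cong[THEN iffD1, rotated]) auto
    then show ?thesis using True by (simp add: g_def)
  qed (use d that in \<open>auto simp: g_def\<close>)
  then have "g holomorphic_on ball 0 d" by (rule power_series_holomorphic)
  then show ?thesis using d by (intro exI[of _ d] exI[of _ g]) (auto simp: g_def)
qed

lemma pser_tendsto: "pser f a \<Longrightarrow> (f \<longlongrightarrow> a 0) (at 0)"
proof -
  assume "pser f a"
  from pser_analytic[OF this] obtain \<delta> g where g: "\<delta> > 0" "g holomorphic_on ball 0 \<delta>" "g 0 = a 0"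
    "\<And>x. x \<noteq> 0 \<Longrightarrow> norm x < \<delta> \<Longrightarrow> g x = f x" by blast
  have "isCont g 0"
    using g(1,2) by (metis at_within_open centre_in_ball continuous_on_eq_continuous_within
        holomorphic_on_imp_continuous_on open_ball)
  then have "(g \<longlongrightarrow> a 0) (at 0)" using g(3) by (simp add: isCont_def)
  moreover have "\<forall>\<^sub>F x in at 0. g x = f x"
    unfolding eventually_at by (rule exI[of _ \<delta>]) (use g in \<open>auto simp: dist_norm\<close>)
  ultimately show ?thesis by (rule Lim_transform_eventually)
qed

lemma eventually_at_infinity_inverse:
  "(\<exists>R. \<forall>z::complex. R < norm z \<longrightarrow> P z) \<longleftrightarrow> (\<forall>\<^sub>F y in at 0. P (1 / y))"
proof -
  have "(\<exists>R. \<forall>z::complex. R < norm z \<longrightarrow> P z) \<longleftrightarrow> eventually P at_infinity"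
    unfolding eventually_at_infinity by (metis gt_ex less_le_trans less_imp_le)
  also have "\<dots> \<longleftrightarrow> (\<forall>\<^sub>F y in at 0. P (1 / y))"
    unfolding at_to_infinity eventually_filtermap
    by (simp add: inverse_eq_divide)
  finally show ?thesis .
qed

lemma eventually_at_zero_norm:
  "(\<exists>\<epsilon>>0. \<forall>z::complex. 0 < norm z \<and> norm z < \<epsilon> \<longrightarrow> P z) \<longleftrightarrow> (\<forall>\<^sub>F z in at 0. P z)"
  unfolding eventually_at by (auto simp: dist_norm)

lemma sums_cmat_iff:
  "f sums (M :: 'n::finite cmat) \<longleftrightarrow> (\<forall>a b. (\<lambda>n. f n $ a $ b) sums (M $ a $ b))"
proof
  assume "f sums M"
  then show "\<forall>a b. (\<lambda>n. f n $ a $ b) sums (M $ a $ b)"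
    by (intro allI bounded_linear.sums[OF bounded_linear_vec_nth])
next
  assume *: "\<forall>a b. (\<lambda>n. f n $ a $ b) sums (M $ a $ b)"
  show "f sums M" unfolding sums_def
  proof (intro vec_tendstoI)
    fix a b
    show "(\<lambda>n. (\<Sum>i<n. f i) $ a $ b) \<longlonglongrightarrow> M $ a $ b"
      using * unfolding sums_def by simp
  qed
qed

lemma eventually_all2_finite:
  "(\<forall>\<^sub>F x in F. \<forall>a b. P a b x) \<longleftrightarrow> (\<forall>(a::'a::finite) (b::'b::finite). \<forall>\<^sub>F x in F. P a b x)"
  by (auto intro!: eventually_all_finite elim: eventually_mono)

text \<open>The condition under the choice in \<open>Psi_fun\<close>, named so that existence can be
  fed to that choice; \<open>x_exp\<close> does the same for \<open>X_fun\<close>.\<close>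

definition psi_exp :: "('i, 'n::finite) lrep \<Rightarrow> 'i \<Rightarrow> (complex \<Rightarrow> 'n cmat) \<Rightarrow> bool" where
  "psi_exp V i f \<longleftrightarrow> ratm f \<and>
     (\<exists>R. \<forall>z. norm z > R \<longrightarrow> (\<lambda>r. smat (z powi (- int r)) (Pp V i r)) sums f z) \<and>
     (\<exists>\<epsilon>>0. \<forall>z. 0 < norm z \<and> norm z < \<epsilon> \<longrightarrow> (\<lambda>r. smat (z ^ r) (Pm V i r)) sums f z)"

definition x_exp :: "('i, 'n::finite) lrep \<Rightarrow> bool \<Rightarrow> 'i \<Rightarrow> (complex \<Rightarrow> 'n cmat) \<Rightarrow> bool" where
  "x_exp V e i f \<longleftrightarrow> ratm f \<and>
     (\<exists>R. \<forall>z. norm z > R \<longrightarrow> (\<lambda>r. smat (z powi (- int r)) (Xs V e i (int r))) sums f z) \<and>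
     (\<exists>\<epsilon>>0. \<forall>z. 0 < norm z \<and> norm z < \<epsilon> \<longrightarrow>
        (\<lambda>r. smat (- (z ^ Suc r)) (Xs V e i (- int (Suc r)))) sums f z)"

definition mpser :: "(complex \<Rightarrow> 'n::finite cmat) \<Rightarrow> (nat \<Rightarrow> 'n cmat) \<Rightarrow> bool" where
  "mpser f A \<longleftrightarrow> (\<forall>a b. pser (\<lambda>z. f z $ a $ b) (\<lambda>r. A r $ a $ b))"

lemma mpser_iff: "mpser f A \<longleftrightarrow> (\<forall>\<^sub>F z in at 0. (\<lambda>r. smat (z ^ r) (A r)) sums f z)"
  unfolding mpser_def pser_def eventually_all2_finite[symmetric] sums_cmat_iff
  by (simp add: mult.commute)

lemma psi_exp_iff:
  "psi_exp V i f \<longleftrightarrow> ratm f \<and> mpser (\<lambda>y. f (1 / y)) (Pp V i) \<and> mpser f (Pm V i)"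
proof -
  have "(1 / y) powi (- int r) = y ^ r" for y :: complex and r
    by (simp add: power_int_minus power_one_over)
  then show ?thesis
    unfolding psi_exp_def mpser_iff eventually_at_infinity_inverse eventually_at_zero_norm by simp
qed

lemma x_exp_iff:
  "x_exp V e i f \<longleftrightarrow> ratm f \<and> mpser (\<lambda>y. f (1 / y)) (\<lambda>r. Xs V e i (int r)) \<and>
     mpser f (\<lambda>r. if r = 0 then 0 else - Xs V e i (- int r))"
proof -
  have 1: "(1 / y) powi (- int r) = y ^ r" for y :: complex and r
    by (simp add: power_int_minus power_one_over)
  \<comment> \<open>The expansion of an X current at 0 starts with the first power of z, so as a
    power series it gets constant term 0.\<close>
  have 2: "((\<lambda>r. smat (- (z ^ Suc r)) (Xs V e i (- int (Suc r)))) sums f z) \<longleftrightarrow>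
    ((\<lambda>r. smat (z ^ r) (if r = 0 then 0 else - Xs V e i (- int r))) sums f z)" for z
  proof -
    let ?g = "\<lambda>r. smat (z ^ r) (if r = 0 then 0 else - Xs V e i (- int r))"
    have "?g 0 = 0" by (simp add: vec_eq_iff)
    moreover have "?g (Suc r) = smat (- (z ^ Suc r)) (Xs V e i (- int (Suc r)))" for r
      by (simp add: vec_eq_iff)
    ultimately show ?thesis using sums_Suc_iff[of ?g "f z"] by simp
  qed
  show ?thesis
    unfolding x_exp_def mpser_iff eventually_at_infinity_inverse eventually_at_zero_norm 1 2 by simp
qed

lemma Psi_fun_spec: "\<exists>f. psi_exp V i f \<Longrightarrow> psi_exp V i (Psi_fun V i)"
  using someI_ex[of "psi_exp V i"] unfolding Psi_fun_def psi_exp_def[abs_def] by blast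

lemma X_fun_spec: "\<exists>f. x_exp V e i f \<Longrightarrow> x_exp V e i (X_fun V e i)"
  using someI_ex[of "x_exp V e i"] unfolding X_fun_def x_exp_def[abs_def] by blast

lemma mpser_add: "mpser f A \<Longrightarrow> mpser g B \<Longrightarrow> mpser (\<lambda>z. f z + g z) (\<lambda>r. A r + B r)"
  unfolding mpser_def by (auto intro: pser_add)

lemma mpser_mult_const_left: "mpser f A \<Longrightarrow> mpser (\<lambda>z. M ** f z) (\<lambda>r. M ** A r)"
  unfolding mpser_def cmat_nth_mult by (auto intro!: pser_sum pser_cmult)

lemma mpser_mult_const_right: "mpser f A \<Longrightarrow> mpser (\<lambda>z. f z ** M) (\<lambda>r. A r ** M)"
  unfolding mpser_def cmat_nth_mult by (auto intro!: pser_sum pser_cmult simp: mult.commute)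

lemma mpser_smat: "mpser f A \<Longrightarrow> mpser (\<lambda>z. smat c (f z)) (\<lambda>r. smat c (A r))"
  unfolding mpser_def by (auto intro!: pser_cmult)

lemma mpser_const: "mpser (\<lambda>z. M) (\<lambda>r. if r = 0 then M else 0)"
proof -
  have e: "(\<lambda>r. (if r = 0 then M else 0) $ a $ b) = (\<lambda>r. if r = 0 then M $ a $ b else 0)" for a b
    by auto
  show ?thesis unfolding mpser_def e by (simp add: pser_const)
qed

lemma mpser_cong: "mpser f A \<Longrightarrow> (\<forall>\<^sub>F z in at 0. g z = f z) \<Longrightarrow> mpser g A"
  unfolding mpser_iff by (erule (1) eventually_elim2) auto

lemma mpser_coeff_cong: "mpser f A \<Longrightarrow> (\<And>r. B r = A r) \<Longrightarrow> mpser f B"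
  by presburger

lemma eventually_one_div_not_in_finite: "finite B \<Longrightarrow> \<forall>\<^sub>F y in at 0. 1 / y \<notin> (B :: complex set)"
proof -
  assume B: "finite B"
  have "finite ((\<lambda>b. 1 / b) ` B)" using B by simp
  from eventually_at_not_in_finite[OF this, of 0] show ?thesis
    by eventually_elim (auto simp: image_iff)
qed

text \<open>A rational function with both expansions shows that the choice in \<open>Psi_fun\<close>
  succeeds; since the expansion at 0 determines a rational function, it also computes the chosen one
  off B.\<close>

lemma psi_exp_of_mreg:
  assumes "mreg B f" "finite B" "mpser (\<lambda>y. f (1 / y)) (Pp V i)" "mpser f (Pm V i)"
  shows "psi_exp V i (Psi_fun V i)" "\<And>z. z \<notin> B \<Longrightarrow> Psi_fun V i z = f z" "mpoles (Psi_fun V i) \<subseteq> B"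
proof -
  obtain g where g: "ratm g" "\<And>z. z \<notin> B \<Longrightarrow> g z = f z" using ratm_of_mreg[OF assms(1)] by blast
  have "psi_exp V i g" unfolding psi_exp_iff
  proof (intro conjI g)
    show "mpser (\<lambda>y. g (1 / y)) (Pp V i)"
      by (rule mpser_cong[OF assms(3)])
         (use eventually_one_div_not_in_finite[OF assms(2)] g(2) in \<open>auto elim: eventually_mono\<close>)
    show "mpser g (Pm V i)"
      by (rule mpser_cong[OF assms(4)])
         (use eventually_at_not_in_finite[OF assms(2), of 0] g(2) in \<open>auto elim: eventually_mono\<close>)
  qed
  then show P: "psi_exp V i (Psi_fun V i)" by (intro Psi_fun_spec) blast
  have ev: "\<forall>\<^sub>F z in at 0. Psi_fun V i z = f z"
  proof -
    have "\<forall>\<^sub>F z in at 0. (\<lambda>r. smat (z ^ r) (Pm V i r)) sums Psi_fun V i z"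
      using P unfolding psi_exp_iff mpser_iff by blast
    moreover have "\<forall>\<^sub>F z in at 0. (\<lambda>r. smat (z ^ r) (Pm V i r)) sums f z"
      using assms(4) unfolding mpser_iff .
    ultimately show ?thesis by eventually_elim (rule sums_unique2)
  qed
  have inf: "\<exists>z. z \<notin> Z \<and> Psi_fun V i z = f z" if "finite Z" for Z
  proof -
    have "\<forall>\<^sub>F z in at 0. z \<notin> Z \<and> Psi_fun V i z = f z"
      using ev eventually_at_not_in_finite[OF that, of 0] by eventually_elim auto
    then show ?thesis using eventually_happens[of _ "at (0 :: complex)"] by auto
  qed
  have "ratm (Psi_fun V i)" using P unfolding psi_exp_iff by blast
  note R = ratm_eq_mreg[OF this assms(1,2) inf]
  show "Psi_fun V i z = f z" if "z \<notin> B" for z by (rule R(3)) (use that in auto)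
  show "mpoles (Psi_fun V i) \<subseteq> B" by (rule R(1)) auto
qed

lemma ex_x_exp_of_mreg:
  assumes "mreg B f" "finite B" "mpser (\<lambda>y. f (1 / y)) (\<lambda>r. Xs V e i (int r))"
    "mpser f (\<lambda>r. if r = 0 then 0 else - Xs V e i (- int r))"
  shows "\<exists>g. x_exp V e i g"
proof -
  obtain g where g: "ratm g" "\<And>z. z \<notin> B \<Longrightarrow> g z = f z" using ratm_of_mreg[OF assms(1)] by blast
  have "x_exp V e i g" unfolding x_exp_iff
  proof (intro conjI g)
    show "mpser (\<lambda>y. g (1 / y)) (\<lambda>r. Xs V e i (int r))"
      by (rule mpser_cong[OF assms(3)])
         (use eventually_one_div_not_in_finite[OF assms(2)] g(2) in \<open>auto elim: eventually_mono\<close>)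
    show "mpser g (\<lambda>r. if r = 0 then 0 else - Xs V e i (- int r))"
      by (rule mpser_cong[OF assms(4)])
         (use eventually_at_not_in_finite[OF assms(2), of 0] g(2) in \<open>auto elim: eventually_mono\<close>)
  qed
  then show ?thesis by blast
qed

section \<open>Generating functions of linear recurrences\<close>

text \<open>Each new term is at most M times a bound for the previous D terms, with M at least 1 and
  at least the sum of the coefficient norms.\<close>

lemma linear_recurrence_growth:
  fixes y :: "nat \<Rightarrow> complex"
  assumes "\<And>n. y (n + D) = (\<Sum>j<D. v j * y (n + j))"
  shows "\<exists>C M. M \<ge> 1 \<and> (\<forall>n. norm (y n) \<le> C * M ^ n)"
proof -
  define M where "M = max 1 (\<Sum>j<D. norm (v j))"
  define C where "C = (\<Sum>j<D. norm (y j))"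
  have M: "M \<ge> 1" "(\<Sum>j<D. norm (v j)) \<le> M" by (auto simp: M_def)
  have C: "C \<ge> 0" unfolding C_def by (simp add: sum_nonneg)
  have "norm (y n) \<le> C * M ^ n" for n
  proof (induction n rule: less_induct)
    case (less n)
    show ?case
    proof (cases "n < D")
      case True
      then have "norm (y n) \<le> C" unfolding C_def by (intro member_le_sum) auto
      also have "\<dots> \<le> C * M ^ n" using C M by (simp add: mult_le_cancel_left1)
      finally show ?thesis .
    next
      case False
      define m where "m = n - D"
      have n: "n = m + D" using False by (simp add: m_def)
      show ?thesis
      proof (cases "D = 0")
        case True
        then show ?thesis using assms[of m] n C M by simp
      next
        case D: False
        have "norm (y n) \<le> (\<Sum>j<D. norm (v j) * norm (y (m + j)))"
          unfolding n assms by (rule order_trans[OF norm_sum]) (simp add: norm_mult)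
        also have "\<dots> \<le> (\<Sum>j<D. norm (v j) * (C * M ^ (m + D - 1)))"
        proof (intro sum_mono mult_left_mono)
          fix j assume j: "j \<in> {..<D}"
          have "norm (y (m + j)) \<le> C * M ^ (m + j)" by (rule less) (use j n in auto)
          also have "\<dots> \<le> C * M ^ (m + D - 1)"
            by (intro mult_left_mono power_increasing) (use j C M in auto)
          finally show "norm (y (m + j)) \<le> C * M ^ (m + D - 1)" .
        qed auto
        also have "\<dots> = (\<Sum>j<D. norm (v j)) * (C * M ^ (m + D - 1))" by (simp add: sum_distrib_right)
        also have "\<dots> \<le> M * (C * M ^ (m + D - 1))"
          by (rule mult_right_mono) (use M C in auto)
        also have "\<dots> = C * M ^ n" using D n by (simp add: power_eq_if)
        finally show ?thesis .
      qed
    qed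
  qed
  then show ?thesis using M by blast
qed

lemma summable_of_growth:
  fixes y :: "nat \<Rightarrow> complex"
  assumes "\<And>n. norm (y n) \<le> C * M ^ n" "M \<ge> 1" "norm x < 1 / M"
  shows "summable (\<lambda>n. y n * x ^ n)"
proof (rule summable_comparison_test')
  show "summable (\<lambda>n. C * (M * norm x) ^ n)"
    by (intro summable_mult summable_geometric) (use assms in \<open>simp add: field_simps\<close>)
  fix n :: nat assume "n \<ge> 0"
  show "norm (y n * x ^ n) \<le> C * (M * norm x) ^ n"
    using mult_right_mono[OF assms(1)[of n], of "norm x ^ n"]
    by (simp add: norm_mult norm_power power_mult_distrib mult_ac)
qed

text \<open>The polynomial U of the recurrence annihilates the formal two-sided series. Cutting the
  series at index 0 leaves a polynomial N which both halves, taken with opposite signs, reproduce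
  after multiplication by U; so both are expansions of N / U.\<close>

lemma bilateral_recurrence_normalised:
  fixes x :: "int \<Rightarrow> complex"
  assumes rec: "\<And>k. (\<Sum>j\<le>D. u j * x (k + int j)) = 0" and u: "u 0 \<noteq> 0" "u D \<noteq> 0"
  shows "\<exists>B f. finite B \<and> rreg B f \<and> pser (\<lambda>y. f (1 / y)) (\<lambda>r. x (int r)) \<and>
     pser f (\<lambda>r. if r = 0 then 0 else - x (- int r))"
proof -
  define U where "U = (\<Sum>j\<le>D. monom (u j) j)"
  \<comment> \<open>The terms of U times the series in 1/z that have a positive exponent
    \<open>j - r\<close>; all other terms cancel by the recurrence.\<close>
  define N where "N = (\<Sum>j\<le>D. \<Sum>r<j. monom (u j * x (int r)) (j - r))"
  have polyU: "poly U z = (\<Sum>j\<le>D. u j * z ^ j)" for z by (simp add: U_def poly_sum poly_monom)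
  have polyN: "poly N z = (\<Sum>j\<le>D. \<Sum>r<j. u j * x (int r) * z ^ (j - r))" for z
    by (simp add: N_def poly_sum poly_monom)
  have "coeff U 0 = u 0" by (simp add: U_def coeff_sum)
  then have U0: "U \<noteq> 0" "poly U 0 \<noteq> 0" using u by (auto simp: poly_0_coeff_0)
  define B where "B = {z. poly U z = 0}"
  define f where "f z = poly N z / poly U z" for z
  have B: "finite B" unfolding B_def using U0 poly_roots_finite by blast
  have f: "rreg B f" by (rule rregI[of U]) (use U0 in \<open>auto simp: B_def f_def\<close>)
  have fwd: "\<exists>C M. M \<ge> 1 \<and> (\<forall>n. norm (x (int n)) \<le> C * M ^ n)"
  proof (rule linear_recurrence_growth)
    fix n
    have "u D * x (int n + int D) + (\<Sum>j<D. u j * x (int n + int j)) = 0"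
      using rec[of "int n"] unfolding lessThan_Suc_atMost[symmetric] by (simp add: add.commute)
    then have "x (int n + int D) = - (\<Sum>j<D. u j * x (int n + int j)) / u D"
      using u by (simp add: field_simps eq_neg_iff_add_eq_0)
    also have "\<dots> = (\<Sum>j<D. (- u j / u D) * x (int n + int j))"
      by (simp add: sum_negf sum_divide_distrib)
    finally show "x (int (n + D)) = (\<Sum>j<D. (- u j / u D) * x (int (n + j)))" by simp
  qed
  have bwd: "\<exists>C M. M \<ge> 1 \<and> (\<forall>n. norm (x (- int n)) \<le> C * M ^ n)"
  proof (rule linear_recurrence_growth)
    fix n
    have "(\<Sum>j\<le>D. u j * x (- int (n + D) + int j)) = (\<Sum>j\<le>D. u (D - j) * x (- int (n + D) + int (D - j)))"
      by (rule sum.nat_diff_reindex[symmetric, where ?n = "Suc D", simplified lessThan_Suc_atMost, simplified])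
    also have "\<dots> = (\<Sum>j\<le>D. u (D - j) * x (- int (n + j)))"
      by (intro sum.cong refl) (auto simp: of_nat_diff)
    finally have "u 0 * x (- int (n + D)) + (\<Sum>j<D. u (D - j) * x (- int (n + j))) = 0"
      using rec[of "- int (n + D)"] unfolding lessThan_Suc_atMost[symmetric] by (simp add: add.commute)
    then have "x (- int (n + D)) = - (\<Sum>j<D. u (D - j) * x (- int (n + j))) / u 0"
      using u by (simp add: field_simps eq_neg_iff_add_eq_0)
    then show "x (- int (n + D)) = (\<Sum>j<D. (- u (D - j) / u 0) * x (- int (n + j)))"
      by (simp add: sum_negf sum_divide_distrib)
  qed
  obtain C M where CM: "M \<ge> 1" "\<And>n. norm (x (int n)) \<le> C * M ^ n" using fwd by blast
  obtain C' M' where CM': "M' \<ge> 1" "\<And>n. norm (x (- int n)) \<le> C' * M' ^ n" using bwd by blast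
  have 1: "pser (\<lambda>y. f (1 / y)) (\<lambda>r. x (int r))"
  proof -
    have "\<forall>\<^sub>F y in at (0::complex). norm y < 1 / M"
      unfolding eventually_at by (rule exI[of _ "1 / M"]) (use CM in auto)
    moreover have "\<forall>\<^sub>F y in at (0::complex). y \<notin> {0}" by (rule eventually_at_not_in_finite) simp
    moreover have "\<forall>\<^sub>F y in at 0. 1 / y \<notin> B" by (rule eventually_one_div_not_in_finite[OF B])
    ultimately show ?thesis unfolding pser_def
    proof eventually_elim
      case (elim y)
      then have y0: "y \<noteq> 0" by simp
      let ?a = "\<lambda>r. x (int r) * y ^ r"
      have s: "summable ?a" by (rule summable_of_growth[OF CM(2,1) elim(1)])
      have sj: "summable (\<lambda>n. x (int n + int j) * y ^ n)" for j
      proof -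
        have "summable (\<lambda>n. ?a (n + j))" using s summable_iff_shift[of ?a j] by blast
        then have "summable (\<lambda>n. (1 / y ^ j) * ?a (n + j))" by (rule summable_mult)
        then show ?thesis using y0 by (simp add: power_add)
      qed
      have split: "(1 / y) ^ j * suminf ?a = (\<Sum>r<j. x (int r) * (1 / y) ^ (j - r)) + (\<Sum>n. x (int n + int j) * y ^ n)" for j
      proof -
        have "suminf ?a = (\<Sum>n. ?a (n + j)) + (\<Sum>r<j. ?a r)"
          by (rule suminf_split_initial_segment[OF s])
        moreover have "(\<Sum>n. ?a (n + j)) = y ^ j * (\<Sum>n. x (int n + int j) * y ^ n)"
          by (subst suminf_mult[OF sj, symmetric]) (simp add: power_add mult_ac)
        moreover have "(1 / y) ^ j * (\<Sum>r<j. ?a r) = (\<Sum>r<j. x (int r) * (1 / y) ^ (j - r))"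
          unfolding sum_distrib_left
          by (intro sum.cong refl) (use y0 in \<open>auto simp: power_diff power_one_over field_simps\<close>)
        ultimately show ?thesis using y0 by (simp add: distrib_left power_one_over)
      qed
      have "poly U (1 / y) * suminf ?a = (\<Sum>j\<le>D. u j * ((1 / y) ^ j * suminf ?a))"
        unfolding polyU sum_distrib_right mult.assoc ..
      also have "\<dots> = poly N (1 / y) + (\<Sum>j\<le>D. \<Sum>n. u j * (x (int n + int j) * y ^ n))"
        unfolding split polyN
        by (simp add: distrib_left sum.distrib sum_distrib_left mult.assoc suminf_mult[OF sj])
      also have "(\<Sum>j\<le>D. \<Sum>n. u j * (x (int n + int j) * y ^ n)) = (\<Sum>n. \<Sum>j\<le>D. u j * (x (int n + int j) * y ^ n))"
        by (rule suminf_sum[symmetric]) (intro summable_mult sj)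
      also have "\<dots> = (\<Sum>n. (\<Sum>j\<le>D. u j * x (int n + int j)) * y ^ n)"
        by (simp add: sum_distrib_right mult.assoc)
      also have "\<dots> = 0" using rec by simp
      finally have "suminf ?a = f (1 / y)"
        using elim(3) by (simp add: f_def B_def field_simps)
      then show ?case using summable_sums[OF s] by simp
    qed
  qed
  have 2: "pser f (\<lambda>r. if r = 0 then 0 else - x (- int r))"
  proof -
    have "\<forall>\<^sub>F z in at (0::complex). norm z < 1 / M'"
      unfolding eventually_at by (rule exI[of _ "1 / M'"]) (use CM' in auto)
    moreover have "\<forall>\<^sub>F z in at 0. z \<notin> B" by (rule eventually_at_not_in_finite[OF B])
    ultimately show ?thesis unfolding pser_def
    proof eventually_elim
      case (elim z)
      let ?a = "\<lambda>r. x (- int r) * z ^ r"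
      have s: "summable ?a" by (rule summable_of_growth[OF CM'(2,1) elim(1)])
      \<comment> \<open>Shifting the series over negative indices by j adds the terms
        \<open>?h j m\<close> with m < j; up to two end terms these form the j-th row of N.\<close>
      let ?h = "\<lambda>j m. x (int j - int m) * z ^ m"
      have hs: "summable (?h j)" for j
      proof -
        have "summable (\<lambda>n. z ^ j * ?a n)" by (intro summable_mult s)
        then have "summable (\<lambda>n. ?h j (n + j))" by (simp add: power_add mult_ac)
        then show ?thesis using summable_iff_shift[of "?h j" j] by blast
      qed
      have split: "z ^ j * suminf ?a = suminf (?h j) - (\<Sum>m<j. ?h j m)" for j
      proof -
        have "suminf (?h j) = (\<Sum>n. ?h j (n + j)) + (\<Sum>m<j. ?h j m)"
          by (rule suminf_split_initial_segment[OF hs])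
        moreover have "(\<Sum>n. ?h j (n + j)) = z ^ j * suminf ?a"
          by (subst suminf_mult[OF s, symmetric]) (simp add: power_add mult_ac)
        ultimately show ?thesis by simp
      qed
      have "(\<Sum>j\<le>D. u j * suminf (?h j)) = (\<Sum>j\<le>D. \<Sum>m. u j * ?h j m)"
        by (simp add: suminf_mult[OF hs])
      also have "\<dots> = (\<Sum>m. \<Sum>j\<le>D. u j * ?h j m)"
        by (rule suminf_sum[symmetric]) (intro summable_mult hs)
      also have "\<dots> = (\<Sum>m. (\<Sum>j\<le>D. u j * x (- int m + int j)) * z ^ m)"
        by (simp add: sum_distrib_right mult.assoc)
      also have "\<dots> = 0" by (simp only: rec mult_zero_left suminf_zero)
      finally have z: "(\<Sum>j\<le>D. u j * suminf (?h j)) = 0" .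
      have "poly U z * suminf ?a = (\<Sum>j\<le>D. u j * (z ^ j * suminf ?a))"
        unfolding polyU sum_distrib_right mult.assoc ..
      also have "\<dots> = - (\<Sum>j\<le>D. u j * (\<Sum>m<j. ?h j m))"
        unfolding split using z by (simp add: right_diff_distrib sum_subtractf)
      finally have Ua: "poly U z * suminf ?a = - (\<Sum>j\<le>D. u j * (\<Sum>m<j. ?h j m))" .
      have inner: "(\<Sum>r<j. x (int r) * z ^ (j - r)) = z ^ j * x 0 + (\<Sum>m<j. ?h j m) - x (int j)" for j
      proof (cases j)
        case (Suc i)
        have "(\<Sum>r<j. x (int r) * z ^ (j - r)) = (\<Sum>r<Suc i. x (int (Suc i - Suc r)) * z ^ (Suc i - (Suc i - Suc r)))"
          unfolding Suc by (rule sum.nat_diff_reindex[symmetric])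
        also have "\<dots> = (\<Sum>r<Suc i. ?h j (Suc r))"
          by (intro sum.cong refl) (auto simp: Suc of_nat_diff Suc_diff_le)
        also have "\<dots> = (\<Sum>r<Suc (Suc i). ?h j r) - ?h j 0" by (subst sum.lessThan_Suc_shift) simp
        finally show ?thesis by (simp add: Suc)
      qed simp
      have "poly N z = (\<Sum>j\<le>D. u j * (\<Sum>r<j. x (int r) * z ^ (j - r)))"
        by (simp add: polyN sum_distrib_left mult.assoc)
      also have "\<dots> = (\<Sum>j\<le>D. u j * z ^ j) * x 0 + (\<Sum>j\<le>D. u j * (\<Sum>m<j. ?h j m)) - (\<Sum>j\<le>D. u j * x (int j))"
        unfolding inner by (simp add: distrib_left right_diff_distrib sum.distrib sum_subtractf sum_distrib_right mult.assoc)
      also have "(\<Sum>j\<le>D. u j * x (int j)) = 0" using rec[of 0] by simp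
      finally have "poly N z = poly U z * (x 0 - suminf ?a)"
        using Ua by (simp add: polyU right_diff_distrib)
      then have fz: "f z = x 0 - suminf ?a" using elim(2) by (simp add: f_def B_def)
      have "(\<lambda>r. - ?a r) sums (- suminf ?a)" by (intro sums_minus summable_sums s)
      moreover have "(\<lambda>r. if r = 0 then x 0 else 0) sums x 0" using sums_single[of 0 "\<lambda>_. x 0"] by simp
      ultimately have "(\<lambda>r. - ?a r + (if r = 0 then x 0 else 0)) sums (- suminf ?a + x 0)"
        by (rule sums_add)
      moreover have "- ?a r + (if r = 0 then x 0 else 0) = (if r = 0 then 0 else - x (- int r)) * z ^ r" for r
        by simp
      ultimately show ?case using fz by simp
    qed
  qed
  show ?thesis using B f 1 2 by blast
qed

text \<open>Trimming to the first and last nonzero coefficient makes the recurrence solvable in both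
  directions.\<close>

lemma bilateral_recurrence:
  fixes x :: "int \<Rightarrow> complex"
  assumes rec: "\<And>k. (\<Sum>j\<le>D. u j * x (k + int j)) = 0" and u: "\<exists>j\<le>D. u j \<noteq> 0"
  shows "\<exists>B f. finite B \<and> rreg B f \<and> pser (\<lambda>y. f (1 / y)) (\<lambda>r. x (int r)) \<and>
     pser f (\<lambda>r. if r = 0 then 0 else - x (- int r))"
proof -
  define J where "J = {j. j \<le> D \<and> u j \<noteq> 0}"
  have J: "finite J" "J \<noteq> {}" using u by (auto simp: J_def)
  define a b where "a = Min J" and "b = Max J"
  have ab: "a \<in> J" "b \<in> J" unfolding a_def b_def using J by (auto intro: Min_in Max_in)
  have Jab: "a \<le> j \<and> j \<le> b" if "j \<in> J" for j
    unfolding a_def b_def using J that by auto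
  have le: "a \<le> b" using Jab[OF ab(2)] by simp
  show ?thesis
  proof (rule bilateral_recurrence_normalised[where D = "b - a" and u = "\<lambda>j. u (j + a)"])
    show "u (0 + a) \<noteq> 0" "u (b - a + a) \<noteq> 0" using ab le by (auto simp: J_def)
    fix k
    have "(\<Sum>j\<le>b - a. u (j + a) * x (k + int j)) = (\<Sum>j\<in>{a..b}. u j * x (k - int a + int j))"
      by (rule sum.reindex_bij_witness[of _ "\<lambda>j. j - a" "\<lambda>j. j + a"]) (use le in auto)
    also have "\<dots> = (\<Sum>j\<le>D. u j * x (k - int a + int j))"
    proof (rule sum.mono_neutral_left)
      show "{a..b} \<subseteq> {..D}" using ab by (auto simp: J_def)
      show "\<forall>i\<in>{..D} - {a..b}. u i * x (k - int a + int i) = 0"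
        using Jab by (force simp: J_def)
    qed auto
    finally show "(\<Sum>j\<le>b - a. u (j + a) * x (k + int j)) = 0" using rec by simp
  qed
qed

section \<open>Well-behaved modules\<close>

lemma rreg_prod: "(\<And>i. i \<in> S \<Longrightarrow> rreg B (f i)) \<Longrightarrow> rreg B (\<lambda>z. \<Prod>i\<in>S. f i z)"
  by (induction S rule: infinite_finite_induct) (auto intro: rreg_mult)

lemma rreg_det: "mreg B f \<Longrightarrow> rreg B (\<lambda>z. det (f z))"
  unfolding det_def mreg_def by (intro rreg_sum rreg_mult rreg_const rreg_prod) auto

lemma rreg_zeros_finite:
  assumes "rreg B f" "finite B" "z0 \<notin> B" "f z0 \<noteq> 0"
  shows "finite {z. z \<notin> B \<and> f z = 0}"
proof (rule ccontr)
  assume "infinite {z. z \<notin> B \<and> f z = 0}"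
  from rreg_unique[OF assms(1) rreg_const this assms(3)] assms(4) show False by simp
qed

lemma matrix_inv_mult:
  assumes "invertible (A :: 'n::finite cmat)"
  shows "A ** matrix_inv A = mat 1" "matrix_inv A ** A = mat 1"
  using someI_ex[OF assms[unfolded invertible_def]] unfolding matrix_inv_def by auto

lemma matrix_inv_unique:
  assumes "A ** B = mat 1"
  shows "matrix_inv A = (B :: 'n::finite cmat)"
proof -
  have "B ** A = mat 1" using assms matrix_left_right_inverse by blast
  then have "invertible A" using assms unfolding invertible_def by blast
  then show ?thesis using matrix_inv_mult[of A] assms
    by (metis matrix_mul_assoc matrix_mul_lid matrix_mul_rid)
qed

text \<open>Writes the entries of the inverse as quotients of determinants, so that inversion
  preserves rationality.\<close>

lemma matrix_inv_cramer:
  assumes "det (A :: 'n::finite cmat) \<noteq> 0"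
  shows "matrix_inv A $ k $ j = det (\<chi> i l. if l = k then axis j 1 $ i else A $ i $ l) / det A"
proof -
  have "invertible A" using assms invertible_det_nz by blast
  then have "A ** matrix_inv A = mat 1" by (rule matrix_inv_mult)
  then have "A *v (\<chi> k. matrix_inv A $ k $ j) = axis j 1"
    by (auto simp: vec_eq_iff matrix_vector_mult_def cmat_nth_mult mat_def axis_def)
  then show ?thesis unfolding cramer[OF assms] by (simp add: vec_eq_iff)
qed

lemma mreg_matrix_inv:
  assumes f: "mreg B f" and B: "finite B" and z0: "z0 \<notin> B" "det (f z0) \<noteq> 0"
  defines "Z \<equiv> {z. z \<in> B \<or> det (f z) = 0}"
  shows "finite Z" "mreg Z (\<lambda>z. matrix_inv (f z))"
proof -
  have "Z = B \<union> {z. z \<notin> B \<and> det (f z) = 0}" by (auto simp: Z_def)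
  then show fin: "finite Z" using B rreg_zeros_finite[OF rreg_det[OF f] B z0] by simp
  have "B \<subseteq> Z" by (auto simp: Z_def)
  then have fZ: "mreg Z f" using f mreg_mono by blast
  have "rreg Z (\<lambda>z. matrix_inv (f z) $ k $ j)" for k j
  proof (rule rreg_cong)
    have "mreg Z (\<lambda>z. \<chi> i l. if l = k then axis j 1 $ i else f z $ i $ l)"
    proof -
      have "rreg Z (\<lambda>z. if b = k then axis j 1 $ a else f z $ a $ b)" for a b
        using fZ unfolding mreg_def by (cases "b = k") auto
      then show ?thesis unfolding mreg_def by simp
    qed
    then show "rreg Z (\<lambda>z. det (\<chi> i l. if l = k then axis j 1 $ i else f z $ i $ l) / det (f z))"
      by (intro rreg_divide fin rreg_det fZ) (auto simp: Z_def)
  qed (rule matrix_inv_cramer, simp add: Z_def)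
  then show "mreg Z (\<lambda>z. matrix_inv (f z))" unfolding mreg_def by blast
qed

text \<open>This is why \<open>spec\<close> contains the poles of the inverse: where f and its
  inverse are both regular, the product of their limits is 1, so f is invertible.\<close>

lemma mreg_invertible_of_not_pole:
  fixes f :: "complex \<Rightarrow> 'n::finite cmat"
  assumes f: "mreg B f" and B: "finite B" and z0: "z0 \<notin> B" "det (f z0) \<noteq> 0"
  shows "finite (mpoles (\<lambda>z. matrix_inv (f z)))"
    and "z \<notin> B \<Longrightarrow> z \<notin> mpoles (\<lambda>z. matrix_inv (f z)) \<Longrightarrow> invertible (f z)"
proof -
  define Z where "Z = {z. z \<in> B \<or> det (f z) = 0}"
  have Z: "finite Z" "mreg Z (\<lambda>z. matrix_inv (f z))"
    using mreg_matrix_inv[OF assms] unfolding Z_def by blast+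
  \<comment> \<open>\<open>matrix_inv\<close> is arbitrary at singular matrices, so the limit
    argument runs with a reduced rational g that agrees with it off the finite set Z.\<close>
  obtain g where g: "ratm g" "\<And>z. z \<notin> Z \<Longrightarrow> g z = matrix_inv (f z)"
    using ratm_of_mreg[OF Z(2)] by blast
  have ev: "\<forall>\<^sub>F w in at z. g w = matrix_inv (f w)" for z
    using eventually_at_not_in_finite[OF Z(1), of z] by eventually_elim (rule g(2))
  have mp: "mpoles (\<lambda>z. matrix_inv (f z)) = mpoles g"
    unfolding mpoles_def using is_pole_cong[OF ev refl] by blast
  show "finite (mpoles (\<lambda>z. matrix_inv (f z)))" unfolding mp by (rule ratm_mpoles(1)[OF g(1)])
  assume z: "z \<notin> B" "z \<notin> mpoles (\<lambda>z. matrix_inv (f z))"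
  have "isCont g z" by (rule mreg_isCont[OF ratm_mpoles(2,1)[OF g(1)]]) (use z mp in auto)
  moreover have "isCont f z" by (rule mreg_isCont[OF f B z(1)])
  ultimately have "((\<lambda>w. (g w ** f w) $ a $ b) \<longlongrightarrow> (g z ** f z) $ a $ b) (at z)" for a b
    unfolding cmat_nth_mult isCont_def by (intro tendsto_intros)
  moreover have "\<forall>\<^sub>F w in at z. (g w ** f w) $ a $ b = mat 1 $ a $ b" for a b
    using eventually_at_not_in_finite[OF Z(1), of z]
  proof eventually_elim
    case (elim w)
    then have "det (f w) \<noteq> 0" by (simp add: Z_def)
    then show ?case using matrix_inv_mult(2)[of "f w"] g(2)[OF elim] by (simp add: invertible_det_nz)
  qed
  ultimately have "(g z ** f z) $ a $ b = mat 1 $ a $ b" for a b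
    by (rule tendsto_unique[OF at_neq_bot _ tendsto_eventually])
  then have "g z ** f z = mat 1" by (simp add: vec_eq_iff)
  then show "invertible (f z)" by (metis invertible_left_inverse)
qed

text \<open>The only consequences of the defining relations that matter below; unlike \<open>is_rep\<close> they are
  easily inherited by shifts and by Drinfeld tensor products.\<close>

definition good :: "('i, 'n::finite) lrep \<Rightarrow> bool" where
  "good V \<longleftrightarrow>
    (\<forall>i j r s. Pp V i r ** Pp V j s = Pp V j s ** Pp V i r \<and>
               Pp V i r ** Pm V j s = Pm V j s ** Pp V i r \<and>
               Pm V i r ** Pm V j s = Pm V j s ** Pm V i r) \<and>
    (\<forall>i. Pp V i 0 ** Pm V i 0 = mat 1) \<and>
    (\<forall>i. \<exists>f. psi_exp V i f) \<and> (\<forall>e i. \<exists>f. x_exp V e i f)"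

lemma good_psi: "good V \<Longrightarrow> psi_exp V i (Psi_fun V i)"
  unfolding good_def using Psi_fun_spec by metis

lemma good_x: "good V \<Longrightarrow> x_exp V e i (X_fun V e i)"
  unfolding good_def using X_fun_spec by metis

lemma mpser_not_pole:
  assumes "mpser f A"
  shows "\<not> is_pole f 0" and "(f \<longlongrightarrow> A 0) (at 0)"
proof -
  show t: "(f \<longlongrightarrow> A 0) (at 0)"
    using assms unfolding mpser_def by (intro vec_tendstoI) (auto dest: pser_tendsto)
  then show "\<not> is_pole f 0" unfolding is_pole_def
    using not_tendsto_and_filterlim_at_infinity[of "at 0" f] by auto
qed

context
  fixes V :: "('i::finite, 'n::finite) lrep"
  assumes V: "good V"
begin

lemma good_ratm_Psi: "ratm (Psi_fun V i)" and good_Psi_inf: "mpser (\<lambda>y. Psi_fun V i (1 / y)) (Pp V i)"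
  and good_Psi_0: "mpser (Psi_fun V i) (Pm V i)"
  using good_psi[OF V, of i] unfolding psi_exp_iff by auto

lemma good_Pp0: "Pp V i 0 ** Pm V i 0 = mat 1" "Pm V i 0 ** Pp V i 0 = mat 1"
  using V matrix_left_right_inverse unfolding good_def by blast+

lemma good_Psi_at_0: "0 \<notin> mpoles (Psi_fun V i)" "Psi_fun V i 0 = Pm V i 0"
proof -
  note m = mpser_not_pole[OF good_Psi_0[of i]]
  show *: "0 \<notin> mpoles (Psi_fun V i)" using m(1) by (simp add: mpoles_def)
  have "isCont (Psi_fun V i) 0"
    by (rule mreg_isCont[OF ratm_mpoles(2,1)[OF good_ratm_Psi] *])
  then show "Psi_fun V i 0 = Pm V i 0"
    using m(2) tendsto_unique[of "at (0::complex)"] unfolding isCont_def by auto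
qed

lemma good_det_0: "det (Psi_fun V i 0) \<noteq> 0"
  using good_Pp0(2)[of i] unfolding good_Psi_at_0 invertible_det_nz[symmetric] invertible_right_inverse
  by blast

lemmas good_inv = mreg_invertible_of_not_pole[OF ratm_mpoles(2,1)[OF good_ratm_Psi] good_Psi_at_0(1) good_det_0]

lemma finite_spec: "finite (spec V)"
proof -
  have "finite (mpoles (X_fun V e i))" for e i
    using good_x[OF V] ratm_mpoles(1) unfolding x_exp_iff by blast
  then show ?thesis
    unfolding spec_def using good_inv(1) ratm_mpoles(1)[OF good_ratm_Psi] by simp
qed

text \<open>All currents have power series at 0, and the value of \<Psi> there is the invertible
  matrix \<open>Pm V i 0\<close>.\<close>

lemma zero_notin_spec: "0 \<notin> spec V"
proof -
  have 1: "0 \<notin> mpoles (X_fun V e i)" for e i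
    using good_x[OF V, of e i] mpser_not_pole(1) unfolding x_exp_iff mpoles_def by blast
  have 2: "0 \<notin> mpoles (\<lambda>z. matrix_inv (Psi_fun V i z))" for i
  proof -
    note r = mreg_matrix_inv[OF ratm_mpoles(2,1)[OF good_ratm_Psi] good_Psi_at_0(1) good_det_0]
    show ?thesis unfolding mpoles_def mem_Collect_eq
      by (rule mreg_not_pole[OF r(2,1)]) (use good_Psi_at_0(1) good_det_0 in auto)
  qed
  show ?thesis unfolding spec_def using 1 2 good_Psi_at_0(1) by auto
qed

lemma spec_Psi: "mpoles (Psi_fun V i) \<subseteq> spec V" and spec_X: "mpoles (X_fun V e i) \<subseteq> spec V"
  by (cases e; auto simp: spec_def)+

lemma mreg_Psi: "mreg (spec V) (Psi_fun V i)"
  using ratm_mpoles(2)[OF good_ratm_Psi] spec_Psi mreg_mono by blast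

lemma mreg_X: "mreg (spec V) (X_fun V e i)"
  using good_x[OF V, of e i] ratm_mpoles(2) spec_X mreg_mono unfolding x_exp_iff by metis

lemma invertible_Psi: "z \<notin> spec V \<Longrightarrow> invertible (Psi_fun V i z)"
  by (rule good_inv(2)) (use spec_Psi in \<open>auto simp: spec_def\<close>)

text \<open>Commutation with the coefficients at infinity gives commutation near infinity, and the
  identity theorem carries it to all regular points.\<close>

lemma Psi_commute_of_Pp:
  assumes "\<And>r. X ** Pp V i r = Pp V i r ** X" "z \<notin> spec V"
  shows "X ** Psi_fun V i z = Psi_fun V i z ** X"
proof (rule mreg_unique[OF mreg_mult[OF mreg_const mreg_Psi] mreg_mult[OF mreg_Psi mreg_const] _ assms(2)])
  let ?P = "\<lambda>z. X ** Psi_fun V i z = Psi_fun V i z ** X"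
  have "\<forall>\<^sub>F y in at 0. ?P (1 / y)"
  proof -
    have 1: "mpser (\<lambda>y. X ** Psi_fun V i (1 / y)) (\<lambda>r. X ** Pp V i r)"
      by (rule mpser_mult_const_left[OF good_Psi_inf])
    have "mpser (\<lambda>y. Psi_fun V i (1 / y) ** X) (\<lambda>r. Pp V i r ** X)"
      by (rule mpser_mult_const_right[OF good_Psi_inf])
    then have 2: "mpser (\<lambda>y. Psi_fun V i (1 / y) ** X) (\<lambda>r. X ** Pp V i r)"
      by (rule mpser_coeff_cong) (rule assms(1))
    show ?thesis using 1[unfolded mpser_iff] 2[unfolded mpser_iff]
      by eventually_elim (rule sums_unique2)
  qed
  then have ev: "\<forall>\<^sub>F y in at 0. 1 / y \<notin> spec V \<and> ?P (1 / y)"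
    using eventually_one_div_not_in_finite[OF finite_spec] by eventually_elim auto
  show "infinite {z. z \<notin> spec V \<and> ?P z}"
  proof
    assume "finite {z. z \<notin> spec V \<and> ?P z}"
    from eventually_one_div_not_in_finite[OF this] ev
    have "\<forall>\<^sub>F y in at (0::complex). False" by eventually_elim auto
    then show False by simp
  qed
qed

lemma Pp_commute: "Pp V i r ** Pp V j s = Pp V j s ** Pp V i r"
  using V unfolding good_def by blast

lemma Psi_commute: "z \<notin> spec V \<Longrightarrow> w \<notin> spec V \<Longrightarrow> Psi_fun V i z ** Psi_fun V j w = Psi_fun V j w ** Psi_fun V i z"
  by (rule Psi_commute_of_Pp, rule Psi_commute_of_Pp[symmetric], rule Pp_commute)

text \<open>The logarithmic derivative is o(1/w) at infinity because \<open>\<Psi>\<close> is regular and invertible there.\<close>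

lemma logderiv_decay:
  "((\<lambda>w. w * (matrix_inv (Psi_fun V i w) ** mderiv (Psi_fun V i) w) $ a $ b) \<longlongrightarrow> 0) at_infinity"
proof -
  let ?F = "Psi_fun V i"
  have der: "((\<lambda>w. w * deriv (\<lambda>z. ?F z $ a $ b) w) \<longlongrightarrow> 0) at_infinity" for a b
  proof -
    let ?f = "\<lambda>z. ?F z $ a $ b"
    have "pser (\<lambda>y. ?f (1 / y)) (\<lambda>r. Pp V i r $ a $ b)"
      using good_Psi_inf unfolding mpser_def by blast
    from pser_analytic[OF this] obtain \<delta> g where g: "\<delta> > 0" "g holomorphic_on ball 0 \<delta>"
      "\<And>x. x \<noteq> 0 \<Longrightarrow> norm x < \<delta> \<Longrightarrow> g x = ?f (1 / x)" by blast
    \<comment> \<open>In the coordinate y = 1/w the entry is a holomorphic g near 0, and the chain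
      rule produces an extra factor 1/w.\<close>
    have eq: "w * deriv ?f w = - deriv g (1 / w) / w" if w: "norm w > 1 / \<delta>" for w
    proof -
      have w0: "w \<noteq> 0" using w g(1) by auto
      have inb: "1 / u \<in> ball 0 \<delta>" if "norm u > 1 / \<delta>" for u :: complex
      proof -
        have "0 < norm u" using that g(1) by (meson divide_pos_pos less_trans zero_less_one)
        moreover have "1 < norm u * \<delta>" using that g(1) by (simp add: pos_divide_less_eq)
        ultimately show ?thesis by (simp add: norm_divide pos_divide_less_eq mult.commute)
      qed
      have "((\<lambda>u. g (1 / u)) has_field_derivative deriv g (1 / w) * (- 1 / w\<^sup>2)) (at w)"
      proof (rule DERIV_chain2[where f = g and g = "\<lambda>u. 1 / u"])
        show "(g has_field_derivative deriv g (1 / w)) (at (1 / w))"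
          using holomorphic_derivI[OF g(2) open_ball inb[OF w]] .
        show "((\<lambda>u. 1 / u) has_field_derivative - 1 / w\<^sup>2) (at w)"
          using w0 by (auto intro!: derivative_eq_intros simp: power2_eq_square)
      qed
      moreover have "\<forall>\<^sub>F u in nhds w. g (1 / u) = ?f u"
      proof -
        have "open {u. norm (u :: complex) > 1 / \<delta>}" by (intro open_Collect_less continuous_intros)
        then have "\<forall>\<^sub>F u in nhds w. u \<in> {u. norm u > 1 / \<delta>}"
          using w by (intro eventually_nhds_in_open) auto
        then show ?thesis
        proof eventually_elim
          case (elim u)
          then have "norm u > 1 / \<delta>" by simp
          with inb[OF this] g(1) have "1 / u \<noteq> 0" "norm (1 / u) < \<delta>" by auto
          from g(3)[OF this] show ?case by simp
        qed
      qed
      ultimately have "(?f has_field_derivative deriv g (1 / w) * (- 1 / w\<^sup>2)) (at w)"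
        using DERIV_cong_ev[OF refl _ refl, of "\<lambda>u. g (1 / u)" ?f w] by blast
      then show ?thesis using w0 by (simp add: DERIV_imp_deriv power2_eq_square)
    qed
    have "(deriv g \<longlongrightarrow> deriv g 0) (at 0)"
    proof -
      have "deriv g holomorphic_on ball 0 \<delta>" by (rule holomorphic_deriv[OF g(2) open_ball])
      then have "isCont (deriv g) 0" using g(1)
        by (metis at_within_open centre_in_ball continuous_on_eq_continuous_within
            holomorphic_on_imp_continuous_on open_ball)
      then show ?thesis by (simp add: isCont_def)
    qed
    moreover have "filterlim (\<lambda>w::complex. 1 / w) (at 0) at_infinity"
      unfolding filterlim_at
    proof
      show "\<forall>\<^sub>F w::complex in at_infinity. 1 / w \<in> UNIV \<and> 1 / w \<noteq> 0"
        unfolding eventually_at_infinity by (rule exI[of _ 1]) auto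
      show "((\<lambda>w::complex. 1 / w) \<longlongrightarrow> 0) at_infinity"
        using tendsto_inverse_0 by (simp add: inverse_eq_divide[abs_def])
    qed
    ultimately have "((\<lambda>w. deriv g (1 / w)) \<longlongrightarrow> deriv g 0) at_infinity"
      by (rule filterlim_compose)
    moreover have "((\<lambda>w::complex. 1 / w) \<longlongrightarrow> 0) at_infinity"
      using tendsto_inverse_0 by (simp add: inverse_eq_divide[abs_def])
    ultimately have "((\<lambda>w. - deriv g (1 / w) * (1 / w)) \<longlongrightarrow> - deriv g 0 * 0) at_infinity"
      by (intro tendsto_intros)
    moreover have "\<forall>\<^sub>F w in at_infinity. - deriv g (1 / w) * (1 / w) = w * deriv ?f w"
      unfolding eventually_at_infinity
      by (rule exI[of _ "1 / \<delta> + 1"]) (use eq in auto)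
    ultimately show ?thesis by (simp add: Lim_transform_eventually)
  qed
  define M where "M = Sq (Pm V i 0)"
  define Y where "Y w = Sq (matrix_inv (?F w))" for w
  have "mpser (\<lambda>y. Pm V i 0 ** ?F (1 / y)) (\<lambda>r. Pm V i 0 ** Pp V i r)"
    by (rule mpser_mult_const_left[OF good_Psi_inf])
  from mpser_not_pole(2)[OF this] have "((\<lambda>y. Pm V i 0 ** ?F (1 / y)) \<longlongrightarrow> mat 1) (at 0)"
    by (simp add: good_Pp0)
  then have "((\<lambda>y. Sq (Pm V i 0 ** ?F (1 / y))) \<longlongrightarrow> Sq (mat 1)) (at 0)"
    by (rule bounded_linear.tendsto[OF bounded_linear_Sq])
  then have "((\<lambda>y. Sq (Pm V i 0 ** ?F (1 / y)) - 1) \<longlongrightarrow> 0) (at 0)"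
    by (simp add: Sq_simps LIM_zero_iff)
  then have "\<forall>\<^sub>F y in at 0. norm (M * Sq (?F (1 / y)) - 1) < 1 / 2"
    using tendstoD[of _ 0 "at 0" "1 / 2"] unfolding M_def by (fastforce simp: Sq_simps dist_norm)
  then have "\<forall>\<^sub>F y in at 0. 1 / y \<notin> spec V \<and> norm (M * Sq (?F (1 / y)) - 1) < 1 / 2"
    using eventually_one_div_not_in_finite[OF finite_spec] by eventually_elim auto
  then have "\<exists>R. \<forall>w. R < norm w \<longrightarrow> w \<notin> spec V \<and> norm (M * Sq (?F w) - 1) < 1 / 2"
    by (rule iffD2[OF eventually_at_infinity_inverse])
  then obtain R where R: "\<And>w. norm w > R \<Longrightarrow> w \<notin> spec V \<and> norm (M * Sq (?F w) - 1) < 1 / 2"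
    by blast
  \<comment> \<open>Near infinity \<open>M * Sq (?F w)\<close> is within 1/2 of 1, so the error term
    is absorbed on the left and the inverse stays bounded.\<close>
  have Yb: "norm (Y w) \<le> 2 * norm M" if "norm w > R" for w
  proof -
    have "Sq (?F w) * Y w = 1"
      unfolding Y_def Sq_simps(6)[symmetric]
      using matrix_inv_mult(1)[OF invertible_Psi] R[OF that] by (simp add: Sq_simps)
    then have "Y w = M - (M * Sq (?F w) - 1) * Y w"
      by (simp add: left_diff_distrib mult.assoc)
    then have "norm (Y w) \<le> norm M + norm ((M * Sq (?F w) - 1) * Y w)"
      by (metis norm_triangle_ineq4)
    also have "\<dots> \<le> norm M + norm (M * Sq (?F w) - 1) * norm (Y w)"
      by (intro add_left_mono norm_mult_ineq)
    also have "\<dots> \<le> norm M + 1 / 2 * norm (Y w)"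
      by (intro add_left_mono mult_right_mono) (use R[OF that] in auto)
    finally show ?thesis by simp
  qed
  have "((\<lambda>w. \<Sum>k\<in>UNIV. matrix_inv (?F w) $ a $ k * (w * mderiv ?F w $ k $ b)) \<longlongrightarrow> (\<Sum>k\<in>(UNIV::'n set). 0)) at_infinity"
  proof (intro tendsto_sum)
    fix k
    show "((\<lambda>w. matrix_inv (?F w) $ a $ k * (w * mderiv ?F w $ k $ b)) \<longlongrightarrow> 0) at_infinity"
    proof (rule Lim_null_comparison)
      have "((\<lambda>w. 2 * norm M * norm (w * deriv (\<lambda>z. ?F z $ k $ b) w)) \<longlongrightarrow> 2 * norm M * norm (0 :: complex)) at_infinity"
        by (intro tendsto_intros der)
      then show "((\<lambda>w. 2 * norm M * norm (w * deriv (\<lambda>z. ?F z $ k $ b) w)) \<longlongrightarrow> 0) at_infinity" by simp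
      show "\<forall>\<^sub>F w in at_infinity. norm (matrix_inv (?F w) $ a $ k * (w * mderiv ?F w $ k $ b))
          \<le> 2 * norm M * norm (w * deriv (\<lambda>z. ?F z $ k $ b) w)"
        unfolding eventually_at_infinity
      proof (intro exI[of _ "R + 1"] allI impI)
        fix w :: complex assume "R + 1 \<le> norm w"
        then have "norm (Y w) \<le> 2 * norm M" by (intro Yb) simp
        moreover have "norm (matrix_inv (?F w) $ a $ k) \<le> norm (Y w)"
          using norm_entry_le[of "Y w" a k] by (simp add: Y_def)
        ultimately show "norm (matrix_inv (?F w) $ a $ k * (w * mderiv ?F w $ k $ b))
          \<le> 2 * norm M * norm (w * deriv (\<lambda>z. ?F z $ k $ b) w)"
          by (simp add: mderiv_def norm_mult mult_right_mono)
      qed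
    qed
  qed
  then show ?thesis by (simp add: cmat_nth_mult sum_distrib_left mult_ac)
qed

end

section \<open>Representations are well behaved\<close>

text \<open>For dimension reasons the first terms satisfy one linear relation; the linear maps T and
  T' transport it along the sequence in both directions with the same coefficients.\<close>

lemma commutator_shift_linear:
  fixes x :: "int \<Rightarrow> 'n::finite sqm" and T T' :: "'n sqm \<Rightarrow> 'n sqm"
  assumes T: "linear T" "\<And>l. x (l + 1) = T (x l)" and T': "linear T'" "\<And>l. x l = T' (x (l + 1))"
  shows "\<exists>(u :: nat \<Rightarrow> real) D. (\<exists>k\<le>D. u k \<noteq> 0) \<and> (\<forall>l. (\<Sum>k\<le>D. u k *\<^sub>R x (l + int k)) = 0)"
proof -
  let ?D = "DIM('n cmat)"
  obtain u :: "nat \<Rightarrow> real" where u: "\<exists>k\<le>?D. u k \<noteq> 0" "(\<Sum>k\<le>?D. u k *\<^sub>R mat_of (x (int k))) = 0"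
    using finite_dim_dependent[of "\<lambda>k. mat_of (x (int k))"] by blast
  have "mat_of (\<Sum>k\<le>?D. u k *\<^sub>R x (int k)) = 0"
    using u(2) by (simp add: mat_of_sum scaleR_sqm.rep_eq)
  then have 0: "(\<Sum>k\<le>?D. u k *\<^sub>R x (int k)) = 0" by (intro mat_of_eqI) simp
  have "(\<Sum>k\<le>?D. u k *\<^sub>R x (l + int k)) = 0" for l
  proof (induction l rule: int_induct[where k = 0])
    case base
    then show ?case using 0 by simp
  next
    case (step1 i)
    have "(\<Sum>k\<le>?D. u k *\<^sub>R x (i + 1 + int k)) = T (\<Sum>k\<le>?D. u k *\<^sub>R x (i + int k))"
      by (simp add: linear_sum[OF T(1)] linear_scale[OF T(1)] flip: T(2)) (simp add: ac_simps)
    then show ?case using step1 linear_0[OF T(1)] by simp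
  next
    case (step2 i)
    have "(\<Sum>k\<le>?D. u k *\<^sub>R x (i - 1 + int k)) = (\<Sum>k\<le>?D. u k *\<^sub>R T' (x (i + int k)))"
      by (intro sum.cong refl) (subst T'(2), simp add: ac_simps)
    also have "\<dots> = T' (\<Sum>k\<le>?D. u k *\<^sub>R x (i + int k))"
      by (simp add: linear_sum[OF T'(1)] linear_scale[OF T'(1)])
    finally show ?case using step2 linear_0[OF T'(1)] by simp
  qed
  then show ?thesis using u(1) by blast
qed

lemma ex_x_exp_of_recurrence:
  assumes u: "\<exists>k\<le>D. u k \<noteq> (0 :: complex)"
    and rec: "\<And>a b l. (\<Sum>k\<le>D. u k * Xs V e i (l + int k) $ a $ b) = 0"
  shows "\<exists>f. x_exp V e i f"
proof -
  define Q where "Q a b B f \<longleftrightarrow> finite B \<and> rreg B f \<and> pser (\<lambda>y. f (1 / y)) (\<lambda>r. Xs V e i (int r) $ a $ b) \<and>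
     pser f (\<lambda>r. if r = 0 then 0 else - Xs V e i (- int r) $ a $ b)" for a b B f
  have "\<exists>B f. Q a b B f" for a b
    unfolding Q_def by (rule bilateral_recurrence[where u = u and D = D, OF rec u])
  then obtain B f where "\<And>a b. Q a b (B a b) (f a b)" by metis
  then have Bf: "\<And>a b. finite (B a b)" "\<And>a b. rreg (B a b) (f a b)"
    "\<And>a b. pser (\<lambda>y. f a b (1 / y)) (\<lambda>r. Xs V e i (int r) $ a $ b)"
    "\<And>a b. pser (f a b) (\<lambda>r. if r = 0 then 0 else - Xs V e i (- int r) $ a $ b)"
    unfolding Q_def by blast+
  define B' where "B' = (\<Union>a. \<Union>b. B a b)"
  show ?thesis
  proof (rule ex_x_exp_of_mreg)
    show "mreg B' (\<lambda>z. \<chi> a b. f a b z)"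
      unfolding mreg_def B'_def using Bf(2) by (auto intro: rreg_mono)
    show "finite B'" unfolding B'_def using Bf(1) by auto
    show "mpser (\<lambda>y. \<chi> a b. f a b (1 / y)) (\<lambda>r. Xs V e i (int r))"
      unfolding mpser_def using Bf(3) by simp
    have "(\<lambda>r. (if r = 0 then 0 else - Xs V e i (- int r)) $ a $ b)
        = (\<lambda>r. if r = 0 then 0 else - Xs V e i (- int r) $ a $ b)" for a b by auto
    then show "mpser (\<lambda>z. \<chi> a b. f a b z) (\<lambda>r. if r = 0 then 0 else - Xs V e i (- int r))"
      unfolding mpser_def using Bf(4) by simp
  qed
qed

lemma
  assumes "is_rep a d q V"
  shows is_rep_comm: "\<forall>i j r s. Pp V i r ** Pp V j s = Pp V j s ** Pp V i r \<and>
               Pp V i r ** Pm V j s = Pm V j s ** Pp V i r \<and>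
               Pm V i r ** Pm V j s = Pm V j s ** Pm V i r"
    and is_rep_inverse: "\<forall>i. Pp V i 0 ** Pm V i 0 = mat 1"
    and is_rep_weight: "\<forall>e i j k. Pp V i 0 ** Xs V e j k ** Pm V i 0 =
       smat ((q ^ d i) powi (sgn_e e * a i j)) (Xs V e j k)"
    and is_rep_PpX: "\<forall>e i j k l. Pp V i (Suc k) ** Xs V e j l -
       smat ((q ^ d i) powi (sgn_e e * a i j)) (Xs V e j l ** Pp V i (Suc k)) =
       smat ((q ^ d i) powi (sgn_e e * a i j)) (Pp V i k ** Xs V e j (l + 1)) - Xs V e j (l + 1) ** Pp V i k"
    and is_rep_PmX: "\<forall>e i j m l. Pm V i m ** Xs V e j l -
       smat ((q ^ d i) powi (sgn_e e * a i j)) (Xs V e j l ** Pm V i m) =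
       smat ((q ^ d i) powi (sgn_e e * a i j)) (Pm V i (Suc m) ** Xs V e j (l + 1)) - Xs V e j (l + 1) ** Pm V i (Suc m)"
    and is_rep_XX: "\<forall>i j k l. Xp V i k ** Xm V j l - Xm V j l ** Xp V i k =
       (if i = j then smat (1 / (q ^ d i - inverse (q ^ d i))) (PsiP V i (k + l) - PsiM V i (k + l)) else 0)"
  using assms unfolding is_rep_def Let_def by - (elim conjE, assumption)+

text \<open>For i = j the relations between \<Psi> and X can be solved for the X mode at l + 1 in
  terms of the mode at l, and conversely. So the modes satisfy a two-sided linear
  recurrence.\<close>

lemma rep_x_exp:
  fixes V :: "('i::finite, 'n::finite) lrep"
  assumes V: "is_rep a d q V" and aii: "a i i = 2" and d: "d i > 0"
    and q: "q \<noteq> 0" "\<And>n::nat. n > 0 \<Longrightarrow> q ^ n \<noteq> 1"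
  shows "\<exists>f. x_exp V e i f"
proof -
  define c where "c = (q ^ d i) powi (sgn_e e * a i i)"
  have c0: "c \<noteq> 0" using q by (simp add: c_def)
  \<comment> \<open>Here c is \<open>q ^ d i\<close> to the power 2 or -2, so
    \<open>c * c = 1\<close> would give \<open>q ^ (4 * d i) = 1\<close>.\<close>
  have c2: "c * c \<noteq> 1"
  proof
    assume "c * c = 1"
    moreover have "c = (q ^ d i) ^ 2 \<or> c = inverse ((q ^ d i) ^ 2)"
      unfolding c_def aii by (cases e) (auto simp: sgn_e_def power_int_minus)
    moreover have "inverse x * inverse x = 1 \<longleftrightarrow> x * x = 1" for x :: complex
      by (metis inverse_1 inverse_inverse_eq inverse_mult_distrib)
    ultimately have "(q ^ d i) ^ 2 * (q ^ d i) ^ 2 = 1" by auto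
    then have "q ^ (4 * d i) = 1" by (simp flip: power_mult power_add)
    then show False using q(2)[of "4 * d i"] d by simp
  qed
  define P0 M0 P1 M1 X where "P0 = Sq (Pp V i 0)" and "M0 = Sq (Pm V i 0)" and "P1 = Sq (Pp V i 1)"
    and "M1 = Sq (Pm V i 1)" and "X k = Sq (Xs V e i k)" for k
  have sm: "Sq (smat x M) = cs x (Sq M)" for x and M :: "'n cmat"
    by (rule mat_of_eqI) (simp add: mat_of_cs)
  have PM: "P0 * M0 = 1" "M0 * P0 = 1"
    unfolding P0_def M0_def Sq_simps(6)[symmetric]
    using is_rep_inverse[OF V] matrix_left_right_inverse[of "Pp V i 0" "Pm V i 0"] by (simp_all add: Sq_simps)
  have r0: "P0 * X k * M0 = cs c (X k)" for k
  proof -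
    have "Pp V i 0 ** Xs V e i k ** Pm V i 0 = smat c (Xs V e i k)"
      unfolding c_def by (rule is_rep_weight[OF V, rule_format])
    then show ?thesis unfolding P0_def M0_def X_def sm[symmetric] Sq_simps(6)[symmetric] by simp
  qed
  have r1: "P1 * X l - cs c (X l * P1) = cs c (P0 * X (l + 1)) - X (l + 1) * P0" for l
  proof -
    have "Pp V i (Suc 0) ** Xs V e i l - smat c (Xs V e i l ** Pp V i (Suc 0)) =
         smat c (Pp V i 0 ** Xs V e i (l + 1)) - Xs V e i (l + 1) ** Pp V i 0"
      unfolding c_def by (rule is_rep_PpX[OF V, rule_format])
    then show ?thesis
      unfolding P0_def P1_def X_def sm[symmetric] Sq_simps(6,4)[symmetric] by simp
  qed
  have r2: "M0 * X l - cs c (X l * M0) = cs c (M1 * X (l + 1)) - X (l + 1) * M1" for l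
  proof -
    have "Pm V i 0 ** Xs V e i l - smat c (Xs V e i l ** Pm V i 0) =
         smat c (Pm V i (Suc 0) ** Xs V e i (l + 1)) - Xs V e i (l + 1) ** Pm V i (Suc 0)"
      unfolding c_def by (rule is_rep_PmX[OF V, rule_format])
    then show ?thesis
      unfolding M0_def M1_def X_def sm[symmetric] Sq_simps(6,4)[symmetric] by simp
  qed
  have PX: "P0 * X k = cs c (X k * P0)" for k
  proof -
    have "P0 * X k = P0 * X k * M0 * P0" by (simp add: mult.assoc PM)
    then show ?thesis by (simp add: r0)
  qed
  have XM: "X k * M0 = cs c (M0 * X k)" for k
  proof -
    have "X k * M0 = M0 * (P0 * X k * M0)" by (simp add: PM flip: mult.assoc)
    then show ?thesis by (simp add: r0)
  qed
  \<comment> \<open>With \<open>PX\<close> the right side of \<open>r1\<close> becomes c^2 - 1 times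
    \<open>X (l + 1) * P0\<close>; \<open>r2\<close> and \<open>XM\<close> give the backward step
    with the factor 1 - c^2.\<close>
  define T where "T Y = cs (1 / (c * c - 1)) ((P1 * Y - cs c (Y * P1)) * M0)" for Y
  define T' where "T' Y = cs (1 / (1 - c * c)) (P0 * (cs c (M1 * Y) - Y * M1))" for Y
  have lT: "linear T" "linear T'"
    unfolding T_def T'_def
    by (rule linearI; simp add: distrib_left distrib_right cs_add_right left_diff_distrib right_diff_distrib
        cs_diff_right scaleR_cs mult_ac)+
  have 1: "X (l + 1) = T (X l)" for l
  proof -
    have "cs (c * c - 1) (X (l + 1)) = (P1 * X l - cs c (X l * P1)) * M0"
      unfolding r1 PX by (simp add: left_diff_distrib mult.assoc PM cs_diff_left)
    then have "T (X l) = cs (1 / (c * c - 1)) (cs (c * c - 1) (X (l + 1)))" unfolding T_def by simp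
    then show ?thesis using c2 by simp
  qed
  have 2: "X l = T' (X (l + 1))" for l
  proof -
    have "P0 * (cs c (M1 * X (l + 1)) - X (l + 1) * M1) = P0 * (M0 * X l - cs c (X l * M0))"
      by (simp only: r2)
    also have "\<dots> = cs (1 - c * c) (X l)"
      unfolding XM by (simp add: right_diff_distrib cs_diff_left PM flip: mult.assoc)
    finally have "T' (X (l + 1)) = cs (1 / (1 - c * c)) (cs (1 - c * c) (X l))" unfolding T'_def by simp
    then show ?thesis using c2 by simp
  qed
  obtain u D where u: "\<exists>k\<le>D. u k \<noteq> (0 :: real)" "\<And>l. (\<Sum>k\<le>D. u k *\<^sub>R X (l + int k)) = 0"
    using commutator_shift_linear[where x = X and T = T and T' = T', OF lT(1) 1 lT(2) 2] by blast
  show ?thesis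
  proof (rule ex_x_exp_of_recurrence)
    show "\<exists>k\<le>D. complex_of_real (u k) \<noteq> 0" using u(1) by simp
    fix a b l
    have "mat_of (\<Sum>k\<le>D. u k *\<^sub>R X (l + int k)) $ a $ b = 0" using u(2) by simp
    then show "(\<Sum>k\<le>D. complex_of_real (u k) * Xs V e i (l + int k) $ a $ b) = 0"
      by (simp add: mat_of_sum scaleR_cs X_def)
  qed
qed

text \<open>Rationality of \<Psi> is inherited from the X current through the commutator with
  \<open>Xm V i 0\<close>.\<close>

lemma rep_good:
  fixes V :: "('i::finite, 'n::finite) lrep"
  assumes V: "is_rep a d q V" and cartan: "finite_cartan a d"
    and q: "q \<noteq> 0" "\<forall>n::nat. n > 0 \<longrightarrow> q ^ n \<noteq> 1"
  shows "good V"
proof -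
  have ad: "a i i = 2" "d i > 0" for i using cartan unfolding finite_cartan_def by auto
  have x: "\<exists>f. x_exp V e i f" for e i by (rule rep_x_exp[OF V ad q(1)]) (use q in auto)
  have "\<exists>f. psi_exp V i f" for i
  proof -
    let ?X = "X_fun V True i" and ?M = "Xm V i 0"
    define \<kappa> where "\<kappa> = q ^ d i - inverse (q ^ d i)"
    have "\<kappa> \<noteq> 0"
    proof
      assume "\<kappa> = 0"
      then have "q ^ d i * q ^ d i = 1" using q(1) by (simp add: \<kappa>_def field_simps)
      then have "q ^ (2 * d i) = 1" by (simp add: mult_2 power_add)
      then show False using q(2) ad(2)[of i] by (metis mult_pos_pos zero_less_numeral)
    qed
    have X: "x_exp V True i ?X" by (rule X_fun_spec[OF x])
    have Xs: "Xs V True = Xp V" by (simp add: Xs_def)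
    \<comment> \<open>The commutator of the mode \<open>Xp V i k\<close> with
      \<open>Xm V i 0\<close> is \<open>PsiP V i k - PsiM V i k\<close> divided by \<kappa>. So the
      commutator with the current is \<Psi> up to a constant, and adding \<open>Pm V i 0\<close>
      corrects the coefficient of index 0 in both expansions.\<close>
    define f where "f z = Pm V i 0 + smat \<kappa> (?X z ** ?M + smat (-1) (?M ** ?X z))" for z
    have comm: "smat \<kappa> (Xp V i k ** ?M + smat (-1) (?M ** Xp V i k)) = PsiP V i k - PsiM V i k" for k
    proof -
      have h: "Xp V i k ** Xm V i 0 - Xm V i 0 ** Xp V i k = smat (1 / \<kappa>) (PsiP V i (k + 0) - PsiM V i (k + 0))"
        using is_rep_XX[OF V, rule_format, of i k i 0] unfolding \<kappa>_def by simp
      have "smat \<kappa> (Xp V i k ** ?M + smat (-1) (?M ** Xp V i k)) = smat \<kappa> (Xp V i k ** Xm V i 0 - Xm V i 0 ** Xp V i k)"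
        by (simp add: vec_eq_iff)
      then show ?thesis unfolding h using \<open>\<kappa> \<noteq> 0\<close> by (simp add: vec_eq_iff)
    qed
    have rX: "ratm ?X" using X unfolding x_exp_iff by blast
    have "mreg (mpoles ?X) f" unfolding f_def
      by (intro mreg_add mreg_const mreg_smat mreg_mult ratm_mpoles(2)[OF rX] rreg_const)
    moreover have "mpser (\<lambda>y. f (1 / y)) (Pp V i)"
    proof (rule mpser_coeff_cong)
      show "mpser (\<lambda>y. f (1 / y)) (\<lambda>r. (if r = 0 then Pm V i 0 else 0) +
          smat \<kappa> (Xp V i (int r) ** ?M + smat (-1) (?M ** Xp V i (int r))))"
        unfolding f_def
        by (intro mpser_add mpser_const mpser_smat mpser_mult_const_left mpser_mult_const_right)
           (use X in \<open>simp_all add: x_exp_iff Xs cong: if_cong\<close>)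
      show "Pp V i r = (if r = 0 then Pm V i 0 else 0) +
          smat \<kappa> (Xp V i (int r) ** ?M + smat (-1) (?M ** Xp V i (int r)))" for r
        unfolding comm by (simp add: PsiP_def PsiM_def)
    qed
    moreover have "mpser f (Pm V i)"
    proof (rule mpser_coeff_cong)
      let ?c = "\<lambda>r. if r = 0 then 0 else - Xp V i (- int r)"
      show "mpser f (\<lambda>r. (if r = 0 then Pm V i 0 else 0) +
          smat \<kappa> (?c r ** ?M + smat (-1) (?M ** ?c r)))"
        unfolding f_def
        by (intro mpser_add mpser_const mpser_smat mpser_mult_const_left mpser_mult_const_right)
           (use X in \<open>simp_all add: x_exp_iff Xs cong: if_cong\<close>)
      show "Pm V i r = (if r = 0 then Pm V i 0 else 0) + smat \<kappa> (?c r ** ?M + smat (-1) (?M ** ?c r))" for r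
      proof (cases "r = 0")
        case True
        then show ?thesis by (simp add: vec_eq_iff cmat_nth_mult)
      next
        case False
        have "smat \<kappa> (?c r ** ?M + smat (-1) (?M ** ?c r))
          = - smat \<kappa> (Xp V i (- int r) ** ?M + smat (-1) (?M ** Xp V i (- int r)))"
          using False by (simp add: vec_eq_iff cmat_nth_mult sum_negf algebra_simps)
        then show ?thesis unfolding comm using False by (simp add: PsiP_def PsiM_def)
      qed
    qed
    ultimately have "psi_exp V i (Psi_fun V i)"
      by (intro psi_exp_of_mreg(1)[of "mpoles ?X"] ratm_mpoles(1)[OF rX])
    then show ?thesis by blast
  qed
  then show ?thesis using is_rep_comm[OF V] is_rep_inverse[OF V] x unfolding good_def by simp
qed

section \<open>Contours separating finite sets\<close>

text \<open>The points of S are enclosed one at a time by lassos from a base point p: out along a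
  path in the complement, once round a small circle, and back. The two long stretches cancel in the
  winding number, and winding numbers of joined loops add.\<close>

lemma sep_contour_exists:
  assumes fin: "finite S" "finite T" and disj: "S \<inter> (T \<union> {0}) = {}"
  shows "\<exists>\<gamma>. sep_contour S T \<gamma>"
proof -
  define P where "P = S \<union> T \<union> {0 :: complex}"
  have P: "finite P" using fin by (simp add: P_def)
  obtain p where p: "p \<notin> P" using infinite_compl_finite[OF P]
    by (metis ComplD finite.emptyI subsetI subset_empty)
  have con: "connected (- P)" "open (- P)"
    using connected_open_delete_finite[of "UNIV :: complex set" P] P finite_imp_closed[OF P]
    by (simp_all add: Compl_eq_Diff_UNIV connected_UNIV open_Compl[unfolded Compl_eq_Diff_UNIV])
  have "\<exists>\<gamma>. valid_path \<gamma> \<and> pathstart \<gamma> = p \<and> pathfinish \<gamma> = p \<and> path_image \<gamma> \<inter> P = {} \<and>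
      (\<forall>z\<in>P. winding_number \<gamma> z = (if z \<in> S' then 1 else 0))" if "finite S'" "S' \<subseteq> S" for S'
    using that
  proof (induction S' rule: finite_induct)
    case empty
    have "path_image (linepath p p) \<inter> P = {}" using p by simp
    moreover have "\<forall>z\<in>P. winding_number (linepath p p) z = 0"
      by (intro ballI winding_number_trivial) (use p in auto)
    ultimately show ?case unfolding empty_iff if_False
      using valid_path_linepath pathstart_linepath pathfinish_linepath by blast
  next
    case (insert s S')
    then obtain \<gamma> where \<gamma>: "valid_path \<gamma>" "pathstart \<gamma> = p" "pathfinish \<gamma> = p" "path_image \<gamma> \<inter> P = {}"
      "\<forall>z\<in>P. winding_number \<gamma> z = (if z \<in> S' then 1 else 0)" by auto
    have sP: "s \<in> P" using insert.prems by (auto simp: P_def)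
    have "\<not> s islimpt P" using P by (rule islimpt_finite)
    then obtain e where e: "e > 0" "\<And>z. z \<in> P \<Longrightarrow> z \<noteq> s \<Longrightarrow> e \<le> dist z s"
      unfolding islimpt_approachable by (metis linorder_not_le)
    define r where "r = e / 2"
    have r: "r > 0" "r < e" using e by (auto simp: r_def)
    have cP: "path_image (circlepath s r) \<inter> P = {}"
    proof -
      have "z \<notin> P" if "z \<in> sphere s r" for z
        using that e(2)[of z] r by (auto simp: dist_commute)
      then show ?thesis using r by auto
    qed
    have "pathstart (circlepath s r) \<in> - P"
      using cP pathstart_in_path_image by blast
    then obtain g where g: "polynomial_function g" "path_image g \<subseteq> - P" "pathstart g = p"
      "pathfinish g = pathstart (circlepath s r)"
      using connected_open_polynomial_connected[OF con(2,1), of p] p by auto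
    have vg: "valid_path g" using g(1) by (rule valid_path_polynomial_function)
    define L where "L = g +++ (circlepath s r +++ reversepath g)"
    have vL: "valid_path L" unfolding L_def using vg g
      by (intro valid_path_join valid_path_circlepath) auto
    have L: "pathstart L = p" "pathfinish L = p" using g by (auto simp: L_def)
    have iL: "path_image L \<inter> P = {}"
    proof -
      have "path_image L \<subseteq> path_image g \<union> (path_image (circlepath s r) \<union> path_image g)"
        unfolding L_def
        using path_image_join_subset[of g "circlepath s r +++ reversepath g"]
          path_image_join_subset[of "circlepath s r" "reversepath g"]
        unfolding path_image_reversepath by blast
      then show ?thesis using g(2) cP by blast
    qed
    have wL: "winding_number L z = (if z = s then 1 else 0)" if z: "z \<in> P" for z
    proof -
      have zg: "z \<notin> path_image g" and zc: "z \<notin> path_image (circlepath s r)" using z g(2) cP by auto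
      have "winding_number L z = winding_number g z + (winding_number (circlepath s r) z + winding_number (reversepath g) z)"
        unfolding L_def using zg zc vg g
        by (subst winding_number_join; simp add: valid_path_imp_path not_in_path_image_join winding_number_join)
      also have "winding_number (reversepath g) z = - winding_number g z"
        using zg vg by (intro winding_number_reversepath) (auto simp: valid_path_imp_path)
      also have "winding_number (circlepath s r) z = (if z = s then 1 else 0)"
      proof (cases "z = s")
        case True
        then show ?thesis using r by (simp add: winding_number_circlepath)
      next
        case False
        have "z \<notin> cball s r" using e(2)[OF z False] r by (auto simp: dist_commute)
        then show ?thesis using False
          using winding_number_zero_outside[of "circlepath s r" "cball s r" z] r by auto
      qed
      finally show ?thesis by simp
    qed
    show ?case
    proof (intro exI[of _ "\<gamma> +++ L"] conjI ballI)
      show "valid_path (\<gamma> +++ L)" using \<gamma> vL L by (intro valid_path_join) auto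
      show "pathstart (\<gamma> +++ L) = p" "pathfinish (\<gamma> +++ L) = p" using \<gamma> L by auto
      show "path_image (\<gamma> +++ L) \<inter> P = {}"
        using path_image_join_subset[of \<gamma> L] \<gamma>(4) iL by blast
      fix z assume z: "z \<in> P"
      have "winding_number (\<gamma> +++ L) z = winding_number \<gamma> z + winding_number L z"
        by (rule winding_number_join) (use \<gamma> vL L iL z in \<open>auto simp: valid_path_imp_path\<close>)
      then show "winding_number (\<gamma> +++ L) z = (if z \<in> insert s S' then 1 else 0)"
        using \<gamma>(5) wL z insert.hyps by auto
    qed
  qed
  from this[OF fin(1) order_refl] obtain \<gamma> where "valid_path \<gamma>" "pathstart \<gamma> = p" "pathfinish \<gamma> = p"
      "path_image \<gamma> \<inter> P = {}" "\<forall>z\<in>P. winding_number \<gamma> z = (if z \<in> S then 1 else 0)" by blast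
  then show ?thesis
    by (intro exI[of _ \<gamma>]) (use disj in \<open>auto simp: sep_contour_def P_def\<close>)
qed

section \<open>Recurrences for contour moments\<close>

lemma poly_split_roots:
  fixes r :: "complex poly"
  assumes "r \<noteq> 0" "finite S"
  shows "\<exists>U r'. U \<noteq> 0 \<and> r = U * r' \<and> (\<forall>s\<in>S. poly r' s \<noteq> 0)"
  using assms(2)
proof (induction S rule: finite_induct)
  case empty
  show ?case by (rule exI[of _ 1]) auto
next
  case (insert s S)
  then obtain U r' where h: "U \<noteq> 0" "r = U * r'" "\<forall>s\<in>S. poly r' s \<noteq> 0" by blast
  then have r': "r' \<noteq> 0" using assms(1) by auto
  obtain r'' where r'': "r' = [:- s, 1:] ^ order s r' * r''" "\<not> [:- s, 1:] dvd r''"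
    using order_decomp[OF r'] by blast
  show ?case
  proof (rule exI[of _ "U * [:- s, 1:] ^ order s r'"], rule exI[of _ r''], intro conjI ballI)
    show "U * [:- s, 1:] ^ order s r' \<noteq> 0" using h by simp
    show "r = U * [:- s, 1:] ^ order s r' * r''" using h r''(1) by (metis mult.assoc)
    fix t assume "t \<in> insert s S"
    then show "poly r'' t \<noteq> 0"
    proof
      assume "t = s"
      then show ?thesis using r''(2) by (simp add: poly_eq_0_iff_dvd)
    next
      assume "t \<in> S"
      then have "poly r' t \<noteq> 0" using h by blast
      then show ?thesis using r''(1) by (metis mult_zero_right poly_mult)
    qed
  qed
qed

text \<open>Multiplying the integrand by the factor U of the denominator that carries its roots in S
  removes every singularity round which the contour winds, so the integral vanishes by Cauchy;
  expanding U gives the recurrence.\<close>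

lemma contour_moments_recurrence:
  assumes fin: "finite S" "finite T" and \<gamma>: "sep_contour S T \<gamma>" and G: "rreg (S \<union> T) G"
  shows "\<exists>D u. (\<exists>j\<le>D. u j \<noteq> (0 :: complex)) \<and>
    (\<forall>k. (\<Sum>j\<le>D. u j * contour_integral \<gamma> (\<lambda>w. w powi (k + int j - 1) * G w)) = 0)"
proof -
  obtain p r where h: "r \<noteq> 0" "\<And>z. z \<notin> S \<union> T \<Longrightarrow> poly r z \<noteq> 0 \<and> G z = poly p z / poly r z"
    using G unfolding rreg_def by blast
  obtain U r' where U: "U \<noteq> 0" "r = U * r'" "\<And>s. s \<in> S \<Longrightarrow> poly r' s \<noteq> 0"
    using poly_split_roots[OF h(1) fin(1)] by blast
  have v: "valid_path \<gamma>" "pathfinish \<gamma> = pathstart \<gamma>" "path_image \<gamma> \<inter> (S \<union> T \<union> {0}) = {}"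
    "\<And>t. t \<in> T \<union> {0} \<Longrightarrow> winding_number \<gamma> t = 0"
    using \<gamma> unfolding sep_contour_def by blast+
  have r'0: "poly r' z \<noteq> 0" if "z \<notin> T" for z
    using U(2,3) h(2)[of z] that by (cases "z \<in> S") auto
  show ?thesis
  proof (rule exI[of _ "degree U"], rule exI[of _ "coeff U"], intro conjI allI)
    show "\<exists>j\<le>degree U. coeff U j \<noteq> 0" using U(1) by (intro exI[of _ "degree U"]) auto
    fix k
    let ?\<Omega> = "- (S \<union> T \<union> {0})"
    have op: "open ?\<Omega>" using fin by (intro open_Compl finite_imp_closed) auto
    have int: "(\<lambda>w. w powi n * G w) contour_integrable_on \<gamma>" for n
    proof (rule contour_integrable_holomorphic_simple[OF _ op v(1)])
      show "(\<lambda>w. w powi n * G w) holomorphic_on ?\<Omega>"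
        by (intro holomorphic_intros holomorphic_on_subset[OF rreg_holomorphic[OF G]]) (use fin in auto)
    qed (use v(3) in blast)
    have "(\<Sum>j\<le>degree U. coeff U j * contour_integral \<gamma> (\<lambda>w. w powi (k + int j - 1) * G w))
        = contour_integral \<gamma> (\<lambda>w. \<Sum>j\<le>degree U. coeff U j * (w powi (k + int j - 1) * G w))"
      by (subst contour_integral_sum) (auto intro!: contour_integrable_lmul int simp: contour_integral_lmul[OF int])
    also have "\<dots> = contour_integral \<gamma> (\<lambda>w. w powi (k - 1) * (poly p w / poly r' w))"
    proof (rule contour_integral_eq)
      fix w assume "w \<in> path_image \<gamma>"
      then have w: "w \<notin> S \<union> T" "w \<noteq> 0" using v(3) by auto
      have "(\<Sum>j\<le>degree U. coeff U j * (w powi (k + int j - 1) * G w)) = w powi (k - 1) * (poly U w * G w)"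
        unfolding poly_altdef sum_distrib_right sum_distrib_left
      proof (rule sum.cong[OF refl])
        fix j
        have "w powi (k + int j - 1) = w powi (k - 1) * w ^ j"
          using w(2) power_int_add[of w "k - 1" "int j"] by (simp add: algebra_simps)
        then show "coeff U j * (w powi (k + int j - 1) * G w) = w powi (k - 1) * (coeff U j * w ^ j * G w)"
          by simp
      qed
      also have "poly U w * G w = poly p w / poly r' w"
        using h(2)[OF w(1)] U(2) by auto
      finally show "(\<Sum>j\<le>degree U. coeff U j * (w powi (k + int j - 1) * G w)) = w powi (k - 1) * (poly p w / poly r' w)" .
    qed
    also have "\<dots> = 0"
    proof (rule contour_integral_unique, rule Cauchy_theorem_global)
      show "open (- (T \<union> {0}))" using fin by (intro open_Compl finite_imp_closed) auto
      show "(\<lambda>w. w powi (k - 1) * (poly p w / poly r' w)) holomorphic_on - (T \<union> {0})"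
        by (intro holomorphic_intros) (use r'0 in auto)
      show "path_image \<gamma> \<subseteq> - (T \<union> {0})" using v(3) by blast
    qed (use v in auto)
    finally show "(\<Sum>j\<le>degree U. coeff U j * contour_integral \<gamma> (\<lambda>w. w powi (k + int j - 1) * G w)) = 0" .
  qed
qed

section \<open>Spectral shifts and Drinfeld tensor products\<close>

text \<open>The shape required of X currents, freed from modules. It survives sums, rescaling and
  tensoring with constants and holds for contour moments, and these are the ingredients of the X
  operators of a Drinfeld tensor product.\<close>

definition mbil :: "(int \<Rightarrow> 'n::finite cmat) \<Rightarrow> bool" where
  "mbil x \<longleftrightarrow> (\<exists>B f. finite B \<and> mreg B f \<and> mpser (\<lambda>y. f (1 / y)) (\<lambda>r. x (int r)) \<and>
     mpser f (\<lambda>r. if r = 0 then 0 else - x (- int r)))"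

lemma x_exp_mbil: "x_exp V e i f \<Longrightarrow> mbil (Xs V e i)"
  unfolding x_exp_iff mbil_def using ratm_mpoles by blast

lemma mbil_x_exp: "mbil (Xs V e i) \<Longrightarrow> \<exists>f. x_exp V e i f"
  unfolding mbil_def by (elim exE conjE) (rule ex_x_exp_of_mreg)

lemma mbil_add:
  assumes "mbil x" "mbil y"
  shows "mbil (\<lambda>k. x k + y k)"
proof -
  obtain B f where f: "finite B" "mreg B f" "mpser (\<lambda>y. f (1 / y)) (\<lambda>r. x (int r))"
     "mpser f (\<lambda>r. if r = 0 then 0 else - x (- int r))" using assms(1) unfolding mbil_def by blast
  obtain C g where g: "finite C" "mreg C g" "mpser (\<lambda>z. g (1 / z)) (\<lambda>r. y (int r))"
     "mpser g (\<lambda>r. if r = 0 then 0 else - y (- int r))" using assms(2) unfolding mbil_def by blast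
  have "mreg (B \<union> C) (\<lambda>z. f z + g z)"
    by (intro mreg_add mreg_mono[OF f(2)] mreg_mono[OF g(2)]) auto
  moreover have "mpser (\<lambda>z. f z + g z) (\<lambda>r. if r = 0 then 0 else - (x (- int r) + y (- int r)))"
    by (rule mpser_coeff_cong[OF mpser_add[OF f(4) g(4)]]) auto
  ultimately show ?thesis unfolding mbil_def
    by (intro exI[of _ "B \<union> C"] exI[of _ "\<lambda>z. f z + g z"]) (use f g mpser_add[OF f(3) g(3)] in auto)
qed

lemma mpser_scale: "mpser f A \<Longrightarrow> \<alpha> \<noteq> 0 \<Longrightarrow> mpser (\<lambda>z. f (\<alpha> * z)) (\<lambda>r. smat (\<alpha> ^ r) (A r))"
  unfolding mpser_def using pser_scale by fastforce

lemma mreg_scale: "mreg B f \<Longrightarrow> \<alpha> \<noteq> 0 \<Longrightarrow> mreg {z. \<alpha> * z \<in> B} (\<lambda>z. f (\<alpha> * z))"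
  unfolding mreg_def using rreg_scale by blast

lemma mreg_scale_divide:
  assumes "mreg B f" "\<alpha> \<noteq> 0"
  shows "mreg ((\<lambda>s. \<alpha> * s) ` B) (\<lambda>z. f (z / \<alpha>))"
proof -
  have "mreg {z. (1 / \<alpha>) * z \<in> B} (\<lambda>z. f ((1 / \<alpha>) * z))" using assms by (intro mreg_scale) auto
  moreover have "{z. (1 / \<alpha>) * z \<in> B} \<subseteq> (\<lambda>s. \<alpha> * s) ` B"
  proof
    fix z assume "z \<in> {z. (1 / \<alpha>) * z \<in> B}"
    then have "z / \<alpha> \<in> B" "z = \<alpha> * (z / \<alpha>)" using assms by auto
    then show "z \<in> (\<lambda>s. \<alpha> * s) ` B" by blast
  qed
  ultimately show ?thesis using mreg_mono by fastforce
qed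

lemma mpser_scale_divide:
  assumes "mpser f A" "\<alpha> \<noteq> 0"
  shows "mpser (\<lambda>z. f (z / \<alpha>)) (\<lambda>r. smat (\<alpha> powi (- int r)) (A r))"
proof -
  have "mpser (\<lambda>z. f ((1 / \<alpha>) * z)) (\<lambda>r. smat ((1 / \<alpha>) ^ r) (A r))"
    using assms by (intro mpser_scale) auto
  moreover have "(1 / \<alpha>) ^ r = \<alpha> powi (- int r)" for r
    by (simp add: power_int_minus power_one_over inverse_eq_divide)
  ultimately show ?thesis by simp
qed

lemma mpser_inf_scale_divide:
  assumes "mpser (\<lambda>y. f (1 / y)) A" "\<alpha> \<noteq> 0"
  shows "mpser (\<lambda>y. f (1 / y / \<alpha>)) (\<lambda>r. smat (\<alpha> ^ r) (A r))"
  using mpser_scale[OF assms] by (simp add: mult.commute)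

lemma mbil_scale:
  assumes "mbil x" "\<alpha> \<noteq> 0"
  shows "mbil (\<lambda>k. smat (\<alpha> powi k) (x k))"
proof -
  obtain B f where f: "finite B" "mreg B f" "mpser (\<lambda>y. f (1 / y)) (\<lambda>r. x (int r))"
     "mpser f (\<lambda>r. if r = 0 then 0 else - x (- int r))" using assms(1) unfolding mbil_def by blast
  show ?thesis unfolding mbil_def
  proof (intro exI conjI)
    show "mreg ((\<lambda>s. \<alpha> * s) ` B) (\<lambda>z. f (z / \<alpha>))" by (rule mreg_scale_divide[OF f(2) assms(2)])
    show "finite ((\<lambda>s. \<alpha> * s) ` B)" using f by simp
    show "mpser (\<lambda>y. f (1 / y / \<alpha>)) (\<lambda>r. smat (\<alpha> powi int r) (x (int r)))"
      using mpser_inf_scale_divide[OF f(3) assms(2)] by simp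
    show "mpser (\<lambda>z. f (z / \<alpha>)) (\<lambda>r. if r = 0 then 0 else - smat (\<alpha> powi - int r) (x (- int r)))"
      by (rule mpser_coeff_cong[OF mpser_scale_divide[OF f(4) assms(2)]]) (auto simp: vec_eq_iff)
  qed
qed

lemma pser_kron_const:
  assumes "mpser f A"
  shows mpser_kron_const_right: "mpser (\<lambda>z. kron (f z) M) (\<lambda>r. kron (A r) M)"
    and mpser_kron_const_left: "mpser (\<lambda>z. kron M (f z)) (\<lambda>r. kron M (A r))"
  using assms unfolding mpser_def kron_nth
  by (auto intro!: pser_cmult simp: mult.commute[of _ "M $ _ $ _"])

lemma mbil_kron_const:
  assumes "mbil x"
  shows "mbil (\<lambda>k. kron (x k) M)" "mbil (\<lambda>k. kron M (x k))"
proof -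
  obtain B f where f: "finite B" "mreg B f" "mpser (\<lambda>y. f (1 / y)) (\<lambda>r. x (int r))"
     "mpser f (\<lambda>r. if r = 0 then 0 else - x (- int r))" using assms(1) unfolding mbil_def by blast
  show "mbil (\<lambda>k. kron (x k) M)" unfolding mbil_def
  proof (intro exI conjI)
    show "mreg B (\<lambda>z. kron (f z) M)" by (intro mreg_kron f mreg_const)
    show "mpser (\<lambda>y. kron (f (1 / y)) M) (\<lambda>r. kron (x (int r)) M)" by (intro mpser_kron_const_right f)
    show "mpser (\<lambda>z. kron (f z) M) (\<lambda>r. if r = 0 then 0 else - kron (x (- int r)) M)"
      by (rule mpser_coeff_cong[OF mpser_kron_const_right[OF f(4)]]) (auto simp: vec_eq_iff kron_nth)
  qed (rule f)
  show "mbil (\<lambda>k. kron M (x k))" unfolding mbil_def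
  proof (intro exI conjI)
    show "mreg B (\<lambda>z. kron M (f z))" by (intro mreg_kron f mreg_const)
    show "mpser (\<lambda>y. kron M (f (1 / y))) (\<lambda>r. kron M (x (int r)))" by (intro mpser_kron_const_left f)
    show "mpser (\<lambda>z. kron M (f z)) (\<lambda>r. if r = 0 then 0 else - kron M (x (- int r)))"
      by (rule mpser_coeff_cong[OF mpser_kron_const_left[OF f(4)]]) (auto simp: vec_eq_iff kron_nth)
  qed (rule f)
qed

lemma mbil_entries:
  assumes "\<And>a b. \<exists>B f. finite B \<and> rreg B f \<and> pser (\<lambda>y. f (1 / y)) (\<lambda>r. x (int r) $ a $ b) \<and>
     pser f (\<lambda>r. if r = 0 then 0 else - x (- int r) $ a $ b)"
  shows "mbil (x :: int \<Rightarrow> 'n::finite cmat)"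
proof -
  define Q where "Q a b B f \<longleftrightarrow> finite B \<and> rreg B f \<and> pser (\<lambda>y. f (1 / y)) (\<lambda>r. x (int r) $ a $ b) \<and>
     pser f (\<lambda>r. if r = 0 then 0 else - x (- int r) $ a $ b)" for a b B f
  have "\<exists>B f. Q a b B f" for a b
    unfolding Q_def by (rule assms)
  then obtain B f where "\<And>a b. Q a b (B a b) (f a b)" by metis
  then have Bf: "\<And>a b. finite (B a b)" "\<And>a b. rreg (B a b) (f a b)"
    "\<And>a b. pser (\<lambda>y. f a b (1 / y)) (\<lambda>r. x (int r) $ a $ b)"
    "\<And>a b. pser (f a b) (\<lambda>r. if r = 0 then 0 else - x (- int r) $ a $ b)"
    unfolding Q_def by blast+
  define B' where "B' = (\<Union>a. \<Union>b. B a b)"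
  have e: "(\<lambda>r. (if r = 0 then 0 else - x (- int r)) $ a $ b)
        = (\<lambda>r. if r = 0 then 0 else - x (- int r) $ a $ b)" for a b by auto
  show ?thesis unfolding mbil_def
  proof (intro exI conjI)
    show "mreg B' (\<lambda>z. \<chi> a b. f a b z)"
      unfolding mreg_def B'_def using Bf(2) by (auto intro: rreg_mono)
    show "finite B'" unfolding B'_def using Bf(1) by auto
    show "mpser (\<lambda>y. \<chi> a b. f a b (1 / y)) (\<lambda>r. x (int r))"
      unfolding mpser_def using Bf(3) by simp
    show "mpser (\<lambda>z. \<chi> a b. f a b z) (\<lambda>r. if r = 0 then 0 else - x (- int r))"
      unfolding mpser_def e using Bf(4) by simp
  qed
qed

lemma mbil_moint:
  assumes fin: "finite S" "finite T" and \<gamma>: "sep_contour S T \<gamma>" and G: "mreg (S \<union> T) G"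
  shows "mbil (\<lambda>k. moint \<gamma> (\<lambda>w. smat (w powi (k - 1)) (G w)))"
proof (rule mbil_entries)
  fix a b
  let ?c = "1 / (2 * pi * \<i>)"
  let ?x = "\<lambda>k. ?c * contour_integral \<gamma> (\<lambda>w. w powi (k - 1) * G w $ a $ b)"
  have "rreg (S \<union> T) (\<lambda>w. G w $ a $ b)" using G unfolding mreg_def by blast
  from contour_moments_recurrence[OF fin \<gamma> this] obtain D u where u: "\<exists>j\<le>D. u j \<noteq> (0 :: complex)"
    "\<And>k. (\<Sum>j\<le>D. u j * contour_integral \<gamma> (\<lambda>w. w powi (k + int j - 1) * G w $ a $ b)) = 0" by blast
  have "(\<Sum>j\<le>D. u j * ?x (k + int j)) = ?c * (\<Sum>j\<le>D. u j * contour_integral \<gamma> (\<lambda>w. w powi (k + int j - 1) * G w $ a $ b))" for k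
    by (simp add: sum_distrib_left mult_ac)
  then have "(\<Sum>j\<le>D. u j * ?x (k + int j)) = 0" for k using u(2) by simp
  moreover have e: "moint \<gamma> (\<lambda>w. smat (w powi (k - 1)) (G w)) $ a $ b = ?x k" for k
    by (simp add: moint_def mcint_def)
  ultimately have "(\<Sum>j\<le>D. u j * moint \<gamma> (\<lambda>w. smat (w powi (k + int j - 1)) (G w)) $ a $ b) = 0" for k
    by (simp only: e)
  from bilateral_recurrence[OF this u(1)]
  show "\<exists>B f. finite B \<and> rreg B f \<and>
      pser (\<lambda>y. f (1 / y)) (\<lambda>r. moint \<gamma> (\<lambda>w. smat (w powi (int r - 1)) (G w)) $ a $ b) \<and>
      pser f (\<lambda>r. if r = 0 then 0 else - moint \<gamma> (\<lambda>w. smat (w powi (- int r - 1)) (G w)) $ a $ b)"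
    by simp
qed

text \<open>Rescaling modes by powers of \<alpha> is the substitution of z / \<alpha> for z in every
  current.\<close>

lemma good_shift:
  fixes V :: "('i::finite, 'n::finite) lrep"
  assumes V: "good V" and \<alpha>: "\<alpha> \<noteq> 0"
  shows "good (shift \<alpha> V)"
    and "z \<notin> (\<lambda>s. \<alpha> * s) ` spec V \<Longrightarrow> Psi_fun (shift \<alpha> V) i z = Psi_fun V i (z / \<alpha>)"
proof -
  let ?W = "shift \<alpha> V"
  have sc: "smat x M ** smat y N = smat y N ** smat x M" if "M ** N = N ** M" for x y and M N :: "'n cmat"
  proof -
    have "smat x M ** smat y N = smat (x * y) (M ** N)" for x y and M N :: "'n cmat"
      by (simp add: vec_eq_iff cmat_nth_mult sum_distrib_left mult_ac)
    then show ?thesis using that by (simp add: mult.commute[of x])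
  qed
  note psi = psi_exp_of_mreg[where V = ?W and B = "(\<lambda>s. \<alpha> * s) ` spec V" and f = "\<lambda>z. Psi_fun V i (z / \<alpha>)" for i]
  have m: "mreg ((\<lambda>s. \<alpha> * s) ` spec V) (\<lambda>z. Psi_fun V i (z / \<alpha>))" for i
    by (rule mreg_scale_divide[OF mreg_Psi[OF V] \<alpha>])
  have fin: "finite ((\<lambda>s. \<alpha> * s) ` spec V)" using finite_spec[OF V] by simp
  have inf: "mpser (\<lambda>y. Psi_fun V i (1 / y / \<alpha>)) (Pp ?W i)" for i
    using mpser_inf_scale_divide[OF good_Psi_inf[OF V, of i] \<alpha>] by (simp add: shift_def)
  have zero: "mpser (\<lambda>z. Psi_fun V i (z / \<alpha>)) (Pm ?W i)" for i
    using mpser_scale_divide[OF good_Psi_0[OF V, of i] \<alpha>] by (simp add: shift_def)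
  have "\<exists>f. psi_exp ?W i f" for i using psi(1)[OF m fin inf zero] by blast
  moreover have "\<exists>f. x_exp ?W e i f" for e i
  proof (rule mbil_x_exp)
    have "mbil (\<lambda>k. smat (\<alpha> powi k) (Xs V e i k))"
      by (rule mbil_scale[OF x_exp_mbil[OF good_x[OF V]] \<alpha>])
    moreover have "Xs ?W e i = (\<lambda>k. smat (\<alpha> powi k) (Xs V e i k))"
      by (auto simp: Xs_def shift_def)
    ultimately show "mbil (Xs ?W e i)" by simp
  qed
  moreover have "Pp ?W i 0 ** Pm ?W i 0 = mat 1" for i
  proof -
    have "smat 1 M = M" for M :: "'n cmat" by (simp add: vec_eq_iff)
    then show ?thesis using good_Pp0(1)[OF V] by (simp add: shift_def)
  qed
  moreover have "\<forall>i j r s. Pp ?W i r ** Pp ?W j s = Pp ?W j s ** Pp ?W i r \<and>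
               Pp ?W i r ** Pm ?W j s = Pm ?W j s ** Pp ?W i r \<and>
               Pm ?W i r ** Pm ?W j s = Pm ?W j s ** Pm ?W i r"
  proof -
    have cV: "\<forall>i j r s. Pp V i r ** Pp V j s = Pp V j s ** Pp V i r \<and>
               Pp V i r ** Pm V j s = Pm V j s ** Pp V i r \<and>
               Pm V i r ** Pm V j s = Pm V j s ** Pm V i r" using V unfolding good_def by blast
    show ?thesis unfolding shift_def lrep.simps
      by (intro allI conjI; rule sc; use cV in blast)
  qed
  ultimately show "good ?W" unfolding good_def by simp
  show "Psi_fun ?W i z = Psi_fun V i (z / \<alpha>)" if "z \<notin> (\<lambda>s. \<alpha> * s) ` spec V"
    by (rule psi(2)[OF m fin inf zero that])
qed

lemma mpser_kron:
  assumes "mpser f A" "mpser g B"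
  shows "mpser (\<lambda>z. kron (f z) (g z)) (\<lambda>m. \<Sum>p\<le>m. kron (A p) (B (m - p)))"
  using assms unfolding mpser_def by (auto simp: kron_nth intro!: pser_mult)

text \<open>The \<Psi> coefficients are Cauchy products, so their current is the Kronecker product
  of the two currents. Each X operator is a mode tensored with the identity plus a contour moment,
  both covered by \<open>mbil\<close>.\<close>

lemma good_dtensor:
  fixes V :: "('i::finite, 'n::finite) lrep" and W :: "('i, 'm::finite) lrep"
  assumes V: "good V" and W: "good W" and \<zeta>: "\<zeta> \<noteq> 0"
    and disj: "(\<lambda>s. \<zeta> * s) ` spec V \<inter> spec W = {}"
  shows "good (dtensor \<zeta> V W)"
    and "z \<notin> (\<lambda>s. \<zeta> * s) ` spec V \<union> spec W \<Longrightarrow>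
      Psi_fun (dtensor \<zeta> V W) i z = kron (Psi_fun V i (z / \<zeta>)) (Psi_fun W i z)"
proof -
  let ?D = "dtensor \<zeta> V W" and ?S = "(\<lambda>s. \<zeta> * s) ` spec V"
  have fin: "finite ?S" "finite (spec W)" using finite_spec[OF V] finite_spec[OF W] by auto
  have 0: "0 \<notin> ?S" "0 \<notin> spec W" using zero_notin_spec[OF V] zero_notin_spec[OF W] \<zeta> by auto
  have d1: "?S \<inter> (spec W \<union> {0}) = {}" and d2: "spec W \<inter> (?S \<union> {0}) = {}"
  proof -
    have gen: "A \<inter> B = {} \<Longrightarrow> 0 \<notin> A \<Longrightarrow> A \<inter> (B \<union> {0}) = {}" for A B :: "complex set" by blast
    show "?S \<inter> (spec W \<union> {0}) = {}" by (rule gen[OF disj 0(1)])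
    show "spec W \<inter> (?S \<union> {0}) = {}" by (rule gen[OF _ 0(2)]) (subst Int_commute, rule disj)
  qed
  \<comment> \<open>Disjointness of the two singular sets and the absence of 0 from both provide
    contours, so the choices made in \<open>dtensor\<close> have the intended property.\<close>
  define C1 where "C1 = (SOME \<gamma>. sep_contour ?S (spec W) \<gamma>)"
  define C2 where "C2 = (SOME \<gamma>. sep_contour (spec W) ?S \<gamma>)"
  have C1: "sep_contour ?S (spec W) C1"
    unfolding C1_def by (rule someI_ex[where P = "sep_contour ?S (spec W)", OF sep_contour_exists[OF fin d1]])
  have C2: "sep_contour (spec W) ?S C2"
    unfolding C2_def by (rule someI_ex[where P = "sep_contour (spec W) ?S", OF sep_contour_exists[OF fin(2,1) d2]])
  have Pp: "Pp ?D = (\<lambda>i m. \<Sum>p\<le>m. smat (\<zeta> ^ p) (kron (Pp V i p) (Pp W i (m - p))))"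
    and Pm: "Pm ?D = (\<lambda>i m. \<Sum>p\<le>m. smat (\<zeta> powi (- int p)) (kron (Pm V i p) (Pm W i (m - p))))"
    and Xp: "Xp ?D = (\<lambda>i k. smat (\<zeta> powi k) (kron (Xp V i k) (mat 1)) +
                 moint C2 (\<lambda>w. smat (w powi (k - 1)) (kron (Psi_fun V i (w / \<zeta>)) (X_fun W True i w))))"
    and Xm: "Xm ?D = (\<lambda>i k. moint C1 (\<lambda>w. smat (w powi (k - 1))
                    (kron (X_fun V False i (w / \<zeta>)) (Psi_fun W i w))) + kron (mat 1) (Xm W i k))"
    unfolding dtensor_def C1_def C2_def Let_def by simp_all
  have sk: "kron (smat c A) B = smat c (kron A B)" for c and A :: "'n cmat" and B :: "'m cmat"
    by (simp add: vec_eq_iff kron_nth)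
  have m: "mreg (?S \<union> spec W) (\<lambda>z. kron (Psi_fun V i (z / \<zeta>)) (Psi_fun W i z))" for i
    by (intro mreg_kron mreg_mono[OF mreg_scale_divide[OF mreg_Psi[OF V] \<zeta>]] mreg_mono[OF mreg_Psi[OF W]]) auto
  have inf: "mpser (\<lambda>y. kron (Psi_fun V i (1 / y / \<zeta>)) (Psi_fun W i (1 / y))) (Pp ?D i)" for i
    using mpser_kron[OF mpser_inf_scale_divide[OF good_Psi_inf[OF V, of i] \<zeta>] good_Psi_inf[OF W, of i]]
    unfolding Pp sk .
  have zero: "mpser (\<lambda>z. kron (Psi_fun V i (z / \<zeta>)) (Psi_fun W i z)) (Pm ?D i)" for i
    using mpser_kron[OF mpser_scale_divide[OF good_Psi_0[OF V, of i] \<zeta>] good_Psi_0[OF W, of i]]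
    unfolding Pm sk .
  have finU: "finite (?S \<union> spec W)" using fin by simp
  note psi = psi_exp_of_mreg[where V = ?D, OF m finU inf zero]
  have "\<exists>f. psi_exp ?D i f" for i using psi(1) by blast
  moreover have "\<exists>f. x_exp ?D e i f" for e i
  proof (rule mbil_x_exp)
    have xV: "mbil (Xs V e i)" and xW: "mbil (Xs W e i)" for e
      by (rule x_exp_mbil, rule good_x[OF V], rule x_exp_mbil, rule good_x[OF W])
    have "mbil (\<lambda>k. kron (smat (\<zeta> powi k) (Xs V True i k)) (mat 1 :: 'm cmat) +
       moint C2 (\<lambda>w. smat (w powi (k - 1)) (kron (Psi_fun V i (w / \<zeta>)) (X_fun W True i w))))"
    proof (intro mbil_add mbil_kron_const mbil_scale xV \<zeta> mbil_moint[OF _ _ C2] fin)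
      show "mreg (spec W \<union> ?S) (\<lambda>w. kron (Psi_fun V i (w / \<zeta>)) (X_fun W True i w))"
        by (intro mreg_kron mreg_mono[OF mreg_scale_divide[OF mreg_Psi[OF V] \<zeta>]] mreg_mono[OF mreg_X[OF W]]) auto
    qed
    then have "mbil (Xs ?D True i)" by (simp add: Xs_def Xp sk)
    moreover have "mbil (\<lambda>k. moint C1 (\<lambda>w. smat (w powi (k - 1))
        (kron (X_fun V False i (w / \<zeta>)) (Psi_fun W i w))) + kron (mat 1 :: 'n cmat) (Xs W False i k))"
    proof (intro mbil_add mbil_kron_const xW mbil_moint[OF _ _ C1] fin)
      show "mreg (?S \<union> spec W) (\<lambda>w. kron (X_fun V False i (w / \<zeta>)) (Psi_fun W i w))"
        by (intro mreg_kron mreg_mono[OF mreg_scale_divide[OF mreg_X[OF V] \<zeta>]] mreg_mono[OF mreg_Psi[OF W]]) auto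
    qed
    then have "mbil (Xs ?D False i)" by (simp add: Xs_def Xm)
    ultimately show "mbil (Xs ?D e i)" by (cases e) auto
  qed
  moreover have "Pp ?D i 0 ** Pm ?D i 0 = mat 1" for i
  proof -
    have "smat 1 M = M" for M :: "('n \<times> 'm) cmat" by (simp add: vec_eq_iff)
    moreover have "kron (mat 1 :: 'n cmat) (mat 1 :: 'm cmat) = mat 1"
      by (auto simp: vec_eq_iff kron_nth mat_def prod_eq_iff)
    ultimately show ?thesis by (simp add: Pp Pm kron_mult good_Pp0(1)[OF V] good_Pp0(1)[OF W])
  qed
  moreover have "\<forall>i j r s. Pp ?D i r ** Pp ?D j s = Pp ?D j s ** Pp ?D i r \<and>
               Pp ?D i r ** Pm ?D j s = Pm ?D j s ** Pp ?D i r \<and>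
               Pm ?D i r ** Pm ?D j s = Pm ?D j s ** Pm ?D i r"
  proof -
    have comm: "(\<Sum>p\<le>r. smat (x p) (kron (A p) (B (r - p)))) ** (\<Sum>p\<le>s. smat (y p) (kron (A' p) (B' (s - p))))
       = (\<Sum>p\<le>s. smat (y p) (kron (A' p) (B' (s - p)))) ** (\<Sum>p\<le>r. smat (x p) (kron (A p) (B (r - p))))"
      if "\<And>p p'. A p ** A' p' = A' p' ** A p" "\<And>p p'. B p ** B' p' = B' p' ** B p"
      for r s and x y and A A' :: "nat \<Rightarrow> 'n cmat" and B B' :: "nat \<Rightarrow> 'm cmat"
    proof -
      have S: "Sq (\<Sum>p\<le>r. smat (x p) (kron (A p) (B (r - p)))) = (\<Sum>p\<le>r. cs (x p) (kronS (Sq (A p)) (Sq (B (r - p)))))"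
        for r x and A :: "nat \<Rightarrow> 'n cmat" and B :: "nat \<Rightarrow> 'm cmat"
        by (rule mat_of_eqI) (simp add: mat_of_sum mat_of_cs mat_of_kronS)
      have c: "Sq (A p) * Sq (A' p') = Sq (A' p') * Sq (A p)" "Sq (B p) * Sq (B' p') = Sq (B' p') * Sq (B p)" for p p'
        unfolding Sq_simps(6)[symmetric] that by (rule refl)+
      have "Sq (\<Sum>p\<le>r. smat (x p) (kron (A p) (B (r - p)))) * Sq (\<Sum>p\<le>s. smat (y p) (kron (A' p) (B' (s - p))))
         = Sq (\<Sum>p\<le>s. smat (y p) (kron (A' p) (B' (s - p)))) * Sq (\<Sum>p\<le>r. smat (x p) (kron (A p) (B (r - p))))"
        unfolding S
        by (intro commute_sum commute_sum[symmetric]) (simp add: kronS_mult c mult.commute)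
      then have "mat_of (Sq (\<Sum>p\<le>r. smat (x p) (kron (A p) (B (r - p)))) * Sq (\<Sum>p\<le>s. smat (y p) (kron (A' p) (B' (s - p)))))
         = mat_of (Sq (\<Sum>p\<le>s. smat (y p) (kron (A' p) (B' (s - p)))) * Sq (\<Sum>p\<le>r. smat (x p) (kron (A p) (B (r - p)))))"
        by (rule arg_cong)
      then show ?thesis unfolding mat_of_simps mat_of_Sq .
    qed
    have cV: "\<forall>i j r s. Pp V i r ** Pp V j s = Pp V j s ** Pp V i r \<and>
               Pp V i r ** Pm V j s = Pm V j s ** Pp V i r \<and>
               Pm V i r ** Pm V j s = Pm V j s ** Pm V i r" using V unfolding good_def by blast
    have cW: "\<forall>i j r s. Pp W i r ** Pp W j s = Pp W j s ** Pp W i r \<and>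
               Pp W i r ** Pm W j s = Pm W j s ** Pp W i r \<and>
               Pm W i r ** Pm W j s = Pm W j s ** Pm W i r" using W unfolding good_def by blast
    show ?thesis unfolding Pp Pm
      by (intro allI conjI; rule comm; use cV cW in blast)
  qed
  ultimately show "good ?D" unfolding good_def by simp
  show "Psi_fun ?D i z = kron (Psi_fun V i (z / \<zeta>)) (Psi_fun W i z)" if "z \<notin> ?S \<union> spec W"
    by (rule psi(2)[OF that])
qed

section \<open>Derivatives of matrix-valued functions\<close>

text \<open>A relation instead of a derivative function, so that every rule carries
  differentiability along.\<close>

definition sder :: "(complex \<Rightarrow> 'n::finite sqm) \<Rightarrow> 'n sqm \<Rightarrow> complex \<Rightarrow> bool" where
  "sder f D w \<longleftrightarrow> (\<forall>a b. ((\<lambda>z. mat_of (f z) $ a $ b) has_field_derivative mat_of D $ a $ b) (at w))"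

lemma sder_unique: "sder f D w \<Longrightarrow> sder f D' w \<Longrightarrow> D = D'"
  unfolding sder_def by (intro sqm_eqI) (metis DERIV_unique)

lemma sder_add: "sder f D w \<Longrightarrow> sder g E w \<Longrightarrow> sder (\<lambda>z. f z + g z) (D + E) w"
  unfolding sder_def by (auto intro: DERIV_add)

lemma sder_const: "sder (\<lambda>z. M) 0 w"
  unfolding sder_def by simp

lemma sder_sum: "(\<And>i. i \<in> S \<Longrightarrow> sder (f i) (D i) w) \<Longrightarrow> sder (\<lambda>z. \<Sum>i\<in>S. f i z) (\<Sum>i\<in>S. D i) w"
  by (induction S rule: infinite_finite_induct) (auto intro: sder_add sder_const)

lemma sder_mult:
  assumes "sder f D w" "sder g E w"
  shows "sder (\<lambda>z. f z * g z) (D * g w + f w * E) w"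
  unfolding sder_def
proof (intro allI)
  fix a b
  have "((\<lambda>z. \<Sum>k\<in>UNIV. mat_of (f z) $ a $ k * mat_of (g z) $ k $ b) has_field_derivative
     (\<Sum>k\<in>UNIV. mat_of D $ a $ k * mat_of (g w) $ k $ b + mat_of E $ k $ b * mat_of (f w) $ a $ k)) (at w)"
    using assms unfolding sder_def by (intro DERIV_sum DERIV_mult) auto
  then show "((\<lambda>z. mat_of (f z * g z) $ a $ b) has_field_derivative mat_of (D * g w + f w * E) $ a $ b) (at w)"
    by (simp add: cmat_nth_mult sum.distrib mult.commute)
qed

lemma sder_cs:
  assumes "(c has_field_derivative c') (at w)" "sder f D w"
  shows "sder (\<lambda>z. cs (c z) (f z)) (cs c' (f w) + cs (c w) D) w"
  unfolding sder_def
proof (intro allI)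
  fix a b
  have "((\<lambda>z. c z * mat_of (f z) $ a $ b) has_field_derivative c' * mat_of (f w) $ a $ b + mat_of D $ a $ b * c w) (at w)"
    using assms unfolding sder_def by (intro DERIV_mult) auto
  then show "((\<lambda>z. mat_of (cs (c z) (f z)) $ a $ b) has_field_derivative mat_of (cs c' (f w) + cs (c w) D) $ a $ b) (at w)"
    by (simp add: mult.commute)
qed

lemma sder_cs_const:
  assumes "(c has_field_derivative c') (at w)"
  shows "sder (\<lambda>z. cs (c z) M) (cs c' M) w"
  using sder_cs[OF assms sder_const[of M]] by simp

text \<open>Commutation of the value with its derivative is what restores the scalar power rule; for
  the nilpotent parts below both lie in one commutative algebra.\<close>

lemma sder_power:
  fixes f :: "complex \<Rightarrow> 'a::finite sqm"
  assumes f: "sder f D w" and c: "D * f w = f w * D"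
  shows "sder (\<lambda>z. f z ^ Suc n) (cs (of_nat (Suc n)) (f w ^ n * D)) w"
proof (induction n)
  case 0
  then show ?case using f by simp
next
  case (Suc n)
  have "D * f w ^ Suc n = f w ^ Suc n * D" by (rule commute_power[OF c])
  moreover have "f w * cs (of_nat (Suc n)) (f w ^ n * D) = cs (of_nat (Suc n)) (f w ^ Suc n * D)"
    by (simp only: cs_mult_right power_Suc mult.assoc)
  moreover have "X + cs c X = cs (1 + c) X" for X :: "'a sqm" and c by (simp add: cs_add_left)
  ultimately have "D * f w ^ Suc n + f w * cs (of_nat (Suc n)) (f w ^ n * D)
     = cs (of_nat (Suc (Suc n))) (f w ^ Suc n * D)"
    by (simp only: of_nat_Suc[of "Suc n"])
  with sder_mult[OF f Suc] show ?case by simp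
qed

lemma sder_cong_ev:
  assumes "sder f D w" "\<forall>\<^sub>F z in nhds w. f z = g z"
  shows "sder g D w"
  unfolding sder_def
proof (intro allI)
  fix a b
  have "\<forall>\<^sub>F z in nhds w. mat_of (f z) $ a $ b = mat_of (g z) $ a $ b"
    using assms(2) by eventually_elim simp
  then show "((\<lambda>z. mat_of (g z) $ a $ b) has_field_derivative mat_of D $ a $ b) (at w)"
    using assms(1) DERIV_cong_ev[OF refl _ refl, of "\<lambda>z. mat_of (f z) $ a $ b" "\<lambda>z. mat_of (g z) $ a $ b" w "mat_of D $ a $ b"]
    unfolding sder_def by blast
qed

section \<open>Structure of the logarithmic derivative of a commuting family\<close>

text \<open>Rational functions with matrix coefficients from W. With W a commutative algebra of
  nilpotents, the logarithm of a unipotent function belongs to this class, and its partial fraction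
  coefficients stay in W.\<close>

inductive rw :: "complex set \<Rightarrow> 'n::finite sqm set \<Rightarrow> (complex \<Rightarrow> 'n sqm) \<Rightarrow> bool" for S W where
  rw_base: "rreg S g \<Longrightarrow> M \<in> W \<Longrightarrow> rw S W (\<lambda>w. cs (g w) M)"
| rw_add: "rw S W f \<Longrightarrow> rw S W g \<Longrightarrow> rw S W (\<lambda>w. f w + g w)"

lemma rw_mult:
  assumes W: "\<And>M N. M \<in> W \<Longrightarrow> N \<in> W \<Longrightarrow> M * N \<in> W" and f: "rw S W f" and g: "rw S W g"
  shows "rw S W (\<lambda>w. f w * g w)"
  using f
proof (induction rule: rw.induct)
  case (rw_base u M)
  note u = rw_base
  show ?case using g
  proof (induction rule: rw.induct)
    case (rw_base v N)
    have "rw S W (\<lambda>w. cs (u w * v w) (M * N))"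
      by (intro rw.rw_base rreg_mult W u rw_base)
    then show ?case by (simp add: mult.commute)
  next
    case (rw_add f g)
    then show ?case using rw.rw_add[OF rw_add.IH] by (simp add: cs_add_right distrib_left)
  qed
next
  case (rw_add f h)
  then show ?case using rw.rw_add[OF rw_add.IH] by (simp add: distrib_right)
qed

lemma rw_cs:
  assumes "\<And>M c. M \<in> W \<Longrightarrow> cs c M \<in> W" "rw S W f"
  shows "rw S W (\<lambda>w. cs c (f w))"
  using assms(2)
proof (induction rule: rw.induct)
  case (rw_base g M)
  then have "rw S W (\<lambda>w. cs (g w) (cs c M))" by (intro rw.rw_base assms(1))
  then show ?case by (simp add: mult.commute)
next
  case (rw_add f g)
  then show ?case using rw.rw_add[OF rw_add.IH] by (simp add: cs_add_right)
qed

lemma rw_sum: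
  assumes "finite T" "0 \<in> W" "\<And>i. i \<in> T \<Longrightarrow> rw S W (f i)"
  shows "rw S W (\<lambda>w. \<Sum>i\<in>T. f i w)"
  using assms(1,3)
proof (induction T rule: finite_induct)
  case empty
  have "rw S W (\<lambda>w. cs 0 0)" by (intro rw_base assms(2)) simp
  then show ?case by simp
qed (auto intro: rw_add)

lemma rw_power:
  assumes W: "\<And>M N. M \<in> W \<Longrightarrow> N \<in> W \<Longrightarrow> M * N \<in> W" and f: "rw S W f"
  shows "rw S W (\<lambda>w. f w ^ Suc n)"
proof (induction n)
  case (Suc n)
  have "rw S W (\<lambda>w. f w * f w ^ Suc n)" by (intro rw_mult W f Suc) auto
  then show ?case by simp
qed (use f in simp)

definition mpf :: "complex set \<Rightarrow> nat \<Rightarrow> (nat \<Rightarrow> 'n::finite sqm) \<Rightarrow> (complex \<Rightarrow> nat \<Rightarrow> 'n sqm) \<Rightarrow> complex \<Rightarrow> 'n sqm" where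
  "mpf S K Q C w = (\<Sum>j<K. cs (w ^ j) (Q j)) + (\<Sum>s\<in>S. \<Sum>k<K. cs (1 / (w - s) ^ Suc k) (C s k))"

lemma mpf_extend:
  assumes "K \<le> K'" "\<And>j. j \<ge> K \<Longrightarrow> Q j = 0" "\<And>s k. k \<ge> K \<Longrightarrow> C s k = 0"
  shows "mpf S K' Q C w = mpf S K Q C w"
proof -
  have "(\<Sum>j<K'. cs (w ^ j) (Q j)) = (\<Sum>j<K. cs (w ^ j) (Q j))"
    by (rule sum.mono_neutral_right) (use assms in auto)
  moreover have "(\<Sum>k<K'. cs (1 / (w - s) ^ Suc k) (C s k)) = (\<Sum>k<K. cs (1 / (w - s) ^ Suc k) (C s k))" for s
    by (rule sum.mono_neutral_right) (use assms in auto)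
  ultimately show ?thesis unfolding mpf_def by simp
qed

lemma rw_partial_fractions:
  assumes S: "finite S" and W: "0 \<in> W" "\<And>M N. M \<in> W \<Longrightarrow> N \<in> W \<Longrightarrow> M + N \<in> W" "\<And>M c. M \<in> W \<Longrightarrow> cs c M \<in> W"
    and f: "rw S W f"
  shows "\<exists>K Q C. (\<forall>j. Q j \<in> W) \<and> (\<forall>s k. C s k \<in> W) \<and> (\<forall>j\<ge>K. Q j = 0) \<and> (\<forall>s. \<forall>k\<ge>K. C s k = 0) \<and>
     (\<forall>w. w \<notin> S \<longrightarrow> f w = mpf S K Q C w)"
  using f
proof (induction rule: rw.induct)
  case (rw_base g M)
  obtain K q c where g: "\<And>w. w \<notin> S \<Longrightarrow> g w = poly q w + pfsum S K c w"
    using pf_of_rreg[OF S rw_base(1)] unfolding pf_def by blast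
  let ?K = "max K (Suc (degree q))"
  let ?Q = "\<lambda>j. cs (coeff q j) M"
  let ?C = "\<lambda>s k. if k < K then cs (c s k) M else 0"
  have "cs (g w) M = mpf S ?K ?Q ?C w" if "w \<notin> S" for w
  proof -
    have "(\<Sum>j<?K. cs (w ^ j) (?Q j)) = (\<Sum>j\<le>degree q. cs (w ^ j) (?Q j))"
      by (rule sum.mono_neutral_right) (auto simp: coeff_eq_0 not_le)
    then have 1: "(\<Sum>j<?K. cs (w ^ j) (?Q j)) = cs (poly q w) M"
      by (simp add: poly_altdef cs_sum_left mult.commute)
    have "(\<Sum>k<?K. cs (1 / (w - s) ^ Suc k) (?C s k)) = (\<Sum>k<K. cs (1 / (w - s) ^ Suc k) (?C s k))" for s
      by (rule sum.mono_neutral_right) auto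
    then have 2: "(\<Sum>s\<in>S. \<Sum>k<?K. cs (1 / (w - s) ^ Suc k) (?C s k)) = cs (pfsum S K c w) M"
      by (simp add: pfsum_def cs_sum_left)
    show ?thesis unfolding mpf_def 1 2 g[OF that] by (simp add: cs_add_left)
  qed
  moreover have "\<forall>j. ?Q j \<in> W" "\<forall>s k. ?C s k \<in> W" using W rw_base(2) by auto
  moreover have "\<forall>j\<ge>?K. ?Q j = 0" by (auto simp: coeff_eq_0)
  moreover have "\<forall>s. \<forall>k\<ge>?K. ?C s k = 0" by auto
  ultimately show ?case
    by (intro exI[of _ ?K]; intro exI[of _ ?Q]; intro exI[of _ ?C] conjI) blast+
next
  case (rw_add f g)
  obtain K Q C where f: "\<forall>j. Q j \<in> W" "\<forall>s k. C s k \<in> W" "\<forall>j\<ge>K. Q j = 0" "\<forall>s. \<forall>k\<ge>K. C s k = 0"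
     "\<forall>w. w \<notin> S \<longrightarrow> f w = mpf S K Q C w" using rw_add.IH(1) by blast
  obtain K' Q' C' where g: "\<forall>j. Q' j \<in> W" "\<forall>s k. C' s k \<in> W" "\<forall>j\<ge>K'. Q' j = 0" "\<forall>s. \<forall>k\<ge>K'. C' s k = 0"
     "\<forall>w. w \<notin> S \<longrightarrow> g w = mpf S K' Q' C' w" using rw_add.IH(2) by blast
  let ?K = "max K K'"
  have "f w + g w = mpf S ?K (\<lambda>j. Q j + Q' j) (\<lambda>s k. C s k + C' s k) w" if "w \<notin> S" for w
  proof -
    have "f w = mpf S ?K Q C w" using f that by (subst mpf_extend[of K]) auto
    moreover have "g w = mpf S ?K Q' C' w" using g that by (subst mpf_extend[of K']) auto
    ultimately show ?thesis
      by (simp add: mpf_def cs_add_right sum.distrib)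
  qed
  then show ?case using f g W
    by (intro exI[of _ ?K] exI[of _ "\<lambda>j. Q j + Q' j"] exI[of _ "\<lambda>s k. C s k + C' s k"]) auto
qed

text \<open>Differentiated partial fractions start at order two. Hence the unipotent part of \<Psi>,
  which enters through the derivative of its logarithm, leaves the residues untouched.\<close>

lemma sder_mpf:
  assumes S: "finite S" and w: "w \<notin> S"
  shows "sder (mpf S K Q C) ((\<Sum>j<K. cs (of_nat j * w ^ (j - 1)) (Q j)) +
     (\<Sum>s\<in>S. \<Sum>k<K. cs (- of_nat (Suc k) / (w - s) ^ Suc (Suc k)) (C s k))) w"
  unfolding mpf_def[abs_def]
proof (intro sder_add sder_sum sder_cs_const)
  show "((\<lambda>z. z ^ j) has_field_derivative of_nat j * w ^ (j - 1)) (at w)" for j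
    by (auto intro!: derivative_eq_intros)
  fix s k assume "s \<in> S"
  then have "w - s \<noteq> 0" using w by auto
  then show "((\<lambda>z. 1 / (z - s) ^ Suc k) has_field_derivative - of_nat (Suc k) / (w - s) ^ Suc (Suc k)) (at w)"
    by (auto intro!: derivative_eq_intros simp: divide_simps simp del: power_Suc of_nat_Suc)
       (simp add: algebra_simps)
qed

text \<open>Orders of zeros are the source of the integer residues.\<close>

lemma poly_logderiv:
  fixes p :: "complex poly"
  assumes "finite S" "p \<noteq> 0" "\<And>z. poly p z = 0 \<Longrightarrow> z \<in> S" "w \<notin> S"
  shows "poly (pderiv p) w / poly p w = (\<Sum>s\<in>S. of_nat (order s p) / (w - s))"
  using assms(2,3)
proof (induction "degree p" arbitrary: p rule: less_induct)
  case less
  show ?case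
  proof (cases "degree p = 0")
    case True
    then obtain a where a: "p = [:a:]" by (meson degree_eq_zeroE)
    have "order s p = 0" for s using less.prems(1) a by (intro order_0I) auto
    then show ?thesis using a by (simp add: pderiv_pCons)
  next
    case False
    then have "\<not> constant (poly p)" by (simp add: constant_degree)
    then obtain x where x: "poly p x = 0" using fundamental_theorem_of_algebra by blast
    then have xS: "x \<in> S" using less.prems by blast
    obtain p' where p: "p = [:- x, 1:] * p'" using x by (auto simp: poly_eq_0_iff_dvd dvd_def)
    have p': "p' \<noteq> 0" using less.prems p by auto
    then have "degree p = 1 + degree p'" unfolding p by (subst degree_mult_eq) auto
    then have "degree p' < degree p" by simp
    moreover have "z \<in> S" if "poly p' z = 0" for z using less.prems(2)[of z] that p by auto
    ultimately have IH: "poly (pderiv p') w / poly p' w = (\<Sum>s\<in>S. of_nat (order s p') / (w - s))"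
      using less.hyps p' by blast
    have nz: "w - x \<noteq> 0" "poly p' w \<noteq> 0" using assms(4) xS less.prems(2)[of w] p by auto
    have d1: "poly (pderiv p) w = poly p' w + (w - x) * poly (pderiv p') w"
      unfolding p by (subst pderiv_mult) (simp add: pderiv_pCons algebra_simps)
    have d2: "poly p w = (w - x) * poly p' w" unfolding p by (simp add: algebra_simps)
    have "poly (pderiv p) w / poly p w = (poly p' w + (w - x) * poly (pderiv p') w) / ((w - x) * poly p' w)"
      by (simp only: d1 d2)
    also have "\<dots> = 1 / (w - x) + poly (pderiv p') w / poly p' w"
      using nz by (simp add: add_divide_distrib)
    finally have "poly (pderiv p) w / poly p w = 1 / (w - x) + poly (pderiv p') w / poly p' w" .
    moreover have "of_nat (order s p) / (w - s) = (if s = x then 1 / (w - x) else 0) + of_nat (order s p') / (w - s)" for s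
    proof -
      have "order s p = order s [:- x, 1:] + order s p'"
        unfolding p by (rule order_mult) (use less.prems(1) p in blast)
      moreover have "order s [:- x, 1:] = (if s = x then 1 else 0)"
      proof (cases "s = x")
        case True
        then show ?thesis using order_power_n_n[of x 1] by simp
      next
        case False
        then show ?thesis by (simp add: order_0I)
      qed
      ultimately show ?thesis by (simp add: add_divide_distrib)
    qed
    ultimately show ?thesis using IH xS assms(1) by (simp add: sum.distrib)
  qed
qed

text \<open>At infinity, w times the sum of fractions tends to the sum of the residues. So w q(w)
  has a finite limit, which forces q = 0, and then the limit itself must be 0.\<close>

lemma decaying_partial_fraction:
  assumes S: "finite S"
    and lim: "((\<lambda>w. w * (poly q w + pfsum S K c w)) \<longlongrightarrow> 0) at_infinity" and K: "K > 0"
  shows "q = 0" "(\<Sum>s\<in>S. c s 0) = 0"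
proof -
  have t1: "((\<lambda>w. w / (w - s)) \<longlongrightarrow> 1) at_infinity" for s :: complex
  proof (rule Lim_transform_eventually)
    have inv: "((\<lambda>w::complex. 1 / w) \<longlongrightarrow> 0) at_infinity"
      using tendsto_inverse_0 by (simp add: inverse_eq_divide[abs_def])
    have "((\<lambda>w. 1 / (1 - s * (1 / w))) \<longlongrightarrow> 1 / (1 - s * 0)) at_infinity"
      by (intro tendsto_intros inv) auto
    then show "((\<lambda>w. 1 / (1 - s * (1 / w))) \<longlongrightarrow> 1) at_infinity" by simp
    show "\<forall>\<^sub>F w in at_infinity. 1 / (1 - s * (1 / w)) = w / (w - s)"
      unfolding eventually_at_infinity
      by (rule exI[of _ 1]) (auto simp: divide_simps)
  qed
  have t2: "((\<lambda>w. 1 / (w - s)) \<longlongrightarrow> 0) at_infinity" for s :: complex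
  proof (rule Lim_transform_eventually)
    have inv: "((\<lambda>w::complex. 1 / w) \<longlongrightarrow> 0) at_infinity"
      using tendsto_inverse_0 by (simp add: inverse_eq_divide[abs_def])
    have "((\<lambda>w. (1 / w) * (w / (w - s))) \<longlongrightarrow> 0 * 1) at_infinity"
      by (intro tendsto_mult inv t1)
    then show "((\<lambda>w. (1 / w) * (w / (w - s))) \<longlongrightarrow> 0) at_infinity" by simp
    show "\<forall>\<^sub>F w in at_infinity. (1 / w) * (w / (w - s)) = 1 / (w - s)"
      unfolding eventually_at_infinity by (rule exI[of _ 1]) (auto simp: divide_simps)
  qed
  have t3: "((\<lambda>w. w * (c s k / (w - s) ^ Suc k)) \<longlongrightarrow> (if k = 0 then c s 0 else 0)) at_infinity" for s k
  proof -
    have "((\<lambda>w. c s k * (w / (w - s)) * (1 / (w - s)) ^ k) \<longlongrightarrow> c s k * 1 * 0 ^ k) at_infinity"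
      by (intro tendsto_intros t1 t2)
    moreover have "c s k * (w / (w - s)) * (1 / (w - s)) ^ k = w * (c s k / (w - s) ^ Suc k)" for w
      by (simp add: power_one_over)
    ultimately show ?thesis by (cases k) (auto simp: mult.commute)
  qed
  have pl: "((\<lambda>w. w * pfsum S K c w) \<longlongrightarrow> (\<Sum>s\<in>S. \<Sum>k<K. if k = 0 then c s 0 else 0)) at_infinity"
    unfolding pfsum_def sum_distrib_left by (intro tendsto_sum t3)
  have sK: "(\<Sum>k<K. if k = 0 then c s 0 else 0) = c s 0" for s using K by simp
  have "((\<lambda>w. w * (poly q w + pfsum S K c w) - w * pfsum S K c w) \<longlongrightarrow> 0 - (\<Sum>s\<in>S. c s 0)) at_infinity"
    using tendsto_diff[OF lim pl] by (simp only: sK)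
  moreover have "poly (pCons 0 q) = (\<lambda>w. w * (poly q w + pfsum S K c w) - w * pfsum S K c w)"
    by (simp add: fun_eq_iff algebra_simps)
  ultimately have ql: "(poly (pCons 0 q) \<longlongrightarrow> - (\<Sum>s\<in>S. c s 0)) at_infinity"
    by simp
  show q0: "q = 0"
  proof (rule ccontr)
    assume "q \<noteq> 0"
    let ?d = "norm (\<Sum>s\<in>S. c s 0) + 2"
    obtain r where r: "\<And>z. r \<le> norm z \<Longrightarrow> ?d \<le> norm (poly (pCons 0 q) z)"
      using poly_infinity[OF \<open>q \<noteq> 0\<close>] by blast
    have "\<forall>\<^sub>F w in at_infinity. dist (poly (pCons 0 q) w) (- (\<Sum>s\<in>S. c s 0)) < 1"
      by (rule tendstoD[OF ql]) simp
    then obtain b where b: "\<And>w. b \<le> norm w \<Longrightarrow> dist (poly (pCons 0 q) w) (- (\<Sum>s\<in>S. c s 0)) < 1"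
      unfolding eventually_at_infinity by blast
    define z where "z = complex_of_real (\<bar>b\<bar> + \<bar>r\<bar>)"
    have "norm z = \<bar>b\<bar> + \<bar>r\<bar>" unfolding z_def norm_of_real by simp
    then have "b \<le> norm z" "r \<le> norm z" by auto
    from b[OF this(1)] r[OF this(2)] show False
      using norm_triangle_ineq2[of "poly (pCons 0 q) z" "- (\<Sum>s\<in>S. c s 0)"] by (simp add: dist_norm)
  qed
  have "poly (pCons 0 q) = (\<lambda>w. 0)" by (simp add: q0 fun_eq_iff)
  with ql have "((\<lambda>w::complex. 0) \<longlongrightarrow> - (\<Sum>s\<in>S. c s 0)) at_infinity" by (simp only:)
  from tendsto_unique[OF trivial_limit_at_infinity this tendsto_const]
  show "(\<Sum>s\<in>S. c s 0) = 0" by simp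
qed

lemma mreg_common_denominator:
  fixes \<Phi> :: "complex \<Rightarrow> 'n::finite cmat"
  assumes \<Phi>: "mreg S \<Phi>"
  shows "\<exists>r D C. r \<noteq> 0 \<and> (\<forall>w. w \<notin> S \<longrightarrow> poly r w \<noteq> 0 \<and> Sq (\<Phi> w) = (\<Sum>m\<le>(D::nat). cs (w ^ m / poly r w) (C m)))"
proof -
  have "\<forall>a b. \<exists>p r. r \<noteq> 0 \<and> (\<forall>z. z \<notin> S \<longrightarrow> poly r z \<noteq> 0 \<and> \<Phi> z $ a $ b = poly p z / poly r z)"
    using \<Phi> unfolding mreg_def rreg_def by blast
  then obtain p r where pr: "\<And>a b. r a b \<noteq> 0"
    "\<And>a b z. z \<notin> S \<Longrightarrow> poly (r a b) z \<noteq> 0 \<and> \<Phi> z $ a $ b = poly (p a b) z / poly (r a b) z" by metis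
  define R where "R = (\<Prod>a\<in>UNIV. \<Prod>b\<in>UNIV. r a b)"
  have R0: "R \<noteq> 0" unfolding R_def using pr(1) by simp
  have Rz: "poly R z \<noteq> 0" if "z \<notin> S" for z
    unfolding R_def poly_prod using pr(2)[OF that] by simp
  have "r a b dvd R" for a b
  proof -
    have "r a b dvd (\<Prod>b\<in>UNIV. r a b)" by (rule dvd_prodI) auto
    also have "\<dots> dvd R" unfolding R_def by (rule dvd_prodI) auto
    finally show ?thesis .
  qed
  then obtain t where t: "\<And>a b. R = r a b * t a b" unfolding dvd_def by metis
  define P where "P a b = p a b * t a b" for a b
  have \<Phi>P: "\<Phi> z $ a $ b = poly (P a b) z / poly R z" if "z \<notin> S" for a b z
  proof -
    have "poly R z = poly (r a b) z * poly (t a b) z" using t[of a b] by simp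
    then show ?thesis using pr(2)[OF that, of a b] Rz[OF that] by (simp add: P_def)
  qed
  define D where "D = Max (range (\<lambda>(a, b). degree (P a b)))"
  have D: "degree (P a b) \<le> D" for a b
    unfolding D_def by (rule Max_ge) (auto simp: image_iff)
  define C where "C m = Sq (\<chi> a b. coeff (P a b) m)" for m
  have "Sq (\<Phi> w) = (\<Sum>m\<le>D. cs (w ^ m / poly R w) (C m))" if w: "w \<notin> S" for w
  proof (rule sqm_eqI)
    fix a b
    have "poly (P a b) w = (\<Sum>m\<le>D. coeff (P a b) m * w ^ m)"
      unfolding poly_altdef by (rule sum.mono_neutral_left) (use D[of a b] in \<open>auto simp: coeff_eq_0 not_le\<close>)
    then show "mat_of (Sq (\<Phi> w)) $ a $ b = mat_of (\<Sum>m\<le>D. cs (w ^ m / poly R w) (C m)) $ a $ b"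
      by (simp add: \<Phi>P[OF w] mat_of_sum C_def sum_divide_distrib mult.commute)
  qed
  then show ?thesis using R0 Rz by blast
qed

text \<open>A polynomial identity in w valid off a finite set holds coefficientwise. Thus commuting
  with all values of F reduces to commuting with finitely many matrices, to which the simultaneous
  splitting applies.\<close>

lemma commute_coefficients:
  fixes C :: "nat \<Rightarrow> 'n::finite sqm"
  assumes S: "finite S" and r: "\<And>w. w \<notin> S \<Longrightarrow> poly r w \<noteq> 0"
    and F: "\<And>w. w \<notin> S \<Longrightarrow> F w = (\<Sum>m\<le>D. cs (w ^ m / poly r w) (C m))"
    and X: "\<And>w. w \<notin> S \<Longrightarrow> X * F w = F w * X" and m: "m \<le> D"
  shows "X * C m = C m * X"
proof (rule sqm_eqI)
  fix a b
  define c where "c m = mat_of (X * C m - C m * X) $ a $ b" for m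
  define p where "p = (\<Sum>m\<le>D. monom (c m) m)"
  have "poly p w = 0" if w: "w \<notin> S" for w
  proof -
    have "X * F w - F w * X = (\<Sum>m\<le>D. cs (w ^ m / poly r w) (X * C m - C m * X))"
      unfolding F[OF w] by (simp add: sum_distrib_left sum_distrib_right cs_diff_right sum_subtractf)
    then have "(\<Sum>m\<le>D. cs (w ^ m / poly r w) (X * C m - C m * X)) = 0" using X[OF w] by simp
    then have "mat_of (\<Sum>m\<le>D. cs (w ^ m / poly r w) (X * C m - C m * X)) $ a $ b = 0" by simp
    then have "(\<Sum>m\<le>D. w ^ m / poly r w * c m) = 0"
      by (simp only: mat_of_sum sum_component mat_of_cs_nth c_def)
    then have "(\<Sum>m\<le>D. w ^ m * c m) / poly r w = 0" by (simp add: sum_divide_distrib)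
    then show ?thesis using r[OF w] by (simp add: p_def poly_sum poly_monom mult.commute)
  qed
  then have "- S \<subseteq> {w. poly p w = 0}" by auto
  then have "infinite {w. poly p w = 0}" using infinite_compl_finite[OF S] finite_subset by blast
  then have "p = 0" using poly_roots_finite by blast
  then have "coeff p m = 0" by simp
  then have "c m = 0" using m by (simp add: p_def coeff_sum)
  then show "mat_of (X * C m) $ a $ b = mat_of (C m * X) $ a $ b" by (simp add: c_def)
qed

text \<open>On each joint generalised eigenspace F is a scalar rational function times a unipotent
  one. The scalar contributes simple poles with integer residues; the unipotent factor contributes
  the derivative of its logarithm, which is rational with nilpotent coefficients. A polynomial part
  Q is still allowed and is removed later by decay at infinity.\<close>

lemma logderiv_structure_pre:
  fixes F :: "complex \<Rightarrow> 'n::finite sqm"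
  assumes S: "finite S" and r0: "r \<noteq> 0" and r: "\<And>w. w \<notin> S \<Longrightarrow> poly r w \<noteq> 0"
    and F: "\<And>w. w \<notin> S \<Longrightarrow> F w = (\<Sum>m\<le>D. cs (w ^ m / poly r w) (C m))"
    and comm: "\<And>z w. z \<notin> S \<Longrightarrow> w \<notin> S \<Longrightarrow> F z * F w = F w * F z"
    and Y: "\<And>w. w \<notin> S \<Longrightarrow> Y w * F w = 1"
    and F': "\<And>w. w \<notin> S \<Longrightarrow> sder F (F' w) w"
  shows "\<exists>A (e :: complex list \<Rightarrow> 'n sqm) \<nu> K Q \<Lambda>. finite A \<and> (\<Sum>a\<in>A. e a) = 1 \<and>
    (\<forall>a\<in>A. \<forall>b\<in>A. e a * e b = (if a = b then e a else 0)) \<and>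
    (\<forall>a\<in>A. \<forall>X. (\<forall>w. w \<notin> S \<longrightarrow> X * F w = F w * X) \<longrightarrow> X * e a = e a * X) \<and>
    (\<forall>s k. nilp (\<Lambda> s k) \<and> (\<forall>X. (\<forall>w. w \<notin> S \<longrightarrow> X * F w = F w * X) \<longrightarrow> X * \<Lambda> s k = \<Lambda> s k * X)) \<and>
    (\<forall>w. w \<notin> S \<longrightarrow> Y w * F' w = (\<Sum>a\<in>A. \<Sum>s\<in>S. cs (of_int (\<nu> a s) / (w - s)) (e a)) +
       ((\<Sum>j<K. cs (of_nat j * w ^ (j - 1)) (Q j)) +
         (\<Sum>s\<in>S. \<Sum>k<K. cs (- of_nat (Suc k) / (w - s) ^ Suc (Suc k)) (\<Lambda> s k))))"
proof -
  define cF where "cF X \<longleftrightarrow> (\<forall>w. w \<notin> S \<longrightarrow> X * F w = F w * X)" for X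
  have cFC: "X * C m = C m * X" if "cF X" "m \<le> D" for X m
    by (rule commute_coefficients[OF S r F _ that(2)]) (use that(1) in \<open>auto simp: cF_def\<close>)
  have FC: "cF (C m)" if "m \<le> D" for m
    unfolding cF_def using cFC[of "F _" m] comm that unfolding cF_def by metis
  have CC: "C m * C m' = C m' * C m" if "m \<le> D" "m' \<le> D" for m m' using cFC[OF FC] that by blast
  let ?Cs = "map C [0..<Suc D]"
  have setCs: "M \<in> set ?Cs \<longleftrightarrow> (\<exists>m\<le>D. M = C m)" for M
    by (simp del: upt_Suc add: atLeast0LessThan lessThan_Suc_atMost image_iff Bex_def)
  obtain A e where Ae: "finite (A :: complex list set)" "(\<Sum>a\<in>A. e a) = 1"
    "\<forall>a\<in>A. \<forall>b\<in>A. e a * e b = (if a = b then e a else 0)"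
    "\<forall>a\<in>A. \<forall>m<length ?Cs. nilp ((?Cs ! m - cs (a ! m) 1) * e a)"
    "\<forall>a\<in>A. \<forall>X. (\<forall>M\<in>set ?Cs. X * M = M * X) \<longrightarrow> X * e a = e a * X"
    using idempotent_splitting[of ?Cs] CC unfolding setCs by metis
  \<comment> \<open>Vanishing idempotents are dropped, so that every remaining eigenvalue polynomial
    can be shown to have no zero off S.\<close>
  define A' where "A' = {a\<in>A. e a \<noteq> 0}"
  have A': "finite A'" using Ae(1) by (simp add: A'_def)
  have one: "(\<Sum>a\<in>A'. e a) = 1"
    unfolding Ae(2)[symmetric] A'_def by (rule sum.mono_neutral_left) (use Ae(1) in auto)
  have orth: "\<forall>a\<in>A'. \<forall>b\<in>A'. e a * e b = (if a = b then e a else 0)"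
    using Ae(3) unfolding A'_def by blast
  have ce: "X * e a = e a * X" if "a \<in> A'" "cF X" for a X
  proof -
    have aA: "a \<in> A" using that(1) by (simp add: A'_def)
    have XM: "X * M = M * X" if Mset: "M \<in> set ?Cs" for M
    proof -
      obtain m where m: "m \<le> D" "M = C m" using iffD1[OF setCs Mset] by blast
      show ?thesis unfolding m(2) by (rule cFC[OF \<open>cF X\<close> m(1)])
    qed
    show ?thesis by (rule Ae(5)[rule_format, OF aA XM])
  qed
  define \<nu> where "\<nu> a m = (C m - cs (a ! m) 1) * e a" for a m
  have nil\<nu>: "nilp (\<nu> a m)" if "a \<in> A'" "m \<le> D" for a m
    using Ae(4) that unfolding A'_def \<nu>_def by (auto simp del: upt_Suc simp add: nth_map)
  have ee: "e a * e a = e a" if "a \<in> A'" for a using orth that by auto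
  have c\<nu>: "X * \<nu> a m = \<nu> a m * X" if "cF X" "a \<in> A'" "m \<le> D" for X a m
    unfolding \<nu>_def
  proof (rule commute_mult)
    show "X * (C m - cs (a ! m) 1) = (C m - cs (a ! m) 1) * X"
      using cFC[OF that(1,3)] by (simp add: left_diff_distrib right_diff_distrib)
    show "X * e a = e a * X" by (rule ce[OF that(2,1)])
  qed
  have cFF: "cF (F w)" if "w \<notin> S" for w unfolding cF_def using comm[OF that] by blast
  \<comment> \<open>Nilpotents commuting with everything that commutes with F. As the values of F
    commute, elements of W commute with F and so with one another; this makes W closed under sums
    and products.\<close>
  define W where "W = {M. nilp M \<and> (\<forall>X. cF X \<longrightarrow> X * M = M * X)}"
  have WF: "cF M" if "M \<in> W" for M
    unfolding cF_def
  proof (intro allI impI)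
    fix w assume "w \<notin> S"
    then have "F w * M = M * F w" using that cFF unfolding W_def by blast
    then show "M * F w = F w * M" by (rule sym)
  qed
  have WW: "M * N = N * M" if "M \<in> W" "N \<in> W" for M N
    using WF[OF that(1)] that(2) unfolding W_def by blast
  have W0: "0 \<in> W" by (simp add: W_def)
  have Wadd: "M + N \<in> W" if "M \<in> W" "N \<in> W" for M N
  proof -
    have "nilp (M + N)" using nilp_add[OF WW[OF that]] that unfolding W_def by blast
    moreover have "X * (M + N) = (M + N) * X" if "cF X" for X
      using \<open>M \<in> W\<close> \<open>N \<in> W\<close> that unfolding W_def by (simp add: distrib_left distrib_right)
    ultimately show ?thesis unfolding W_def by blast
  qed
  have Wcs: "cs c M \<in> W" if "M \<in> W" for c M
  proof -
    have "X * cs c M = cs c M * X" if "cF X" for X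
      using \<open>M \<in> W\<close> that unfolding W_def by simp
    then show ?thesis using that nilp_cs unfolding W_def by blast
  qed
  have Wmult: "M * N \<in> W" if "M \<in> W" "N \<in> W" for M N
  proof -
    have "nilp (M * N)" using nilp_mult[OF WW[OF that]] that unfolding W_def by blast
    moreover have "X * (M * N) = (M * N) * X" if "cF X" for X
      by (rule commute_mult) (use \<open>M \<in> W\<close> \<open>N \<in> W\<close> that in \<open>auto simp: W_def\<close>)
    ultimately show ?thesis unfolding W_def by blast
  qed
  have \<nu>W: "\<nu> a m \<in> W" if "a \<in> A'" "m \<le> D" for a m
    unfolding W_def using nil\<nu>[OF that] c\<nu> that by blast
  have comb: "(\<Sum>m\<le>D. cs (x m) (\<nu> a m)) \<in> W" if "a \<in> A'" for x a
  proof -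
    have "(\<Sum>m\<in>T. cs (x m) (\<nu> a m)) \<in> W" if "finite T" "T \<subseteq> {..D}" for T
      using that
    proof (induction T rule: finite_induct)
      case (insert m T)
      then have "cs (x m) (\<nu> a m) \<in> W" "(\<Sum>m\<in>T. cs (x m) (\<nu> a m)) \<in> W"
        using Wcs \<nu>W[OF \<open>a \<in> A'\<close>] by auto
      then show ?case using insert.hyps Wadd by simp
    qed (simp add: W0)
    then show ?thesis by blast
  qed
  define \<phi> where "\<phi> a = (\<Sum>m\<le>D. monom (a ! m) m)" for a :: "complex list"
  have poly\<phi>: "poly (\<phi> a) w = (\<Sum>m\<le>D. a ! m * w ^ m)" for a w by (simp add: \<phi>_def poly_sum poly_monom)
  have Fe0: "F w * e a = cs (poly (\<phi> a) w / poly r w) (e a) + (\<Sum>m\<le>D. cs (w ^ m / poly r w) (\<nu> a m))"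
    if "w \<notin> S" for w a
  proof -
    have "C m * e a = cs (a ! m) (e a) + \<nu> a m" for m
      by (simp add: \<nu>_def left_diff_distrib)
    then have "F w * e a = (\<Sum>m\<le>D. cs (w ^ m / poly r w * a ! m) (e a) + cs (w ^ m / poly r w) (\<nu> a m))"
      unfolding F[OF that] by (simp add: sum_distrib_right cs_add_right)
    also have "\<dots> = cs (\<Sum>m\<le>D. w ^ m / poly r w * a ! m) (e a) + (\<Sum>m\<le>D. cs (w ^ m / poly r w) (\<nu> a m))"
      by (simp add: sum.distrib cs_sum_left)
    also have "(\<Sum>m\<le>D. w ^ m / poly r w * a ! m) = poly (\<phi> a) w / poly r w"
      by (simp add: poly\<phi> sum_divide_distrib mult.commute)
    finally show ?thesis .
  qed
  \<comment> \<open>Otherwise \<open>F w\<close> would be nilpotent on the nonzero range of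
    \<open>e a\<close>, although \<open>Y w\<close> inverts it.\<close>
  have \<phi>nz: "poly (\<phi> a) w \<noteq> 0" if a: "a \<in> A'" and w: "w \<notin> S" for a w
  proof
    assume "poly (\<phi> a) w = 0"
    then have Fe: "F w * e a = (\<Sum>m\<le>D. cs (w ^ m / poly r w) (\<nu> a m))" using Fe0[OF w, of a] by simp
    have "nilp (F w * e a)" unfolding Fe using comb[OF a, of "\<lambda>m. w ^ m / poly r w"]
      unfolding W_def mem_Collect_eq by (rule conjunct1)
    then obtain p where p: "(F w * e a) ^ p = 0" unfolding nilp_def by blast
    have c: "F w * e a = e a * F w" by (rule ce[OF a cFF[OF w]])
    have "e a ^ Suc p = e a" by (induction p) (use ee[OF a] in auto)
    moreover have "(F w * e a) ^ Suc p = 0" using p by simp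
    ultimately have z: "F w ^ Suc p * e a = 0" using power_mult_commuting[OF c, of "Suc p"] by simp
    have "Y w ^ n * F w ^ n = 1" for n
    proof (induction n)
      case (Suc n)
      have "Y w ^ Suc n * F w ^ Suc n = Y w ^ n * (Y w * F w) * F w ^ n"
        by (simp only: power_Suc2[of "Y w"] power_Suc[of "F w"] mult.assoc)
      then show ?case using Suc Y[OF w] by simp
    qed simp
    then have "e a = Y w ^ Suc p * (F w ^ Suc p * e a)" by (metis mult.assoc mult_1)
    then have "e a = 0" using z by simp
    then show False using a by (simp add: A'_def)
  qed
  define N where "N a w = (\<Sum>m\<le>D. cs (w ^ m / poly (\<phi> a) w) (\<nu> a m))" for a w
  have Fe: "F w * e a = cs (poly (\<phi> a) w / poly r w) (e a + N a w)" if "a \<in> A'" "w \<notin> S" for a w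
    using \<phi>nz[OF that] unfolding Fe0[OF that(2)] N_def by (simp add: cs_add_right cs_sum_right)
  have N': "sder (N a) (\<Sum>m\<le>D. cs ((deriv (\<lambda>z. z ^ m / poly (\<phi> a) z) w)) (\<nu> a m)) w" if "a \<in> A'" "w \<notin> S" for a w
    unfolding N_def[abs_def]
  proof (intro sder_sum sder_cs_const)
    fix m
    have "(\<lambda>z. z ^ m / poly (\<phi> a) z) field_differentiable at w"
      unfolding field_differentiable_def
      by (rule exI, rule DERIV_divide[OF DERIV_power[OF DERIV_ident] poly_DERIV \<phi>nz[OF that]])
    then show "((\<lambda>z. z ^ m / poly (\<phi> a) z) has_field_derivative deriv (\<lambda>z. z ^ m / poly (\<phi> a) z) w) (at w)"
      using field_differentiable_derivI by blast
  qed
  define N1 where "N1 a w = (\<Sum>m\<le>D. cs ((deriv (\<lambda>z. z ^ m / poly (\<phi> a) z) w)) (\<nu> a m))" for a w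
  have NW: "N a w \<in> W" "N1 a w \<in> W" if "a \<in> A'" for a w unfolding N_def N1_def by (rule comb[OF that])+
  have e\<nu>: "e a * \<nu> a m = \<nu> a m" if a: "a \<in> A'" and m: "m \<le> D" for a m
  proof -
    have "e a * (C m - cs (a ! m) 1) = (C m - cs (a ! m) 1) * e a"
      using ce[OF a FC[OF m]] by (simp add: left_diff_distrib right_diff_distrib)
    then show ?thesis unfolding \<nu>_def using ee[OF a] by (metis mult.assoc)
  qed
  have eN: "e a * N a w = N a w" "e a * N1 a w = N1 a w" if "a \<in> A'" for a w
    unfolding N_def N1_def sum_distrib_left by (auto intro!: sum.cong simp: e\<nu>[OF that])
  have "\<exists>n>0. \<forall>w. N a w ^ n = 0" if a: "a \<in> A'" for a
  proof -
    have "\<forall>m. \<exists>p. m \<le> D \<longrightarrow> \<nu> a m ^ p = 0" using nil\<nu>[OF a] unfolding nilp_def by blast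
    then obtain p where p: "\<And>m. m \<le> D \<Longrightarrow> \<nu> a m ^ p m = 0" by metis
    have "N a w ^ Suc (sum p {..D}) = 0" for w
      unfolding N_def
    proof (rule nilp_sum_power)
      fix i j assume "i \<in> {..D}" "j \<in> {..D}"
      then have "\<nu> a i * \<nu> a j = \<nu> a j * \<nu> a i" by (intro WW \<nu>W a) auto
      then show "cs (w ^ i / poly (\<phi> a) w) (\<nu> a i) * cs (w ^ j / poly (\<phi> a) w) (\<nu> a j) =
           cs (w ^ j / poly (\<phi> a) w) (\<nu> a j) * cs (w ^ i / poly (\<phi> a) w) (\<nu> a i)"
        by (simp add: mult.commute)
    qed (use p in \<open>auto simp: cs_power\<close>)
    then show ?thesis by blast
  qed
  then obtain n where n: "\<And>a. a \<in> A' \<Longrightarrow> n a > 0 \<and> (\<forall>w. N a w ^ n a = 0)" by metis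
  text \<open>\<open>\<l> a\<close> is the logarithm of the unipotent factor \<open>1 + N a\<close>.\<close>
  define \<l> where "\<l> a w = (\<Sum>k<n a. cs ((-1) ^ k / of_nat (Suc k)) (N a w ^ Suc k))" for a w
  define \<l>1 where "\<l>1 a w = (\<Sum>k<n a. cs ((-1) ^ k) (N a w ^ k * N1 a w))" for a w
  have \<l>1: "sder (\<l> a) (\<l>1 a w) w" if "a \<in> A'" "w \<notin> S" for a w
    unfolding \<l>_def[abs_def] \<l>1_def
  proof (rule sder_sum)
    fix k
    have "sder (\<lambda>z. N a z ^ Suc k) (cs (of_nat (Suc k)) (N a w ^ k * N1 a w)) w"
      by (rule sder_power[OF N'[OF that, folded N1_def] WW[OF NW(2,1)[OF that(1)]]])
    from sder_cs[OF DERIV_const this, of "(-1) ^ k / of_nat (Suc k)"]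
    show "sder (\<lambda>z. cs ((-1) ^ k / of_nat (Suc k)) (N a z ^ Suc k)) (cs ((-1) ^ k) (N a w ^ k * N1 a w)) w"
      by (simp del: of_nat_Suc power_Suc)
  qed
  \<comment> \<open>The derivative of the logarithm series is \<open>N1 a w\<close> times the
    geometric series for the inverse of \<open>1 + N a w\<close>, which is exact since powers vanish
    from \<open>n a\<close> on.\<close>
  have key: "(1 + N a w) * \<l>1 a w = N1 a w" if a: "a \<in> A'" for a w
  proof -
    have "(1 + N a w) * (\<Sum>k<m. cs ((-1) ^ k) (N a w ^ k)) = 1 - cs ((-1) ^ m) (N a w ^ m)" for m
      by (induction m) (simp_all add: distrib_left distrib_right cs_minus_left cs_add_right power_commutes)
    from this[of "n a"] have 1: "(1 + N a w) * (\<Sum>k<n a. cs ((-1) ^ k) (N a w ^ k)) = 1"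
      using n[OF a] by simp
    have 2: "\<l>1 a w = (\<Sum>k<n a. cs ((-1) ^ k) (N a w ^ k)) * N1 a w"
      by (simp add: \<l>1_def sum_distrib_right)
    show ?thesis unfolding 2 mult.assoc[symmetric] 1 by (rule mult_1)
  qed
  have e\<l>: "e a * \<l>1 a w = \<l>1 a w" if a: "a \<in> A'" for a w
  proof -
    have "e a * (N a w ^ k * N1 a w) = N a w ^ k * N1 a w" for k
    proof -
      have c: "N a w * e a = e a * N a w" using ce[OF a WF[OF NW(1)[OF a]]] .
      have k: "e a * N a w ^ k = N a w ^ k * e a" by (rule commute_power) (rule c[symmetric])
      have "e a * (N a w ^ k * N1 a w) = N a w ^ k * e a * N1 a w"
        unfolding mult.assoc[symmetric] k ..
      then show ?thesis by (simp only: mult.assoc eN(2)[OF a])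
    qed
    then show ?thesis unfolding \<l>1_def sum_distrib_left by simp
  qed
  have rW: "rw S W (\<lambda>w. \<Sum>a\<in>A'. \<l> a w)"
  proof (intro rw_sum A' W0)
    fix a assume a: "a \<in> A'"
    have N: "rw S W (N a)" unfolding N_def[abs_def]
      by (intro rw_sum W0 rw_base rreg_divide S rreg_power rreg_id rreg_poly) (use \<phi>nz[OF a] \<nu>W[OF a] in auto)
    show "rw S W (\<l> a)" unfolding \<l>_def[abs_def]
      by (intro rw_sum W0 rw_cs rw_power N) (use Wcs Wmult in auto)
  qed
  obtain K Q \<Lambda> where pf: "\<forall>s k. \<Lambda> s k \<in> W" "\<And>w. w \<notin> S \<Longrightarrow> (\<Sum>a\<in>A'. \<l> a w) = mpf S K Q \<Lambda> w"
    using rw_partial_fractions[OF S W0 Wadd Wcs rW] by blast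
  \<comment> \<open>The order of \<open>\<phi> a / r\<close> at s, negative at a pole: the
    eigenvalue of the residue on the range of \<open>e a\<close>.\<close>
  define \<mu> where "\<mu> a s = int (order s (\<phi> a)) - int (order s r)" for a s
  have logd: "Y w * F' w = (\<Sum>a\<in>A'. \<Sum>s\<in>S. cs (of_int (\<mu> a s) / (w - s)) (e a)) +
       ((\<Sum>j<K. cs (of_nat j * w ^ (j - 1)) (Q j)) +
         (\<Sum>s\<in>S. \<Sum>k<K. cs (- of_nat (Suc k) / (w - s) ^ Suc (Suc k)) (\<Lambda> s k)))" if w: "w \<notin> S" for w
  proof -
    have ev: "\<forall>\<^sub>F z in nhds w. z \<notin> S" by (rule eventually_not_in_finite[OF S w])
    have "sder (\<lambda>z. \<Sum>a\<in>A'. \<l> a z) (\<Sum>a\<in>A'. \<l>1 a w) w" by (intro sder_sum \<l>1 w)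
    then have "sder (mpf S K Q \<Lambda>) (\<Sum>a\<in>A'. \<l>1 a w) w"
      by (rule sder_cong_ev) (use ev pf(2) in \<open>auto elim: eventually_mono\<close>)
    from sder_unique[OF this sder_mpf[OF S w]]
    have 1: "(\<Sum>a\<in>A'. \<l>1 a w) = (\<Sum>j<K. cs (of_nat j * w ^ (j - 1)) (Q j)) +
         (\<Sum>s\<in>S. \<Sum>k<K. cs (- of_nat (Suc k) / (w - s) ^ Suc (Suc k)) (\<Lambda> s k))" .
    define g where "g a z = poly (\<phi> a) z / poly r z" for a z
    define g' where "g' a = (poly (pderiv (\<phi> a)) w * poly r w - poly (\<phi> a) w * poly (pderiv r) w) / (poly r w * poly r w)" for a
    have gd: "(g a has_field_derivative g' a) (at w)" for a
      unfolding g_def[abs_def] g'_def by (rule DERIV_divide[OF poly_DERIV poly_DERIV r[OF w]])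
    have gnz: "g a w \<noteq> 0" if "a \<in> A'" for a using \<phi>nz[OF that w] r[OF w] by (simp add: g_def)
    have gg: "g' a / g a w = (\<Sum>s\<in>S. of_int (\<mu> a s) / (w - s))" if a: "a \<in> A'" for a
    proof -
      have "\<phi> a \<noteq> 0" using \<phi>nz[OF a w] by auto
      then have "poly (pderiv (\<phi> a)) w / poly (\<phi> a) w = (\<Sum>s\<in>S. of_nat (order s (\<phi> a)) / (w - s))"
        using \<phi>nz[OF a] by (intro poly_logderiv S w) auto
      moreover have "poly (pderiv r) w / poly r w = (\<Sum>s\<in>S. of_nat (order s r) / (w - s))"
        using r r0 by (intro poly_logderiv S w) auto
      moreover have "g' a / g a w = poly (pderiv (\<phi> a)) w / poly (\<phi> a) w - poly (pderiv r) w / poly r w"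
        using \<phi>nz[OF a w] r[OF w] by (simp add: g_def g'_def field_simps)
      ultimately show ?thesis by (simp add: \<mu>_def sum_subtractf diff_divide_distrib)
    qed
    have F'e: "F' w * e a = cs (g' a) (e a + N a w) + cs (g a w) (N1 a w)" if a: "a \<in> A'" for a
    proof -
      have "sder (\<lambda>z. F z * e a) (F' w * e a + F w * 0) w" by (rule sder_mult[OF F'[OF w] sder_const])
      moreover have "sder (\<lambda>z. cs (g a z) (e a + N a z)) (cs (g' a) (e a + N a w) + cs (g a w) (0 + N1 a w)) w"
        by (rule sder_cs[OF gd sder_add[OF sder_const N'[OF a w, folded N1_def]]])
      then have "sder (\<lambda>z. F z * e a) (cs (g' a) (e a + N a w) + cs (g a w) (0 + N1 a w)) w"
        by (rule sder_cong_ev) (use ev Fe[OF a] in \<open>auto simp: g_def elim: eventually_mono\<close>)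
      ultimately show ?thesis using sder_unique by fastforce
    qed
    \<comment> \<open>Checked after multiplication by \<open>F w\<close>, where no inverse occurs.
      Summing over the idempotents and applying \<open>Y w\<close> then gives the logarithmic
      derivative.\<close>
    have FD: "F w * (cs (g' a / g a w) (e a) + \<l>1 a w) = F' w * e a" if a: "a \<in> A'" for a
    proof -
      have "F w * \<l>1 a w = F w * e a * \<l>1 a w" using e\<l>[OF a] by (simp add: mult.assoc)
      also have "\<dots> = cs (g a w) ((e a + N a w) * \<l>1 a w)" unfolding Fe[OF a w] g_def by simp
      also have "(e a + N a w) * \<l>1 a w = N1 a w"
        using key[OF a, of w] e\<l>[OF a, of w] by (simp add: distrib_right)
      finally have "F w * \<l>1 a w = cs (g a w) (N1 a w)" .
      moreover have "F w * cs (g' a / g a w) (e a) = cs (g' a) (e a + N a w)"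
        using gnz[OF a] Fe[OF a w] by (simp add: g_def[symmetric])
      ultimately show ?thesis unfolding F'e[OF a] by (simp add: distrib_left)
    qed
    have "F' w = F' w * (\<Sum>a\<in>A'. e a)" by (simp add: one)
    also have "\<dots> = (\<Sum>a\<in>A'. F w * (cs (g' a / g a w) (e a) + \<l>1 a w))"
      unfolding sum_distrib_left by (intro sum.cong refl) (simp add: FD)
    also have "\<dots> = F w * ((\<Sum>a\<in>A'. cs (g' a / g a w) (e a)) + (\<Sum>a\<in>A'. \<l>1 a w))"
      by (simp add: sum_distrib_left sum.distrib[symmetric])
    finally have F'Z: "F' w = F w * ((\<Sum>a\<in>A'. cs (g' a / g a w) (e a)) + (\<Sum>a\<in>A'. \<l>1 a w))" .
    have "Y w * F' w = (\<Sum>a\<in>A'. cs (g' a / g a w) (e a)) + (\<Sum>a\<in>A'. \<l>1 a w)"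
      unfolding F'Z mult.assoc[symmetric] Y[OF w] by (rule mult_1)
    moreover have "(\<Sum>a\<in>A'. cs (g' a / g a w) (e a)) = (\<Sum>a\<in>A'. \<Sum>s\<in>S. cs (of_int (\<mu> a s) / (w - s)) (e a))"
      by (intro sum.cong refl) (simp add: gg cs_sum_left)
    ultimately show ?thesis unfolding 1 by simp
  qed
  have \<Lambda>: "\<forall>s k. nilp (\<Lambda> s k) \<and> (\<forall>X. (\<forall>w. w \<notin> S \<longrightarrow> X * F w = F w * X) \<longrightarrow> X * \<Lambda> s k = \<Lambda> s k * X)"
    using pf(1) unfolding W_def cF_def by blast
  have ce': "\<forall>a\<in>A'. \<forall>X. (\<forall>w. w \<notin> S \<longrightarrow> X * F w = F w * X) \<longrightarrow> X * e a = e a * X"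
    using ce unfolding cF_def by blast
  show ?thesis
    by (rule exI[of _ A'], rule exI[of _ e], rule exI[of _ \<mu>], rule exI[of _ K], rule exI[of _ Q], rule exI[of _ \<Lambda>])
       (intro conjI A' one orth \<Lambda> ce' allI impI logd)
qed

section \<open>Residue data of a module\<close>

definition Lsum :: "complex set \<Rightarrow> nat \<Rightarrow> (complex \<Rightarrow> nat \<Rightarrow> 'n::finite sqm) \<Rightarrow> complex \<Rightarrow> 'n sqm" where
  "Lsum S K C w = (\<Sum>s\<in>S. \<Sum>k<K. cs (1 / (w - s) ^ Suc k) (C s k))"

lemma Lsum_extend: "K \<le> K' \<Longrightarrow> (\<And>s k. k \<ge> K \<Longrightarrow> C s k = 0) \<Longrightarrow> Lsum S K' C w = Lsum S K C w"
proof -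
  assume K: "K \<le> K'" "\<And>s k. k \<ge> K \<Longrightarrow> C s k = 0"
  have "(\<Sum>k<K'. cs (1 / (w - s) ^ Suc k) (C s k)) = (\<Sum>k<K. cs (1 / (w - s) ^ Suc k) (C s k))" for s
    by (rule sum.mono_neutral_right) (use K in auto)
  then show ?thesis unfolding Lsum_def by simp
qed

text \<open>The singular set S is a parameter because for shifts and tensor products an explicit set
  is at hand, while their \<open>spec\<close> is not computed. Coefficients vanish outside S and
  from K on, so index ranges of sums can be enlarged freely.\<close>

definition logdata :: "('i, 'n::finite) lrep \<Rightarrow> complex set \<Rightarrow> nat \<Rightarrow> ('i \<Rightarrow> complex \<Rightarrow> nat \<Rightarrow> 'n sqm) \<Rightarrow> bool" where
  "logdata V S K L \<longleftrightarrow> finite S \<and> 0 \<notin> S \<and>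
    (\<forall>i w. w \<notin> S \<longrightarrow> invertible (Psi_fun V i w) \<and>
       (\<forall>a b. (\<lambda>z. Psi_fun V i z $ a $ b) field_differentiable (at w)) \<and>
       matrix_inv (Psi_fun V i w) ** mderiv (Psi_fun V i) w = mat_of (Lsum S K (L i) w)) \<and>
    (\<forall>i. (\<Sum>s\<in>S. L i s 0) = 0) \<and> (\<forall>i s k. s \<notin> S \<or> k \<ge> K \<longrightarrow> L i s k = 0)"

text \<open>Kept apart from \<open>logdata\<close>: exponents near 0 can be evaluated from
  \<open>logdata\<close> alone, and this finer information enters where exponentials are shown to be
  rational or to commute.\<close>

definition structured :: "('i, 'n::finite) lrep \<Rightarrow> ('i \<Rightarrow> complex \<Rightarrow> nat \<Rightarrow> 'n sqm) \<Rightarrow> bool" where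
  "structured V L \<longleftrightarrow> (\<forall>i s. intss (L i s 0)) \<and> (\<forall>i s k. k > 0 \<longrightarrow> nilp (L i s k)) \<and>
     (\<forall>i s k j s' k'. L i s k * L j s' k' = L j s' k' * L i s k)"

lemma intss_0: "intss 0"
  by (rule intssI[of "{()}" _ "\<lambda>_. 0" "\<lambda>_. 1"]) auto

lemma good_logdata_single:
  fixes V :: "('i::finite, 'n::finite) lrep"
  assumes V: "good V"
  shows "\<exists>K L. (\<forall>w. w \<notin> spec V \<longrightarrow> matrix_inv (Psi_fun V i w) ** mderiv (Psi_fun V i) w = mat_of (Lsum (spec V) K L w)) \<and>
    (\<Sum>s\<in>spec V. L s 0) = 0 \<and> (\<forall>s k. s \<notin> spec V \<or> k \<ge> K \<longrightarrow> L s k = 0) \<and>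
    (\<forall>s. intss (L s 0)) \<and> (\<forall>s k. k > 0 \<longrightarrow> nilp (L s k)) \<and>
    (\<forall>X. (\<forall>r. X * Sq (Pp V i r) = Sq (Pp V i r) * X) \<longrightarrow> (\<forall>s k. X * L s k = L s k * X))"
proof -
  let ?S = "spec V"
  define F where "F w = Sq (Psi_fun V i w)" for w
  define Y where "Y w = Sq (matrix_inv (Psi_fun V i w))" for w
  define F' where "F' w = Sq (mderiv (Psi_fun V i) w)" for w
  have S: "finite ?S" by (rule finite_spec[OF V])
  obtain r D C where rDC: "r \<noteq> 0" "\<And>w. w \<notin> ?S \<Longrightarrow> poly r w \<noteq> 0"
    "\<And>w. w \<notin> ?S \<Longrightarrow> F w = (\<Sum>m\<le>(D::nat). cs (w ^ m / poly r w) (C m))"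
    using mreg_common_denominator[OF mreg_Psi[OF V, of i]] unfolding F_def by blast
  have comm: "F z * F w = F w * F z" if "z \<notin> ?S" "w \<notin> ?S" for z w
    unfolding F_def Sq_simps(6)[symmetric] using Psi_commute[OF V that] by simp
  have YF: "Y w * F w = 1" if "w \<notin> ?S" for w
    unfolding F_def Y_def Sq_simps(6)[symmetric] matrix_inv_mult(2)[OF invertible_Psi[OF V that]] Sq_simps ..
  have sd: "sder F (F' w) w" if w: "w \<notin> ?S" for w
    unfolding sder_def
  proof (intro allI)
    fix a b
    have "(\<lambda>z. Psi_fun V i z $ a $ b) field_differentiable (at w)"
      using rreg_field_differentiable[OF _ S w] mreg_Psi[OF V, of i] unfolding mreg_def by blast
    then show "((\<lambda>z. mat_of (F z) $ a $ b) has_field_derivative mat_of (F' w) $ a $ b) (at w)"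
      using field_differentiable_derivI by (simp add: F_def F'_def mderiv_def)
  qed
  have "\<exists>A (e :: complex list \<Rightarrow> 'n sqm) \<nu> K Q \<Lambda>. finite A \<and> (\<Sum>a\<in>A. e a) = 1 \<and>
    (\<forall>a\<in>A. \<forall>b\<in>A. e a * e b = (if a = b then e a else 0)) \<and>
    (\<forall>a\<in>A. \<forall>X. (\<forall>w. w \<notin> ?S \<longrightarrow> X * F w = F w * X) \<longrightarrow> X * e a = e a * X) \<and>
    (\<forall>s k. nilp (\<Lambda> s k) \<and> (\<forall>X. (\<forall>w. w \<notin> ?S \<longrightarrow> X * F w = F w * X) \<longrightarrow> X * \<Lambda> s k = \<Lambda> s k * X)) \<and>
    (\<forall>w. w \<notin> ?S \<longrightarrow> Y w * F' w = (\<Sum>a\<in>A. \<Sum>s\<in>?S. cs (of_int (\<nu> a s) / (w - s)) (e a)) +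
       ((\<Sum>j<K. cs (of_nat j * w ^ (j - 1)) (Q j)) +
         (\<Sum>s\<in>?S. \<Sum>k<K. cs (- of_nat (Suc k) / (w - s) ^ Suc (Suc k)) (\<Lambda> s k))))"
    by (rule logderiv_structure_pre[OF S rDC comm YF sd])
  then obtain A e \<nu> K Q \<Lambda> where h: "finite (A :: complex list set)" "(\<Sum>a\<in>A. e a) = 1"
    "\<forall>a\<in>A. \<forall>b\<in>A. e a * e b = (if a = b then e a else 0)"
    "\<forall>a\<in>A. \<forall>X. (\<forall>w. w \<notin> ?S \<longrightarrow> X * F w = F w * X) \<longrightarrow> X * e a = e a * X"
    "\<forall>s k. nilp (\<Lambda> s k) \<and> (\<forall>X. (\<forall>w. w \<notin> ?S \<longrightarrow> X * F w = F w * X) \<longrightarrow> X * \<Lambda> s k = \<Lambda> s k * X)"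
    "\<forall>w. w \<notin> ?S \<longrightarrow> Y w * F' w = (\<Sum>a\<in>A. \<Sum>s\<in>?S. cs (of_int (\<nu> a s) / (w - s)) (e a)) +
       ((\<Sum>j<K. cs (of_nat j * w ^ (j - 1)) (Q j)) +
         (\<Sum>s\<in>?S. \<Sum>k<K. cs (- of_nat (Suc k) / (w - s) ^ Suc (Suc k)) (\<Lambda> s k)))"
    by (elim exE conjE) (rule that)
  define P where "P s = (\<Sum>a\<in>A. cs (of_int (\<nu> a s)) (e a))" for s
  \<comment> \<open>The term with \<open>\<Lambda> s k\<close> has order k + 2, hence index k + 1,
    and carries the factor -(k + 1) from differentiation.\<close>
  define L where "L s k = (if s \<notin> ?S then 0 else case k of 0 \<Rightarrow> P s
      | Suc k \<Rightarrow> (if k < K then cs (- of_nat (Suc k)) (\<Lambda> s k) else 0))" for s k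
  have form: "Y w * F' w = (\<Sum>j<K. cs (of_nat j * w ^ (j - 1)) (Q j)) + Lsum ?S (Suc K) L w" if w: "w \<notin> ?S" for w
  proof -
    have "Lsum ?S (Suc K) L w = (\<Sum>s\<in>?S. cs (1 / (w - s)) (P s)) +
        (\<Sum>s\<in>?S. \<Sum>k<K. cs (1 / (w - s) ^ Suc (Suc k)) (L s (Suc k)))"
      unfolding Lsum_def sum.lessThan_Suc_shift sum.distrib by (simp add: L_def)
    also have "(\<Sum>s\<in>?S. \<Sum>k<K. cs (1 / (w - s) ^ Suc (Suc k)) (L s (Suc k)))
        = (\<Sum>s\<in>?S. \<Sum>k<K. cs (- of_nat (Suc k) / (w - s) ^ Suc (Suc k)) (\<Lambda> s k))"
      by (intro sum.cong refl) (simp add: L_def)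
    also have "(\<Sum>s\<in>?S. cs (1 / (w - s)) (P s)) = (\<Sum>a\<in>A. \<Sum>s\<in>?S. cs (of_int (\<nu> a s) / (w - s)) (e a))"
      unfolding P_def by (subst sum.swap) (simp add: cs_sum_right)
    finally show ?thesis using h(6) w by (simp add: add_ac)
  qed
  \<comment> \<open>Entry by entry, the decay at infinity kills the polynomial part and the total
    residue.\<close>
  have dec: "poly q w = 0 \<and> (\<Sum>s\<in>?S. mat_of (L s 0) $ a $ b) = 0"
    if q: "q = (\<Sum>j<K. monom (of_nat j * mat_of (Q j) $ a $ b) (j - 1))" for q a b w
  proof -
    let ?c = "\<lambda>s k. mat_of (L s k) $ a $ b"
    have eq: "(matrix_inv (Psi_fun V i w) ** mderiv (Psi_fun V i) w) $ a $ b = poly q w + pfsum ?S (Suc K) ?c w"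
      if w: "w \<notin> ?S" for w
    proof -
      have "(matrix_inv (Psi_fun V i w) ** mderiv (Psi_fun V i) w) $ a $ b = mat_of (Y w * F' w) $ a $ b"
        by (simp add: Y_def F'_def)
      also have "\<dots> = (\<Sum>j<K. of_nat j * w ^ (j - 1) * mat_of (Q j) $ a $ b) + (\<Sum>s\<in>?S. \<Sum>k<Suc K. 1 / (w - s) ^ Suc k * ?c s k)"
        unfolding form[OF w] Lsum_def
        by (simp only: mat_of_simps mat_of_sum vector_add_component sum_component mat_of_cs_nth)
      also have "\<dots> = poly q w + pfsum ?S (Suc K) ?c w"
        unfolding q pfsum_def poly_sum poly_monom by (simp add: mult_ac)
      finally show ?thesis .
    qed
    have "\<forall>\<^sub>F y in at 0. 1 / y \<notin> ?S" by (rule eventually_one_div_not_in_finite[OF S])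
    then have "\<exists>R. \<forall>w. R < norm w \<longrightarrow> w \<notin> ?S" by (rule iffD2[OF eventually_at_infinity_inverse])
    then obtain R where R: "\<And>w. R < norm w \<Longrightarrow> w \<notin> ?S" by blast
    have "((\<lambda>w. w * (poly q w + pfsum ?S (Suc K) ?c w)) \<longlongrightarrow> 0) at_infinity"
    proof (rule Lim_transform_eventually[OF logderiv_decay[OF V, of i a b]])
      show "\<forall>\<^sub>F w in at_infinity. w * (matrix_inv (Psi_fun V i w) ** mderiv (Psi_fun V i) w) $ a $ b
         = w * (poly q w + pfsum ?S (Suc K) ?c w)"
        unfolding eventually_at_infinity by (rule exI[of _ "R + 1"]) (use R eq in auto)
    qed
    from decaying_partial_fraction[OF S this] show ?thesis by simp
  qed
  have Q0: "(\<Sum>j<K. cs (of_nat j * w ^ (j - 1)) (Q j)) = 0" for w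
  proof (rule sqm_eqI)
    fix a b
    have "poly (\<Sum>j<K. monom (of_nat j * mat_of (Q j) $ a $ b) (j - 1)) w = 0" using dec by blast
    then show "mat_of (\<Sum>j<K. cs (of_nat j * w ^ (j - 1)) (Q j)) $ a $ b = mat_of 0 $ a $ b"
      by (simp add: mat_of_sum poly_sum poly_monom mult_ac)
  qed
  have 1: "matrix_inv (Psi_fun V i w) ** mderiv (Psi_fun V i) w = mat_of (Lsum ?S (Suc K) L w)" if "w \<notin> ?S" for w
    using form[OF that] unfolding Q0 Y_def F'_def Sq_simps(6)[symmetric] by (metis add_0 mat_of_Sq)
  have 2: "(\<Sum>s\<in>?S. L s 0) = 0"
  proof (rule sqm_eqI)
    show "mat_of (\<Sum>s\<in>?S. L s 0) $ a $ b = mat_of 0 $ a $ b" for a b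
      using dec[OF refl, of a b] by (simp add: mat_of_sum)
  qed
  have 3: "L s k = 0" if "s \<notin> ?S \<or> k \<ge> Suc K" for s k
    using that by (auto simp: L_def split: nat.split)
  have 4: "intss (L s 0)" for s
  proof (cases "s \<in> ?S")
    case True
    have "intss (P s)"
      by (rule intssI[OF h(1) _ h(2), where \<nu> = "\<lambda>a. \<nu> a s"]) (use h(3) in \<open>auto simp: P_def\<close>)
    then show ?thesis using True by (simp add: L_def)
  qed (simp add: L_def intss_0)
  have 5: "nilp (L s k)" if "k > 0" for s k
    using that h(5) by (cases k) (auto simp: L_def intro!: nilp_cs)
  have 6: "X * L s k = L s k * X" if X: "\<forall>r. X * Sq (Pp V i r) = Sq (Pp V i r) * X" for X s k
  proof -
    have "mat_of X ** Pp V i r = Pp V i r ** mat_of X" for r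
    proof -
      have "mat_of (X * Sq (Pp V i r)) = mat_of (Sq (Pp V i r) * X)" using X by simp
      then show ?thesis by simp
    qed
    then have "mat_of X ** Psi_fun V i w = Psi_fun V i w ** mat_of X" if "w \<notin> ?S" for w
      using Psi_commute_of_Pp[OF V _ that] by blast
    then have XF: "\<forall>w. w \<notin> ?S \<longrightarrow> X * F w = F w * X"
      unfolding F_def by (intro allI impI mat_of_eqI) simp
    have XP: "X * P s = P s * X"
      unfolding P_def
    proof (rule commute_sum)
      fix a assume "a \<in> A"
      then have "X * e a = e a * X" using h(4) XF by blast
      then show "X * cs (of_int (\<nu> a s)) (e a) = cs (of_int (\<nu> a s)) (e a) * X" by simp
    qed
    have X\<Lambda>: "X * \<Lambda> s k = \<Lambda> s k * X" for s k using h(5) XF by blast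
    show ?thesis
      by (cases k) (simp_all add: L_def XP X\<Lambda>)
  qed
  show ?thesis
    by (rule exI[of _ "Suc K"], rule exI[of _ L]) (intro conjI allI impI 1 2 3 4 5 6; simp)
qed

lemma good_logdata:
  fixes V :: "('i::finite, 'n::finite) lrep"
  assumes V: "good V"
  shows "\<exists>K L. logdata V (spec V) K L \<and> structured V L"
proof -
  define Q where "Q i K L \<longleftrightarrow> (\<forall>w. w \<notin> spec V \<longrightarrow> matrix_inv (Psi_fun V i w) ** mderiv (Psi_fun V i) w = mat_of (Lsum (spec V) K L w)) \<and>
    (\<Sum>s\<in>spec V. L s 0) = 0 \<and> (\<forall>s k. s \<notin> spec V \<or> k \<ge> K \<longrightarrow> L s k = 0) \<and>
    (\<forall>s. intss (L s 0)) \<and> (\<forall>s k. k > 0 \<longrightarrow> nilp (L s k)) \<and>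
    (\<forall>X. (\<forall>r. X * Sq (Pp V i r) = Sq (Pp V i r) * X) \<longrightarrow> (\<forall>s k. X * L s k = L s k * X))" for i K L
  have "\<exists>K L. Q i K L" for i unfolding Q_def by (rule good_logdata_single[OF V])
  then obtain K L where "\<And>i. Q i (K i) (L i)" by metis
  then have h: "\<And>i w. w \<notin> spec V \<Longrightarrow> matrix_inv (Psi_fun V i w) ** mderiv (Psi_fun V i) w = mat_of (Lsum (spec V) (K i) (L i) w)"
    "\<And>i. (\<Sum>s\<in>spec V. L i s 0) = 0" "\<And>i s k. s \<notin> spec V \<or> k \<ge> K i \<Longrightarrow> L i s k = 0"
    "\<And>i s. intss (L i s 0)" "\<And>i s k. k > 0 \<Longrightarrow> nilp (L i s k)"
    "\<And>i X s k. (\<forall>r. X * Sq (Pp V i r) = Sq (Pp V i r) * X) \<Longrightarrow> X * L i s k = L i s k * X"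
    unfolding Q_def by blast+
  define K' where "K' = Max (range K)"
  have K': "K i \<le> K'" for i unfolding K'_def by (rule Max_ge) auto
  \<comment> \<open>The commutant property is used twice: coefficients for i commute with every
    \<open>Pp V j r\<close>, and hence with the coefficients for j.\<close>
  have c: "L i s k * L j s' k' = L j s' k' * L i s k" for i j s k s' k'
  proof (rule h(6), rule allI)
    fix r
    have "Sq (Pp V j r) * L i s k = L i s k * Sq (Pp V j r)"
    proof (rule h(6), rule allI)
      fix r'
      show "Sq (Pp V j r) * Sq (Pp V i r') = Sq (Pp V i r') * Sq (Pp V j r)"
        unfolding Sq_simps(6)[symmetric] Pp_commute[OF V, of j r i r'] ..
    qed
    then show "L i s k * Sq (Pp V j r) = Sq (Pp V j r) * L i s k" by (rule sym)
  qed
  have "structured V L" unfolding structured_def by (intro conjI allI impI h(4,5) c)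
  moreover have "logdata V (spec V) K' L"
    unfolding logdata_def
  proof (intro conjI allI impI)
    fix i w assume w: "w \<notin> spec V"
    show "(\<lambda>z. Psi_fun V i z $ a $ b) field_differentiable (at w)" for a b
      using rreg_field_differentiable[OF _ finite_spec[OF V] w] mreg_Psi[OF V, of i] unfolding mreg_def by blast
    have "Lsum (spec V) K' (L i) w = Lsum (spec V) (K i) (L i) w"
      by (rule Lsum_extend[OF K']) (use h(3) in blast)
    then show "matrix_inv (Psi_fun V i w) ** mderiv (Psi_fun V i) w = mat_of (Lsum (spec V) K' (L i) w)"
      using h(1)[OF w] by simp
  next
    fix i s k assume "s \<notin> spec V \<or> k \<ge> K'"
    then have "s \<notin> spec V \<or> k \<ge> K i" using K'[of i] by linarith
    then show "L i s k = 0" by (rule h(3))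
  qed (use finite_spec[OF V] zero_notin_spec[OF V] invertible_Psi[OF V] h(2) in auto)
  ultimately show ?thesis by blast
qed

section \<open>The pairing functions\<close>

text \<open>\<open>pairing k m \<kappa> s t\<close> is the k-th Taylor coefficient at \<open>w = s\<close> of the primitive of \<open>1/(u - t)^(m+1)\<close>
  evaluated at \<open>u = \<kappa> w\<close> (up to a constant when \<open>k = 0 < m\<close>).\<close>

definition pairing :: "nat \<Rightarrow> nat \<Rightarrow> complex \<Rightarrow> complex \<Rightarrow> complex \<Rightarrow> complex" where
  "pairing k m \<kappa> s t = (if k = 0 \<and> m = 0 then Ln (1 - \<kappa> * s / t)
     else (-1) ^ Suc k * fact (k + m - 1) / (fact k * fact m) * \<kappa> ^ k / (\<kappa> * s - t) ^ (k + m))"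

text \<open>The cut of \<open>Ln (1 - u / t)\<close> is exactly the ray from t away from 0, so the
  principal branch is the logarithm obtained by integration along segments from 0.\<close>

lemma in_segment_iff:
  assumes "t \<noteq> (0 :: complex)"
  shows "t \<in> closed_segment 0 u \<longleftrightarrow> 1 - u / t \<in> \<real>\<^sub>\<le>\<^sub>0"
proof
  assume "t \<in> closed_segment 0 u"
  then obtain x where x: "0 \<le> x" "x \<le> 1" "t = of_real x * u"
    by (auto simp: closed_segment_def scaleR_conv_of_real)
  then have "x > 0" "u \<noteq> 0" using assms by auto
  then have "1 - u / t = of_real (1 - 1 / x)" using x by simp
  moreover have "1 - 1 / x \<le> 0" using x \<open>x > 0\<close> by simp
  ultimately show "1 - u / t \<in> \<real>\<^sub>\<le>\<^sub>0" by (metis nonpos_Reals_of_real_iff)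
next
  assume "1 - u / t \<in> \<real>\<^sub>\<le>\<^sub>0"
  then obtain y where y: "1 - u / t = of_real y" "y \<le> 0" by (auto elim: nonpos_Reals_cases)
  have "u / t = of_real (1 - y)" using y(1) by (simp add: algebra_simps)
  then have "t = of_real (1 / (1 - y)) * u" using assms y(2) by (auto simp: field_simps)
  moreover have "0 \<le> 1 / (1 - y)" "1 / (1 - y) \<le> 1" using y(2) by auto
  ultimately show "t \<in> closed_segment 0 u"
    unfolding closed_segment_def by (auto simp: scaleR_conv_of_real intro!: exI[of _ "1 / (1 - y)"])
qed

text \<open>Differentiation in w raises k with the factor k + 1 expected of Taylor coefficients; the
  logarithm at k = m = 0 feeds into the same rational formula.\<close>

lemma pairing_deriv:
  assumes t: "t \<noteq> 0" and w: "t \<notin> closed_segment 0 (\<kappa> * w)"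
  shows "((\<lambda>w. pairing k m \<kappa> w t) has_field_derivative of_nat (Suc k) * pairing (Suc k) m \<kappa> w t) (at w)"
proof -
  have slit: "1 - \<kappa> * w / t \<notin> \<real>\<^sub>\<le>\<^sub>0" using w in_segment_iff[OF t] by blast
  then have "1 - \<kappa> * w / t \<noteq> 0" by (metis nonpos_Reals_zero_I)
  then have nz: "\<kappa> * w - t \<noteq> 0" using t by auto
  show ?thesis
  proof (cases "k = 0 \<and> m = 0")
    case True
    have "((\<lambda>w. Ln (1 - \<kappa> * w / t)) has_field_derivative inverse (1 - \<kappa> * w / t) * (- \<kappa> / t)) (at w)"
      by (rule DERIV_chain2[where f = Ln and g = "\<lambda>w. 1 - \<kappa> * w / t", OF has_field_derivative_Ln[OF slit]])
         (use t in \<open>auto intro!: derivative_eq_intros\<close>)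
    moreover have "inverse (1 - \<kappa> * w / t) * (- \<kappa> / t) = \<kappa> / (\<kappa> * w - t)"
      using nz t by (simp add: divide_simps) (simp add: algebra_simps)
    ultimately show ?thesis using True by (simp add: pairing_def)
  next
    case False
    then obtain n where n: "k + m = Suc n" by (cases "k + m") auto
    let ?A = "(-1) ^ Suc k * fact n / (fact k * fact m) * \<kappa> ^ k :: complex"
    have p: "pairing k m \<kappa> z t = ?A / (\<kappa> * z - t) ^ Suc n" for z
      unfolding pairing_def if_not_P[OF False] n by simp
    have "((\<lambda>z. ?A / (\<kappa> * z - t) ^ Suc n) has_field_derivative
       - (?A * (of_nat (Suc n) * \<kappa>)) / (\<kappa> * w - t) ^ Suc (Suc n)) (at w)"
    proof -
      have "((\<lambda>z. (\<kappa> * z - t) ^ Suc n) has_field_derivative of_nat (Suc n) * (\<kappa> * (\<kappa> * w - t) ^ n)) (at w)"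
        by (rule derivative_eq_intros refl)+ (simp add: algebra_simps)
      from DERIV_divide[OF DERIV_const this, of ?A] nz
      show ?thesis by (rule_tac DERIV_cong) (auto simp: divide_simps simp del: of_nat_Suc)
    qed
    moreover have "- (?A * (of_nat (Suc n) * \<kappa>)) / (\<kappa> * w - t) ^ Suc (Suc n) = of_nat (Suc k) * pairing (Suc k) m \<kappa> w t"
      unfolding pairing_def using n by (simp add: divide_simps del: of_nat_Suc)
    ultimately show ?thesis unfolding p by simp
  qed
qed

lemma pairing_0_scale: "pairing 0 m 1 (\<kappa> * w) t = pairing 0 m \<kappa> w t"
  by (simp add: pairing_def)

lemma pairing_1_primitive: "pairing (Suc 0) m 1 w t = 1 / (w - t) ^ Suc m"
  by (simp add: pairing_def)

section \<open>The logarithm along segments\<close>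

lemma closed_segment_0_scale:
  assumes "y \<in> closed_segment 0 x"
  shows "closed_segment 0 (\<kappa> * y) \<subseteq> closed_segment 0 (\<kappa> * x :: complex)"
proof -
  obtain u where u: "0 \<le> u" "u \<le> 1" "y = u *\<^sub>R x"
    using assms by (auto simp: closed_segment_def)
  then have "\<kappa> * y \<in> closed_segment 0 (\<kappa> * x)"
    unfolding closed_segment_def by (auto intro!: exI[of _ u])
  then show ?thesis by (simp add: subset_closed_segment)
qed

text \<open>A constant left factor such as \<open>Pp V j 0\<close> drops out of a logarithmic
  derivative.\<close>

lemma H_integrand:
  fixes V :: "('i::finite, 'n::finite) lrep"
  assumes V: "good V" and L: "logdata V S K L" and w: "w \<notin> S"
  shows "matrix_inv (Pp V j 0 ** Psi_fun V j w) ** mderiv (\<lambda>u. Pp V j 0 ** Psi_fun V j u) w = mat_of (Lsum S K (L j) w)"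
proof -
  let ?P = "Pp V j 0" and ?F = "Psi_fun V j"
  have inv: "invertible (?F w)" and fd: "\<And>a b. (\<lambda>z. ?F z $ a $ b) field_differentiable (at w)"
    and eq: "matrix_inv (?F w) ** mderiv ?F w = mat_of (Lsum S K (L j) w)"
    using L w unfolding logdata_def by blast+
  have "(?P ** ?F w) ** (matrix_inv (?F w) ** Pm V j 0) = ?P ** (?F w ** matrix_inv (?F w)) ** Pm V j 0"
    by (simp only: matrix_mul_assoc)
  then have "(?P ** ?F w) ** (matrix_inv (?F w) ** Pm V j 0) = mat 1"
    by (simp add: matrix_inv_mult(1)[OF inv] good_Pp0(1)[OF V])
  then have 1: "matrix_inv (?P ** ?F w) = matrix_inv (?F w) ** Pm V j 0" by (rule matrix_inv_unique)
  have 2: "mderiv (\<lambda>u. ?P ** ?F u) w = ?P ** mderiv ?F w"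
  proof -
    have "((\<lambda>z. \<Sum>k\<in>UNIV. ?P $ a $ k * ?F z $ k $ b) has_field_derivative
        (\<Sum>k\<in>UNIV. ?P $ a $ k * deriv (\<lambda>z. ?F z $ k $ b) w)) (at w)" for a b
      by (intro DERIV_sum DERIV_cmult field_differentiable_derivI fd)
    then show ?thesis by (simp add: vec_eq_iff mderiv_def cmat_nth_mult DERIV_imp_deriv)
  qed
  have "matrix_inv (?F w) ** Pm V j 0 ** (?P ** mderiv ?F w) = matrix_inv (?F w) ** (Pm V j 0 ** ?P) ** mderiv ?F w"
    by (simp only: matrix_mul_assoc)
  then show ?thesis unfolding 1 2 using eq by (simp add: good_Pp0(2)[OF V])
qed

text \<open>Only points of S with a nonzero coefficient must stay off the segment. At the others the
  integrand may deviate from its formula, but this concerns finitely many parameters and leaves the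
  integral unchanged.\<close>

lemma H_fun_formula:
  fixes V :: "('i::finite, 'n::finite) lrep"
  assumes V: "good V" and L: "logdata V S K L"
    and u: "\<And>t. t \<in> S \<Longrightarrow> \<exists>m. L j t m \<noteq> 0 \<Longrightarrow> t \<notin> closed_segment 0 u"
  shows "H_fun V j u = mat_of (\<Sum>t\<in>S. \<Sum>m<K. cs (pairing 0 m 1 u t - pairing 0 m 1 0 t) (L j t m))"
proof (cases "u = 0")
  case True
  then show ?thesis by (simp add: H_fun_def mcint_def vec_eq_iff mat_of_sum)
next
  case False
  have S: "finite S" "0 \<notin> S" using L unfolding logdata_def by blast+
  define T where "T = {t\<in>S. \<exists>m. L j t m \<noteq> 0}"
  have T: "finite T" "T \<subseteq> S" using S by (auto simp: T_def)
  have Tz: "L j t m = 0" if "t \<in> S - T" for t m using that by (auto simp: T_def)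
  let ?I = "\<lambda>w. matrix_inv (Pp V j 0 ** Psi_fun V j w) ** mderiv (\<lambda>u. Pp V j 0 ** Psi_fun V j u) w"
  have "H_fun V j u $ a $ b = mat_of (\<Sum>t\<in>S. \<Sum>m<K. cs (pairing 0 m 1 u t - pairing 0 m 1 0 t) (L j t m)) $ a $ b" for a b
  proof -
    let ?e = "\<lambda>t m. mat_of (L j t m) $ a $ b"
    define f where "f w = (\<Sum>t\<in>T. \<Sum>m<K. pairing 0 m 1 w t * ?e t m)" for w
    define g where "g w = (\<Sum>t\<in>T. \<Sum>m<K. 1 / (w - t) ^ Suc m * ?e t m)" for w
    have "(g has_contour_integral (f (pathfinish (linepath 0 u)) - f (pathstart (linepath 0 u)))) (linepath 0 u)"
    proof (rule contour_integral_primitive[where S = "closed_segment 0 u"])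
      fix w assume w: "w \<in> closed_segment 0 u"
      have "(f has_field_derivative g w) (at w)"
        unfolding f_def[abs_def] g_def
      proof (intro DERIV_sum)
        fix t m assume t: "t \<in> T"
        have "t \<notin> closed_segment 0 (1 * w)"
          using u[of t] t closed_segment_0_scale[OF w, of 1] by (auto simp: T_def)
        from pairing_deriv[OF _ this, of 0 m] t S T
        have "((\<lambda>w. pairing 0 m 1 w t) has_field_derivative 1 / (w - t) ^ Suc m) (at w)"
          by (auto simp: pairing_1_primitive)
        then show "((\<lambda>w. pairing 0 m 1 w t * ?e t m) has_field_derivative 1 / (w - t) ^ Suc m * ?e t m) (at w)"
          by (rule DERIV_cmult_right)
      qed
      then show "(f has_field_derivative g w) (at w within closed_segment 0 u)"
        by (rule has_field_derivative_at_within)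
    qed (rule valid_path_linepath, simp only: path_image_linepath subset_refl)
    then have gi: "((\<lambda>x. g (linepath 0 u x) * (u - 0)) has_integral (f u - f 0)) {0..1}"
      unfolding has_contour_integral_linepath by simp
    have "((\<lambda>w. ?I w $ a $ b) has_contour_integral (f u - f 0)) (linepath 0 u)"
      unfolding has_contour_integral_linepath
    proof (rule has_integral_spike_finite[OF _ _ gi])
      let ?N = "{x. linepath 0 u x \<in> S}"
      have "?N \<subseteq> (\<lambda>s. Re (s / u)) ` S"
      proof
        fix x assume "x \<in> ?N"
        then have "linepath 0 u x \<in> S" "x = Re (linepath 0 u x / u)"
          using False by (auto simp: linepath_def scaleR_conv_of_real)
        then show "x \<in> (\<lambda>s. Re (s / u)) ` S" by blast
      qed
      then show "finite ?N" using S(1) finite_surj by blast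
      fix x assume "x \<in> {0..1} - ?N"
      then have x: "linepath 0 u x \<notin> S" by simp
      let ?w = "linepath 0 u x"
      have "?I ?w $ a $ b = (\<Sum>t\<in>S. \<Sum>m<K. 1 / (?w - t) ^ Suc m * ?e t m)"
        unfolding H_integrand[OF V L x] Lsum_def by (simp only: mat_of_sum sum_component mat_of_cs_nth)
      also have "\<dots> = g ?w" unfolding g_def
        by (rule sum.mono_neutral_right) (use S T Tz in auto)
      finally show "?I ?w $ a $ b * (u - 0) = g ?w * (u - 0)" by simp
    qed
    then have "H_fun V j u $ a $ b = f u - f 0"
      unfolding H_fun_def Let_def mcint_def by (simp add: contour_integral_unique)
    also have "\<dots> = (\<Sum>t\<in>T. \<Sum>m<K. (pairing 0 m 1 u t - pairing 0 m 1 0 t) * ?e t m)"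
      unfolding f_def by (simp add: sum_subtractf left_diff_distrib)
    also have "\<dots> = (\<Sum>t\<in>S. \<Sum>m<K. (pairing 0 m 1 u t - pairing 0 m 1 0 t) * ?e t m)"
      by (rule sum.mono_neutral_left) (use S T Tz in auto)
    finally show ?thesis by (simp only: mat_of_sum sum_component mat_of_cs_nth)
  qed
  then show ?thesis by (simp add: vec_eq_iff)
qed

section \<open>Residue computation of the exponent\<close>

text \<open>The region is star-shaped about 0, hence connected as the residue theorem
  requires.\<close>

lemma slit_region:
  fixes \<kappa> t :: complex
  assumes t: "t \<noteq> 0"
  defines "U \<equiv> {w. t \<notin> closed_segment 0 (\<kappa> * w)}"
  shows "open U" "connected U"
proof -
  have "U = (\<lambda>w. 1 - \<kappa> * w / t) -` (- \<real>\<^sub>\<le>\<^sub>0)" unfolding U_def in_segment_iff[OF t] by auto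
  then show "open U" by (simp only:) (intro open_vimage continuous_intros, use t in auto)
  have "starlike U" unfolding starlike_def
  proof (intro bexI[of _ 0] ballI subsetI)
    show "0 \<in> U" using t by (simp add: U_def)
    fix x y assume "x \<in> U" "y \<in> closed_segment 0 x"
    then show "y \<in> U" using closed_segment_0_scale[of y x \<kappa>] unfolding U_def by blast
  qed
  then show "connected U" by (rule starlike_imp_connected)
qed

text \<open>The only singularity round which the contour winds is s, where the residue of
  \<open>f w / (w - s) ^ Suc k\<close> is the k-th Taylor coefficient of f. The constant \<delta>
  shows up for k = 0 only.\<close>

lemma pairing_contour_integral:
  assumes t: "t \<noteq> 0" and \<gamma>: "valid_path \<gamma>" "pathfinish \<gamma> = pathstart \<gamma>"
    and dom: "\<And>z. t \<in> closed_segment 0 (\<kappa> * z) \<Longrightarrow> z \<notin> path_image \<gamma> \<and> winding_number \<gamma> z = 0"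
    and s: "s \<notin> path_image \<gamma>" "winding_number \<gamma> s = 1"
  shows "((\<lambda>w. 1 / (w - s) ^ Suc k * (pairing 0 m 1 (\<kappa> * w) t - \<delta>)) has_contour_integral
     2 * pi * \<i> * (pairing k m \<kappa> s t - (if k = 0 then \<delta> else 0))) \<gamma>"
proof -
  define U where "U = {w. t \<notin> closed_segment 0 (\<kappa> * w)}"
  have U: "open U" "connected U" unfolding U_def by (rule slit_region[OF t])+
  define f where "f w = pairing 0 m \<kappa> w t - \<delta>" for w
  have der: "((\<lambda>w. pairing k m \<kappa> w t) has_field_derivative of_nat (Suc k) * pairing (Suc k) m \<kappa> w t) (at w)"
    if "w \<in> U" for k w
    by (rule pairing_deriv[OF t]) (use that in \<open>simp add: U_def\<close>)
  have f: "f holomorphic_on U"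
  proof -
    have "f field_differentiable (at w)" if "w \<in> U" for w
      unfolding f_def[abs_def] field_differentiable_def
      using DERIV_diff[OF der[OF that, of 0] DERIV_const[of \<delta>]] by blast
    then show ?thesis using holomorphic_onI field_differentiable_at_within by blast
  qed
  have hd: "(deriv ^^ k) f w = fact k * pairing k m \<kappa> w t - (if k = 0 then \<delta> else 0)" if "w \<in> U" for w
    using that
  proof (induction k arbitrary: w)
    case (Suc k)
    have "((\<lambda>w. fact k * pairing k m \<kappa> w t - (if k = 0 then \<delta> else 0)) has_field_derivative
        fact k * (of_nat (Suc k) * pairing (Suc k) m \<kappa> w t) - 0) (at w)"
      by (intro DERIV_diff DERIV_cmult der[OF Suc.prems] DERIV_const)
    then have "((deriv ^^ k) f has_field_derivative fact k * (of_nat (Suc k) * pairing (Suc k) m \<kappa> w t) - 0) (at w)"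
      by (rule has_field_derivative_transform_within_open[OF _ U(1) Suc.prems]) (simp add: Suc.IH)
    then show ?case by (simp add: DERIV_imp_deriv algebra_simps)
  qed (simp add: f_def)
  have sU: "s \<in> U" using dom[of s] s unfolding U_def by auto
  have pU: "path_image \<gamma> \<subseteq> U - {s}" using dom s(1) unfolding U_def by auto
  let ?g = "\<lambda>w. f w / (w - s) ^ Suc k"
  have hol: "?g holomorphic_on U - {s}"
    by (intro holomorphic_intros holomorphic_on_subset[OF f]) auto
  have "contour_integral \<gamma> ?g = 2 * pi * \<i> * (\<Sum>p\<in>{s}. winding_number \<gamma> p * residue ?g p)"
    by (rule Residue_theorem[OF U _ hol \<gamma> pU]) (use dom in \<open>auto simp: U_def\<close>)
  also have "\<dots> = 2 * pi * \<i> * ((deriv ^^ k) f s / fact k)"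
    using residue_holomorphic_over_power[OF U(1) sU f] s by simp
  also have "(deriv ^^ k) f s / fact k = pairing k m \<kappa> s t - (if k = 0 then \<delta> else 0)"
    unfolding hd[OF sU] by simp
  finally have ci: "contour_integral \<gamma> ?g = 2 * pi * \<i> * (pairing k m \<kappa> s t - (if k = 0 then \<delta> else 0))" .
  have "open (U - {s})" using U(1) by (simp add: open_delete)
  then have "?g contour_integrable_on \<gamma>" by (intro contour_integrable_holomorphic_simple[OF hol _ \<gamma>(1) pU])
  then have "(?g has_contour_integral 2 * pi * \<i> * (pairing k m \<kappa> s t - (if k = 0 then \<delta> else 0))) \<gamma>"
    using has_contour_integral_integral ci by metis
  moreover have "?g = (\<lambda>w. 1 / (w - s) ^ Suc k * (pairing 0 m 1 (\<kappa> * w) t - \<delta>))"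
    by (simp add: fun_eq_iff f_def pairing_0_scale)
  ultimately show ?thesis by simp
qed

definition pairsum :: "complex \<Rightarrow> complex set \<Rightarrow> nat \<Rightarrow> (complex \<Rightarrow> nat \<Rightarrow> 'n::finite sqm) \<Rightarrow>
    complex set \<Rightarrow> nat \<Rightarrow> (complex \<Rightarrow> nat \<Rightarrow> 'm::finite sqm) \<Rightarrow> ('n \<times> 'm) sqm" where
  "pairsum \<kappa> S K C T M D = (\<Sum>s\<in>S. \<Sum>k<K. \<Sum>t\<in>T. \<Sum>m<M. cs (pairing k m \<kappa> s t) (kronS (C s k) (D t m)))"

lemma moint_formula:
  fixes V1 :: "('i::finite, 'n::finite) lrep" and V2 :: "('i, 'm::finite) lrep"
  assumes L1: "logdata V1 S1 K1 L1" and V2: "good V2" and L2: "logdata V2 S2 K2 L2"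
    and \<gamma>: "valid_path \<gamma>" "pathfinish \<gamma> = pathstart \<gamma>" "path_image \<gamma> \<inter> S1 = {}"
      "\<And>s. s \<in> S1 \<Longrightarrow> winding_number \<gamma> s = 1"
    and dom: "\<And>t z. t \<in> S2 \<Longrightarrow> \<exists>m. L2 j t m \<noteq> 0 \<Longrightarrow> t \<in> closed_segment 0 (\<kappa> * z) \<Longrightarrow>
       z \<notin> path_image \<gamma> \<and> winding_number \<gamma> z = 0"
  shows "moint \<gamma> (\<lambda>w. kron (matrix_inv (Psi_fun V1 i w) ** mderiv (Psi_fun V1 i) w) (H_fun V2 j (\<kappa> * w)))
     = mat_of (pairsum \<kappa> S1 K1 (L1 i) S2 K2 (L2 j))"
proof -
  have S: "finite S1" "finite S2" "0 \<notin> S2" and z1: "(\<Sum>s\<in>S1. L1 i s 0) = 0" and l1: "\<And>w. w \<notin> S1 \<Longrightarrow>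
     matrix_inv (Psi_fun V1 i w) ** mderiv (Psi_fun V1 i) w = mat_of (Lsum S1 K1 (L1 i) w)"
    and lK: "\<And>s k. k \<ge> K1 \<Longrightarrow> L1 i s k = 0"
    using L1 L2 unfolding logdata_def by blast+
  have "moint \<gamma> (\<lambda>w. kron (matrix_inv (Psi_fun V1 i w) ** mderiv (Psi_fun V1 i) w) (H_fun V2 j (\<kappa> * w))) $ x $ y
     = mat_of (pairsum \<kappa> S1 K1 (L1 i) S2 K2 (L2 j)) $ x $ y" for x y
  proof -
    define a where "a s k = mat_of (L1 i s k) $ fst x $ fst y" for s k
    define b where "b t m = mat_of (L2 j t m) $ snd x $ snd y" for t m
    define \<delta> where "\<delta> t m = pairing 0 m 1 0 t" for t m
    let ?c = "2 * pi * \<i>"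
    have one: "((\<lambda>w. a s k * b t m * (1 / (w - s) ^ Suc k * (pairing 0 m 1 (\<kappa> * w) t - \<delta> t m))) has_contour_integral
       a s k * b t m * (?c * (pairing k m \<kappa> s t - (if k = 0 then \<delta> t m else 0)))) \<gamma>"
      if st: "s \<in> S1" "t \<in> S2" for s k t m
    \<comment> \<open>If the coefficient vanishes, t may lie anywhere relative to the contour, but
      then both sides are 0.\<close>
    proof (cases "b t m = 0")
      case True
      then show ?thesis by (simp add: has_contour_integral_0)
    next
      case False
      then have ex: "\<exists>m. L2 j t m \<noteq> 0" unfolding b_def by (metis mat_of_simps(1) zero_index)
      show ?thesis
      proof (rule has_contour_integral_lmul, rule pairing_contour_integral)
        show "t \<noteq> 0" using st S by auto
        show "s \<notin> path_image \<gamma>" using st \<gamma>(3) by auto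
      qed (use \<gamma> dom[OF st(2) ex] st in auto)
    qed
    have "((\<lambda>w. \<Sum>s\<in>S1. \<Sum>k<K1. \<Sum>t\<in>S2. \<Sum>m<K2.
        a s k * b t m * (1 / (w - s) ^ Suc k * (pairing 0 m 1 (\<kappa> * w) t - \<delta> t m))) has_contour_integral
        (\<Sum>s\<in>S1. \<Sum>k<K1. \<Sum>t\<in>S2. \<Sum>m<K2. a s k * b t m * (?c * (pairing k m \<kappa> s t - (if k = 0 then \<delta> t m else 0))))) \<gamma>"
      by (intro has_contour_integral_sum S finite_lessThan one)
    then have hc: "((\<lambda>w. kron (matrix_inv (Psi_fun V1 i w) ** mderiv (Psi_fun V1 i) w) (H_fun V2 j (\<kappa> * w)) $ x $ y) has_contour_integral
        (\<Sum>s\<in>S1. \<Sum>k<K1. \<Sum>t\<in>S2. \<Sum>m<K2. a s k * b t m * (?c * (pairing k m \<kappa> s t - (if k = 0 then \<delta> t m else 0))))) \<gamma>"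
    proof (rule has_contour_integral_eq)
      fix w assume w: "w \<in> path_image \<gamma>"
      then have wS: "w \<notin> S1" using \<gamma>(3) by auto
      have H: "H_fun V2 j (\<kappa> * w) = mat_of (\<Sum>t\<in>S2. \<Sum>m<K2. cs (pairing 0 m 1 (\<kappa> * w) t - \<delta> t m) (L2 j t m))"
        unfolding \<delta>_def by (rule H_fun_formula[OF V2 L2]) (use dom w in blast)
      have "kron (matrix_inv (Psi_fun V1 i w) ** mderiv (Psi_fun V1 i) w) (H_fun V2 j (\<kappa> * w)) $ x $ y
        = (\<Sum>s\<in>S1. \<Sum>k<K1. 1 / (w - s) ^ Suc k * a s k) * (\<Sum>t\<in>S2. \<Sum>m<K2. (pairing 0 m 1 (\<kappa> * w) t - \<delta> t m) * b t m)"
        unfolding kron_nth H l1[OF wS] Lsum_def a_def b_def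
        by (simp only: mat_of_sum sum_component mat_of_cs_nth)
      also have "\<dots> = (\<Sum>s\<in>S1. \<Sum>k<K1. \<Sum>t\<in>S2. \<Sum>m<K2.
        a s k * b t m * (1 / (w - s) ^ Suc k * (pairing 0 m 1 (\<kappa> * w) t - \<delta> t m)))"
        unfolding sum_distrib_right unfolding sum_distrib_left by (intro sum.cong refl) (simp only: mult_ac)
      finally show "(\<Sum>s\<in>S1. \<Sum>k<K1. \<Sum>t\<in>S2. \<Sum>m<K2.
        a s k * b t m * (1 / (w - s) ^ Suc k * (pairing 0 m 1 (\<kappa> * w) t - \<delta> t m)))
        = kron (matrix_inv (Psi_fun V1 i w) ** mderiv (Psi_fun V1 i) w) (H_fun V2 j (\<kappa> * w)) $ x $ y" by (rule sym)
    qed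
    \<comment> \<open>The integration constants \<delta> occur only next to the residues
      \<open>a s 0\<close>, and these sum to zero.\<close>
    have za: "(\<Sum>s\<in>S1. a s 0) = 0"
    proof -
      have "mat_of (\<Sum>s\<in>S1. L1 i s 0) $ fst x $ fst y = 0" using z1 by simp
      then show ?thesis by (simp add: mat_of_sum a_def)
    qed
    have "(\<Sum>s\<in>S1. \<Sum>k<K1. \<Sum>t\<in>S2. \<Sum>m<K2. a s k * b t m * (?c * (pairing k m \<kappa> s t - (if k = 0 then \<delta> t m else 0))))
      = ?c * (\<Sum>s\<in>S1. \<Sum>k<K1. \<Sum>t\<in>S2. \<Sum>m<K2. pairing k m \<kappa> s t * (a s k * b t m))
       - ?c * (\<Sum>s\<in>S1. \<Sum>k<K1. \<Sum>t\<in>S2. \<Sum>m<K2. (if k = 0 then a s 0 else 0) * (b t m * \<delta> t m))"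
      unfolding sum_distrib_left sum_subtractf[symmetric]
      by (intro sum.cong refl) (auto simp: algebra_simps)
    also have "(\<Sum>s\<in>S1. \<Sum>k<K1. \<Sum>t\<in>S2. \<Sum>m<K2. (if k = 0 then a s 0 else 0) * (b t m * \<delta> t m))
       = (\<Sum>k<K1. (\<Sum>s\<in>S1. if k = 0 then a s 0 else 0) * (\<Sum>t\<in>S2. \<Sum>m<K2. b t m * \<delta> t m))"
      by (simp only: sum_distrib_left[symmetric] sum_distrib_right[symmetric] sum.swap[of _ "{..<K1}" S1])
    also have "\<dots> = 0"
    proof (rule sum.neutral, rule ballI)
      fix k
      show "(\<Sum>s\<in>S1. if k = 0 then a s 0 else 0) * (\<Sum>t\<in>S2. \<Sum>m<K2. b t m * \<delta> t m) = 0"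
        using za by (cases "k = 0") auto
    qed
    finally have val: "(\<Sum>s\<in>S1. \<Sum>k<K1. \<Sum>t\<in>S2. \<Sum>m<K2. a s k * b t m * (?c * (pairing k m \<kappa> s t - (if k = 0 then \<delta> t m else 0))))
      = ?c * mat_of (pairsum \<kappa> S1 K1 (L1 i) S2 K2 (L2 j)) $ x $ y"
      by (simp add: pairsum_def mat_of_sum mat_of_kronS kron_nth a_def b_def)
    show ?thesis
      unfolding moint_def mcint_def smat_nth vec_lambda_beta contour_integral_unique[OF hc] val by simp
  qed
  then show ?thesis by (simp add: vec_eq_iff)
qed

text \<open>The exponent with all contour integrals evaluated, so that no contour is left in
  it.\<close>

definition Eexp :: "complex \<Rightarrow> nat \<Rightarrow> ('i::finite \<Rightarrow> 'i \<Rightarrow> int \<Rightarrow> int) \<Rightarrow>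
    complex set \<Rightarrow> nat \<Rightarrow> ('i \<Rightarrow> complex \<Rightarrow> nat \<Rightarrow> 'n::finite sqm) \<Rightarrow>
    complex set \<Rightarrow> nat \<Rightarrow> ('i \<Rightarrow> complex \<Rightarrow> nat \<Rightarrow> 'm::finite sqm) \<Rightarrow> complex \<Rightarrow> ('n \<times> 'm) sqm" where
  "Eexp q l c S1 K1 L1 S2 K2 L2 \<zeta> = cs (-1) (\<Sum>i\<in>UNIV. \<Sum>j\<in>UNIV. \<Sum>r\<in>relevant_r c. cs (of_int (c i j r))
      (pairsum (q powi (int l + r) * \<zeta>) S1 K1 (L1 i) S2 K2 (L2 j)))"

lemma A_int_formula:
  fixes V1 :: "('i::finite, 'n::finite) lrep" and V2 :: "('i, 'm::finite) lrep"
  assumes L1: "logdata V1 S1 K1 L1" and V2: "good V2" and L2: "logdata V2 S2 K2 L2"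
    and \<gamma>: "valid_path \<gamma>" "pathfinish \<gamma> = pathstart \<gamma>" "path_image \<gamma> \<inter> S1 = {}"
      "\<And>s. s \<in> S1 \<Longrightarrow> winding_number \<gamma> s = 1"
    and dom: "\<And>j r t z. r \<in> relevant_r c \<Longrightarrow> t \<in> S2 \<Longrightarrow> \<exists>m. L2 j t m \<noteq> 0 \<Longrightarrow>
       t \<in> closed_segment 0 (q powi (int l + r) * \<zeta> * z) \<Longrightarrow> z \<notin> path_image \<gamma> \<and> winding_number \<gamma> z = 0"
  shows "A_int q l c V1 V2 \<gamma> \<zeta> = mat_of (exp (Eexp q l c S1 K1 L1 S2 K2 L2 \<zeta>))"
proof -
  have "(\<Sum>i\<in>UNIV. \<Sum>j\<in>UNIV. \<Sum>r\<in>relevant_r c. smat (of_int (c i j r))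
        (moint \<gamma> (\<lambda>w. kron (matrix_inv (Psi_fun V1 i w) ** mderiv (Psi_fun V1 i) w)
                          (H_fun V2 j (q powi (int l + r) * \<zeta> * w)))))
     = (\<Sum>i\<in>UNIV. \<Sum>j\<in>UNIV. \<Sum>r\<in>relevant_r c. smat (of_int (c i j r))
        (mat_of (pairsum (q powi (int l + r) * \<zeta>) S1 K1 (L1 i) S2 K2 (L2 j))))"
    by (intro sum.cong refl arg_cong[where f = "smat _"] moint_formula[OF L1 V2 L2 \<gamma>] dom)
  moreover have "mat_of (Eexp q l c S1 K1 L1 S2 K2 L2 \<zeta>) = smat (-1) (\<Sum>i\<in>UNIV. \<Sum>j\<in>UNIV. \<Sum>r\<in>relevant_r c. smat (of_int (c i j r))
        (mat_of (pairsum (q powi (int l + r) * \<zeta>) S1 K1 (L1 i) S2 K2 (L2 j))))"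
    by (simp add: Eexp_def mat_of_cs mat_of_sum)
  ultimately show ?thesis
    unfolding A_int_def mexp_exp by (metis Sq_mat_of)
qed

section \<open>Analyticity of the logarithm forces a slit domain\<close>

text \<open>The integral is not absolute, so cancellation has to be excluded. Rotation by
  \<open>cnj c1\<close> makes the real part positive and at least a multiple of 1 / (\<tau> - x)
  near \<tau>; the indefinite integral, bounded by continuity, would have to grow like a
  logarithm.\<close>

lemma not_integrable_at_pole:
  fixes f :: "real \<Rightarrow> complex"
  assumes x: "a < \<tau>" "\<tau> \<le> b" and c1: "c1 \<noteq> 0"
    and lim: "((\<lambda>x. of_real (\<tau> - x) ^ Suc M * f x) \<longlongrightarrow> c1) (at_left \<tau>)"
  shows "\<not> f integrable_on {a..b}"
proof
  assume int: "f integrable_on {a..b}"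
  define g where "g x = Re (cnj c1 * f x)" for x
  define \<delta> where "\<delta> = (norm c1)\<^sup>2 / 2"
  have \<delta>: "\<delta> > 0" using c1 by (simp add: \<delta>_def)
  have "((\<lambda>x. Re (cnj c1 * (of_real (\<tau> - x) ^ Suc M * f x))) \<longlongrightarrow> Re (cnj c1 * c1)) (at_left \<tau>)"
    by (intro tendsto_Re tendsto_mult_left lim)
  moreover have "Re (cnj c1 * (of_real (\<tau> - x) ^ Suc M * f x)) = (\<tau> - x) ^ Suc M * g x" for x
  proof -
    have "cnj c1 * (of_real (\<tau> - x) ^ Suc M * f x) = of_real ((\<tau> - x) ^ Suc M) * (cnj c1 * f x)"
      by (simp only: mult_ac of_real_power)
    moreover have "Re (of_real r * z) = r * Re z" for r z by simp
    ultimately show ?thesis unfolding g_def by (simp only:)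
  qed
  moreover have "Re (cnj c1 * c1) = 2 * \<delta>" by (simp add: \<delta>_def cmod_def power2_eq_square)
  ultimately have "((\<lambda>x. (\<tau> - x) ^ Suc M * g x) \<longlongrightarrow> 2 * \<delta>) (at_left \<tau>)" by simp
  then have "eventually (\<lambda>x. (\<tau> - x) ^ Suc M * g x > \<delta>) (at_left \<tau>)"
    by (rule order_tendstoD(1)) (use \<delta> in simp)
  then obtain x0 where x0: "x0 < \<tau>" "\<And>x. x0 < x \<Longrightarrow> x < \<tau> \<Longrightarrow> (\<tau> - x) ^ Suc M * g x > \<delta>"
    unfolding eventually_at_left_field by blast
  define x1 where "x1 = max a (max ((x0 + \<tau>) / 2) (\<tau> - 1))"
  have x1: "x0 < x1" "a \<le> x1" "x1 < \<tau>" "\<tau> - 1 \<le> x1" using x0(1) x by (auto simp: x1_def max_def)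
  have low: "\<delta> / (\<tau> - x) \<le> g x" if "x1 \<le> x" "x < \<tau>" for x
  proof -
    have p: "0 < \<tau> - x" "\<tau> - x \<le> 1" using that x1 by auto
    have "\<delta> < (\<tau> - x) ^ Suc M * g x" using x0(2)[of x] that x1 by auto
    then have pos: "0 < (\<tau> - x) ^ Suc M * g x" using \<delta> by linarith
    then have g0: "0 < g x" using p by (metis zero_less_mult_pos zero_less_power)
    have "(\<tau> - x) ^ Suc M \<le> (\<tau> - x) ^ 1" by (rule power_decreasing) (use p in auto)
    then have "(\<tau> - x) ^ Suc M * g x \<le> (\<tau> - x) * g x" using g0 by (simp add: mult_right_mono)
    then show ?thesis using \<open>\<delta> < _\<close> p by (simp add: divide_simps mult.commute)
  qed
  have gi: "g integrable_on {a..b}"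
    unfolding g_def[abs_def]
    using integrable_linear[OF integrable_on_mult_right[OF int, of "cnj c1"] bounded_linear_Re] by (simp add: o_def)
  have gi1: "g integrable_on {x1..\<tau>}" by (rule integrable_on_subinterval[OF gi]) (use x x1 in auto)
  have "bounded ((\<lambda>x. integral {x1..x} g) ` {x1..\<tau>})"
    by (intro compact_imp_bounded compact_continuous_image indefinite_integral_continuous_1 gi1) simp
  then obtain B where B: "\<And>x. x \<in> {x1..\<tau>} \<Longrightarrow> \<bar>integral {x1..x} g\<bar> \<le> B"
    unfolding bounded_iff real_norm_def by blast
  have B0: "B \<ge> 0" using B[of x1] x1 by auto
  \<comment> \<open>Chosen so that the integral of \<delta> / (\<tau> - x) from x1 to y is \<delta>
    N = B + 1.\<close>
  define N where "N = (B + 1) / \<delta>"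
  define y where "y = \<tau> - (\<tau> - x1) * exp (- N)"
  have N: "N \<ge> 0" using B0 \<delta> by (simp add: N_def)
  have "(\<tau> - x1) * exp (- N) \<le> (\<tau> - x1) * 1" by (rule mult_left_mono) (use N x1 in auto)
  moreover have "0 < (\<tau> - x1) * exp (- N)" using x1 by simp
  ultimately have y: "x1 \<le> y" "y < \<tau>" unfolding y_def mult_1_right by linarith+
  have hi: "((\<lambda>x. \<delta> / (\<tau> - x)) has_integral (- \<delta> * ln (\<tau> - y) - - \<delta> * ln (\<tau> - x1))) {x1..y}"
  proof (rule fundamental_theorem_of_calculus[OF y(1)])
    fix x assume "x \<in> {x1..y}"
    then have "\<tau> - x > 0" using y by auto
    then show "((\<lambda>x. - \<delta> * ln (\<tau> - x)) has_vector_derivative \<delta> / (\<tau> - x)) (at x within {x1..y})"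
      by (auto intro!: derivative_eq_intros simp: has_real_derivative_iff_has_vector_derivative[symmetric] field_simps)
  qed
  have "- \<delta> * ln (\<tau> - y) - - \<delta> * ln (\<tau> - x1) = integral {x1..y} (\<lambda>x. \<delta> / (\<tau> - x))"
    using hi by (simp add: integral_unique)
  also have "\<dots> \<le> integral {x1..y} g"
  proof (rule integral_le)
    show "g integrable_on {x1..y}" by (rule integrable_on_subinterval[OF gi1]) (use y in auto)
  qed (use hi low y in \<open>auto intro: has_integral_integrable\<close>)
  also have "\<dots> \<le> B" using B[of y] y by auto
  also have "- \<delta> * ln (\<tau> - y) - - \<delta> * ln (\<tau> - x1) = \<delta> * N"
  proof -
    have "\<tau> - y = (\<tau> - x1) * exp (- N)" by (simp add: y_def)
    then have e: "ln (\<tau> - y) = ln (\<tau> - x1) - N" using x1 by (simp add: ln_mult)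
    show ?thesis unfolding e by (simp add: algebra_simps)
  qed
  also have "\<dots> = B + 1" using \<delta> by (simp add: N_def)
  finally show False by simp
qed

lemma contour_integrable_linepath_iff:
  "f contour_integrable_on linepath a b \<longleftrightarrow> (\<lambda>x. f (linepath a b x) * (b - a)) integrable_on {0..1}"
  unfolding contour_integrable_on_def has_contour_integral_linepath integrable_on_def ..

text \<open>On the segment \<open>x *\<^sub>R u - t\<close> is a constant times
  \<open>\<tau> - x\<close>, so the leading behaviour at t becomes a one-sided real singularity of
  the parametrised integrand.\<close>

lemma pfsum_not_integrable:
  assumes S: "finite S" "t \<in> S" and t: "t \<noteq> 0" and c: "k < K" "c t k \<noteq> 0" and u: "t \<in> closed_segment 0 u"
  shows "\<not> pfsum S K c contour_integrable_on linepath 0 u"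
proof -
  obtain \<tau> where \<tau>: "0 \<le> \<tau>" "\<tau> \<le> 1" "t = \<tau> *\<^sub>R u" using u by (auto simp: closed_segment_def)
  have u0: "u \<noteq> 0" "\<tau> > 0" using \<tau> t by (auto simp: less_le)
  obtain M c0 where c0: "c0 \<noteq> 0" and lim: "((\<lambda>w. (w - t) ^ Suc M * pfsum S K c w) \<longlongrightarrow> c0) (at t)"
    using pfsum_leading[where c = c, OF S c] by blast
  have fl: "filterlim (\<lambda>x. x *\<^sub>R u) (at t) (at_left \<tau>)"
    unfolding filterlim_at
  proof
    show "((\<lambda>x. x *\<^sub>R u) \<longlongrightarrow> t) (at_left \<tau>)" unfolding \<tau>(3) by (intro tendsto_intros)
    show "\<forall>\<^sub>F x in at_left \<tau>. x *\<^sub>R u \<in> UNIV \<and> x *\<^sub>R u \<noteq> t"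
      unfolding eventually_at_left_field using u0 \<tau> by (intro exI[of _ "\<tau> - 1"]) auto
  qed
  have "((\<lambda>x. (-1) ^ Suc M * u / u ^ Suc M * ((x *\<^sub>R u - t) ^ Suc M * pfsum S K c (x *\<^sub>R u))) \<longlongrightarrow>
      (-1) ^ Suc M * u / u ^ Suc M * c0) (at_left \<tau>)"
    by (rule tendsto_mult_left[OF filterlim_compose[OF lim fl]])
  moreover have "(-1) ^ Suc M * u / u ^ Suc M * ((x *\<^sub>R u - t) ^ Suc M * pfsum S K c (x *\<^sub>R u))
     = of_real (\<tau> - x) ^ Suc M * (pfsum S K c (linepath 0 u x) * (u - 0))" for x
  proof -
    have "x *\<^sub>R u - t = (- 1) * (of_real (\<tau> - x) * u)" by (simp add: \<tau> scaleR_conv_of_real algebra_simps)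
    then have e: "(x *\<^sub>R u - t) ^ Suc M = (-1) ^ Suc M * (of_real (\<tau> - x) ^ Suc M * u ^ Suc M)"
      by (simp only: power_mult_distrib)
    have m: "((-1) ^ Suc M * (-1) ^ Suc M :: complex) = 1" by (simp only: power_mult_distrib[symmetric]) simp
    have n: "u ^ Suc M \<noteq> 0" using u0 by simp
    have "(-1) ^ Suc M * u / u ^ Suc M * ((-1) ^ Suc M * (of_real (\<tau> - x) ^ Suc M * u ^ Suc M) * pfsum S K c (x *\<^sub>R u))
       = ((-1) ^ Suc M * (-1) ^ Suc M) * (u ^ Suc M / u ^ Suc M) * (of_real (\<tau> - x) ^ Suc M * (pfsum S K c (x *\<^sub>R u) * u))"
      by (simp only: mult_ac times_divide_eq_right times_divide_eq_left)
    then show ?thesis unfolding e m using n by (simp add: linepath_def)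
  qed
  ultimately have l: "((\<lambda>x. of_real (\<tau> - x) ^ Suc M * (pfsum S K c (linepath 0 u x) * (u - 0))) \<longlongrightarrow>
      (-1) ^ Suc M * u / u ^ Suc M * c0) (at_left \<tau>)" by (simp only:)
  have "(-1) ^ Suc M * u / u ^ Suc M * c0 \<noteq> 0" using u0 c0 by simp
  from not_integrable_at_pole[OF u0(2) \<tau>(2) this l]
  show ?thesis unfolding contour_integrable_linepath_iff .
qed

text \<open>Points of the ray beyond u0 accumulate at u0, so the identity theorem applies.\<close>

lemma ray_identity:
  assumes u0: "u0 \<noteq> (0 :: complex)" and f: "f analytic_on {u0}" and z: "\<And>s. s \<ge> 1 \<Longrightarrow> f (s *\<^sub>R u0) = 0"
  shows "\<exists>\<epsilon>>0. \<forall>u\<in>ball u0 \<epsilon>. f u = 0"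
proof -
  obtain \<epsilon> where \<epsilon>: "\<epsilon> > 0" "f holomorphic_on ball u0 \<epsilon>" using f by (auto simp: analytic_on_def)
  let ?U = "{s *\<^sub>R u0 | s. s \<ge> 1} \<inter> ball u0 \<epsilon>"
  have lp: "u0 islimpt ?U"
    unfolding islimpt_approachable
  proof (intro allI impI)
    fix e :: real assume e: "0 < e"
    define s where "s = 1 + min e \<epsilon> / (2 * norm u0)"
    have s: "s > 1" using e \<epsilon> u0 by (simp add: s_def)
    have d: "dist (s *\<^sub>R u0) u0 = min e \<epsilon> / 2"
    proof -
      have "s *\<^sub>R u0 - u0 = (s - 1) *\<^sub>R u0" by (simp add: algebra_simps)
      then show ?thesis using e \<epsilon> u0 by (simp add: dist_norm s_def)
    qed
    show "\<exists>x'\<in>?U. x' \<noteq> u0 \<and> dist x' u0 < e"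
      by (rule bexI[of _ "s *\<^sub>R u0"]) (use s d e \<epsilon> u0 in \<open>auto simp: dist_commute\<close>)
  qed
  have "f u = 0" if "u \<in> ball u0 \<epsilon>" for u
    by (rule analytic_continuation[OF \<epsilon>(2) open_ball _ _ _ lp _ that]) (use \<epsilon> z in auto)
  then show ?thesis using \<epsilon>(1) by blast
qed

text \<open>Moving from u0 perpendicularly to its direction meets each ray at no more than one
  parameter, so a small parameter avoiding finitely many values exists.\<close>

lemma avoid_rays:
  assumes S: "finite S" and u0: "u0 \<noteq> (0 :: complex)" and \<epsilon>: "\<epsilon> > 0" and z: "0 \<notin> S"
  shows "\<exists>u1\<in>ball u0 \<epsilon>. \<forall>t\<in>S. t \<notin> closed_segment 0 u1"
proof -
  define p where "p y = u0 * (1 + \<i> * of_real y)" for y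
  have "finite ((\<lambda>t. - Im (u0 / t) / Re (u0 / t)) ` S)" using S by simp
  moreover have "infinite {0<..<\<epsilon> / norm u0}" using \<epsilon> u0 by (simp add: infinite_Ioo)
  ultimately obtain y where y: "y \<in> {0<..<\<epsilon> / norm u0}" "y \<notin> (\<lambda>t. - Im (u0 / t) / Re (u0 / t)) ` S"
    by (meson finite_subset subsetI)
  show ?thesis
  proof (rule bexI[of _ "p y"], rule ballI, rule notI)
    have "u0 - p y = - (u0 * (\<i> * of_real y))" by (simp add: p_def algebra_simps)
    then have "dist u0 (p y) = norm u0 * y" using y by (simp add: dist_norm norm_mult)
    then show "p y \<in> ball u0 \<epsilon>" using y u0 by (simp add: field_simps)
  next
    fix t assume t: "t \<in> S" "t \<in> closed_segment 0 (p y)"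
    obtain x where x: "t = x *\<^sub>R p y" "0 \<le> x" using t(2) by (auto simp: closed_segment_def)
    have t0: "t \<noteq> 0" using t z by auto
    then have xn: "x \<noteq> 0" "p y \<noteq> 0" using x by auto
    have "p y / t = of_real (1 / x)" unfolding x(1) using xn by (simp add: scaleR_conv_of_real)
    then have "u0 / t * (1 + \<i> * of_real y) = of_real (1 / x)" by (simp add: p_def)
    then have "Im (u0 / t * (1 + \<i> * of_real y)) = 0" by (simp only: Im_complex_of_real)
    moreover have "Im (v * (1 + \<i> * of_real y)) = Im v + Re v * y" for v by simp
    ultimately have im: "Im (u0 / t) + Re (u0 / t) * y = 0" by (simp only:)
    have "Re (u0 / t) \<noteq> 0"
    proof
      assume r: "Re (u0 / t) = 0"
      then have "u0 / t = 0" using im by (intro complex_eqI) simp_all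
      then show False using u0 t0 by simp
    qed
    moreover have "Re (u0 / t) * y = - Im (u0 / t)" using im by linarith
    ultimately have "y = - Im (u0 / t) / Re (u0 / t)" by (metis nonzero_mult_div_cancel_left)
    then show False using y(2) t(1) by blast
  qed
qed

lemma Lsum_entry: "mat_of (Lsum S K C w) $ a $ b = pfsum S K (\<lambda>s k. mat_of (C s k) $ a $ b) w"
  unfolding Lsum_def pfsum_def by (simp only: mat_of_sum sum_component mat_of_cs_nth times_divide_eq_left mult_1_left)

text \<open>The integral along the segment diverges, and a divergent contour integral takes the
  default value 0.\<close>

lemma H_fun_junk:
  fixes V :: "('i::finite, 'n::finite) lrep"
  assumes V: "good V" and L: "logdata V S K L" and t: "t \<in> S" "m < K" "mat_of (L j t m) $ a $ b \<noteq> 0"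
    and u: "t \<in> closed_segment 0 u"
  shows "H_fun V j u $ a $ b = 0"
proof -
  have S: "finite S" "0 \<notin> S" using L unfolding logdata_def by blast+
  have u0: "u \<noteq> 0" using u t S by auto
  let ?I = "\<lambda>w. matrix_inv (Pp V j 0 ** Psi_fun V j w) ** mderiv (\<lambda>u. Pp V j 0 ** Psi_fun V j u) w"
  let ?f = "pfsum S K (\<lambda>s k. mat_of (L j s k) $ a $ b)"
  have "\<not> (\<lambda>w. ?I w $ a $ b) contour_integrable_on linepath 0 u"
  proof
    assume "(\<lambda>w. ?I w $ a $ b) contour_integrable_on linepath 0 u"
    then have i: "(\<lambda>x. ?I (linepath 0 u x) $ a $ b * (u - 0)) integrable_on {0..1}"
      unfolding contour_integrable_linepath_iff .
    have "(\<lambda>x. ?f (linepath 0 u x) * (u - 0)) integrable_on {0..1}"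
    proof (rule integrable_spike_finite[OF _ _ i])
      let ?N = "{x. linepath 0 u x \<in> S}"
      have "?N \<subseteq> (\<lambda>s. Re (s / u)) ` S"
      proof
        fix x assume "x \<in> ?N"
        then have "linepath 0 u x \<in> S" "x = Re (linepath 0 u x / u)"
          using u0 by (auto simp: linepath_def scaleR_conv_of_real)
        then show "x \<in> (\<lambda>s. Re (s / u)) ` S" by blast
      qed
      then show "finite ?N" using S(1) finite_surj by blast
      fix x assume "x \<in> {0..1} - ?N"
      then have x: "linepath 0 u x \<notin> S" by simp
      show "?f (linepath 0 u x) * (u - 0) = ?I (linepath 0 u x) $ a $ b * (u - 0)"
        unfolding H_integrand[OF V L x] Lsum_entry ..
    qed
    then have "?f contour_integrable_on linepath 0 u" unfolding contour_integrable_linepath_iff .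
    then show False using pfsum_not_integrable[OF S(1) t(1) _ t(2) _ u, of "\<lambda>s k. mat_of (L j s k) $ a $ b"] t S by auto
  qed
  then show ?thesis unfolding H_fun_def Let_def mcint_def by (simp add: not_integrable_contour_integral)
qed

lemma H_fun_deriv:
  fixes V :: "('i::finite, 'n::finite) lrep"
  assumes V: "good V" and L: "logdata V S K L" and w: "\<forall>t\<in>S. t \<notin> closed_segment 0 w"
  shows "((\<lambda>u. H_fun V j u $ a $ b) has_field_derivative pfsum S K (\<lambda>s k. mat_of (L j s k) $ a $ b) w) (at w)"
proof -
  have S: "finite S" "0 \<notin> S" using L unfolding logdata_def by blast+
  let ?e = "\<lambda>t m. mat_of (L j t m) $ a $ b"
  define W where "W = (\<Inter>t\<in>S. {w. t \<notin> closed_segment 0 (1 * w)})"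
  have oW: "open W" unfolding W_def
    by (intro open_INT S ballI slit_region(1)) (use S in auto)
  have wW: "w \<in> W" using w by (simp add: W_def)
  have "((\<lambda>u. \<Sum>t\<in>S. \<Sum>m<K. (pairing 0 m 1 u t - pairing 0 m 1 0 t) * ?e t m) has_field_derivative
     (\<Sum>t\<in>S. \<Sum>m<K. (1 / (w - t) ^ Suc m - 0) * ?e t m)) (at w)"
  proof (intro DERIV_sum DERIV_cmult_right DERIV_diff DERIV_const)
    fix t m assume t: "t \<in> S"
    have "t \<notin> closed_segment 0 (1 * w)" "t \<noteq> 0" using w t S by auto
    from pairing_deriv[OF this(2,1), of 0 m]
    show "((\<lambda>w. pairing 0 m 1 w t) has_field_derivative 1 / (w - t) ^ Suc m) (at w)"
      by (simp add: pairing_1_primitive)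
  qed
  then have "((\<lambda>u. H_fun V j u $ a $ b) has_field_derivative
     (\<Sum>t\<in>S. \<Sum>m<K. (1 / (w - t) ^ Suc m - 0) * ?e t m)) (at w)"
  proof (rule has_field_derivative_transform_within_open[OF _ oW wW])
    fix u assume "u \<in> W"
    then have u: "\<And>t. t \<in> S \<Longrightarrow> t \<notin> closed_segment 0 u" by (simp add: W_def)
    have "H_fun V j u = mat_of (\<Sum>t\<in>S. \<Sum>m<K. cs (pairing 0 m 1 u t - pairing 0 m 1 0 t) (L j t m))"
      by (rule H_fun_formula[OF V L]) (rule u)
    then show "(\<Sum>t\<in>S. \<Sum>m<K. (pairing 0 m 1 u t - pairing 0 m 1 0 t) * ?e t m) = H_fun V j u $ a $ b"
      by (simp only: mat_of_sum sum_component mat_of_cs_nth)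
  qed
  then show ?thesis unfolding pfsum_def
    by (simp only: diff_0_right times_divide_eq_left mult_1_left)
qed

text \<open>If a genuine pole \<open>t\<close> lies on \<open>[0, u0]\<close>, the defining integral diverges along the whole ray
  beyond \<open>u0\<close>, so \<open>H_fun\<close> takes the junk value \<open>0\<close> there; analyticity at \<open>u0\<close> would make it
  vanish identically nearby, contradicting the poles of its derivative.\<close>

lemma genuine_not_in_segment:
  fixes V :: "('i::finite, 'n::finite) lrep"
  assumes V: "good V" and L: "logdata V S K L" and t: "t \<in> S" "\<exists>m. L j t m \<noteq> 0"
    and an: "\<And>a b. (\<lambda>u. H_fun V j u $ a $ b) analytic_on {u0}"
  shows "t \<notin> closed_segment 0 u0"
proof
  assume seg: "t \<in> closed_segment 0 u0"
  have S: "finite S" "0 \<notin> S" and LK: "\<And>s k. k \<ge> K \<Longrightarrow> L j s k = 0" using L unfolding logdata_def by blast+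
  have u0: "u0 \<noteq> 0" using seg t S by auto
  obtain m where m: "L j t m \<noteq> 0" using t by blast
  then have mK: "m < K" using LK[of m t] by (meson not_less)
  obtain a b where ab: "mat_of (L j t m) $ a $ b \<noteq> 0"
  proof -
    have "\<exists>a b. mat_of (L j t m) $ a $ b \<noteq> 0"
    proof (rule ccontr)
      assume "\<not> ?thesis"
      then have "mat_of (L j t m) = mat_of 0" by (simp add: vec_eq_iff mat_of_simps)
      then show False using m by (metis Sq_mat_of)
    qed
    then show thesis using that by blast
  qed
  let ?H = "\<lambda>u. H_fun V j u $ a $ b" and ?f = "pfsum S K (\<lambda>s k. mat_of (L j s k) $ a $ b)"
  have "?H (s *\<^sub>R u0) = 0" if s: "s \<ge> 1" for s
  proof (rule H_fun_junk[OF V L t(1) mK ab])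
    have "u0 \<in> closed_segment 0 (s *\<^sub>R u0)" unfolding closed_segment_def
      using s by (auto intro!: exI[of _ "1 / s"])
    then show "t \<in> closed_segment 0 (s *\<^sub>R u0)"
      using seg subset_closed_segment[of 0 u0 0 "s *\<^sub>R u0"] by auto
  qed
  from ray_identity[OF u0 an this]
  obtain \<epsilon> where \<epsilon>: "\<epsilon> > 0" "\<And>u. u \<in> ball u0 \<epsilon> \<Longrightarrow> ?H u = 0" by blast
  obtain u1 where u1: "u1 \<in> ball u0 \<epsilon>" "\<forall>t\<in>S. t \<notin> closed_segment 0 u1"
    using avoid_rays[OF S(1) u0 \<epsilon>(1) S(2)] by blast
  define W where "W = ball u0 \<epsilon> \<inter> (\<Inter>t\<in>S. {w. t \<notin> closed_segment 0 (1 * w)})"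
  have oW: "open W" unfolding W_def
    by (intro open_Int open_ball open_INT S ballI slit_region(1)) (use S in auto)
  have wW: "u1 \<in> W" using u1 by (simp add: W_def)
  have "?f w = 0" if w: "w \<in> W" for w
  proof -
    have d: "(?H has_field_derivative ?f w) (at w)"
      by (rule H_fun_deriv[OF V L]) (use w in \<open>simp add: W_def\<close>)
    have "((\<lambda>_. 0) has_field_derivative ?f w) (at w)"
      by (rule has_field_derivative_transform_within_open[OF d oW w]) (use \<epsilon> in \<open>simp add: W_def\<close>)
    then show ?thesis using DERIV_unique DERIV_const by blast
  qed
  moreover have "w \<notin> S" if "w \<in> W" for w using that by (auto simp: W_def)
  ultimately have "W \<subseteq> {w. w \<notin> S \<and> ?f w = 0}" by blast
  moreover have "infinite W" using oW wW finite_imp_not_open by blast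
  ultimately have inf: "infinite {w. w \<notin> S \<and> ?f w = 0}" using finite_subset by blast
  from pfsum_eq_0[OF S(1) t(1) mK inf] ab show False by simp
qed

text \<open>Turns membership in \<open>A_dom\<close> into the condition on segments under which
  \<open>A_int\<close> can be evaluated; composition with u / \<kappa> moves analyticity from z to
  \<kappa> z.\<close>

lemma A_dom_segment:
  fixes V2 :: "('i::finite, 'm::finite) lrep"
  assumes V: "good V2" and L: "logdata V2 S K L" and t: "t \<in> S" "\<exists>m. L j t m \<noteq> 0"
    and \<zeta>: "\<zeta> \<in> A_dom q l c V2 \<gamma>" and r: "r \<in> relevant_r c"
    and seg: "t \<in> closed_segment 0 (q powi (int l + r) * \<zeta> * z)"
  shows "z \<notin> path_image \<gamma> \<and> winding_number \<gamma> z = 0"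
proof (rule ccontr)
  assume "\<not> ?thesis"
  then have z: "z \<in> path_image \<gamma> \<union> inside_path \<gamma>" by (auto simp: inside_path_def)
  define \<kappa> where "\<kappa> = q powi (int l + r) * \<zeta>"
  have \<kappa>: "\<kappa> \<noteq> 0"
  proof
    assume "\<kappa> = 0"
    then have "t = 0" using seg unfolding \<kappa>_def[symmetric] by simp
    then show False using t L unfolding logdata_def by blast
  qed
  have "(\<lambda>u. H_fun V2 j u $ a $ b) analytic_on {\<kappa> * z}" for a b
  proof -
    let ?h = "\<lambda>w. H_fun V2 j (\<kappa> * w) $ a $ b"
    have "?h analytic_on (path_image \<gamma> \<union> inside_path \<gamma>)"
      using \<zeta> r unfolding A_dom_def \<kappa>_def by blast
    then have h: "?h analytic_on {z}" by (rule analytic_on_subset) (use z in simp)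
    have im: "(\<lambda>u. u / \<kappa>) ` {\<kappa> * z} = {z}" using \<kappa> by simp
    have "(?h \<circ> (\<lambda>u. u / \<kappa>)) analytic_on {\<kappa> * z}"
      by (rule analytic_on_compose) (use \<kappa> h im in \<open>auto intro!: analytic_intros\<close>)
    moreover have "?h \<circ> (\<lambda>u. u / \<kappa>) = (\<lambda>u. H_fun V2 j u $ a $ b)" using \<kappa> by (simp add: fun_eq_iff)
    ultimately show ?thesis by simp
  qed
  from genuine_not_in_segment[OF V L t this] seg show False by (simp add: \<kappa>_def)
qed

section \<open>Rational exponentials\<close>

lemma mreg_cs: "rreg B g \<Longrightarrow> mreg B (\<lambda>z. mat_of (cs (g z) A))"
  unfolding mreg_def by (simp add: mat_of_cs_nth rreg_mult)

lemma mreg_mat_of_sum: "(\<And>i. i \<in> S \<Longrightarrow> mreg B (\<lambda>z. mat_of (f i z))) \<Longrightarrow> mreg B (\<lambda>z. mat_of (\<Sum>i\<in>S. f i z))"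
  unfolding mat_of_sum by (rule mreg_sum)

text \<open>With integer eigenvalues n the exponential is a sum of powers \<open>g z powi n\<close>
  times idempotents, independent of the branch \<omega>.\<close>

lemma exp_integral_semisimple_rational:
  assumes M: "intss M" and B: "finite B" and g: "rreg B g" "\<And>z. z \<notin> B \<Longrightarrow> g z \<noteq> 0"
  shows "\<exists>P. mreg B P \<and> (\<forall>z. z \<notin> B \<longrightarrow> (\<forall>\<omega>. exp \<omega> = g z \<longrightarrow> P z = mat_of (exp (cs \<omega> M))))"
proof -
  obtain N :: "int set" and E where N: "finite N" "M = (\<Sum>n\<in>N. cs (of_int n) (E n))" "(\<Sum>n\<in>N. E n) = 1"
    "\<forall>n\<in>N. \<forall>m\<in>N. E n * E m = (if n = m then E n else 0)"
    using M unfolding intss_def by blast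
  define P where "P z = mat_of (\<Sum>n\<in>N. cs (g z powi n) (E n))" for z
  have "mreg B P" unfolding P_def[abs_def]
    by (intro mreg_mat_of_sum mreg_cs rreg_powi B g)
  moreover have "P z = mat_of (exp (cs \<omega> M))" if "exp \<omega> = g z" for z \<omega>
  proof -
    have "exp (\<Sum>n\<in>N. cs (of_int n * \<omega>) (E n)) = (\<Sum>n\<in>N. cs (exp (of_int n * \<omega>)) (E n))"
      by (rule exp_orthogonal_idempotents) (use N in auto)
    moreover have "cs \<omega> M = (\<Sum>n\<in>N. cs (of_int n * \<omega>) (E n))"
      unfolding N(2) by (simp add: cs_sum_right mult.commute)
    ultimately show ?thesis unfolding P_def using that by (simp add: exp_power_int[symmetric])
  qed
  ultimately show ?thesis by blast
qed

lemma exp_nilpotent_rational: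
  assumes M: "nilp M" and g: "rreg B g"
  shows "\<exists>P. mreg B P \<and> (\<forall>z. P z = mat_of (exp (cs (g z) M)))"
proof -
  obtain p where p: "M ^ p = 0" using M unfolding nilp_def by blast
  have e: "exp (cs (g z) M) = (\<Sum>k<p. cs (g z ^ k * of_real (inverse (fact k))) (M ^ k))" for z
  proof -
    have "cs (g z) M ^ p = 0" by (simp add: cs_power p cs_simps)
    from exp_nilpotent[OF this] show ?thesis
      by (simp add: cs_power scaleR_cs mult.commute)
  qed
  show ?thesis
  proof (rule exI[of _ "\<lambda>z. mat_of (exp (cs (g z) M))"], rule conjI)
    show "mreg B (\<lambda>z. mat_of (exp (cs (g z) M)))" unfolding e
      by (intro mreg_mat_of_sum mreg_cs rreg_mult rreg_power g rreg_const)
  qed simp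
qed

text \<open>The flag \<open>cl\<close> marks logarithmic summands, for which only
  \<open>exp (\<omega> x)\<close> is prescribed. Commutativity splits the exponential into factors
  of the two elementary kinds.\<close>

lemma exp_sum_rational:
  fixes M :: "'y \<Rightarrow> 'n::finite sqm"
  assumes X: "finite X" and B: "finite B"
    and comm: "\<And>x y. x \<in> X \<Longrightarrow> y \<in> X \<Longrightarrow> M x * M y = M y * M x"
    and g: "\<And>x. x \<in> X \<Longrightarrow> rreg B (g x)"
    and cl: "\<And>x. x \<in> X \<Longrightarrow> cl x \<Longrightarrow> intss (M x)" "\<And>x z. x \<in> X \<Longrightarrow> cl x \<Longrightarrow> z \<notin> B \<Longrightarrow> g x z \<noteq> 0"
    and nc: "\<And>x. x \<in> X \<Longrightarrow> \<not> cl x \<Longrightarrow> nilp (M x)"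
  shows "\<exists>R. mreg B R \<and> (\<forall>z. z \<notin> B \<longrightarrow> (\<forall>\<omega>. (\<forall>x\<in>X. if cl x then exp (\<omega> x) = g x z else \<omega> x = g x z) \<longrightarrow>
     R z = mat_of (exp (\<Sum>x\<in>X. cs (\<omega> x) (M x)))))"
  using X comm g cl nc
proof (induction X rule: finite_induct)
  case empty
  show ?case by (rule exI[of _ "\<lambda>_. mat 1"]) (simp add: mreg_const mat_of_simps)
next
  case (insert x X)
  have "\<exists>R. mreg B R \<and> (\<forall>z. z \<notin> B \<longrightarrow> (\<forall>\<omega>. (\<forall>x\<in>X. if cl x then exp (\<omega> x) = g x z else \<omega> x = g x z) \<longrightarrow>
     R z = mat_of (exp (\<Sum>x\<in>X. cs (\<omega> x) (M x)))))"
    by (rule insert.IH) (rule insert.prems; simp)+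
  then obtain R where R: "mreg B R" "\<And>z \<omega>. z \<notin> B \<Longrightarrow> (\<forall>x\<in>X. if cl x then exp (\<omega> x) = g x z else \<omega> x = g x z) \<Longrightarrow>
     R z = mat_of (exp (\<Sum>x\<in>X. cs (\<omega> x) (M x)))" by blast
  have "\<exists>P. mreg B P \<and> (\<forall>z. z \<notin> B \<longrightarrow> (\<forall>\<omega>. (if cl x then exp \<omega> = g x z else \<omega> = g x z) \<longrightarrow> P z = mat_of (exp (cs \<omega> (M x)))))"
  proof (cases "cl x")
    case True
    then show ?thesis
      using exp_integral_semisimple_rational[OF insert.prems(3)[of x] B insert.prems(2)[of x] insert.prems(4)[of x]] by simp
  next
    case False
    then show ?thesis
      using exp_nilpotent_rational[OF insert.prems(5)[of x] insert.prems(2)[of x]] by auto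
  qed
  then obtain P where P: "mreg B P" "\<And>z \<omega>. z \<notin> B \<Longrightarrow> (if cl x then exp \<omega> = g x z else \<omega> = g x z) \<Longrightarrow> P z = mat_of (exp (cs \<omega> (M x)))"
    by blast
  show ?case
  proof (rule exI[of _ "\<lambda>z. P z ** R z"], rule conjI, rule mreg_mult[OF P(1) R(1)], intro allI impI)
    fix z \<omega>
    assume z: "z \<notin> B" and \<omega>: "\<forall>x\<in>insert x X. if cl x then exp (\<omega> x) = g x z else \<omega> x = g x z"
    have c: "cs (\<omega> x) (M x) * (\<Sum>x\<in>X. cs (\<omega> x) (M x)) = (\<Sum>x\<in>X. cs (\<omega> x) (M x)) * cs (\<omega> x) (M x)"
    proof (rule commute_sum)
      fix y assume "y \<in> X"
      then have "M x * M y = M y * M x" by (intro insert.prems(1)) auto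
      then show "cs (\<omega> x) (M x) * cs (\<omega> y) (M y) = cs (\<omega> y) (M y) * cs (\<omega> x) (M x)"
        unfolding cs_mult_left cs_mult_right cs_cs by (simp only: mult.commute)
    qed
    have "P z ** R z = mat_of (exp (cs (\<omega> x) (M x))) ** mat_of (exp (\<Sum>x\<in>X. cs (\<omega> x) (M x)))"
      using P(2)[OF z, of "\<omega> x"] R(2)[OF z, of \<omega>] \<omega> by simp
    also have "\<dots> = mat_of (exp (cs (\<omega> x) (M x)) * exp (\<Sum>x\<in>X. cs (\<omega> x) (M x)))"
      by (simp only: mat_of_simps)
    also have "\<dots> = mat_of (exp (\<Sum>x\<in>insert x X. cs (\<omega> x) (M x)))"
      unfolding sum.insert[OF insert.hyps] exp_add_commuting[OF c] ..
    finally show "P z ** R z = mat_of (exp (\<Sum>x\<in>insert x X. cs (\<omega> x) (M x)))" .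
  qed
qed

section \<open>The exponent as a sum over pairs of singular points\<close>

text \<open>An index \<open>(i, j, r, s, k, t, m)\<close> pairs the coefficient of \<open>(w - s)^(-k-1)\<close> for node \<open>i\<close> of the
  first module with that of \<open>(w - t)^(-m-1)\<close> for node \<open>j\<close> of the second.\<close>

type_synonym 'i pidx = "'i \<times> 'i \<times> int \<times> complex \<times> nat \<times> complex \<times> nat"

definition pidx :: "int set \<Rightarrow> complex set \<Rightarrow> nat \<Rightarrow> complex set \<Rightarrow> nat \<Rightarrow> 'i::finite pidx set" where
  "pidx R S1 K1 S2 K2 = UNIV \<times> UNIV \<times> R \<times> S1 \<times> {..<K1} \<times> S2 \<times> {..<K2}"

definition pcoef :: "complex \<Rightarrow> nat \<Rightarrow> complex \<Rightarrow> 'i pidx \<Rightarrow> complex" where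
  "pcoef q l \<zeta> = (\<lambda>(i, j, r, s, k, t, m). pairing k m (q powi (int l + r) * \<zeta>) s t)"

definition plog :: "'i pidx \<Rightarrow> bool" where
  "plog = (\<lambda>(i, j, r, s, k, t, m). k = 0 \<and> m = 0)"

text \<open>What is rational about a coefficient: the exponential of a logarithm, and otherwise the
  coefficient itself.\<close>

definition pratio :: "complex \<Rightarrow> nat \<Rightarrow> complex \<Rightarrow> 'i pidx \<Rightarrow> complex" where
  "pratio q l \<zeta> = (\<lambda>(i, j, r, s, k, t, m). if k = 0 \<and> m = 0 then 1 - q powi (int l + r) * \<zeta> * s / t
     else pairing k m (q powi (int l + r) * \<zeta>) s t)"

definition pmat :: "('i \<Rightarrow> 'i \<Rightarrow> int \<Rightarrow> int) \<Rightarrow> ('i \<Rightarrow> complex \<Rightarrow> nat \<Rightarrow> 'n::finite sqm) \<Rightarrow>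
    ('i \<Rightarrow> complex \<Rightarrow> nat \<Rightarrow> 'm::finite sqm) \<Rightarrow> 'i pidx \<Rightarrow> ('n \<times> 'm) sqm" where
  "pmat c L1 L2 = (\<lambda>(i, j, r, s, k, t, m). cs (of_int (- c i j r)) (kronS (L1 i s k) (L2 j t m)))"

lemma pidx_sum:
  "(\<Sum>y\<in>pidx R S1 K1 S2 K2. cs (w y) (pmat c L1 L2 y)) = (\<Sum>i\<in>UNIV. \<Sum>j\<in>UNIV. \<Sum>r\<in>R. \<Sum>s\<in>S1. \<Sum>k<K1. \<Sum>t\<in>S2. \<Sum>m<K2.
     cs (w (i, j, r, s, k, t, m) * of_int (- c i j r)) (kronS (L1 i s k) (L2 j t m)))"
  unfolding pidx_def pmat_def sum.cartesian_product'
  by (simp add: sum.cartesian_product[symmetric] case_prod_unfold)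

lemma Eexp_sum:
  "Eexp q l c S1 K1 L1 S2 K2 L2 \<zeta> = (\<Sum>y\<in>pidx (relevant_r c) S1 K1 S2 K2. cs (pcoef q l \<zeta> y) (pmat c L1 L2 y))"
  unfolding pidx_sum by (simp add: Eexp_def pairsum_def cs_sum_right pcoef_def mult.commute)

text \<open>Restricted to points t that carry a nonzero coefficient: for these the analyticity in
  \<open>A_dom\<close> can be exploited, so that \<zeta> in \<open>A_dom\<close> of an admissible
  contour never lies in this set.\<close>

definition pairpoles :: "complex \<Rightarrow> nat \<Rightarrow> int set \<Rightarrow> complex set \<Rightarrow> ('i \<Rightarrow> complex \<Rightarrow> nat \<Rightarrow> 'm::finite sqm) \<Rightarrow> complex set \<Rightarrow> complex set" where
  "pairpoles q l R S1 L2 S2 = (\<lambda>(s, t, r). t / s * q powi (- int l - r)) ` (S1 \<times> {t \<in> S2. \<exists>j m. L2 j t m \<noteq> 0} \<times> R)"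

lemma finite_pairpoles: "finite R \<Longrightarrow> finite S1 \<Longrightarrow> finite S2 \<Longrightarrow> finite (pairpoles q l R S1 L2 S2)"
  unfolding pairpoles_def by (intro finite_imageI finite_cartesian_product) auto

lemma pairpolesI:
  assumes "q \<noteq> 0" "s \<in> S1" "t \<in> S2" "L2 j t m \<noteq> 0" "r \<in> R" "s \<noteq> 0" "q powi (int l + r) * \<zeta> * s = t"
  shows "\<zeta> \<in> pairpoles q l R S1 L2 S2"
proof -
  have "q powi (int l + r) * q powi (- int l - r) = 1"
    using assms(1) by (simp add: power_int_add[symmetric])
  then have "\<zeta> = q powi (int l + r) * \<zeta> * s / s * q powi (- int l - r)" using assms(6) by simp
  then have "\<zeta> = t / s * q powi (- int l - r)" unfolding assms(7) .
  then show ?thesis using assms unfolding pairpoles_def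
    by (intro image_eqI[of _ _ "(s, t, r)"]) auto
qed

lemma kronS_0 [simp]: "kronS A 0 = 0" "kronS 0 B = 0"
  using kronS_sum_right[of A "\<lambda>_. 0" "{}"] kronS_sum_left[of "\<lambda>_. 0" "{}" B] by simp_all

lemma kronS_commute:
  assumes "A * A' = A' * A" "B * B' = B' * B"
  shows "kronS A B * kronS A' B' = kronS A' B' * kronS A B"
  unfolding kronS_mult assms ..

lemma structured_commute: "structured V L \<Longrightarrow> L i s k * L j s' k' = L j s' k' * L i s k"
  unfolding structured_def by (elim conjE) (erule allE, erule allE, erule allE, erule allE, erule allE, erule allE, assumption)

lemma structured_intss: "structured V L \<Longrightarrow> intss (L i s 0)"
  and structured_nilp: "structured V L \<Longrightarrow> k > 0 \<Longrightarrow> nilp (L i s k)"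
  unfolding structured_def by blast+

lemma pmat_commute:
  assumes st: "structured V1 L1" "structured V2 L2"
  shows "pmat c L1 L2 x * pmat c L1 L2 y = pmat c L1 L2 y * pmat c L1 L2 x"
proof -
  obtain i j r s k t m where x: "x = (i, j, r, s, k, t, m)" by (cases x)
  obtain i' j' r' s' k' t' m' where y: "y = (i', j', r', s', k', t', m')" by (cases y)
  have "kronS (L1 i s k) (L2 j t m) * kronS (L1 i' s' k') (L2 j' t' m') = kronS (L1 i' s' k') (L2 j' t' m') * kronS (L1 i s k) (L2 j t m)"
    by (rule kronS_commute[OF structured_commute[OF st(1)] structured_commute[OF st(2)]])
  then show ?thesis unfolding pmat_def x y prod.case cs_mult_left cs_mult_right cs_cs
    by (simp only: mult.commute)
qed

lemma pmat_nonzero: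
  assumes "(i, j, r, s, k, t, m) \<in> pidx R S1 K1 S2 K2" "pmat c L1 L2 (i, j, r, s, k, t, m) \<noteq> 0"
  shows "s \<in> S1" "t \<in> S2" "r \<in> R" "L2 j t m \<noteq> 0"
  using assms unfolding pidx_def pmat_def by (cases "L2 j t m = 0"; auto simp del: of_int_minus)+

lemma pmat_nonpole:
  assumes y: "(i, j, r, s, k, t, m) \<in> pidx R S1 K1 S2 K2" "pmat c L1 L2 (i, j, r, s, k, t, m) \<noteq> 0"
    and q: "q \<noteq> 0" and S1: "0 \<notin> S1" and z: "z \<notin> pairpoles q l R S1 L2 S2"
  shows "q powi (int l + r) * z * s \<noteq> t"
proof
  assume e: "q powi (int l + r) * z * s = t"
  note g = pmat_nonzero[OF y]
  have s0: "s \<noteq> 0" using g(1) S1 by blast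
  have "z \<in> pairpoles q l R S1 L2 S2" by (rule pairpolesI[where ?L2.0 = L2, OF q g(1,2,4,3) s0 e])
  then show False using z by contradiction
qed

text \<open>Any choice of branches of the logarithms is allowed; this freedom is used near \<open>\<infinity>\<close>.\<close>

definition plift :: "complex \<Rightarrow> nat \<Rightarrow> ('i \<Rightarrow> 'i \<Rightarrow> int \<Rightarrow> int) \<Rightarrow> 'i::finite pidx set \<Rightarrow> ('i \<Rightarrow> complex \<Rightarrow> nat \<Rightarrow> 'n::finite sqm) \<Rightarrow>
    ('i \<Rightarrow> complex \<Rightarrow> nat \<Rightarrow> 'm::finite sqm) \<Rightarrow> complex \<Rightarrow> ('i pidx \<Rightarrow> complex) \<Rightarrow> bool" where
  "plift q l c J L1 L2 z \<omega> \<longleftrightarrow> (\<forall>y\<in>J. pmat c L1 L2 y \<noteq> 0 \<longrightarrow>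
     (if plog y then exp (\<omega> y) = pratio q l z y else \<omega> y = pratio q l z y))"

lemma plift_pcoef:
  assumes q: "q \<noteq> 0" and S: "0 \<notin> S1" "0 \<notin> S2" and z: "z \<notin> pairpoles q l R S1 L2 S2"
  shows "plift q l c (pidx R S1 K1 S2 K2) L1 L2 z (pcoef q l z)"
  unfolding plift_def
proof (intro ballI impI)
  fix y assume y: "y \<in> pidx R S1 K1 S2 K2" "pmat c L1 L2 y \<noteq> 0"
  obtain i j r s k t m where e: "y = (i, j, r, s, k, t, m)" by (cases y)
  note g = pmat_nonzero[OF y[unfolded e]] and n = pmat_nonpole[OF y[unfolded e] q S(1) z]
  have "t \<noteq> 0" using g S by auto
  then have "1 - q powi (int l + r) * z * s / t \<noteq> 0" using n by simp
  then show "if plog y then exp (pcoef q l z y) = pratio q l z y else pcoef q l z y = pratio q l z y"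
    unfolding e by (simp add: plog_def pcoef_def pratio_def pairing_def)
qed

text \<open>The factor \<epsilon> is there because \<epsilon> = -1 gives the rational inverse, with
  the same set of possible poles.\<close>

lemma Eexp_rational:
  fixes V1 :: "('i::finite, 'n::finite) lrep" and V2 :: "('i, 'm::finite) lrep" and \<epsilon> :: int
  assumes q: "q \<noteq> 0" and S: "finite S1" "0 \<notin> S1" "finite S2" "0 \<notin> S2" and R: "finite (relevant_r c)"
    and st: "structured V1 L1" "structured V2 L2"
  shows "\<exists>P. mreg (pairpoles q l (relevant_r c) S1 L2 S2) P \<and> (\<forall>z. z \<notin> pairpoles q l (relevant_r c) S1 L2 S2 \<longrightarrow>
     (\<forall>\<omega>. plift q l c (pidx (relevant_r c) S1 K1 S2 K2) L1 L2 z \<omega> \<longrightarrow>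
       P z = mat_of (exp (cs (of_int \<epsilon>) (\<Sum>y\<in>pidx (relevant_r c) S1 K1 S2 K2. cs (\<omega> y) (pmat c L1 L2 y))))))"
proof -
  let ?B = "pairpoles q l (relevant_r c) S1 L2 S2" and ?J = "pidx (relevant_r c) S1 K1 S2 K2 :: 'i pidx set"
  \<comment> \<open>Indices with zero matrix are dropped, since their coefficients may be singular
    outside the pole set.\<close>
  define X where "X = {y \<in> ?J. pmat c L1 L2 y \<noteq> 0}"
  define M where "M y = cs (of_int \<epsilon>) (pmat c L1 L2 y)" for y
  have J: "finite ?J" unfolding pidx_def using S R by auto
  then have X: "finite X" by (simp add: X_def)
  have B: "finite ?B" using R S by (intro finite_pairpoles)
  have "\<exists>P. mreg ?B P \<and> (\<forall>z. z \<notin> ?B \<longrightarrow> (\<forall>\<omega>. (\<forall>y\<in>X. if plog y then exp (\<omega> y) = pratio q l z y else \<omega> y = pratio q l z y) \<longrightarrow>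
     P z = mat_of (exp (\<Sum>y\<in>X. cs (\<omega> y) (M y)))))"
  proof (rule exp_sum_rational[where g = "\<lambda>y z. pratio q l z y", OF X B])
    show "M x * M y = M y * M x" for x y
      unfolding M_def cs_mult_left cs_mult_right cs_cs pmat_commute[OF st, of c x y] by (simp only: mult.commute)
  next
    fix y assume yX: "y \<in> X"
    obtain i j r s k t m where y: "y = (i, j, r, s, k, t, m)" by (cases y)
    have yJ: "(i, j, r, s, k, t, m) \<in> ?J" "pmat c L1 L2 (i, j, r, s, k, t, m) \<noteq> 0" using yX by (auto simp: X_def y)
    note d = pmat_nonpole[OF yJ q S(2)] and g = pmat_nonzero[OF yJ]
    show "rreg ?B (\<lambda>z. pratio q l z y)"
    proof (cases "k = 0 \<and> m = 0")
      case True
      have "rreg ?B (\<lambda>z. 1 - q powi (int l + r) * z * s / t)"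
        by (intro rreg_diff rreg_const rreg_divide B rreg_mult rreg_id) (use g S in auto)
      then show ?thesis using True by (simp add: pratio_def y)
    next
      case False
      have "rreg ?B (\<lambda>z. (-1) ^ Suc k * fact (k + m - 1) / (fact k * fact m) * (q powi (int l + r) * z) ^ k / (q powi (int l + r) * z * s - t) ^ (k + m))"
      proof (rule rreg_divide[OF B])
        show "rreg ?B (\<lambda>z. (-1) ^ Suc k * fact (k + m - 1) / (fact k * fact m) * (q powi (int l + r) * z) ^ k)"
          by (intro rreg_mult rreg_power rreg_const rreg_id)
        show "rreg ?B (\<lambda>z. (q powi (int l + r) * z * s - t) ^ (k + m))"
          by (intro rreg_mult rreg_power rreg_diff rreg_const rreg_id)
        show "(q powi (int l + r) * z * s - t) ^ (k + m) \<noteq> 0" if "z \<notin> ?B" for z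
          using d[OF that] by simp
      qed
      moreover have "pratio q l z y = (-1) ^ Suc k * fact (k + m - 1) / (fact k * fact m) * (q powi (int l + r) * z) ^ k / (q powi (int l + r) * z * s - t) ^ (k + m)" for z
        using False unfolding pratio_def y prod.case pairing_def by (simp only: if_False)
      ultimately show ?thesis by (simp only:)
    qed
    show "intss (M y)" if "plog y"
    proof -
      from intss_kronS[OF structured_intss[OF st(1), of i s] structured_intss[OF st(2), of j t], of "\<epsilon> * (- c i j r)"] that show ?thesis
        by (simp add: M_def pmat_def y plog_def)
    qed
    show "pratio q l z y \<noteq> 0" if "plog y" "z \<notin> ?B" for z
      using that d[OF that(2)] g S by (auto simp: plog_def y pratio_def field_simps)
    show "nilp (M y)" if "\<not> plog y"
    proof -
      have "nilp (L1 i s k) \<or> nilp (L2 j t m)" using structured_nilp[OF st(1)] structured_nilp[OF st(2)] that unfolding plog_def y prod.case by blast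
      then show ?thesis unfolding M_def pmat_def y prod.case by (intro nilp_cs nilp_kronS)
    qed
  qed
  then obtain P where P: "mreg ?B P" "\<And>z \<omega>. z \<notin> ?B \<Longrightarrow> (\<forall>y\<in>X. if plog y then exp (\<omega> y) = pratio q l z y else \<omega> y = pratio q l z y) \<Longrightarrow>
     P z = mat_of (exp (\<Sum>y\<in>X. cs (\<omega> y) (M y)))" by blast
  have "(\<Sum>y\<in>X. cs (\<omega> y) (M y)) = cs (of_int \<epsilon>) (\<Sum>y\<in>?J. cs (\<omega> y) (pmat c L1 L2 y))" for \<omega>
  proof -
    have "(\<Sum>y\<in>X. cs (\<omega> y) (M y)) = (\<Sum>y\<in>?J. cs (\<omega> y) (M y))"
      by (rule sum.mono_neutral_left[OF J]) (auto simp: X_def M_def)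
    also have "\<dots> = (\<Sum>y\<in>?J. cs (of_int \<epsilon>) (cs (\<omega> y) (pmat c L1 L2 y)))" by (simp add: M_def mult.commute)
    also have "\<dots> = cs (of_int \<epsilon>) (\<Sum>y\<in>?J. cs (\<omega> y) (pmat c L1 L2 y))" by (simp only: cs_sum_right)
    finally show ?thesis .
  qed
  then have "P z = mat_of (exp (cs (of_int \<epsilon>) (\<Sum>y\<in>?J. cs (\<omega> y) (pmat c L1 L2 y))))"
    if "z \<notin> ?B" "plift q l c ?J L1 L2 z \<omega>" for z \<omega>
    using P(2)[OF that(1), of \<omega>] that(2) by (simp add: X_def plift_def)
  with P(1) show ?thesis by blast
qed

section \<open>Small spectral parameters\<close>

text \<open>For small \<zeta> a large circle is a valid contour, because the arguments of the
  logarithm stay in a disc around 0 free of singularities. A whole disc of \<zeta> is thus available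
  to determine the rational extension.\<close>

lemma A_int_near_0:
  fixes V1 :: "('i::finite, 'n::finite) lrep" and V2 :: "('i, 'm::finite) lrep"
  assumes V1: "good V1" and L1: "logdata V1 S1 K1 L1" and V2: "good V2" and L2: "logdata V2 S2 K2 L2"
    and R: "finite (relevant_r c)"
  shows "\<exists>\<epsilon>>0. \<exists>\<gamma>. adm_contour (spec V1) \<gamma> \<and> (\<forall>\<zeta>. norm \<zeta> < \<epsilon> \<longrightarrow> \<zeta> \<in> A_dom q l c V2 \<gamma> \<and>
     A_int q l c V1 V2 \<gamma> \<zeta> = mat_of (exp (Eexp q l c S1 K1 L1 S2 K2 L2 \<zeta>)))"
proof -
  have S: "finite S1" "finite S2" "0 \<notin> S2" using L1 L2 unfolding logdata_def by blast+
  have "bounded (S1 \<union> spec V1)" using S finite_spec[OF V1] by (simp add: finite_imp_bounded)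
  then obtain \<rho> where \<rho>: "\<rho> > 0" "\<And>s. s \<in> S1 \<union> spec V1 \<Longrightarrow> norm s < \<rho>"
    unfolding bounded_pos_less by blast
  \<comment> \<open>A lower bound for the moduli in S2; inserting 1 covers the empty set.\<close>
  define \<delta> where "\<delta> = Min (insert 1 (norm ` S2))"
  have \<delta>: "\<delta> > 0" "\<And>t. t \<in> S2 \<Longrightarrow> \<delta> \<le> norm t" using S by (auto simp: \<delta>_def)
  have "bounded ((\<lambda>r. q powi (int l + r)) ` relevant_r c)" using R by (intro finite_imp_bounded finite_imageI)
  then obtain C where C: "C > 0" "\<And>r. r \<in> relevant_r c \<Longrightarrow> norm (q powi (int l + r)) \<le> C"
    unfolding bounded_pos by blast
  define \<epsilon> where "\<epsilon> = \<delta> / (C * \<rho>)"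
  have \<epsilon>: "\<epsilon> > 0" using \<delta> C \<rho> by (simp add: \<epsilon>_def)
  let ?\<gamma> = "circlepath 0 \<rho>"
  have im: "path_image ?\<gamma> = sphere 0 \<rho>" using \<rho> by simp
  have w0: "winding_number ?\<gamma> z = 0" if "norm z > \<rho>" for z
    by (rule winding_number_zero_outside[of _ "cball 0 \<rho>"]) (use that \<rho> in auto)
  have w1: "winding_number ?\<gamma> z = 1" if "norm z < \<rho>" for z
    by (rule winding_number_circlepath) (use that in simp)
  have inside: "norm z \<le> \<rho>" if "z \<in> path_image ?\<gamma> \<union> inside_path ?\<gamma>" for z
    using that w0[of z] im by (fastforce simp: inside_path_def)
  have adm: "adm_contour S ?\<gamma>" if "S \<subseteq> S1 \<union> spec V1" for S
    unfolding adm_contour_def im using w1 \<rho>(2) that by fastforce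
  have small: "norm (q powi (int l + r) * \<zeta> * z) < \<delta>"
    if "norm \<zeta> < \<epsilon>" "r \<in> relevant_r c" "norm z \<le> \<rho>" for \<zeta> r z
  proof -
    have "norm (q powi (int l + r) * \<zeta> * z) \<le> C * norm \<zeta> * \<rho>"
      unfolding norm_mult by (intro mult_mono C that) (use C \<rho> in auto)
    also have "\<dots> < C * \<epsilon> * \<rho>" using that C \<rho> by simp
    also have "\<dots> = \<delta>" using C \<rho> by (simp add: \<epsilon>_def)
    finally show ?thesis .
  qed
  have seg: "norm t \<le> norm u" if "t \<in> closed_segment 0 u" for t u :: complex
    using that by (auto simp: closed_segment_def mult_left_le_one_le)
  have dom: "\<zeta> \<in> A_dom q l c V2 ?\<gamma>" if \<zeta>: "norm \<zeta> < \<epsilon>" for \<zeta>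
    unfolding A_dom_def
  proof (intro CollectI allI ballI)
    fix j r a b assume r: "r \<in> relevant_r c"
    let ?\<kappa> = "q powi (int l + r) * \<zeta>"
    have "(\<lambda>u. H_fun V2 j u $ a $ b) holomorphic_on ball 0 \<delta>"
    proof (rule holomorphic_onI)
      fix w assume "w \<in> ball (0 :: complex) \<delta>"
      then have "\<forall>t\<in>S2. t \<notin> closed_segment 0 w" using seg[of _ w] \<delta>(2) by fastforce
      from H_fun_deriv[OF V2 L2 this] show "(\<lambda>u. H_fun V2 j u $ a $ b) field_differentiable (at w within ball 0 \<delta>)"
        using field_differentiable_def has_field_derivative_at_within by blast
    qed
    then have h: "(\<lambda>u. H_fun V2 j u $ a $ b) analytic_on ball 0 \<delta>" by (simp add: analytic_on_open)
    have "((\<lambda>u. H_fun V2 j u $ a $ b) \<circ> (\<lambda>w. ?\<kappa> * w)) analytic_on (path_image ?\<gamma> \<union> inside_path ?\<gamma>)"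
    proof (rule analytic_on_compose)
      show "(\<lambda>w. ?\<kappa> * w) analytic_on (path_image ?\<gamma> \<union> inside_path ?\<gamma>)" by (intro analytic_intros)
      show "(\<lambda>u. H_fun V2 j u $ a $ b) analytic_on (\<lambda>w. ?\<kappa> * w) ` (path_image ?\<gamma> \<union> inside_path ?\<gamma>)"
        by (rule analytic_on_subset[OF h]) (use small[OF \<zeta> r inside] in auto)
    qed
    then show "(\<lambda>w. H_fun V2 j (?\<kappa> * w) $ a $ b) analytic_on (path_image ?\<gamma> \<union> inside_path ?\<gamma>)"
      by (simp add: o_def)
  qed
  have val: "A_int q l c V1 V2 ?\<gamma> \<zeta> = mat_of (exp (Eexp q l c S1 K1 L1 S2 K2 L2 \<zeta>))" if \<zeta>: "norm \<zeta> < \<epsilon>" for \<zeta>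
  proof (rule A_int_formula[OF L1 V2 L2])
    show "path_image ?\<gamma> \<inter> S1 = {}" using adm[of S1] unfolding adm_contour_def by blast
    show "winding_number ?\<gamma> s = 1" if "s \<in> S1" for s using w1 \<rho>(2) that by blast
    fix j r t z assume r: "r \<in> relevant_r c" and t: "t \<in> S2" "t \<in> closed_segment 0 (q powi (int l + r) * \<zeta> * z)"
    have "\<not> norm z \<le> \<rho>" using small[OF \<zeta> r, of z] seg[OF t(2)] \<delta>(2)[OF t(1)] by linarith
    then show "z \<notin> path_image ?\<gamma> \<and> winding_number ?\<gamma> z = 0" using w0 im by auto
  qed simp_all
  show ?thesis
    by (intro exI[of _ \<epsilon>] exI[of _ ?\<gamma>] conjI allI impI \<epsilon> adm dom val) auto
qed

section \<open>The rational operator\<close>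

lemma A_int_rational:
  fixes V1 :: "('i::finite, 'n::finite) lrep" and V2 :: "('i, 'm::finite) lrep"
  assumes V1: "good V1" and V2: "good V2" and q: "q \<noteq> 0" and R: "finite (relevant_r c)"
    and L1: "logdata V1 (spec V1) K1 L1" and L2: "logdata V2 (spec V2) K2 L2"
    and \<gamma>: "adm_contour (spec V1) \<gamma>" and \<zeta>: "\<zeta> \<in> A_dom q l c V2 \<gamma>"
  shows "\<zeta> \<notin> pairpoles q l (relevant_r c) (spec V1) L2 (spec V2)"
    and "A_int q l c V1 V2 \<gamma> \<zeta> = mat_of (exp (Eexp q l c (spec V1) K1 L1 (spec V2) K2 L2 \<zeta>))"
proof -
  have g: "valid_path \<gamma>" "pathfinish \<gamma> = pathstart \<gamma>" "path_image \<gamma> \<inter> spec V1 = {}"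
    "\<And>s. s \<in> spec V1 \<Longrightarrow> winding_number \<gamma> s = 1" using \<gamma> unfolding adm_contour_def by blast+
  have dom: "z \<notin> path_image \<gamma> \<and> winding_number \<gamma> z = 0" if "r \<in> relevant_r c" "t \<in> spec V2" "\<exists>m. L2 j t m \<noteq> 0"
     "t \<in> closed_segment 0 (q powi (int l + r) * \<zeta> * z)" for j r t z
    by (rule A_dom_segment[OF V2 L2 that(2,3) \<zeta> that(1,4)])
  show "A_int q l c V1 V2 \<gamma> \<zeta> = mat_of (exp (Eexp q l c (spec V1) K1 L1 (spec V2) K2 L2 \<zeta>))"
    by (rule A_int_formula[OF L1 V2 L2 g dom])
  \<comment> \<open>A pole would make t the endpoint of the segment to \<kappa> s, although s is
    enclosed by the contour.\<close>
  show "\<zeta> \<notin> pairpoles q l (relevant_r c) (spec V1) L2 (spec V2)"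
  proof
    assume "\<zeta> \<in> pairpoles q l (relevant_r c) (spec V1) L2 (spec V2)"
    then obtain s t r j m where h: "s \<in> spec V1" "t \<in> spec V2" "L2 j t m \<noteq> 0" "r \<in> relevant_r c"
      "\<zeta> = t / s * q powi (- int l - r)" unfolding pairpoles_def by auto
    have s0: "s \<noteq> 0" using h(1) zero_notin_spec[OF V1] by blast
    have "q powi (int l + r) * q powi (- int l - r) = 1"
      using q by (simp add: power_int_add[symmetric])
    moreover have "q powi (int l + r) * \<zeta> * s = q powi (int l + r) * q powi (- int l - r) * (t / s * s)"
      unfolding h(5) by (simp only: mult_ac)
    ultimately have "q powi (int l + r) * \<zeta> * s = t" using s0 by simp
    then have "t \<in> closed_segment 0 (q powi (int l + r) * \<zeta> * s)" by simp
    moreover have "\<exists>m. L2 j t m \<noteq> 0" using h(3) by blast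
    ultimately have "winding_number \<gamma> s = 0" using dom[OF h(4,2)] by blast
    then show False using g(4)[OF h(1)] by simp
  qed
qed

text \<open>Shows that the choice in \<open>A_op\<close> succeeds and computes its outcome off B.
  The functions P and P' are the exponentials of the exponent and of its negative.\<close>

lemma A_op_structure:
  fixes V1 :: "('i::finite, 'n::finite) lrep" and V2 :: "('i, 'm::finite) lrep" and l :: nat
  assumes V1: "good V1" and V2: "good V2" and q: "q \<noteq> 0" and R: "finite (relevant_r c)"
    and L1: "logdata V1 (spec V1) K1 L1" "structured V1 L1" and L2: "logdata V2 (spec V2) K2 L2" "structured V2 L2"
  defines "B \<equiv> pairpoles q l (relevant_r c) (spec V1) L2 (spec V2)"
  shows "A_ext_prop q l c V1 V2 (A_op q l c V1 V2)"
    and "mpoles (A_op q l c V1 V2) \<subseteq> B"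
    and "mpoles (\<lambda>\<zeta>. matrix_inv (A_op q l c V1 V2 \<zeta>)) \<subseteq> B"
    and "mreg B (A_op q l c V1 V2)"
    and "\<And>z \<omega>. z \<notin> B \<Longrightarrow> plift q l c (pidx (relevant_r c) (spec V1) K1 (spec V2) K2) L1 L2 z \<omega> \<Longrightarrow>
       A_op q l c V1 V2 z = mat_of (exp (\<Sum>y\<in>pidx (relevant_r c) (spec V1) K1 (spec V2) K2. cs (\<omega> y) (pmat c L1 L2 y)))"
proof -
  let ?S1 = "spec V1" and ?S2 = "spec V2"
  let ?J = "pidx (relevant_r c) ?S1 K1 ?S2 K2 :: 'i pidx set" and ?A = "A_op q l c V1 V2"
  let ?sum = "\<lambda>\<omega>. \<Sum>y\<in>?J. cs (\<omega> y) (pmat c L1 L2 y)"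
  have S: "finite ?S1" "0 \<notin> ?S1" "finite ?S2" "0 \<notin> ?S2" using finite_spec zero_notin_spec V1 V2 by blast+
  have B: "finite B" unfolding B_def by (rule finite_pairpoles[OF R S(1,3)])
  note rat = Eexp_rational[OF q S R L1(2) L2(2), of l K1 K2]
  obtain P where P: "mreg B P" "\<And>z \<omega>. z \<notin> B \<Longrightarrow> plift q l c ?J L1 L2 z \<omega> \<Longrightarrow> P z = mat_of (exp (cs (of_int 1) (?sum \<omega>)))"
    using rat[of 1] unfolding B_def by blast
  obtain P' where P': "mreg B P'" "\<And>z \<omega>. z \<notin> B \<Longrightarrow> plift q l c ?J L1 L2 z \<omega> \<Longrightarrow> P' z = mat_of (exp (cs (of_int (-1)) (?sum \<omega>)))"
    using rat[of "-1"] unfolding B_def by blast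
  have lift: "plift q l c ?J L1 L2 z (pcoef q l z)" if "z \<notin> B" for z
    using plift_pcoef[OF q S(2,4)] that unfolding B_def by blast
  obtain Q where Q: "ratm Q" "\<And>z. z \<notin> B \<Longrightarrow> Q z = P z" using ratm_of_mreg[OF P(1)] by blast
  have int: "\<zeta> \<notin> B \<and> A_int q l c V1 V2 \<gamma> \<zeta> = P \<zeta>" if "adm_contour ?S1 \<gamma>" "\<zeta> \<in> A_dom q l c V2 \<gamma>" for \<gamma> \<zeta>
  proof
    show z: "\<zeta> \<notin> B" unfolding B_def by (rule A_int_rational(1)[OF V1 V2 q R L1(1) L2(1) that])
    show "A_int q l c V1 V2 \<gamma> \<zeta> = P \<zeta>"
      unfolding A_int_rational(2)[OF V1 V2 q R L1(1) L2(1) that] P(2)[OF z lift[OF z]] Eexp_sum by simp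
  qed
  have "A_ext_prop q l c V1 V2 Q" unfolding A_ext_prop_def using Q int by metis
  then show ext: "A_ext_prop q l c V1 V2 ?A" unfolding A_op_def by (rule someI[of "A_ext_prop q l c V1 V2"])
  obtain \<epsilon> \<gamma> where e: "\<epsilon> > 0" "adm_contour ?S1 \<gamma>" "\<And>\<zeta>. norm \<zeta> < \<epsilon> \<Longrightarrow> \<zeta> \<in> A_dom q l c V2 \<gamma>"
    using A_int_near_0[OF V1 L1(1) V2 L2(1) R, of q l] by blast
  \<comment> \<open>Agreement on a disc identifies the chosen function with P everywhere off B,
    although the extension property itself speaks only of \<open>A_dom\<close>.\<close>
  have near: "?A \<zeta> = P \<zeta>" if "norm \<zeta> < \<epsilon>" for \<zeta>
    using ext int[OF e(2) e(3)[OF that]] e(2) e(3)[OF that] unfolding A_ext_prop_def by metis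
  have inf: "\<exists>z. z \<notin> Z \<and> ?A z = P z" if fZ: "finite Z" for Z
  proof -
    have "infinite (ball (0::complex) \<epsilon>)" using e(1) finite_imp_not_open[of "ball (0::complex) \<epsilon>"] by auto
    then obtain z where "z \<in> ball 0 \<epsilon>" "z \<notin> Z" using fZ by (meson finite_subset subsetI)
    then show ?thesis using near[of z] by auto
  qed
  have rA: "ratm ?A" using ext unfolding A_ext_prop_def by blast
  show "mpoles ?A \<subseteq> B" by (rule ratm_eq_mreg(1)[OF rA P(1) B]) (rule inf)
  show "mreg B ?A" by (rule ratm_eq_mreg(2)[OF rA P(1) B]) (rule inf)
  have AP: "?A z = P z" if "z \<notin> B" for z by (rule ratm_eq_mreg(3)[OF rA P(1) B _ that]) (rule inf)
  show val: "?A z = mat_of (exp (?sum \<omega>))" if "z \<notin> B" "plift q l c ?J L1 L2 z \<omega>" for z \<omega>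
    using AP[OF that(1)] P(2)[OF that] by simp
  show "mpoles (\<lambda>\<zeta>. matrix_inv (?A \<zeta>)) \<subseteq> B"
  proof
    fix z assume z: "z \<in> mpoles (\<lambda>\<zeta>. matrix_inv (?A \<zeta>))"
    show "z \<in> B"
    proof (rule ccontr)
      assume zB: "z \<notin> B"
      have "\<not> is_pole (\<lambda>\<zeta>. matrix_inv (?A \<zeta>)) z"
      proof (rule mreg_not_pole[OF P'(1) B zB])
        fix z assume z: "z \<notin> B"
        let ?X = "?sum (pcoef q l z)"
        have "cs (of_int (-1)) ?X = - ?X" by (simp add: cs_minus_left)
        then have "?A z ** P' z = mat_of (exp ?X * exp (- ?X))"
          unfolding val[OF z lift[OF z]] P'(2)[OF z lift[OF z]] by (simp only: mat_of_simps)
        also have "\<dots> = mat 1" unfolding exp_minus_inverse by (simp only: mat_of_simps)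
        finally show "matrix_inv (?A z) = P' z" by (rule matrix_inv_unique)
      qed
      then show False using z unfolding mpoles_def by simp
    qed
  qed
qed

lemma A_op_ext:
  assumes "good V1" "good V2" "q \<noteq> 0" "finite (relevant_r c)"
  shows "A_ext_prop q l c V1 V2 (A_op q l c V1 V2)"
proof -
  obtain K1 L1 where 1: "logdata V1 (spec V1) K1 L1" "structured V1 L1" using good_logdata[OF assms(1)] by blast
  obtain K2 L2 where 2: "logdata V2 (spec V2) K2 L2" "structured V2 L2" using good_logdata[OF assms(2)] by blast
  show ?thesis by (rule A_op_structure(1)[OF assms 1 2])
qed

lemma A_op_mreg:
  assumes "good V1" "good V2" "q \<noteq> 0" "finite (relevant_r c)"
  shows "finite (mpoles (A_op q l c V1 V2))" "mreg (mpoles (A_op q l c V1 V2)) (A_op q l c V1 V2)"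
  using ratm_mpoles A_op_ext[OF assms, of l] unfolding A_ext_prop_def by blast+

lemma A_op_near_0:
  assumes "good V1" "good V2" "q \<noteq> 0" "finite (relevant_r c)"
    and "logdata V1 S1 K1 L1" "logdata V2 S2 K2 L2"
  shows "\<exists>\<epsilon>>0. \<forall>\<zeta>. norm \<zeta> < \<epsilon> \<longrightarrow> A_op q l c V1 V2 \<zeta> = mat_of (exp (Eexp q l c S1 K1 L1 S2 K2 L2 \<zeta>))"
proof -
  obtain \<epsilon> \<gamma> where e: "\<epsilon> > 0" "adm_contour (spec V1) \<gamma>" "\<And>\<zeta>. norm \<zeta> < \<epsilon> \<Longrightarrow> \<zeta> \<in> A_dom q l c V2 \<gamma>"
    "\<And>\<zeta>. norm \<zeta> < \<epsilon> \<Longrightarrow> A_int q l c V1 V2 \<gamma> \<zeta> = mat_of (exp (Eexp q l c S1 K1 L1 S2 K2 L2 \<zeta>))"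
    using A_int_near_0[OF assms(1,5,2,6,4), of q l] by blast
  have "A_op q l c V1 V2 \<zeta> = mat_of (exp (Eexp q l c S1 K1 L1 S2 K2 L2 \<zeta>))" if "norm \<zeta> < \<epsilon>" for \<zeta>
    using A_op_ext[OF assms(1-4), of l] e(2) e(3,4)[OF that] unfolding A_ext_prop_def by metis
  with e(1) show ?thesis by blast
qed

lemma A_op_0:
  fixes V1 :: "('i::finite, 'n::finite) lrep" and V2 :: "('i, 'm::finite) lrep"
  assumes "good V1" "good V2" "q \<noteq> 0" "finite (relevant_r c)"
  shows "A_op q l c V1 V2 0 = mat 1" "0 \<notin> mpoles (A_op q l c V1 V2)"
proof -
  obtain K1 L1 where 1: "logdata V1 (spec V1) K1 L1" "structured V1 L1" using good_logdata[OF assms(1)] by blast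
  obtain K2 L2 where 2: "logdata V2 (spec V2) K2 L2" "structured V2 L2" using good_logdata[OF assms(2)] by blast
  have "0 \<notin> pairpoles q l (relevant_r c) (spec V1) L2 (spec V2)"
    using zero_notin_spec[OF assms(1)] zero_notin_spec[OF assms(2)] assms(3) unfolding pairpoles_def by auto
  then show "0 \<notin> mpoles (A_op q l c V1 V2)" using A_op_structure(2)[OF assms 1 2, of l] by blast
  obtain \<epsilon> \<gamma> where e: "\<epsilon> > 0" "adm_contour (spec V1) \<gamma>" "\<And>\<zeta>. norm \<zeta> < \<epsilon> \<Longrightarrow> \<zeta> \<in> A_dom q l c V2 \<gamma>"
    using A_int_near_0[OF assms(1) 1(1) assms(2) 2(1) assms(4), of q l] by blast
  \<comment> \<open>At \<zeta> = 0 every segment of integration is constant, so the whole exponent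
    vanishes.\<close>
  have H: "H_fun V2 j 0 = 0" for j by (simp add: H_fun_def mcint_def vec_eq_iff)
  have "A_int q l c V1 V2 \<gamma> 0 = mexp (smat (-1) 0)"
    unfolding A_int_def by (intro arg_cong[where f = mexp] arg_cong[where f = "smat (-1)"] sum.neutral ballI)
      (simp add: H vec_eq_iff moint_def mcint_def kron_nth)
  also have "smat (-1) 0 = (0 :: ('n \<times> 'm) cmat)" by (simp add: vec_eq_iff)
  also have "mexp (0 :: ('n \<times> 'm) cmat) = mat 1"
  proof -
    have "mexp (mat_of 0 :: ('n \<times> 'm) cmat) = mat_of (exp 0)" unfolding mexp_exp by (simp only: Sq_mat_of)
    then show ?thesis by (simp add: mat_of_simps)
  qed
  finally have "A_int q l c V1 V2 \<gamma> 0 = mat 1" .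
  then show "A_op q l c V1 V2 0 = mat 1"
    using A_op_ext[OF assms, of l] e(1,2) e(3)[of 0] unfolding A_ext_prop_def by (metis norm_zero)
qed

lemma mat_of_exp_commute:
  assumes "X * Y = Y * X"
  shows "mat_of (exp X) ** mat_of (exp Y) = mat_of (exp Y) ** mat_of (exp X)"
proof -
  have "exp X * exp Y = exp (X + Y)" by (rule exp_add_commuting[OF assms, symmetric])
  also have "X + Y = Y + X" by (rule add.commute)
  also have "exp (Y + X) = exp Y * exp X" by (rule exp_add_commuting[OF assms[symmetric]])
  finally show ?thesis unfolding mat_of_simps(6)[symmetric] by (rule arg_cong)
qed

text \<open>Off the explicit set B both values are exponentials of commuting sums. As B may exceed
  the true pole set, the identity is then extended in one variable at a time.\<close>

lemma A_op_commute:
  assumes h: "good V1" "good V2" "q \<noteq> 0" "finite (relevant_r c)"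
    and z: "\<zeta> \<notin> mpoles (A_op q l c V1 V2)" "\<zeta>' \<notin> mpoles (A_op q l c V1 V2)"
  shows "A_op q l c V1 V2 \<zeta> ** A_op q l c V1 V2 \<zeta>' = A_op q l c V1 V2 \<zeta>' ** A_op q l c V1 V2 \<zeta>"
proof -
  let ?A = "A_op q l c V1 V2"
  obtain K1 L1 where 1: "logdata V1 (spec V1) K1 L1" "structured V1 L1" using good_logdata[OF h(1)] by blast
  obtain K2 L2 where 2: "logdata V2 (spec V2) K2 L2" "structured V2 L2" using good_logdata[OF h(2)] by blast
  let ?B = "pairpoles q l (relevant_r c) (spec V1) L2 (spec V2)"
  have S: "finite (spec V1)" "0 \<notin> spec V1" "finite (spec V2)" "0 \<notin> spec V2" using finite_spec zero_notin_spec h by blast+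
  have B: "finite ?B" by (rule finite_pairpoles[OF h(4) S(1,3)])
  note m = A_op_mreg[OF h, of l]
  let ?X = "\<lambda>z. \<Sum>y\<in>pidx (relevant_r c) (spec V1) K1 (spec V2) K2. cs (pcoef q l z y) (pmat c L1 L2 y)"
  have val: "?A z = mat_of (exp (?X z))" if "z \<notin> ?B" for z
    by (rule A_op_structure(5)[OF h 1 2 that plift_pcoef[OF h(3) S(2,4) that]])
  have c0: "cs u (pmat c L1 L2 x) * cs v (pmat c L1 L2 y) = cs v (pmat c L1 L2 y) * cs u (pmat c L1 L2 x)" for u v x y
    unfolding cs_mult_left cs_mult_right cs_cs pmat_commute[OF 1(2) 2(2), of c x y] by (simp only: mult.commute)
  have c1: "cs u (pmat c L1 L2 x) * ?X w = ?X w * cs u (pmat c L1 L2 x)" for u x w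
    by (rule commute_sum) (rule c0)
  have c: "?X z * ?X w = ?X w * ?X z" for z w
    by (rule commute_sum) (rule c1[symmetric])
  have gen: "?A z ** ?A w = ?A w ** ?A z" if "z \<notin> ?B" "w \<notin> ?B" for z w
    unfolding val[OF that(1)] val[OF that(2)] by (rule mat_of_exp_commute[OF c])
  have ext: "?A z ** ?A w = ?A w ** ?A z" if "w \<notin> ?B" "z \<notin> mpoles ?A" for z w
  proof (rule mreg_unique[OF _ _ _ that(2), of "\<lambda>z. ?A z ** ?A w" "\<lambda>z. ?A w ** ?A z"])
    have "infinite (- (?B \<union> mpoles ?A))" using B m by (intro infinite_compl_finite) auto
    then show "infinite {z. z \<notin> mpoles ?A \<and> ?A z ** ?A w = ?A w ** ?A z}"
      by (rule infinite_super[rotated]) (use gen that(1) in auto)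
  qed (intro mreg_mult mreg_const m)+
  show ?thesis
  proof (rule mreg_unique[OF _ _ _ z(2), of "\<lambda>w. ?A \<zeta> ** ?A w" "\<lambda>w. ?A w ** ?A \<zeta>"])
    have "infinite (- (?B \<union> mpoles ?A))" using B m by (intro infinite_compl_finite) auto
    then show "infinite {w. w \<notin> mpoles ?A \<and> ?A \<zeta> ** ?A w = ?A w ** ?A \<zeta>}"
      by (rule infinite_super[rotated]) (use ext z(1) in auto)
  qed (intro mreg_mult mreg_const m)+
qed

text \<open>The point 0 is exempted from the agreement so that functions of 1/z can be compared as
  well.\<close>

lemma mreg_eq_near_0:
  assumes "mreg B f" "mreg B' g" "finite B" "finite B'"
    and "\<epsilon> > 0" "\<And>z. z \<noteq> 0 \<Longrightarrow> norm z < \<epsilon> \<Longrightarrow> f z = g z" and z: "z \<notin> B" "z \<notin> B'"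
  shows "f z = g z"
proof (rule mreg_unique[of "B \<union> B'"])
  show "mreg (B \<union> B') f" "mreg (B \<union> B') g" using assms mreg_mono by blast+
  have "infinite (ball (0::complex) \<epsilon>)" using assms(5) finite_imp_not_open[of "ball (0::complex) \<epsilon>"] by auto
  then have "infinite (ball 0 \<epsilon> - (insert 0 (B \<union> B')))" using assms(3,4) by (intro Diff_infinite_finite) auto
  then show "infinite {z. z \<notin> B \<union> B' \<and> f z = g z}"
    by (rule infinite_super[rotated]) (use assms(6) in auto)
qed (use z in auto)

section \<open>Homomorphisms into tensor products\<close>

text \<open>After relabelling by f, the matrix acts on the first factor and the identity on the
  second. The legs occurring in the theorem and the flip all have this form and can share one set of
  lemmas.\<close>

definition emb :: "('x::finite \<Rightarrow> 'y::finite \<times> 'z::finite) \<Rightarrow> 'y cmat \<Rightarrow> 'x cmat" where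
  "emb f M = (\<chi> x y. M $ fst (f x) $ fst (f y) * (if snd (f x) = snd (f y) then 1 else 0))"

definition embS :: "('x::finite \<Rightarrow> 'y::finite \<times> 'z::finite) \<Rightarrow> 'y sqm \<Rightarrow> 'x sqm" where
  "embS f X = Sq (emb f (mat_of X))"

lemma mat_of_embS: "mat_of (embS f X) = emb f (mat_of X)"
  by (simp add: embS_def mat_of_Sq)

lemma embS_add: "embS f (X + Y) = embS f X + embS f Y"
  by (rule sqm_eqI) (simp add: mat_of_embS mat_of_simps emb_def algebra_simps)

lemma embS_cs: "embS f (cs c X) = cs c (embS f X)"
  by (rule sqm_eqI) (simp add: mat_of_embS mat_of_cs_nth emb_def algebra_simps)

lemma embS_sum: "embS f (sum g S) = (\<Sum>i\<in>S. embS f (g i))"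
proof (induction S rule: infinite_finite_induct)
  case (insert x F)
  then show ?case by (simp add: embS_add)
qed (rule sqm_eqI, simp add: mat_of_embS mat_of_simps emb_def)+

lemma embS_mult:
  assumes f: "bij f"
  shows "embS f (X * Y) = embS f X * embS f Y"
proof (rule sqm_eqI)
  fix a b
  let ?d = "\<lambda>x y. (if x = y then 1 else 0 :: complex)"
  have "mat_of (embS f X * embS f Y) $ a $ b = (\<Sum>z\<in>UNIV. (\<lambda>(u, v).
      mat_of X $ fst (f a) $ u * ?d (snd (f a)) v * (mat_of Y $ u $ fst (f b) * ?d v (snd (f b)))) (f z))"
    by (simp add: mat_of_simps mat_of_embS cmat_nth_mult emb_def case_prod_unfold)
  also have "\<dots> = (\<Sum>z\<in>UNIV. (\<lambda>(u, v).
      mat_of X $ fst (f a) $ u * ?d (snd (f a)) v * (mat_of Y $ u $ fst (f b) * ?d v (snd (f b)))) z)"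
    by (rule sum.reindex_bij_betw[OF f])
  also have "\<dots> = (\<Sum>u\<in>UNIV. \<Sum>v\<in>UNIV. if v = snd (f a) then
      mat_of X $ fst (f a) $ u * (mat_of Y $ u $ fst (f b) * ?d (snd (f a)) (snd (f b))) else 0)"
    unfolding UNIV_Times_UNIV[symmetric] sum.cartesian_product[symmetric] by (intro sum.cong refl) auto
  also have "\<dots> = (\<Sum>u\<in>UNIV. mat_of X $ fst (f a) $ u * (mat_of Y $ u $ fst (f b) * ?d (snd (f a)) (snd (f b))))"
    by simp
  also have "\<dots> = (\<Sum>u\<in>UNIV. mat_of X $ fst (f a) $ u * mat_of Y $ u $ fst (f b)) * ?d (snd (f a)) (snd (f b))"
    by (simp only: sum_distrib_right mult.assoc)
  also have "\<dots> = mat_of (embS f (X * Y)) $ a $ b"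
    by (simp only: mat_of_simps mat_of_embS cmat_nth_mult emb_def vec_lambda_beta)
  finally show "mat_of (embS f (X * Y)) $ a $ b = mat_of (embS f X * embS f Y) $ a $ b" ..
qed

lemma embS_one:
  assumes f: "inj f"
  shows "embS f 1 = 1"
  by (rule sqm_eqI) (auto simp: mat_of_embS mat_of_simps emb_def mat_def prod_eq_iff inj_eq[OF f, symmetric])

lemma emb_exp:
  assumes f: "bij f"
  shows "emb f (mat_of (exp X)) = mat_of (exp (embS f X))"
  unfolding mat_of_embS[symmetric]
  by (rule arg_cong[where f = mat_of], rule exp_hom)
    (auto simp: embS_add embS_cs embS_mult[OF f] embS_one[OF bij_is_inj[OF f]])

lemma mreg_emb: "mreg B g \<Longrightarrow> mreg B (\<lambda>z. emb f (g z))"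
  unfolding mreg_def emb_def by (auto intro!: rreg_mult)

lemma pairsum_embS_left:
  assumes "\<And>A C. embS f (kronS A C) = kronS (\<psi> A) C"
  shows "embS f (pairsum \<kappa> S K C T M D) = pairsum \<kappa> S K (\<lambda>s k. \<psi> (C s k)) T M D"
  unfolding pairsum_def embS_sum embS_cs assms ..

lemma pairsum_embS_right:
  assumes "\<And>A C. embS f (kronS A C) = kronS A (\<psi> C)"
  shows "embS f (pairsum \<kappa> S K C T M D) = pairsum \<kappa> S K C T M (\<lambda>t m. \<psi> (D t m))"
  unfolding pairsum_def embS_sum embS_cs assms ..

lemma embS_Eexp: "embS f (Eexp q l c S1 K1 L1 S2 K2 L2 \<zeta>) = cs (-1) (\<Sum>i\<in>UNIV. \<Sum>j\<in>UNIV. \<Sum>r\<in>relevant_r c. cs (of_int (c i j r))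
      (embS f (pairsum (q powi (int l + r) * \<zeta>) S1 K1 (L1 i) S2 K2 (L2 j))))"
  unfolding Eexp_def embS_cs embS_sum ..

text \<open>A homogeneity property: together with \<open>pairing_scale_right\<close> it moves a
  rescaling of singular points into \<kappa>.\<close>

lemma pairing_scale_left: "\<zeta> ^ k * pairing k m \<kappa> (\<zeta> * s) t = pairing k m (\<kappa> * \<zeta>) s t"
  by (simp add: pairing_def power_mult_distrib mult_ac)

lemma pairing_scale_right:
  assumes "\<zeta> \<noteq> 0"
  shows "\<zeta> ^ m * pairing k m \<kappa> s (\<zeta> * t) = pairing k m (\<kappa> / \<zeta>) s t"
proof -
  have "(\<kappa> * s - \<zeta> * t) = \<zeta> * (\<kappa> / \<zeta> * s - t)" using assms by (simp add: field_simps)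
  then have e: "(\<kappa> * s - \<zeta> * t) ^ (k + m) = \<zeta> ^ k * \<zeta> ^ m * (\<kappa> / \<zeta> * s - t) ^ (k + m)"
    by (simp only: power_mult_distrib power_add mult_ac)
  show ?thesis unfolding pairing_def e using assms
    by (simp add: power_divide mult_ac)
qed

lemma pairsum_scale_left:
  assumes "\<zeta> \<noteq> 0"
  shows "pairsum \<kappa> ((\<lambda>s. \<zeta> * s) ` S) K (\<lambda>s k. cs (\<zeta> ^ k) (C (s / \<zeta>) k)) T M D = pairsum (\<kappa> * \<zeta>) S K C T M D"
proof -
  have inj: "inj_on (\<lambda>s. \<zeta> * s) S" using assms by (simp add: inj_on_def)
  show ?thesis unfolding pairsum_def sum.reindex[OF inj] o_def
    using assms by (simp add: mult.commute pairing_scale_left[symmetric])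
qed

lemma pairsum_scale_right:
  assumes "\<zeta> \<noteq> 0"
  shows "pairsum \<kappa> S K C ((\<lambda>s. \<zeta> * s) ` T) M (\<lambda>t m. cs (\<zeta> ^ m) (D (t / \<zeta>) m)) = pairsum (\<kappa> / \<zeta>) S K C T M D"
proof -
  have inj: "inj_on (\<lambda>s. \<zeta> * s) T" using assms by (simp add: inj_on_def)
  show ?thesis unfolding pairsum_def sum.reindex[OF inj] o_def
    using assms by (simp add: mult.commute pairing_scale_right[OF assms, symmetric])
qed

lemma pairsum_add_left: "pairsum \<kappa> S K (\<lambda>s k. C s k + C' s k) T M D = pairsum \<kappa> S K C T M D + pairsum \<kappa> S K C' T M D"
  unfolding pairsum_def kronS_add_left cs_add_right sum.distrib ..

lemma pairsum_add_right: "pairsum \<kappa> S K C T M (\<lambda>s k. D s k + D' s k) = pairsum \<kappa> S K C T M D + pairsum \<kappa> S K C T M D'"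
  unfolding pairsum_def kronS_add_right cs_add_right sum.distrib ..

lemma pairsum_extend_left:
  assumes "finite S'" "S \<subseteq> S'" "K \<le> K'" "\<And>s k. s \<notin> S \<or> k \<ge> K \<Longrightarrow> C s k = 0"
  shows "pairsum \<kappa> S' K' C T M D = pairsum \<kappa> S K C T M D"
proof -
  have "pairsum \<kappa> S' K' C T M D = (\<Sum>s\<in>S'. \<Sum>k<K. \<Sum>t\<in>T. \<Sum>m<M. cs (pairing k m \<kappa> s t) (kronS (C s k) (D t m)))"
    unfolding pairsum_def by (intro sum.cong refl sum.mono_neutral_right) (use assms in auto)
  also have "\<dots> = pairsum \<kappa> S K C T M D" unfolding pairsum_def
    by (intro sum.mono_neutral_right) (use assms in auto)
  finally show ?thesis .
qed

lemma pairsum_extend_right: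
  assumes "finite T'" "T \<subseteq> T'" "M \<le> M'" "\<And>s k. s \<notin> T \<or> k \<ge> M \<Longrightarrow> D s k = 0"
  shows "pairsum \<kappa> S K C T' M' D = pairsum \<kappa> S K C T M D"
proof -
  have "pairsum \<kappa> S K C T' M' D = (\<Sum>s\<in>S. \<Sum>k<K. \<Sum>t\<in>T'. \<Sum>m<M. cs (pairing k m \<kappa> s t) (kronS (C s k) (D t m)))"
    unfolding pairsum_def by (intro sum.cong refl sum.mono_neutral_right) (use assms in auto)
  also have "\<dots> = pairsum \<kappa> S K C T M D" unfolding pairsum_def
    by (intro sum.cong refl sum.mono_neutral_right) (use assms in auto)
  finally show ?thesis .
qed

section \<open>Logarithmic derivatives of shifts and tensor products\<close>

text \<open>The chain rule for w / \<zeta>: poles move to \<zeta> s, and the coefficient with index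
  k gains \<open>\<zeta> ^ k\<close>.\<close>

lemma Lsum_scale:
  assumes "\<zeta> \<noteq> 0"
  shows "Lsum ((\<lambda>s. \<zeta> * s) ` S) K (\<lambda>s k. cs (\<zeta> ^ k) (C (s / \<zeta>) k)) w = cs (1 / \<zeta>) (Lsum S K C (w / \<zeta>))"
proof -
  have inj: "inj_on (\<lambda>s. \<zeta> * s) S" using assms by (simp add: inj_on_def)
  have "1 / (w - \<zeta> * s) ^ Suc k * \<zeta> ^ k = 1 / \<zeta> * (1 / (w / \<zeta> - s) ^ Suc k)" for s k
  proof -
    have "w - \<zeta> * s = \<zeta> * (w / \<zeta> - s)" using assms by (simp add: field_simps)
    then have e: "(w - \<zeta> * s) ^ Suc k = \<zeta> * \<zeta> ^ k * (w / \<zeta> - s) ^ Suc k"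
      by (simp only: power_mult_distrib power_Suc mult_ac)
    show ?thesis unfolding e using assms by simp
  qed
  then show ?thesis unfolding Lsum_def sum.reindex[OF inj] o_def cs_sum_right cs_cs
    using assms by simp
qed

lemma DERIV_scaled:
  assumes "f field_differentiable (at (w / \<zeta>))"
  shows "((\<lambda>z. f (z / \<zeta>)) has_field_derivative deriv f (w / \<zeta>) / \<zeta>) (at w)"
proof -
  have "((\<lambda>z. z / \<zeta>) has_field_derivative 1 / \<zeta>) (at w)" by (rule DERIV_cdivide[OF DERIV_ident])
  from DERIV_chain2[OF field_differentiable_derivI[OF assms] this] show ?thesis by simp
qed

lemma logdata_transfer:
  assumes S: "finite S" and w: "w \<notin> S" and eq: "\<forall>z. z \<notin> S \<longrightarrow> f z = g z"
    and d: "\<forall>a b. ((\<lambda>z. g z $ a $ b) has_field_derivative G $ a $ b) (at w)"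
  shows "mderiv f w = G" "(\<lambda>z. f z $ a $ b) field_differentiable (at w)"
proof -
  have "((\<lambda>z. f z $ a $ b) has_field_derivative G $ a $ b) (at w)" for a b
    by (rule has_field_derivative_transform_within_open[OF d[rule_format], of "- S"])
      (use S w eq in \<open>auto simp: finite_imp_closed\<close>)
  then show "mderiv f w = G" "(\<lambda>z. f z $ a $ b) field_differentiable (at w)"
    by (auto simp: mderiv_def vec_eq_iff DERIV_imp_deriv field_differentiable_def)
qed

lemma logdata_shift:
  fixes V :: "('i::finite, 'n::finite) lrep"
  assumes V: "good V" and \<alpha>: "\<alpha> \<noteq> 0" and L: "logdata V (spec V) K L"
  shows "logdata (shift \<alpha> V) ((\<lambda>s. \<alpha> * s) ` spec V) K (\<lambda>i s k. cs (\<alpha> ^ k) (L i (s / \<alpha>) k))"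
  unfolding logdata_def
proof (intro conjI allI impI)
  let ?S = "(\<lambda>s. \<alpha> * s) ` spec V"
  have inj: "inj_on (\<lambda>s. \<alpha> * s) (spec V)" using \<alpha> by (simp add: inj_on_def)
  show fS: "finite ?S" using finite_spec[OF V] by simp
  show "0 \<notin> ?S" using zero_notin_spec[OF V] \<alpha> by auto
  show "(\<Sum>s\<in>?S. cs (\<alpha> ^ 0) (L i (s / \<alpha>) 0)) = 0" for i
    unfolding sum.reindex[OF inj] o_def using \<alpha> L by (simp add: logdata_def)
  show "cs (\<alpha> ^ k) (L i (s / \<alpha>) k) = 0" if "s \<notin> ?S \<or> K \<le> k" for i s k
  proof -
    have "s / \<alpha> \<notin> spec V \<or> K \<le> k" using that \<alpha> by (auto simp: image_iff field_simps)
    then have "L i (s / \<alpha>) k = 0" using L unfolding logdata_def by blast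
    then show ?thesis by simp
  qed
  fix i w assume w: "w \<notin> ?S"
  have w': "w / \<alpha> \<notin> spec V" using w \<alpha> by (auto simp: image_iff)
  have F: "invertible (Psi_fun V i (w / \<alpha>))" "\<And>a b. (\<lambda>z. Psi_fun V i z $ a $ b) field_differentiable (at (w / \<alpha>))"
    "matrix_inv (Psi_fun V i (w / \<alpha>)) ** mderiv (Psi_fun V i) (w / \<alpha>) = mat_of (Lsum (spec V) K (L i) (w / \<alpha>))"
    using L w' unfolding logdata_def by blast+
  have P: "\<And>z. z \<notin> ?S \<Longrightarrow> Psi_fun (shift \<alpha> V) i z = Psi_fun V i (z / \<alpha>)" using good_shift(2)[OF V \<alpha>] by blast
  have d: "((\<lambda>z. Psi_fun V i (z / \<alpha>) $ a $ b) has_field_derivative smat (1 / \<alpha>) (mderiv (Psi_fun V i) (w / \<alpha>)) $ a $ b) (at w)" for a b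
    using DERIV_scaled[OF F(2)[of a b]] by (simp add: mderiv_def)
  have P': "\<forall>z. z \<notin> ?S \<longrightarrow> Psi_fun (shift \<alpha> V) i z = Psi_fun V i (z / \<alpha>)" by (intro allI impI P)
  have d': "\<forall>a b. ((\<lambda>z. Psi_fun V i (z / \<alpha>) $ a $ b) has_field_derivative smat (1 / \<alpha>) (mderiv (Psi_fun V i) (w / \<alpha>)) $ a $ b) (at w)" by (intro allI d)
  note t = logdata_transfer[OF fS w, of "Psi_fun (shift \<alpha> V) i" _ _, OF P' d']
  show "invertible (Psi_fun (shift \<alpha> V) i w)" unfolding P[OF w] by (rule F(1))
  show "(\<lambda>z. Psi_fun (shift \<alpha> V) i z $ a $ b) field_differentiable at w" for a b by (rule t(2))
  have "M ** smat x N = smat x (M ** N)" for x and M N :: "'n cmat"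
    by (simp add: vec_eq_iff cmat_nth_mult sum_distrib_left mult_ac)
  then show "matrix_inv (Psi_fun (shift \<alpha> V) i w) ** mderiv (Psi_fun (shift \<alpha> V) i) w =
      mat_of (Lsum ?S K (\<lambda>s k. cs (\<alpha> ^ k) (L i (s / \<alpha>) k)) w)"
    unfolding t(1) P[OF w] Lsum_scale[OF \<alpha>] mat_of_cs F(3)[symmetric] by simp
qed

text \<open>The Leibniz rule for \<Psi> of a tensor product: the logarithmic derivative of a
  Kronecker product is the sum of those of the factors, the first one rescaled by \<zeta>.\<close>

definition Ldt :: "complex \<Rightarrow> ('i \<Rightarrow> complex \<Rightarrow> nat \<Rightarrow> 'n::finite sqm) \<Rightarrow> ('i \<Rightarrow> complex \<Rightarrow> nat \<Rightarrow> 'm::finite sqm) \<Rightarrow>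
    'i \<Rightarrow> complex \<Rightarrow> nat \<Rightarrow> ('n \<times> 'm) sqm" where
  "Ldt \<zeta> L1 L2 i s k = kronS (cs (\<zeta> ^ k) (L1 i (s / \<zeta>) k)) 1 + kronS 1 (L2 i s k)"

lemma logdata_dtensor:
  fixes V :: "('i::finite, 'n::finite) lrep" and W :: "('i, 'm::finite) lrep"
  assumes V: "good V" and W: "good W" and \<zeta>: "\<zeta> \<noteq> 0" and disj: "(\<lambda>s. \<zeta> * s) ` spec V \<inter> spec W = {}"
    and L1: "logdata V (spec V) K1 L1" and L2: "logdata W (spec W) K2 L2"
  shows "logdata (dtensor \<zeta> V W) ((\<lambda>s. \<zeta> * s) ` spec V \<union> spec W) (max K1 K2) (Ldt \<zeta> L1 L2)"
  unfolding logdata_def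
proof (intro conjI allI impI)
  let ?S1 = "(\<lambda>s. \<zeta> * s) ` spec V" and ?S2 = "spec W" and ?K = "max K1 K2"
  \<comment> \<open>The first factor is treated as the shift by \<zeta>, whose residue data are
    known.\<close>
  define C where "C i s k = cs (\<zeta> ^ k) (L1 i (s / \<zeta>) k)" for i s k
  have Cd: "logdata (shift \<zeta> V) ?S1 K1 C" unfolding C_def[abs_def] by (rule logdata_shift[OF V \<zeta> L1])
  have Ldt: "Ldt \<zeta> L1 L2 i s k = kronS (C i s k) 1 + kronS 1 (L2 i s k)" for i s k unfolding Ldt_def C_def ..
  have C0: "C i s k = 0" if "s \<notin> ?S1 \<or> k \<ge> K1" for i s k using Cd that unfolding logdata_def by blast
  have D0: "L2 i s k = 0" if "s \<notin> ?S2 \<or> k \<ge> K2" for i s k using L2 that unfolding logdata_def by blast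
  have fin: "finite ?S1" "finite ?S2" using finite_spec V W by auto
  show fS: "finite (?S1 \<union> ?S2)" using fin by simp
  show "0 \<notin> ?S1 \<union> ?S2" using zero_notin_spec[OF V] zero_notin_spec[OF W] \<zeta> by auto
  show "Ldt \<zeta> L1 L2 i s k = 0" if "s \<notin> ?S1 \<union> ?S2 \<or> ?K \<le> k" for i s k
    unfolding Ldt using C0[of s k i] D0[of s k i] that by auto
  have r1: "(\<Sum>s\<in>?S1 \<union> ?S2. C i s k) = (\<Sum>s\<in>?S1. C i s k)" "(\<Sum>s\<in>?S1 \<union> ?S2. L2 i s k) = (\<Sum>s\<in>?S2. L2 i s k)" for i k
    by (rule sum.mono_neutral_right; use fS C0 D0 in auto)+
  show "(\<Sum>s\<in>?S1 \<union> ?S2. Ldt \<zeta> L1 L2 i s 0) = 0" for i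
  proof -
    have "(\<Sum>s\<in>?S1. C i s 0) = 0" "(\<Sum>s\<in>?S2. L2 i s 0) = 0" using Cd L2 unfolding logdata_def by blast+
    then show ?thesis unfolding Ldt sum.distrib kronS_sum_left[symmetric] kronS_sum_right[symmetric] r1 by simp
  qed
  fix i w assume w: "w \<notin> ?S1 \<union> ?S2"
  then have w1: "w \<notin> ?S1" and w2: "w \<notin> ?S2" by auto
  let ?F = "\<lambda>z. Psi_fun (shift \<zeta> V) i z" and ?G = "\<lambda>z. Psi_fun W i z"
  have F: "invertible (?F w)" "\<And>a b. (\<lambda>z. ?F z $ a $ b) field_differentiable (at w)"
    "matrix_inv (?F w) ** mderiv ?F w = mat_of (Lsum ?S1 K1 (C i) w)" using Cd w1 unfolding logdata_def by blast+
  have G: "invertible (?G w)" "\<And>a b. (\<lambda>z. ?G z $ a $ b) field_differentiable (at w)"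
    "matrix_inv (?G w) ** mderiv ?G w = mat_of (Lsum ?S2 K2 (L2 i) w)" using L2 w2 unfolding logdata_def by blast+
  have P: "Psi_fun (dtensor \<zeta> V W) i z = kron (?F z) (?G z)" if "z \<notin> ?S1 \<union> ?S2" for z
    using good_dtensor(2)[OF V W \<zeta> disj that] good_shift(2)[OF V \<zeta>, of z i] that by auto
  have d: "((\<lambda>z. kron (?F z) (?G z) $ a $ b) has_field_derivative (kron (mderiv ?F w) (?G w) + kron (?F w) (mderiv ?G w)) $ a $ b) (at w)" for a b
    unfolding kron_nth vector_add_component mderiv_def vec_lambda_beta
    by (rule DERIV_cong[OF DERIV_mult[OF field_differentiable_derivI[OF F(2)] field_differentiable_derivI[OF G(2)]]]) (simp add: mult_ac)
  have P': "\<forall>z. z \<notin> ?S1 \<union> ?S2 \<longrightarrow> Psi_fun (dtensor \<zeta> V W) i z = kron (?F z) (?G z)" by (intro allI impI P)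
  have d': "\<forall>a b. ((\<lambda>z. kron (?F z) (?G z) $ a $ b) has_field_derivative (kron (mderiv ?F w) (?G w) + kron (?F w) (mderiv ?G w)) $ a $ b) (at w)" by (intro allI d)
  note t = logdata_transfer[OF fS w, of "Psi_fun (dtensor \<zeta> V W) i" _ _, OF P' d']
  have inv: "kron (?F w) (?G w) ** kron (matrix_inv (?F w)) (matrix_inv (?G w)) = mat 1"
    "kron (matrix_inv (?F w)) (matrix_inv (?G w)) ** kron (?F w) (?G w) = mat 1"
    unfolding kron_mult matrix_inv_mult[OF F(1)] matrix_inv_mult[OF G(1)]
    by (auto simp: vec_eq_iff kron_nth mat_def prod_eq_iff)
  then show "invertible (Psi_fun (dtensor \<zeta> V W) i w)" unfolding P[OF w] invertible_def by blast
  show "(\<lambda>z. Psi_fun (dtensor \<zeta> V W) i z $ a $ b) field_differentiable at w" for a b by (rule t(2))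
  have e: "matrix_inv (Psi_fun (dtensor \<zeta> V W) i w) = kron (matrix_inv (?F w)) (matrix_inv (?G w))"
    unfolding P[OF w] by (rule matrix_inv_unique[OF inv(1)])
  have m1: "mat_of (kronS X Y) = kron (mat_of X) (mat_of Y)" for X :: "'n sqm" and Y :: "'m sqm" by (rule mat_of_kronS)
  have "matrix_inv (Psi_fun (dtensor \<zeta> V W) i w) ** mderiv (Psi_fun (dtensor \<zeta> V W) i) w =
    kron (mat_of (Lsum ?S1 K1 (C i) w)) (mat 1) + kron (mat 1) (mat_of (Lsum ?S2 K2 (L2 i) w))"
    unfolding t(1) e matrix_add_ldistrib kron_mult F(3) G(3) matrix_inv_mult[OF F(1)] matrix_inv_mult[OF G(1)] ..
  also have "\<dots> = mat_of (kronS (Lsum ?S1 K1 (C i) w) 1 + kronS 1 (Lsum ?S2 K2 (L2 i) w))"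
    by (simp only: mat_of_simps m1)
  also have "Lsum ?S1 K1 (C i) w = Lsum (?S1 \<union> ?S2) ?K (C i) w"
  proof -
    have "Lsum (?S1 \<union> ?S2) ?K (C i) w = Lsum (?S1 \<union> ?S2) K1 (C i) w" by (rule Lsum_extend) (auto intro: C0)
    also have "\<dots> = Lsum ?S1 K1 (C i) w" unfolding Lsum_def by (rule sum.mono_neutral_right) (use fS C0 in auto)
    finally show ?thesis ..
  qed
  also have "Lsum ?S2 K2 (L2 i) w = Lsum (?S1 \<union> ?S2) ?K (L2 i) w"
  proof -
    have "Lsum (?S1 \<union> ?S2) ?K (L2 i) w = Lsum (?S1 \<union> ?S2) K2 (L2 i) w" by (rule Lsum_extend) (auto intro: D0)
    also have "\<dots> = Lsum ?S2 K2 (L2 i) w" unfolding Lsum_def by (rule sum.mono_neutral_right) (use fS D0 in auto)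
    finally show ?thesis ..
  qed
  also have "kronS (Lsum (?S1 \<union> ?S2) ?K (C i) w) 1 + kronS 1 (Lsum (?S1 \<union> ?S2) ?K (L2 i) w) = Lsum (?S1 \<union> ?S2) ?K (Ldt \<zeta> L1 L2 i) w"
    unfolding Lsum_def Ldt by (simp only: kronS_sum_left kronS_sum_right kronS_cs_left kronS_cs_right cs_add_right sum.distrib)
  finally show "matrix_inv (Psi_fun (dtensor \<zeta> V W) i w) ** mderiv (Psi_fun (dtensor \<zeta> V W) i) w =
      mat_of (Lsum (?S1 \<union> ?S2) ?K (Ldt \<zeta> L1 L2 i) w)" .
qed

section \<open>Multiplicativity\<close>

lemma finite_scaled: "finite B \<Longrightarrow> \<alpha> \<noteq> 0 \<Longrightarrow> finite {z. \<alpha> * z \<in> (B :: complex set)}"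
  using finite_vimageI[of B "\<lambda>z. \<alpha> * z"] by (simp add: inj_on_def vimage_def)

lemma commute_cs: "Z * X = X * Z \<Longrightarrow> Z * cs u X = cs u X * Z"
  by (simp only: cs_mult_left cs_mult_right)

lemma commute_embS_Eexp:
  assumes "\<And>i s k j t m. Z * embS f (kronS (L1 i s k) (L2 j t m)) = embS f (kronS (L1 i s k) (L2 j t m)) * Z"
  shows "Z * embS f (Eexp q l c S1 K1 L1 S2 K2 L2 \<zeta>) = embS f (Eexp q l c S1 K1 L1 S2 K2 L2 \<zeta>) * Z"
  unfolding Eexp_def pairsum_def embS_cs embS_sum
  by ((rule commute_cs commute_sum)+, rule assms)

text \<open>A common frame for both multiplicativity identities: near 0 the exponents add and
  commute, and rationality extends the product formula. The factors \<alpha> and \<beta> hold the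
  rescaling of the spectral parameter.\<close>

lemma A_op_product:
  fixes f :: "('u::finite \<times> 'w::finite) \<Rightarrow> ('n::finite \<times> 'm::finite) \<times> 'x::finite"
    and g :: "('u \<times> 'w) \<Rightarrow> ('k::finite \<times> 'h::finite) \<times> 'y::finite"
  assumes qR: "q \<noteq> 0" "finite (relevant_r c)" and f: "bij f" and g: "bij g" and \<alpha>\<beta>: "\<alpha> \<noteq> 0" "\<beta> \<noteq> 0"
    and U: "good U" "good W" and V1: "good V1" "good W1" and V2: "good V2" "good W2"
    and LU: "logdata U SU KU LU" "logdata W SW KW LW"
    and L1: "logdata V1 S1 K1 L1" "logdata W1 T1 M1 D1"
    and L2: "logdata V2 S2 K2 L2" "logdata W2 T2 M2 D2"
    and E: "\<And>z. Eexp q l c SU KU LU SW KW LW z =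
      embS f (Eexp q l c S1 K1 L1 T1 M1 D1 (\<alpha> * z)) + embS g (Eexp q l c S2 K2 L2 T2 M2 D2 (\<beta> * z))"
    and comm: "\<And>i s k j t m i' s' k' j' t' m'. embS f (kronS (L1 i s k) (D1 j t m)) * embS g (kronS (L2 i' s' k') (D2 j' t' m')) =
      embS g (kronS (L2 i' s' k') (D2 j' t' m')) * embS f (kronS (L1 i s k) (D1 j t m))"
    and z: "z \<notin> mpoles (A_op q l c U W)" "\<alpha> * z \<notin> mpoles (A_op q l c V1 W1)" "\<beta> * z \<notin> mpoles (A_op q l c V2 W2)"
  shows "A_op q l c U W z = emb f (A_op q l c V1 W1 (\<alpha> * z)) ** emb g (A_op q l c V2 W2 (\<beta> * z))"
proof -
  note m0 = A_op_mreg[OF U qR, of l] and m1 = A_op_mreg[OF V1 qR, of l] and m2 = A_op_mreg[OF V2 qR, of l]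
  obtain e0 where e0: "e0 > 0" "\<And>z. norm z < e0 \<Longrightarrow> A_op q l c U W z = mat_of (exp (Eexp q l c SU KU LU SW KW LW z))"
    using A_op_near_0[OF U qR LU, of l] by blast
  obtain e1 where e1: "e1 > 0" "\<And>z. norm z < e1 \<Longrightarrow> A_op q l c V1 W1 z = mat_of (exp (Eexp q l c S1 K1 L1 T1 M1 D1 z))"
    using A_op_near_0[OF V1 qR L1, of l] by blast
  obtain e2 where e2: "e2 > 0" "\<And>z. norm z < e2 \<Longrightarrow> A_op q l c V2 W2 z = mat_of (exp (Eexp q l c S2 K2 L2 T2 M2 D2 z))"
    using A_op_near_0[OF V2 qR L2, of l] by blast
  let ?e = "min e0 (min (e1 / norm \<alpha>) (e2 / norm \<beta>))"
  have near: "A_op q l c U W z = emb f (A_op q l c V1 W1 (\<alpha> * z)) ** emb g (A_op q l c V2 W2 (\<beta> * z))" if "norm z < ?e" for z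
  proof -
    have n: "norm z < e0" "norm (\<alpha> * z) < e1" "norm (\<beta> * z) < e2"
      using that \<alpha>\<beta> by (auto simp: norm_mult field_simps)
    have c: "embS f (Eexp q l c S1 K1 L1 T1 M1 D1 (\<alpha> * z)) * embS g (Eexp q l c S2 K2 L2 T2 M2 D2 (\<beta> * z)) =
       embS g (Eexp q l c S2 K2 L2 T2 M2 D2 (\<beta> * z)) * embS f (Eexp q l c S1 K1 L1 T1 M1 D1 (\<alpha> * z))"
      by (rule commute_embS_Eexp, rule commute_embS_Eexp[symmetric], rule comm[symmetric])
    show ?thesis unfolding e0(2)[OF n(1)] e1(2)[OF n(2)] e2(2)[OF n(3)] emb_exp[OF f] emb_exp[OF g] E exp_add_commuting[OF c]
      by (simp only: mat_of_simps)
  qed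
  show ?thesis
  proof (rule mreg_eq_near_0[OF m0(2) _ m0(1)])
    let ?B1 = "{z. \<alpha> * z \<in> mpoles (A_op q l c V1 W1)}" and ?B2 = "{z. \<beta> * z \<in> mpoles (A_op q l c V2 W2)}"
    have "mreg (?B1 \<union> ?B2) (\<lambda>z. emb f (A_op q l c V1 W1 (\<alpha> * z)))"
      by (rule mreg_mono[OF mreg_emb[OF mreg_scale[OF m1(2) \<alpha>\<beta>(1)]]]) auto
    moreover have "mreg (?B1 \<union> ?B2) (\<lambda>z. emb g (A_op q l c V2 W2 (\<beta> * z)))"
      by (rule mreg_mono[OF mreg_emb[OF mreg_scale[OF m2(2) \<alpha>\<beta>(2)]]]) auto
    ultimately show "mreg (?B1 \<union> ?B2) (\<lambda>z. emb f (A_op q l c V1 W1 (\<alpha> * z)) ** emb g (A_op q l c V2 W2 (\<beta> * z)))"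
      by (rule mreg_mult)
    show "finite (?B1 \<union> ?B2)" using finite_scaled[OF m1(1) \<alpha>\<beta>(1)] finite_scaled[OF m2(1) \<alpha>\<beta>(2)] by simp
    show "?e > 0" using e0 e1 e2 \<alpha>\<beta> by simp
    show "z \<notin> ?B1 \<union> ?B2" using z by simp
  qed (use near z in auto)
qed

section \<open>Legs and flip as relabellings\<close>

definition swap13 :: "('a \<times> 'b) \<times> 'c \<Rightarrow> ('a \<times> 'c) \<times> 'b" where
  "swap13 x = ((fst (fst x), snd x), snd (fst x))"
definition swap23 :: "('a \<times> 'b) \<times> 'c \<Rightarrow> ('b \<times> 'c) \<times> 'a" where
  "swap23 x = ((snd (fst x), snd x), fst (fst x))"
definition swapR12 :: "'a \<times> ('b \<times> 'c) \<Rightarrow> ('a \<times> 'b) \<times> 'c" where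
  "swapR12 x = ((fst x, fst (snd x)), snd (snd x))"
definition swapR13 :: "'a \<times> ('b \<times> 'c) \<Rightarrow> ('a \<times> 'c) \<times> 'b" where
  "swapR13 x = ((fst x, snd (snd x)), fst (snd x))"
text \<open>The one-point second factor makes the flip an instance of \<open>emb\<close>.\<close>

definition swapF :: "'b \<times> 'a \<Rightarrow> ('a \<times> 'b) \<times> unit" where
  "swapF x = ((snd x, fst x), ())"

lemma bij_swap: "bij swap13" "bij swap23" "bij swapR12" "bij swapR13" "bij swapF"
proof -
  show "bij swap13" by (rule bij_betw_byWitness[where f' = "\<lambda>y. ((fst (fst y), snd y), snd (fst y))"]) (auto simp: swap13_def)
  show "bij swap23" by (rule bij_betw_byWitness[where f' = "\<lambda>y. ((snd y, fst (fst y)), snd (fst y))"]) (auto simp: swap23_def)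
  show "bij swapR12" by (rule bij_betw_byWitness[where f' = "\<lambda>y. (fst (fst y), (snd (fst y), snd y))"]) (auto simp: swapR12_def)
  show "bij swapR13" by (rule bij_betw_byWitness[where f' = "\<lambda>y. (fst (fst y), (snd y, snd (fst y)))"]) (auto simp: swapR13_def)
  show "bij swapF" by (rule bij_betw_byWitness[where f' = "\<lambda>y. (snd (fst y), fst (fst y))"]) (auto simp: swapF_def)
qed

lemma leg_emb:
  "leg13 M1 = emb swap13 M1" "leg23 M2 = emb swap23 M2" "legR12 M3 = emb swapR12 M3" "legR13 M4 = emb swapR13 M4"
  "flipm M5 = emb swapF M5"
  by (simp_all add: vec_eq_iff leg13_def leg23_def legR12_def legR13_def flipm_def emb_def
      swap13_def swap23_def swapR12_def swapR13_def swapF_def)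

lemma embS_swap:
  "embS swap13 (kronS A C) = kronS (kronS A 1) C" "embS swap23 (kronS B C) = kronS (kronS 1 B) C"
  "embS swapR12 (kronS A B) = kronS A (kronS B 1)" "embS swapR13 (kronS A C) = kronS A (kronS 1 C)"
  "embS swapF (kronS A B) = kronS B A"
  by (rule sqm_eqI, simp add: mat_of_embS emb_def mat_of_kronS kron_nth mat_def
      swap13_def swap23_def swapR12_def swapR13_def swapF_def)+

text \<open>Scaling the first group of poles by \<zeta> turns \<kappa> into \<kappa> \<zeta>; this
  is the origin of the argument \<zeta>1 \<zeta>2 on the legs 1 and 3.\<close>

lemma Ldt_pairsum_left:
  assumes \<zeta>: "\<zeta> \<noteq> 0" and S: "finite S1" "finite S2"
    and C: "\<And>s k. s \<notin> S1 \<or> k \<ge> K1 \<Longrightarrow> L1 i s k = 0" and D: "\<And>s k. s \<notin> S2 \<or> k \<ge> K2 \<Longrightarrow> L2 i s k = 0"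
  shows "pairsum \<kappa> ((\<lambda>s. \<zeta> * s) ` S1 \<union> S2) (max K1 K2) (Ldt \<zeta> L1 L2 i) T M L3 =
    embS swap13 (pairsum (\<kappa> * \<zeta>) S1 K1 (L1 i) T M L3) + embS swap23 (pairsum \<kappa> S2 K2 (L2 i) T M L3)"
proof -
  let ?S1 = "(\<lambda>s. \<zeta> * s) ` S1"
  have z: "L1 i (s / \<zeta>) k = 0" if "s \<notin> ?S1 \<or> k \<ge> K1" for s k
    by (rule C) (use that \<zeta> in \<open>auto simp: image_iff\<close>)
  have "pairsum \<kappa> (?S1 \<union> S2) (max K1 K2) (Ldt \<zeta> L1 L2 i) T M L3 =
     pairsum \<kappa> (?S1 \<union> S2) (max K1 K2) (\<lambda>s k. kronS (cs (\<zeta> ^ k) (L1 i (s / \<zeta>) k)) 1) T M L3 +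
     pairsum \<kappa> (?S1 \<union> S2) (max K1 K2) (\<lambda>s k. kronS 1 (L2 i s k)) T M L3"
    unfolding pairsum_add_left[symmetric] by (rule arg_cong[where f = "\<lambda>C. pairsum \<kappa> _ _ C T M L3"]) (simp add: fun_eq_iff Ldt_def)
  also have "pairsum \<kappa> (?S1 \<union> S2) (max K1 K2) (\<lambda>s k. kronS (cs (\<zeta> ^ k) (L1 i (s / \<zeta>) k)) 1) T M L3 =
     pairsum \<kappa> ?S1 K1 (\<lambda>s k. kronS (cs (\<zeta> ^ k) (L1 i (s / \<zeta>) k)) 1) T M L3"
    by (rule pairsum_extend_left) (use S z in auto)
  also have "\<dots> = embS swap13 (pairsum \<kappa> ?S1 K1 (\<lambda>s k. cs (\<zeta> ^ k) (L1 i (s / \<zeta>) k)) T M L3)"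
    by (rule pairsum_embS_left[symmetric, where \<psi> = "\<lambda>A. kronS A 1"]) (rule embS_swap)
  also have "\<dots> = embS swap13 (pairsum (\<kappa> * \<zeta>) S1 K1 (L1 i) T M L3)" unfolding pairsum_scale_left[OF \<zeta>] ..
  also have "pairsum \<kappa> (?S1 \<union> S2) (max K1 K2) (\<lambda>s k. kronS 1 (L2 i s k)) T M L3 =
     pairsum \<kappa> S2 K2 (\<lambda>s k. kronS 1 (L2 i s k)) T M L3"
    by (rule pairsum_extend_left) (use S D in auto)
  also have "\<dots> = embS swap23 (pairsum \<kappa> S2 K2 (L2 i) T M L3)"
    by (rule pairsum_embS_left[symmetric, where \<psi> = "\<lambda>A. kronS 1 A"]) (rule embS_swap)
  finally show ?thesis .
qed

text \<open>In the second module the rescaling divides \<kappa> by \<zeta>, which reduces \<zeta>1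
  \<zeta>2 to \<zeta>1 on the legs 1 and 2.\<close>

lemma Ldt_pairsum_right:
  assumes \<zeta>: "\<zeta> \<noteq> 0" and S: "finite S1" "finite S2"
    and C: "\<And>s k. s \<notin> S1 \<or> k \<ge> K1 \<Longrightarrow> L1 i s k = 0" and D: "\<And>s k. s \<notin> S2 \<or> k \<ge> K2 \<Longrightarrow> L2 i s k = 0"
  shows "pairsum \<kappa> T M L3 ((\<lambda>s. \<zeta> * s) ` S1 \<union> S2) (max K1 K2) (Ldt \<zeta> L1 L2 i) =
    embS swapR13 (pairsum \<kappa> T M L3 S2 K2 (L2 i)) + embS swapR12 (pairsum (\<kappa> / \<zeta>) T M L3 S1 K1 (L1 i))"
proof -
  let ?S1 = "(\<lambda>s. \<zeta> * s) ` S1"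
  have z: "L1 i (s / \<zeta>) k = 0" if "s \<notin> ?S1 \<or> k \<ge> K1" for s k
    by (rule C) (use that \<zeta> in \<open>auto simp: image_iff\<close>)
  have "pairsum \<kappa> T M L3 (?S1 \<union> S2) (max K1 K2) (Ldt \<zeta> L1 L2 i) =
     pairsum \<kappa> T M L3 (?S1 \<union> S2) (max K1 K2) (\<lambda>s k. kronS 1 (L2 i s k)) +
     pairsum \<kappa> T M L3 (?S1 \<union> S2) (max K1 K2) (\<lambda>s k. kronS (cs (\<zeta> ^ k) (L1 i (s / \<zeta>) k)) 1)"
    unfolding pairsum_add_right[symmetric] by (rule arg_cong[where f = "pairsum \<kappa> T M L3 _ _"]) (simp add: fun_eq_iff Ldt_def)
  also have "pairsum \<kappa> T M L3 (?S1 \<union> S2) (max K1 K2) (\<lambda>s k. kronS (cs (\<zeta> ^ k) (L1 i (s / \<zeta>) k)) 1) =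
     pairsum \<kappa> T M L3 ?S1 K1 (\<lambda>s k. kronS (cs (\<zeta> ^ k) (L1 i (s / \<zeta>) k)) 1)"
    by (rule pairsum_extend_right) (use S z in auto)
  also have "\<dots> = embS swapR12 (pairsum \<kappa> T M L3 ?S1 K1 (\<lambda>s k. cs (\<zeta> ^ k) (L1 i (s / \<zeta>) k)))"
    by (rule pairsum_embS_right[symmetric, where \<psi> = "\<lambda>A. kronS A 1"]) (rule embS_swap)
  also have "\<dots> = embS swapR12 (pairsum (\<kappa> / \<zeta>) T M L3 S1 K1 (L1 i))" unfolding pairsum_scale_right[OF \<zeta>] ..
  also have "pairsum \<kappa> T M L3 (?S1 \<union> S2) (max K1 K2) (\<lambda>s k. kronS 1 (L2 i s k)) =
     pairsum \<kappa> T M L3 S2 K2 (\<lambda>s k. kronS 1 (L2 i s k))"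
    by (rule pairsum_extend_right) (use S D in auto)
  also have "\<dots> = embS swapR13 (pairsum \<kappa> T M L3 S2 K2 (L2 i))"
    by (rule pairsum_embS_right[symmetric, where \<psi> = "\<lambda>A. kronS 1 A"]) (rule embS_swap)
  finally show ?thesis .
qed

lemma A_op_dtensor_left:
  fixes V1 :: "('i::finite, 'n::finite) lrep" and V2 :: "('i, 'm::finite) lrep" and V3 :: "('i, 'k::finite) lrep"
  assumes V: "good V1" "good V2" "good V3" and qR: "q \<noteq> 0" "finite (relevant_r c)"
    and \<zeta>: "\<zeta>1 \<noteq> 0" and disj: "(\<lambda>s. \<zeta>1 * s) ` spec V1 \<inter> spec V2 = {}"
    and z: "z \<notin> mpoles (A_op q l c (dtensor \<zeta>1 V1 V2) V3)"
      "\<zeta>1 * z \<notin> mpoles (A_op q l c V1 V3)" "z \<notin> mpoles (A_op q l c V2 V3)"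
  shows "A_op q l c (dtensor \<zeta>1 V1 V2) V3 z = leg13 (A_op q l c V1 V3 (\<zeta>1 * z)) ** leg23 (A_op q l c V2 V3 z)"
proof -
  obtain K1 L1 where 1: "logdata V1 (spec V1) K1 L1" "structured V1 L1" using good_logdata[OF V(1)] by blast
  obtain K2 L2 where 2: "logdata V2 (spec V2) K2 L2" "structured V2 L2" using good_logdata[OF V(2)] by blast
  obtain K3 L3 where 3: "logdata V3 (spec V3) K3 L3" "structured V3 L3" using good_logdata[OF V(3)] by blast
  note g = good_dtensor(1)[OF V(1,2) \<zeta> disj] and L = logdata_dtensor[OF V(1,2) \<zeta> disj 1(1) 2(1)]
  have P: "pairsum \<kappa> ((\<lambda>s. \<zeta>1 * s) ` spec V1 \<union> spec V2) (max K1 K2) (Ldt \<zeta>1 L1 L2 i) (spec V3) K3 (L3 j) =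
    embS swap13 (pairsum (\<kappa> * \<zeta>1) (spec V1) K1 (L1 i) (spec V3) K3 (L3 j)) + embS swap23 (pairsum \<kappa> (spec V2) K2 (L2 i) (spec V3) K3 (L3 j))" for \<kappa> i j
    by (rule Ldt_pairsum_left[OF \<zeta> finite_spec[OF V(1)] finite_spec[OF V(2)]])
      (use 1(1) 2(1) in \<open>unfold logdata_def, blast+\<close>)
  have E: "Eexp q l c ((\<lambda>s. \<zeta>1 * s) ` spec V1 \<union> spec V2) (max K1 K2) (Ldt \<zeta>1 L1 L2) (spec V3) K3 L3 z =
     embS swap13 (Eexp q l c (spec V1) K1 L1 (spec V3) K3 L3 (\<zeta>1 * z)) + embS swap23 (Eexp q l c (spec V2) K2 L2 (spec V3) K3 L3 (1 * z))" for z
  proof -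
    have a: "q powi (int l + r) * z * \<zeta>1 = q powi (int l + r) * (\<zeta>1 * z)" for r by (simp only: mult_ac)
    show ?thesis unfolding embS_Eexp unfolding Eexp_def P a mult_1_left cs_add_right sum.distrib ..
  qed
  \<comment> \<open>The two legs overlap only in the third factor, where all coefficients belong to
    one module and commute.\<close>
  have comm: "embS swap13 (kronS (L1 i s k) (L3 j t m)) * embS swap23 (kronS (L2 i' s' k') (L3 j' t' m')) =
      embS swap23 (kronS (L2 i' s' k') (L3 j' t' m')) * embS swap13 (kronS (L1 i s k) (L3 j t m))" for i s k j t m i' s' k' j' t' m'
    unfolding embS_swap by (rule kronS_commute[OF kronS_commute structured_commute[OF 3(2)]]) simp_all
  have "A_op q l c (dtensor \<zeta>1 V1 V2) V3 z = emb swap13 (A_op q l c V1 V3 (\<zeta>1 * z)) ** emb swap23 (A_op q l c V2 V3 (1 * z))"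
    by (rule A_op_product[OF qR bij_swap(1,2) \<zeta> one_neq_zero g V(3) V(1,3) V(2,3) L 3(1) 1(1) 3(1) 2(1) 3(1) E comm]) (use z in simp_all)
  then show ?thesis by (simp add: leg_emb)
qed

lemma A_op_dtensor_right:
  fixes V1 :: "('i::finite, 'n::finite) lrep" and V2 :: "('i, 'm::finite) lrep" and V3 :: "('i, 'k::finite) lrep"
  assumes V: "good V1" "good V2" "good V3" and qR: "q \<noteq> 0" "finite (relevant_r c)"
    and \<zeta>: "\<zeta>2 \<noteq> 0" and disj: "(\<lambda>s. \<zeta>2 * s) ` spec V2 \<inter> spec V3 = {}"
    and z: "z \<notin> mpoles (A_op q l c V1 (dtensor \<zeta>2 V2 V3))"
      "z \<notin> mpoles (A_op q l c V1 V3)" "inverse \<zeta>2 * z \<notin> mpoles (A_op q l c V1 V2)"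
  shows "A_op q l c V1 (dtensor \<zeta>2 V2 V3) z = legR13 (A_op q l c V1 V3 z) ** legR12 (A_op q l c V1 V2 (inverse \<zeta>2 * z))"
proof -
  obtain K1 L1 where 1: "logdata V1 (spec V1) K1 L1" "structured V1 L1" using good_logdata[OF V(1)] by blast
  obtain K2 L2 where 2: "logdata V2 (spec V2) K2 L2" "structured V2 L2" using good_logdata[OF V(2)] by blast
  obtain K3 L3 where 3: "logdata V3 (spec V3) K3 L3" "structured V3 L3" using good_logdata[OF V(3)] by blast
  note g = good_dtensor(1)[OF V(2,3) \<zeta> disj] and L = logdata_dtensor[OF V(2,3) \<zeta> disj 2(1) 3(1)]
  have P: "pairsum \<kappa> (spec V1) K1 (L1 i) ((\<lambda>s. \<zeta>2 * s) ` spec V2 \<union> spec V3) (max K2 K3) (Ldt \<zeta>2 L2 L3 j) =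
    embS swapR13 (pairsum \<kappa> (spec V1) K1 (L1 i) (spec V3) K3 (L3 j)) + embS swapR12 (pairsum (\<kappa> / \<zeta>2) (spec V1) K1 (L1 i) (spec V2) K2 (L2 j))" for \<kappa> i j
    by (rule Ldt_pairsum_right[OF \<zeta> finite_spec[OF V(2)] finite_spec[OF V(3)]])
      (use 2(1) 3(1) in \<open>unfold logdata_def, blast+\<close>)
  have E: "Eexp q l c (spec V1) K1 L1 ((\<lambda>s. \<zeta>2 * s) ` spec V2 \<union> spec V3) (max K2 K3) (Ldt \<zeta>2 L2 L3) z =
     embS swapR13 (Eexp q l c (spec V1) K1 L1 (spec V3) K3 L3 (1 * z)) + embS swapR12 (Eexp q l c (spec V1) K1 L1 (spec V2) K2 L2 (inverse \<zeta>2 * z))" for z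
  proof -
    have a: "q powi (int l + r) * z / \<zeta>2 = q powi (int l + r) * (inverse \<zeta>2 * z)" for r by (simp only: divide_inverse mult_ac)
    show ?thesis unfolding embS_Eexp unfolding Eexp_def P a mult_1_left cs_add_right sum.distrib ..
  qed
  have comm: "embS swapR13 (kronS (L1 i s k) (L3 j t m)) * embS swapR12 (kronS (L1 i' s' k') (L2 j' t' m')) =
      embS swapR12 (kronS (L1 i' s' k') (L2 j' t' m')) * embS swapR13 (kronS (L1 i s k) (L3 j t m))" for i s k j t m i' s' k' j' t' m'
    unfolding embS_swap by (rule kronS_commute[OF structured_commute[OF 1(2)] kronS_commute]) simp_all
  have i: "inverse \<zeta>2 \<noteq> 0" using \<zeta> by simp
  have "A_op q l c V1 (dtensor \<zeta>2 V2 V3) z = emb swapR13 (A_op q l c V1 V3 (1 * z)) ** emb swapR12 (A_op q l c V1 V2 (inverse \<zeta>2 * z))"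
    by (rule A_op_product[OF qR bij_swap(4,3) one_neq_zero i V(1) g V(1,3) V(1,2) 1(1) L 1(1) 3(1) 1(1) 2(1) E comm]) (use z in simp_all)
  then show ?thesis by (simp add: leg_emb)
qed

lemma A_op_shift:
  fixes V1 :: "('i::finite, 'n::finite) lrep" and V2 :: "('i, 'm::finite) lrep"
  assumes V: "good V1" "good V2" and qR: "q \<noteq> 0" "finite (relevant_r c)" and \<alpha>: "\<alpha> \<noteq> 0" "\<beta> \<noteq> 0"
    and z: "z \<notin> mpoles (A_op q l c (shift \<alpha> V1) (shift \<beta> V2))" "\<alpha> / \<beta> * z \<notin> mpoles (A_op q l c V1 V2)"
  shows "A_op q l c (shift \<alpha> V1) (shift \<beta> V2) z = A_op q l c V1 V2 (\<alpha> / \<beta> * z)"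
proof -
  obtain K1 L1 where 1: "logdata V1 (spec V1) K1 L1" using good_logdata[OF V(1)] by blast
  obtain K2 L2 where 2: "logdata V2 (spec V2) K2 L2" using good_logdata[OF V(2)] by blast
  note g = good_shift(1)[OF V(1) \<alpha>(1)] good_shift(1)[OF V(2) \<alpha>(2)]
  note L = logdata_shift[OF V(1) \<alpha>(1) 1] logdata_shift[OF V(2) \<alpha>(2) 2]
  have ab: "\<alpha> / \<beta> \<noteq> 0" using \<alpha> by simp
  note m = A_op_mreg[OF g qR, of l] and m' = A_op_mreg[OF V qR, of l]
  have E: "Eexp q l c ((\<lambda>s. \<alpha> * s) ` spec V1) K1 (\<lambda>i s k. cs (\<alpha> ^ k) (L1 i (s / \<alpha>) k))
     ((\<lambda>s. \<beta> * s) ` spec V2) K2 (\<lambda>i s k. cs (\<beta> ^ k) (L2 i (s / \<beta>) k)) z = Eexp q l c (spec V1) K1 L1 (spec V2) K2 L2 (\<alpha> / \<beta> * z)" for z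
  proof -
    have a: "q powi (int l + r) * z / \<beta> * \<alpha> = q powi (int l + r) * (\<alpha> / \<beta> * z)" for r
      by (simp only: times_divide_eq_left times_divide_eq_right mult_ac)
    show ?thesis unfolding Eexp_def pairsum_scale_right[OF \<alpha>(2)] pairsum_scale_left[OF \<alpha>(1)] a ..
  qed
  obtain e0 where e0: "e0 > 0" "\<And>z. norm z < e0 \<Longrightarrow> A_op q l c (shift \<alpha> V1) (shift \<beta> V2) z = mat_of (exp (Eexp q l c ((\<lambda>s. \<alpha> * s) ` spec V1) K1 (\<lambda>i s k. cs (\<alpha> ^ k) (L1 i (s / \<alpha>) k))
     ((\<lambda>s. \<beta> * s) ` spec V2) K2 (\<lambda>i s k. cs (\<beta> ^ k) (L2 i (s / \<beta>) k)) z))"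
    using A_op_near_0[OF g qR L, of l] by blast
  obtain e1 where e1: "e1 > 0" "\<And>z. norm z < e1 \<Longrightarrow> A_op q l c V1 V2 z = mat_of (exp (Eexp q l c (spec V1) K1 L1 (spec V2) K2 L2 z))"
    using A_op_near_0[OF V qR 1 2, of l] by blast
  show ?thesis
  proof (rule mreg_eq_near_0[OF m(2) mreg_scale[OF m'(2) ab] m(1) finite_scaled[OF m'(1) ab]])
    show "min e0 (e1 / norm (\<alpha> / \<beta>)) > 0" using e0(1) e1(1) ab by simp
    fix z :: complex assume "norm z < min e0 (e1 / norm (\<alpha> / \<beta>))"
    then have n: "norm z < e0" "norm (\<alpha> / \<beta> * z) < e1" using \<alpha> by (auto simp: norm_mult norm_divide field_simps)
    show "A_op q l c (shift \<alpha> V1) (shift \<beta> V2) z = A_op q l c V1 V2 (\<alpha> / \<beta> * z)"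
      unfolding e0(2)[OF n(1)] e1(2)[OF n(2)] E ..
  qed (use z in auto)
qed

section \<open>Symmetry of the coefficients\<close>

text \<open>Multiplication by \<open>T powi N\<close>, with N at least every absolute value of an
  exponent, turns the Laurent sum into a polynomial with the same coefficients.\<close>

lemma laurent_zero:
  assumes R: "finite R" and inf: "infinite {T :: complex. T \<noteq> 0 \<and> (\<Sum>r\<in>R. e r * T powi r) = 0}" and r: "r \<in> R"
  shows "e r = 0"
proof -
  define N where "N = (\<Sum>r\<in>R. \<bar>r :: int\<bar>)"
  have N: "r + N \<ge> 0" if "r \<in> R" for r
  proof -
    have "\<bar>r\<bar> \<le> N" unfolding N_def by (rule member_le_sum) (use that R in auto)
    then show ?thesis by linarith
  qed
  define p where "p = (\<Sum>r\<in>R. monom (e r) (nat (r + N)))"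
  have "poly p T = T powi N * (\<Sum>r\<in>R. e r * T powi r)" if "T \<noteq> 0" for T
  proof -
    have "e r * T ^ nat (r + N) = T powi N * (e r * T powi r)" if "r \<in> R" for r
    proof -
      have "T ^ nat (r + N) = T powi (r + N)" using N[OF that] by (simp add: power_int_def)
      then show ?thesis using \<open>T \<noteq> 0\<close> by (simp add: power_int_add)
    qed
    then show ?thesis unfolding p_def poly_sum poly_monom sum_distrib_left by (rule sum.cong[OF refl])
  qed
  then have "{T. T \<noteq> 0 \<and> (\<Sum>r\<in>R. e r * T powi r) = 0} \<subseteq> {T. poly p T = 0}" by auto
  then have "infinite {T. poly p T = 0}" using inf infinite_super by blast
  then have p0: "p = 0" using poly_roots_finite by blast
  have "coeff p (nat (r + N)) = (\<Sum>r'\<in>R. if r' = r then e r' else 0)"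
    unfolding p_def coeff_sum coeff_monom
  proof (intro sum.cong refl)
    fix r' assume "r' \<in> R"
    then show "(if nat (r' + N) = nat (r + N) then e r' else 0) = (if r' = r then e r' else 0)"
      using N[of r'] N[OF r] by auto
  qed
  then show ?thesis using R r p0 by simp
qed

lemma qnum_inverse: "T \<noteq> 0 \<Longrightarrow> qnum n (inverse T) = qnum n T"
proof -
  assume T: "T \<noteq> 0"
  have "qnum n (inverse T) = (T powi (- n) - T powi n) / (inverse T - T)"
    by (simp add: qnum_def power_int_inverse power_int_minus)
  also have "\<dots> = (- (T powi n - T powi (- n))) / (- (T - inverse T))" by simp
  also have "\<dots> = qnum n T" unfolding qnum_def by (rule minus_divide_divide)
  finally show ?thesis .
qed

lemma qnum_nonzero:
  assumes x: "x > (1 :: real)" and l: "l > 0"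
  shows "qnum (int l) (of_real x) \<noteq> 0"
proof -
  let ?T = "complex_of_real x"
  have "x ^ 2 > 1" "x ^ (2 * l) > 1" using x l by (simp_all add: one_less_power)
  then have p: "?T ^ 2 \<noteq> 1" "?T ^ (2 * l) \<noteq> 1" by (metis of_real_1 of_real_eq_iff of_real_power less_irrefl)+
  have T: "?T \<noteq> 0" using x by simp
  have "?T - inverse ?T \<noteq> 0" using p(1) T by (simp add: field_simps power2_eq_square)
  moreover have "?T powi int l \<noteq> ?T powi (- int l)"
  proof
    assume "?T powi int l = ?T powi (- int l)"
    then have "?T ^ l * ?T ^ l = 1" using T by (simp add: power_int_minus field_simps)
    then show False using p(2) by (simp add: mult_2 power_add)
  qed
  ultimately show ?thesis by (simp add: qnum_def)
qed

text \<open>With \<open>B\<close> symmetric and invariant under \<open>T \<mapsto> 1/T\<close>, the identity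
  \<open>C(1/T) (B C(T)\<^sup>t) = (C(1/T) B) C(T)\<^sup>t\<close> gives \<open>C(1/T) = C(T)\<^sup>t\<close>.\<close>

lemma c_matrix_symmetric:
  fixes a :: "'i::finite \<Rightarrow> 'i \<Rightarrow> int"
  assumes cartan: "finite_cartan a d" and l: "l > 0" and c: "is_c_matrix a d l c"
  shows "c j i r = c i j (- r)"
proof -
  let ?R = "relevant_r c"
  have R: "finite ?R" using c unfolding is_c_matrix_def by blast
  define Cm where "Cm T = ((\<chi> i j. \<Sum>r\<in>?R. of_int (c i j r) * T powi r) :: complex^'i^'i)" for T
  define Bm where "Bm T = ((\<chi> i j. qnum (int (d i) * a i j) T) :: complex^'i^'i)" for T
  have CB: "Cm T ** Bm T = smat (qnum (int l) T) (mat 1)" if "T \<noteq> 0" "T\<^sup>2 \<noteq> 1" for T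
    using c that unfolding is_c_matrix_def by (simp add: vec_eq_iff cmat_nth_mult Cm_def Bm_def mat_def)
  have Bt: "transpose (Bm T) = Bm T" for T
    using cartan unfolding finite_cartan_def by (simp add: vec_eq_iff transpose_def Bm_def)
  have key: "(\<Sum>r\<in>?R. of_int (c i j r) * inverse T powi r) = (\<Sum>r\<in>?R. of_int (c j i r) * T powi r)"
    if T: "T \<noteq> 0" "T\<^sup>2 \<noteq> 1" "qnum (int l) T \<noteq> 0" for T
  proof -
    have Ti: "inverse T \<noteq> 0" "(inverse T)\<^sup>2 \<noteq> 1" using T by (auto simp: field_simps)
    have sl: "smat x (mat 1) ** M = smat x M" "M ** smat x (mat 1) = smat x M" for x and M :: "complex^'i^'i"
      by (simp_all add: vec_eq_iff cmat_nth_mult mat_def if_distrib if_distribR cong: if_cong)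
    have "transpose (Cm T ** Bm T) = transpose (smat (qnum (int l) T) (mat 1))" unfolding CB[OF T(1,2)] ..
    also have "\<dots> = smat (qnum (int l) T) (mat 1)" by (simp add: vec_eq_iff transpose_def mat_def)
    finally have 1: "Bm T ** transpose (Cm T) = smat (qnum (int l) T) (mat 1)" unfolding matrix_transpose_mul Bt .
    have "Bm (inverse T) = Bm T" unfolding Bm_def qnum_inverse[OF T(1)] ..
    then have 2: "Cm (inverse T) ** Bm T = smat (qnum (int l) T) (mat 1)"
      using CB[OF Ti] unfolding qnum_inverse[OF T(1)] by simp
    have "smat (qnum (int l) T) (Cm (inverse T)) = Cm (inverse T) ** (Bm T ** transpose (Cm T))" unfolding 1 sl ..
    also have "\<dots> = (Cm (inverse T) ** Bm T) ** transpose (Cm T)" by (rule matrix_mul_assoc)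
    also have "\<dots> = smat (qnum (int l) T) (transpose (Cm T))" unfolding 2 sl ..
    finally have "qnum (int l) T * Cm (inverse T) $ i $ j = qnum (int l) T * transpose (Cm T) $ i $ j"
      by (metis smat_nth)
    then show ?thesis using T(3) by (simp add: Cm_def transpose_def)
  qed
  \<comment> \<open>The exponents of both sides are gathered in one set closed under
    negation.\<close>
  define R' where "R' = ?R \<union> uminus ` ?R"
  define e where "e r = (of_int (c j i r) - of_int (c i j (- r)) :: complex)" for r
  have R': "finite R'" using R by (simp add: R'_def)
  have c0: "c i' j' r' = 0" if "r' \<notin> ?R" for i' j' r' using that unfolding relevant_r_def by blast
  have z: "(\<Sum>r\<in>R'. e r * T powi r) = 0" if T: "T \<noteq> 0" "T\<^sup>2 \<noteq> 1" "qnum (int l) T \<noteq> 0" for T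
  proof -
    have "(\<Sum>r\<in>R'. of_int (c j i r) * T powi r) = (\<Sum>r\<in>?R. of_int (c j i r) * T powi r)"
      by (rule sum.mono_neutral_right) (use R' c0 in \<open>auto simp: R'_def\<close>)
    moreover have "(\<Sum>r\<in>R'. of_int (c i j (- r)) * T powi r) = (\<Sum>r\<in>R'. of_int (c i j r) * inverse T powi r)"
      by (rule sum.reindex_bij_witness[where i = uminus and j = uminus])
        (auto simp: R'_def power_int_inverse power_int_minus)
    moreover have "(\<Sum>r\<in>R'. of_int (c i j r) * inverse T powi r) = (\<Sum>r\<in>?R. of_int (c i j r) * inverse T powi r)"
      by (rule sum.mono_neutral_right) (use R' c0 in \<open>auto simp: R'_def\<close>)
    ultimately show ?thesis using key[OF T] by (simp add: e_def left_diff_distrib sum_subtractf)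
  qed
  \<comment> \<open>Real T between 1 and 2 avoid 0 and the zeros of T^2 - 1 and of
    \<open>qnum (int l)\<close>, which is enough for a Laurent identity.\<close>
  have "infinite (complex_of_real ` {1<..<2})"
    by (subst finite_image_iff) (auto simp: inj_on_def infinite_Ioo)
  moreover have "complex_of_real ` {1<..<2} \<subseteq> {T. T \<noteq> 0 \<and> (\<Sum>r\<in>R'. e r * T powi r) = 0}"
  proof
    fix T assume "T \<in> complex_of_real ` {1<..<2}"
    then obtain x where x: "T = of_real x" "x > 1" by auto
    have "x ^ 2 > 1" using x by (simp add: one_less_power)
    then have "T\<^sup>2 \<noteq> 1" unfolding x(1) by (metis of_real_1 of_real_eq_iff of_real_power less_irrefl)
    then show "T \<in> {T. T \<noteq> 0 \<and> (\<Sum>r\<in>R'. e r * T powi r) = 0}"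
      using z[of T] qnum_nonzero[OF x(2) l] x by simp
  qed
  ultimately have inf: "infinite {T. T \<noteq> 0 \<and> (\<Sum>r\<in>R'. e r * T powi r) = 0}" by (rule infinite_super[rotated])
  show ?thesis
  proof (cases "r \<in> R'")
    case True
    from laurent_zero[OF R' inf this] show ?thesis by (simp add: e_def)
  next
    case False
    then have "r \<notin> ?R" "- r \<notin> ?R" by (auto simp: R'_def image_iff)
    then show ?thesis by (simp add: c0)
  qed
qed

section \<open>Exchanging the factors\<close>

text \<open>Exchanging the two sides replaces \<open>\<kappa> * s - t\<close> by its multiple with
  factor -1 / \<kappa>, and the powers of \<kappa> and of -1 balance. The logarithmic case alone
  breaks the symmetry.\<close>

lemma pairing_flip:
  assumes km: "\<not> (k = 0 \<and> m = 0)" and \<kappa>: "\<kappa> \<noteq> 0"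
  shows "pairing k m \<kappa> s t = pairing m k (1 / \<kappa>) t s"
proof -
  have b: "1 / \<kappa> * t - s = (- 1) * (\<kappa> * s - t) / \<kappa>" using \<kappa> by (simp add: field_simps)
  have e: "(1 / \<kappa> * t - s) ^ (m + k) = (- 1) ^ (m + k) * (\<kappa> * s - t) ^ (k + m) / (\<kappa> ^ k * \<kappa> ^ m)"
    unfolding b power_divide power_mult_distrib by (simp only: power_add mult_ac)
  have sg: "(- 1) ^ Suc m / (- 1) ^ (m + k) = ((- 1) ^ Suc k :: complex)"
    by (simp add: minus_one_power_iff)
  have "pairing m k (1 / \<kappa>) t s = (- 1) ^ Suc m * fact (m + k - 1) / (fact m * fact k) * (1 / \<kappa>) ^ m /
      ((- 1) ^ (m + k) * (\<kappa> * s - t) ^ (k + m) / (\<kappa> ^ k * \<kappa> ^ m))"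
    using km unfolding pairing_def e by auto
  also have "\<dots> = ((- 1) ^ Suc m / (- 1) ^ (m + k)) * fact (k + m - 1) / (fact k * fact m) * \<kappa> ^ k / (\<kappa> * s - t) ^ (k + m)"
    using \<kappa> by (simp add: power_divide mult_ac add.commute)
  also have "\<dots> = pairing k m \<kappa> s t" unfolding sg using km unfolding pairing_def by auto
  finally show ?thesis ..
qed

text \<open>A logarithmic coefficient independent of t is multiplied by the total residue of the
  second module, which is zero.\<close>

lemma pidx_zero_right:
  assumes "\<And>j. (\<Sum>t\<in>S2. L2 j t 0) = 0"
  shows "(\<Sum>y\<in>pidx R S1 K1 S2 K2. cs (case y of (i, j, r, s, k, t, m) \<Rightarrow> if k = 0 \<and> m = 0 then g r s else 0) (pmat c L1 L2 y)) = 0"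
  unfolding pidx_sum prod.case
proof (rule sum.neutral, rule ballI, rule sum.neutral, rule ballI, rule sum.neutral, rule ballI, rule sum.neutral, rule ballI, rule sum.neutral, rule ballI)
  fix i j r s k
  have z: "(\<Sum>t\<in>S2. cs ((if k = 0 \<and> m = 0 then g r s else 0) * of_int (- c i j r)) (kronS (L1 i s k) (L2 j t m))) = 0" for m
  proof (cases "m = 0")
    case True
    show ?thesis unfolding True cs_sum_right[symmetric] kronS_sum_right[symmetric] assms by simp
  qed simp
  show "(\<Sum>t\<in>S2. \<Sum>m<K2. cs ((if k = 0 \<and> m = 0 then g r s else 0) * of_int (- c i j r)) (kronS (L1 i s k) (L2 j t m))) = 0"
    unfolding sum.swap[of _ "{..<K2}" S2] by (rule sum.neutral, rule ballI, rule z)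
qed

lemma pidx_zero_left:
  assumes "\<And>i. (\<Sum>s\<in>S1. L1 i s 0) = 0"
  shows "(\<Sum>y\<in>pidx R S1 K1 S2 K2. cs (case y of (i, j, r, s, k, t, m) \<Rightarrow> if k = 0 \<and> m = 0 then g r t else 0) (pmat c L1 L2 y)) = 0"
  unfolding pidx_sum prod.case
proof (rule sum.neutral, rule ballI, rule sum.neutral, rule ballI, rule sum.neutral, rule ballI)
  fix i j r
  let ?f = "\<lambda>k t m. (if k = 0 \<and> m = 0 then g r t else 0) * of_int (- c i j r)"
  have z: "(\<Sum>s\<in>S1. \<Sum>t\<in>S2. \<Sum>m<K2. cs (?f k t m) (kronS (L1 i s k) (L2 j t m))) = 0" for k
  proof (cases "k = 0")
    case True
    show ?thesis unfolding True kronS_cs_right[symmetric] kronS_sum_right[symmetric] kronS_sum_left[symmetric] assms by simp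
  qed simp
  show "(\<Sum>s\<in>S1. \<Sum>k<K1. \<Sum>t\<in>S2. \<Sum>m<K2. cs (?f k t m) (kronS (L1 i s k) (L2 j t m))) = 0"
    unfolding sum.swap[of _ "{..<K1}" S1] by (rule sum.neutral, rule ballI, rule z)
qed

text \<open>Exchanging the modules exchanges i with j and, by the symmetry of c, sends r to -r. The
  constant q^(-2l) is the one that turns q^(l-r) into q^(-(l+r)), so that \<kappa> becomes 1 /
  \<kappa>.\<close>

lemma flip_Eexp:
  assumes q: "q \<noteq> 0" and csym: "\<And>i j r. c j i r = c i j (- r)"
  shows "Eexp q l c S2 K2 L2 S1 K1 L1 (q powi (- 2 * int l) * inverse \<eta>) =
    embS swapF (\<Sum>y\<in>pidx (relevant_r c) S1 K1 S2 K2. cs (case y of (i, j, r, s, k, t, m) \<Rightarrow>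
       pairing m k (1 / (q powi (int l + r) * \<eta>)) t s) (pmat c L1 L2 y))"
proof -
  let ?sw = "\<lambda>(j, i, r, t, m, s, k). (i, j, - r, s, k, t, m)"
  let ?R = "relevant_r c"
  have R: "- r \<in> ?R" if r: "r \<in> ?R" for r
  proof -
    from r obtain i j where "c j i r \<noteq> 0" unfolding relevant_r_def by blast
    then have "c i j (- r) \<noteq> 0" unfolding csym[of j i r] .
    then show ?thesis unfolding relevant_r_def by blast
  qed
  have \<kappa>: "q powi (int l + - r) * (q powi (- 2 * int l) * inverse \<eta>) = 1 / (q powi (int l + r) * \<eta>)" for r
  proof -
    have h: "q powi (int l + - r) * q powi (- 2 * int l) = q powi (- (int l + r))"
      using q by (simp add: power_int_add[symmetric])
    show ?thesis unfolding mult.assoc[symmetric] h power_int_minus by (simp add: divide_inverse)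
  qed
  show ?thesis unfolding Eexp_sum embS_sum embS_cs
  proof (rule sum.reindex_bij_witness[where i = ?sw and j = ?sw])
    fix y :: "'a pidx" assume y: "y \<in> pidx ?R S2 K2 S1 K1"
    obtain j i r t m s k where e: "y = (j, i, r, t, m, s, k)" by (cases y)
    show "?sw (?sw y) = y" "?sw y \<in> pidx ?R S1 K1 S2 K2" using y R by (auto simp: e pidx_def)
    show "cs (case ?sw y of (i, j, r, s, k, t, m) \<Rightarrow> pairing m k (1 / (q powi (int l + r) * \<eta>)) t s) (embS swapF (pmat c L1 L2 (?sw y))) =
       cs (pcoef q l (q powi (- 2 * int l) * inverse \<eta>) y) (pmat c L2 L1 y)"
    proof -
      have "q powi (int l + r) * (q powi (- 2 * int l) * inverse \<eta>) = 1 / (q powi (int l + - r) * \<eta>)"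
        using \<kappa>[of "- r"] by (simp only: minus_minus)
      then show ?thesis unfolding e prod.case pcoef_def pmat_def embS_cs embS_swap csym[of j i r] by (simp only:)
    qed
  next
    fix y :: "'a pidx" assume y: "y \<in> pidx ?R S1 K1 S2 K2"
    obtain i j r s k t m where e: "y = (i, j, r, s, k, t, m)" by (cases y)
    show "?sw (?sw y) = y" "?sw y \<in> pidx ?R S2 K2 S1 K1" using y R by (auto simp: e pidx_def)
  qed
qed

text \<open>Near infinity the logarithms \<open>Ln (1 - \<kappa> s / t)\<close> may be replaced by
  \<open>Ln (1 - t / (\<kappa> s)) + Ln \<kappa> + Ln (- s) - Ln t\<close>: the exponential only depends on the
  exponentials of these coefficients, and the last three terms cancel since residues sum to zero.\<close>

lemma A_op_near_infinity:
  fixes V1 :: "('i::finite, 'n::finite) lrep" and V2 :: "('i, 'm::finite) lrep"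
  assumes V: "good V1" "good V2" and qR: "q \<noteq> 0" "finite (relevant_r c)" and csym: "\<And>i j r. c j i r = c i j (- r)"
  shows "\<exists>\<epsilon>>0. \<forall>\<zeta>. \<zeta> \<noteq> 0 \<longrightarrow> norm \<zeta> < \<epsilon> \<longrightarrow>
    flipm (A_op q l c V1 V2 (inverse \<zeta>)) = A_op q l c V2 V1 (q powi (- 2 * int l) * \<zeta>)"
proof -
  obtain K1 L1 where 1: "logdata V1 (spec V1) K1 L1" "structured V1 L1" using good_logdata[OF V(1)] by blast
  obtain K2 L2 where 2: "logdata V2 (spec V2) K2 L2" "structured V2 L2" using good_logdata[OF V(2)] by blast
  let ?S1 = "spec V1" and ?S2 = "spec V2" and ?R = "relevant_r c"
  let ?J = "pidx ?R ?S1 K1 ?S2 K2 :: 'i pidx set" and ?B = "pairpoles q l ?R ?S1 L2 ?S2"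
  have S: "finite ?S1" "0 \<notin> ?S1" "finite ?S2" "0 \<notin> ?S2" using finite_spec zero_notin_spec V by blast+
  have "bounded ?B" by (intro finite_imp_bounded finite_pairpoles qR S)
  then obtain b where b: "b > 0" "\<And>z. z \<in> ?B \<Longrightarrow> norm z \<le> b" unfolding bounded_pos by blast
  obtain e1 where e1: "e1 > 0" "\<And>z. norm z < e1 \<Longrightarrow> A_op q l c V2 V1 z = mat_of (exp (Eexp q l c ?S2 K2 L2 ?S1 K1 L1 z))"
    using A_op_near_0[OF V(2,1) qR 2(1) 1(1), of l] by blast
  let ?Q = "q powi (- 2 * int l)"
  have Q: "?Q \<noteq> 0" using qR by simp
  have main: "flipm (A_op q l c V1 V2 (inverse \<zeta>)) = A_op q l c V2 V1 (?Q * \<zeta>)"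
    if z: "\<zeta> \<noteq> 0" "norm \<zeta> < min (1 / b) (e1 / norm ?Q)" for \<zeta>
  proof -
    define \<eta> where "\<eta> = inverse \<zeta>"
    have \<eta>: "\<eta> \<noteq> 0" "inverse \<eta> = \<zeta>" using z by (simp_all add: \<eta>_def)
    have "norm \<zeta> < 1 / b" using z by simp
    then have "b < 1 / norm \<zeta>" using z b by (simp add: field_simps)
    also have "1 / norm \<zeta> = norm \<eta>" by (simp add: \<eta>_def norm_inverse divide_inverse)
    finally have "norm \<eta> > b" .
    then have \<eta>B: "\<eta> \<notin> ?B" using b(2)[of \<eta>] by auto
    \<comment> \<open>\<open>w0\<close> is the coefficient for the exchanged modules;
      \<open>w1\<close> and \<open>w2\<close> collect the corrections that are independent of t and
      of s respectively.\<close>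
    define w0 where "w0 y = (case y of (i, j, r, s, k, t, m) \<Rightarrow> pairing m k (1 / (q powi (int l + r) * \<eta>)) t s)" for y :: "'i pidx"
    define w1 where "w1 y = (case y of (i, j, r, s, k, t, m) \<Rightarrow> if k = 0 \<and> m = 0 then Ln (q powi (int l + r) * \<eta>) + Ln (- s) else 0)" for y :: "'i pidx"
    define w2 where "w2 y = (case y of (i, j, r, s, k, t, m) \<Rightarrow> if k = 0 \<and> m = 0 then - Ln t else 0)" for y :: "'i pidx"
    have lift: "plift q l c ?J L1 L2 \<eta> (\<lambda>y. w0 y + w1 y + w2 y)" unfolding plift_def
    proof (intro ballI impI)
      fix y assume y: "y \<in> ?J" "pmat c L1 L2 y \<noteq> 0"
      obtain i j r s k t m where e: "y = (i, j, r, s, k, t, m)" by (cases y)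
      note g = pmat_nonzero[OF y[unfolded e]] and n = pmat_nonpole[OF y[unfolded e] qR(1) S(2) \<eta>B]
      define \<kappa> where "\<kappa> = q powi (int l + r) * \<eta>"
      have \<kappa>: "\<kappa> \<noteq> 0" using qR \<eta> by (simp add: \<kappa>_def)
      have st: "s \<noteq> 0" "t \<noteq> 0" using g S by auto
      have n': "\<kappa> * s \<noteq> t" using n by (simp add: \<kappa>_def)
      show "if plog y then exp (w0 y + w1 y + w2 y) = pratio q l \<eta> y else w0 y + w1 y + w2 y = pratio q l \<eta> y"
      proof (cases "k = 0 \<and> m = 0")
        case True
        have nz: "1 - 1 / \<kappa> * t / s \<noteq> 0" using n' \<kappa> st by (simp add: field_simps)
        have "w0 y + w1 y + w2 y = Ln (1 - 1 / \<kappa> * t / s) + (Ln \<kappa> + Ln (- s)) + - Ln t"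
          using True unfolding w0_def w1_def w2_def e prod.case pairing_def \<kappa>_def by simp
        then have "exp (w0 y + w1 y + w2 y) = (1 - 1 / \<kappa> * t / s) * (\<kappa> * (- s)) * inverse t"
          using nz \<kappa> st by (simp only: exp_add exp_minus exp_Ln neg_equal_0_iff_equal not_False_eq_True)
        also have "\<dots> = 1 - \<kappa> * s / t" using \<kappa> st by (simp add: field_simps)
        finally show ?thesis using True by (simp add: plog_def pratio_def e \<kappa>_def)
      next
        case False
        have "w0 y + w1 y + w2 y = pairing m k (1 / \<kappa>) t s" using False by (auto simp: w0_def w1_def w2_def e \<kappa>_def)
        also have "\<dots> = pairing k m \<kappa> s t" by (rule pairing_flip[OF False \<kappa>, symmetric])
        finally show ?thesis using False by (auto simp: plog_def pratio_def e \<kappa>_def)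
      qed
    qed
    have s1: "(\<Sum>s\<in>?S1. L1 i s 0) = 0" and s2: "(\<Sum>s\<in>?S2. L2 i s 0) = 0" for i
      using 1(1) 2(1) unfolding logdata_def by blast+
    have "(\<Sum>y\<in>?J. cs (w1 y) (pmat c L1 L2 y)) = 0" unfolding w1_def by (rule pidx_zero_right) (rule s2)
    moreover have "(\<Sum>y\<in>?J. cs (w2 y) (pmat c L1 L2 y)) = 0" unfolding w2_def by (rule pidx_zero_left) (rule s1)
    ultimately have sum: "(\<Sum>y\<in>?J. cs (w0 y + w1 y + w2 y) (pmat c L1 L2 y)) = (\<Sum>y\<in>?J. cs (w0 y) (pmat c L1 L2 y))"
      unfolding cs_add_left sum.distrib by simp
    have n2: "norm (?Q * \<zeta>) < e1" using z Q by (simp add: norm_mult field_simps)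
    have "A_op q l c V1 V2 \<eta> = mat_of (exp (\<Sum>y\<in>?J. cs (w0 y) (pmat c L1 L2 y)))"
      unfolding A_op_structure(5)[OF V qR 1 2 \<eta>B lift] sum ..
    then have "flipm (A_op q l c V1 V2 \<eta>) = mat_of (exp (embS swapF (\<Sum>y\<in>?J. cs (w0 y) (pmat c L1 L2 y))))"
      by (simp only: leg_emb emb_exp[OF bij_swap(5)])
    also have "embS swapF (\<Sum>y\<in>?J. cs (w0 y) (pmat c L1 L2 y)) = Eexp q l c ?S2 K2 L2 ?S1 K1 L1 (?Q * inverse \<eta>)"
      unfolding w0_def by (rule flip_Eexp[where c = c, OF qR(1) csym, symmetric])
    finally show ?thesis unfolding e1(2)[OF n2] \<eta>_def inverse_inverse_eq .
  qed
  show ?thesis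
  proof (rule exI[of _ "min (1 / b) (e1 / norm ?Q)"], rule conjI)
    show "min (1 / b) (e1 / norm ?Q) > 0" using b e1 Q by simp
  qed (use main in blast)
qed

text \<open>Both sides are rational in \<zeta>, and their agreement near 0 is what the comparison at
  infinity provides.\<close>

lemma A_op_flip:
  fixes V1 :: "('i::finite, 'n::finite) lrep" and V2 :: "('i, 'm::finite) lrep"
  assumes V: "good V1" "good V2" and qR: "q \<noteq> 0" "finite (relevant_r c)" and csym: "\<And>i j r. c j i r = c i j (- r)"
    and z: "\<zeta> \<noteq> 0" "inverse \<zeta> \<notin> mpoles (A_op q l c V1 V2)" "q powi (- 2 * int l) * \<zeta> \<notin> mpoles (A_op q l c V2 V1)"
  shows "flipm (A_op q l c V1 V2 (inverse \<zeta>)) = A_op q l c V2 V1 (q powi (- 2 * int l) * \<zeta>)"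
proof -
  let ?Q = "q powi (- 2 * int l)"
  have Q: "?Q \<noteq> 0" using qR by simp
  note m = A_op_mreg[OF V qR, of l] and m' = A_op_mreg[OF V(2,1) qR, of l]
  obtain \<epsilon> where \<epsilon>: "\<epsilon> > 0" "\<And>\<zeta>. \<zeta> \<noteq> 0 \<Longrightarrow> norm \<zeta> < \<epsilon> \<Longrightarrow>
    flipm (A_op q l c V1 V2 (inverse \<zeta>)) = A_op q l c V2 V1 (?Q * \<zeta>)"
    using A_op_near_infinity[of V1 V2 q c l, OF V qR csym] by blast
  let ?B = "insert 0 {z. 1 / z \<in> mpoles (A_op q l c V1 V2)}"
  have r: "mreg ?B (\<lambda>z. A_op q l c V1 V2 (1 / z))"
    using m(2) unfolding mreg_def by (intro allI rreg_reciprocal) auto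
  have "?B \<subseteq> insert 0 ((\<lambda>w. 1 / w) ` mpoles (A_op q l c V1 V2))"
  proof
    fix z assume "z \<in> ?B"
    then show "z \<in> insert 0 ((\<lambda>w. 1 / w) ` mpoles (A_op q l c V1 V2))"
      by (cases "z = 0") (auto intro!: image_eqI[of _ _ "1 / z"])
  qed
  then have fB: "finite ?B" using m(1) by (meson finite_imageI finite_insert finite_subset)
  have "flipm (A_op q l c V1 V2 (1 / \<zeta>)) = A_op q l c V2 V1 (?Q * \<zeta>)"
  proof (rule mreg_eq_near_0[OF _ mreg_scale[OF m'(2) Q] fB finite_scaled[OF m'(1) Q] \<epsilon>(1)])
    show "mreg ?B (\<lambda>z. flipm (A_op q l c V1 V2 (1 / z)))" unfolding leg_emb by (rule mreg_emb[OF r])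
    show "flipm (A_op q l c V1 V2 (1 / z)) = A_op q l c V2 V1 (?Q * z)" if "z \<noteq> 0" "norm z < \<epsilon>" for z
      using \<epsilon>(2)[OF that] by (simp add: inverse_eq_divide)
    show "\<zeta> \<notin> ?B" using z by (simp add: inverse_eq_divide)
  qed (use z in simp)
  then show ?thesis by (simp add: inverse_eq_divide)
qed

text \<open>Near infinity the operator is the flip of the exchanged one near 0, where continuity and
  the value 1 are known.\<close>

lemma A_op_at_infinity:
  fixes V1 :: "('i::finite, 'n::finite) lrep" and V2 :: "('i, 'm::finite) lrep"
  assumes V: "good V1" "good V2" and qR: "q \<noteq> 0" "finite (relevant_r c)" and csym: "\<And>i j r. c j i r = c i j (- r)"
  shows "(A_op q l c V1 V2 \<longlongrightarrow> mat 1) at_infinity"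
proof -
  let ?Q = "q powi (- 2 * int l)"
  obtain \<epsilon> where \<epsilon>: "\<epsilon> > 0" "\<And>\<zeta>. \<zeta> \<noteq> 0 \<Longrightarrow> norm \<zeta> < \<epsilon> \<Longrightarrow>
    flipm (A_op q l c V1 V2 (inverse \<zeta>)) = A_op q l c V2 V1 (?Q * \<zeta>)"
    using A_op_near_infinity[of V1 V2 q c l, OF V qR csym] by blast
  note m' = A_op_mreg[OF V(2,1) qR, of l] and z = A_op_0[OF V(2,1) qR, of l]
  have "isCont (A_op q l c V2 V1) (?Q * 0)" using mreg_isCont[OF m'(2,1) z(2)] by simp
  then have "((\<lambda>\<zeta>. A_op q l c V2 V1 (?Q * \<zeta>)) \<longlongrightarrow> A_op q l c V2 V1 (?Q * 0)) (at 0)"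
    by (rule isCont_tendsto_compose) (intro tendsto_intros)
  then have "((\<lambda>\<zeta>. A_op q l c V2 V1 (?Q * \<zeta>) $ a $ b) \<longlongrightarrow> mat 1 $ a $ b) (at 0)" for a b
    using z(1) by (intro tendsto_vec_nth) simp
  then have "((\<lambda>\<zeta>. flipm (A_op q l c V2 V1 (?Q * \<zeta>))) \<longlongrightarrow> (\<chi> x y. mat 1 $ (snd x, fst x) $ (snd y, fst y))) (at 0)"
    unfolding flipm_def by (intro vec_tendstoI) simp
  also have "(\<chi> x y. mat 1 $ (snd x, fst x) $ (snd y, fst y)) = (mat 1 :: ('n \<times> 'm) cmat)"
    by (auto simp: vec_eq_iff mat_def prod_eq_iff)
  finally have lim: "((\<lambda>\<zeta>. A_op q l c V1 V2 (inverse \<zeta>)) \<longlongrightarrow> mat 1) (at 0)"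
  proof (rule Lim_transform_eventually)
    show "\<forall>\<^sub>F \<zeta> in at 0. flipm (A_op q l c V2 V1 (?Q * \<zeta>)) = A_op q l c V1 V2 (inverse \<zeta>)"
      unfolding eventually_at
    proof (intro exI[of _ \<epsilon>] conjI ballI impI \<epsilon>(1))
      fix \<zeta> :: complex assume "\<zeta> \<noteq> 0 \<and> dist \<zeta> 0 < \<epsilon>"
      then have "flipm (A_op q l c V1 V2 (inverse \<zeta>)) = A_op q l c V2 V1 (?Q * \<zeta>)" using \<epsilon>(2) by simp
      moreover have "flipm (flipm M) = M" for M :: "('n \<times> 'm) cmat" by (simp add: flipm_def vec_eq_iff)
      ultimately show "flipm (A_op q l c V2 V1 (?Q * \<zeta>)) = A_op q l c V1 V2 (inverse \<zeta>)" by metis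
    qed
  qed
  have "filterlim (\<lambda>z :: complex. inverse z) (at 0) at_infinity"
    unfolding filterlim_inverse_at_iff by (rule filterlim_ident)
  from filterlim_compose[OF lim this] show ?thesis by simp
qed

text \<open>The identities are stated at regular points, because an entry in reduced form takes the
  value 0 at its poles.\<close>

theorem theorem8p5:
  fixes a :: "'i::finite \<Rightarrow> 'i \<Rightarrow> int" and d :: "'i \<Rightarrow> nat"
    and q :: complex and l :: nat and c :: "'i \<Rightarrow> 'i \<Rightarrow> int \<Rightarrow> int"
    and V1 :: "('i, 'n::finite) lrep" and V2 :: "('i, 'm::finite) lrep"
    and V3 :: "('i, 'k::finite) lrep"
  assumes cartan: "finite_cartan a d"
    and q_nz: "q \<noteq> 0" and q_nonroot: "\<forall>n::nat. n > 0 \<longrightarrow> q ^ n \<noteq> 1"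
    and l_pos: "l > 0" and c_def: "is_c_matrix a d l c"
    and V1: "is_rep a d q V1" and V2: "is_rep a d q V2" and V3: "is_rep a d q V3"
  shows
    "\<comment> \<open>(i)\<close>
     (A_ext_prop q l c V1 V2 (A_op q l c V1 V2) \<and>
      0 \<notin> mpoles (A_op q l c V1 V2) \<and> A_op q l c V1 V2 0 = mat 1 \<and>
      (A_op q l c V1 V2 \<longlongrightarrow> mat 1) at_infinity) \<and>
     \<comment> \<open>(ii)\<close>
     mpoles (A_op q l c V1 V2) \<union> mpoles (\<lambda>\<zeta>. matrix_inv (A_op q l c V1 V2 \<zeta>)) \<subseteq>
       {s2 / s1 * q powi (- int l - r) | s1 s2 r.
          s1 \<in> spec V1 \<and> s2 \<in> spec V2 \<and> r \<in> relevant_r c} \<and>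
     \<comment> \<open>(iii)\<close>
     (\<forall>\<zeta> \<zeta>'. \<zeta> \<notin> mpoles (A_op q l c V1 V2) \<longrightarrow> \<zeta>' \<notin> mpoles (A_op q l c V1 V2) \<longrightarrow>
       A_op q l c V1 V2 \<zeta> ** A_op q l c V1 V2 \<zeta>' = A_op q l c V1 V2 \<zeta>' ** A_op q l c V1 V2 \<zeta>) \<and>
     \<comment> \<open>(iv), first identity\<close>
     (\<forall>\<zeta>1 \<zeta>2. \<zeta>1 \<noteq> 0 \<longrightarrow> (\<lambda>s. \<zeta>1 * s) ` spec V1 \<inter> spec V2 = {} \<longrightarrow>
       \<zeta>2 \<notin> mpoles (A_op q l c (dtensor \<zeta>1 V1 V2) V3) \<longrightarrow>
       \<zeta>1 * \<zeta>2 \<notin> mpoles (A_op q l c V1 V3) \<longrightarrow> \<zeta>2 \<notin> mpoles (A_op q l c V2 V3) \<longrightarrow>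
       A_op q l c (dtensor \<zeta>1 V1 V2) V3 \<zeta>2 =
         leg13 (A_op q l c V1 V3 (\<zeta>1 * \<zeta>2)) ** leg23 (A_op q l c V2 V3 \<zeta>2)) \<and>
     \<comment> \<open>(iv), second identity\<close>
     (\<forall>\<zeta>1 \<zeta>2. \<zeta>2 \<noteq> 0 \<longrightarrow> (\<lambda>s. \<zeta>2 * s) ` spec V2 \<inter> spec V3 = {} \<longrightarrow>
       \<zeta>1 * \<zeta>2 \<notin> mpoles (A_op q l c V1 (dtensor \<zeta>2 V2 V3)) \<longrightarrow>
       \<zeta>1 * \<zeta>2 \<notin> mpoles (A_op q l c V1 V3) \<longrightarrow> \<zeta>1 \<notin> mpoles (A_op q l c V1 V2) \<longrightarrow>
       A_op q l c V1 (dtensor \<zeta>2 V2 V3) (\<zeta>1 * \<zeta>2) =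
         legR13 (A_op q l c V1 V3 (\<zeta>1 * \<zeta>2)) ** legR12 (A_op q l c V1 V2 \<zeta>1)) \<and>
     \<comment> \<open>(v)\<close>
     (\<forall>\<zeta>. \<zeta> \<noteq> 0 \<longrightarrow> inverse \<zeta> \<notin> mpoles (A_op q l c V1 V2) \<longrightarrow>
       q powi (- 2 * int l) * \<zeta> \<notin> mpoles (A_op q l c V2 V1) \<longrightarrow>
       flipm (A_op q l c V1 V2 (inverse \<zeta>)) = A_op q l c V2 V1 (q powi (- 2 * int l) * \<zeta>)) \<and>
     \<comment> \<open>(vi)\<close>
     (\<forall>\<alpha> \<beta> \<zeta>. \<alpha> \<noteq> 0 \<longrightarrow> \<beta> \<noteq> 0 \<longrightarrow>
       \<zeta> \<notin> mpoles (A_op q l c (shift \<alpha> V1) (shift \<beta> V2)) \<longrightarrow>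
       \<zeta> * \<alpha> / \<beta> \<notin> mpoles (A_op q l c V1 V2) \<longrightarrow>
       A_op q l c (shift \<alpha> V1) (shift \<beta> V2) \<zeta> = A_op q l c V1 V2 (\<zeta> * \<alpha> / \<beta>))"
proof -
  have R: "finite (relevant_r c)" using c_def unfolding is_c_matrix_def by blast
  note qR = q_nz R and csym = c_matrix_symmetric[OF cartan l_pos c_def]
  have g1: "good V1" and g2: "good V2" and g3: "good V3"
    using rep_good[OF _ cartan q_nz q_nonroot] V1 V2 V3 by blast+
  let ?A = "A_op q l c V1 V2"
  obtain K1 L1 where 1: "logdata V1 (spec V1) K1 L1" "structured V1 L1" using good_logdata[OF g1] by blast
  obtain K2 L2 where 2: "logdata V2 (spec V2) K2 L2" "structured V2 L2" using good_logdata[OF g2] by blast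
  note A = A_op_structure[OF g1 g2 qR 1 2, of l]
  have i: "A_ext_prop q l c V1 V2 ?A \<and> 0 \<notin> mpoles ?A \<and> ?A 0 = mat 1 \<and> (?A \<longlongrightarrow> mat 1) at_infinity"
    using A(1) A_op_0[OF g1 g2 qR, of l] A_op_at_infinity[where c = c, OF g1 g2 qR csym, of l] by blast
  \<comment> \<open>The explicit set uses only those points of \<open>spec V2\<close> that carry a
    nonzero coefficient, hence the inclusion.\<close>
  have "pairpoles q l (relevant_r c) (spec V1) L2 (spec V2) \<subseteq> {s2 / s1 * q powi (- int l - r) | s1 s2 r.
          s1 \<in> spec V1 \<and> s2 \<in> spec V2 \<and> r \<in> relevant_r c}" unfolding pairpoles_def by auto
  then have ii: "mpoles ?A \<union> mpoles (\<lambda>\<zeta>. matrix_inv (?A \<zeta>)) \<subseteq>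
       {s2 / s1 * q powi (- int l - r) | s1 s2 r.
          s1 \<in> spec V1 \<and> s2 \<in> spec V2 \<and> r \<in> relevant_r c}" using A(2,3) by blast
  have iv: "A_op q l c V1 (dtensor \<zeta>2 V2 V3) (\<zeta>1 * \<zeta>2) =
         legR13 (A_op q l c V1 V3 (\<zeta>1 * \<zeta>2)) ** legR12 (A_op q l c V1 V2 \<zeta>1)"
    if "\<zeta>2 \<noteq> 0" "(\<lambda>s. \<zeta>2 * s) ` spec V2 \<inter> spec V3 = {}"
      "\<zeta>1 * \<zeta>2 \<notin> mpoles (A_op q l c V1 (dtensor \<zeta>2 V2 V3))"
      "\<zeta>1 * \<zeta>2 \<notin> mpoles (A_op q l c V1 V3)" "\<zeta>1 \<notin> mpoles (A_op q l c V1 V2)" for \<zeta>1 \<zeta>2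
  proof -
    have e: "inverse \<zeta>2 * (\<zeta>1 * \<zeta>2) = \<zeta>1" using that(1) by simp
    show ?thesis using A_op_dtensor_right[OF g1 g2 g3 qR that(1-4)] that(5) unfolding e by blast
  qed
  have vi: "A_op q l c (shift \<alpha> V1) (shift \<beta> V2) \<zeta> = ?A (\<zeta> * \<alpha> / \<beta>)"
    if "\<alpha> \<noteq> 0" "\<beta> \<noteq> 0" "\<zeta> \<notin> mpoles (A_op q l c (shift \<alpha> V1) (shift \<beta> V2))" "\<zeta> * \<alpha> / \<beta> \<notin> mpoles ?A" for \<alpha> \<beta> \<zeta>
  proof -
    have e: "\<alpha> / \<beta> * \<zeta> = \<zeta> * \<alpha> / \<beta>" by simp
    show ?thesis using A_op_shift[OF g1 g2 qR that(1-3)] that(4) unfolding e by blast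
  qed
  show ?thesis
    by (intro conjI[OF i] conjI[OF ii] conjI allI impI A_op_commute[OF g1 g2 qR]
        A_op_dtensor_left[OF g1 g2 g3 qR] iv A_op_flip[where c = c, OF g1 g2 qR csym] vi)
qed

end
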